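(* For every (strict) $2$-category $\mathcal{C}$, the (derived) counit $\epsilon^{\natural}_{\mathcal{C}}\colon c^{\natural}_2(N^{\natural}_2(\mathcal{C}))\to\mathcal{C}$ of the natural nerve-categorification adjunction is an acyclic fibration in Lack's model structure on $2\mathcal{C}at$, and in particular a biequivalence.
   Context: **The category $t\Delta$.** Objects: $[m]$ for $m\ge 0$ and $[m]_t$ for $m\ge 1$. Morphisms are generated by cofaces $d^i\colon[m]\to[m+1]$ ($0\le i\le m+1$), codegeneracies $s^i\colon[m]\to[m-1]$ ($0\le i\le m-1$), maps $\varphi\colon[m]\to[m]_t$ ($m\ge1$) and maps $\zeta^i\colon[m]_t\to[m-1]$ ($m\geq 1$, $0\le i\le m-1$), subject to the cosimplicial identities and to $\zeta^i\varphi=s^i\colon[m+1]\to[m]$ ($0\le i\le m$, $m\ge0$) and $s^i\zeta^{j+1}=s^j\zeta^i\colon[m+2]_t\to[m]$ ($0\le i\le j\le m$). A $t\Delta$-set is a presheaf $X\colon t\Delta^{\mathrm{op}}\to\mathcal{S}et$. **Lack's model structure.** The (known) model structure on the category $2\mathcal{C}at$ of strict $2$-categories and strict $2$-functors whose weak equivalences are the biequivalences, in which all objects are fibrant, and whose cofibrations are generated by $[-1]\to[0]$, $[0]\amalg[0]\to[1]$, $\Sigma([0]\amalg[0])\to\Sigma[1]$ and $\Sigma[\rightrightarrows]\to\Sigma[1]$. Here $[m]$ is the poset $\{0<\dots<m\}$ ($[-1]=\varnothing$), $[\rightrightarrows]$ is the free category on two parallel arrows, and for a category $\mathcal{D}$,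 $\Sigma\mathcal{D}$ is the $2$-category with two objects $x,y$ and hom-categories $\mathrm{Map}(x,y)=\mathcal{D}$, $\mathrm{Map}(y,x)=\varnothing$, $\mathrm{Map}(x,x)=\mathrm{Map}(y,y)=[0]$. **Natural nerve.** $\mathcal{O}_2[m]$ is the $2$-truncated $m$-th oriental: the $2$-category with objects $0,\dots,m$, where $\mathrm{Map}(i,j)$ is, for $i\le j$, the poset of subsets of $\{i,\dots,j\}$ containing $i$ and $j$ ordered by inclusion, and empty for $i>j$; composition is union. (So $\mathcal{O}_2[2]$ has one non-identity $2$-morphism $f_{02}\Rightarrow f_{12}f_{01}$.) $\mathbb{E}$ is the free adjoint equivalence: the $2$-category generated by $f\colon x\to y$, $g\colon y\to x$ and invertible $2$-morphisms $\eta\colon\mathrm{id}_x\Rightarrow gf$, $\epsilon\colon fg\Rightarrow\mathrm{id}_y$ satisfying the triangle identities. $\mathbb{O}_2[2]$ is obtained from $\mathcal{O}_2[2]$ by freely inverting the non-identity $2$-morphism. The functor $t\Delta\to2\mathcal{C}at$ given by $[m]\mapsto\mathcal{O}_2[m]$, $[1]_t\mapsto\mathbb{E}$, $[2]_t\mapsto\mathbb{O}_2[2]$, $[m]_t\mapsto\mathcal{O}_2[m]$ for $m\ge3$ (usual cosimplicial structure; $\varphi$ sent to the canonical maps $[1]\to\mathbb{E}$ picking $f$, $\mathcal{O}_2[2]\to\mathbb{O}_2[2]$, and identities for $m\ge3$; $\zeta^i$ sent to the unique factorizations of the codegeneracies) induces an adjunction $c^{\natural}_2\colon\mathcal{S}et^{t\Delta^{\mathrm{op}}}\rightleftarrows2\mathcal{C}at\colon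 N^{\natural}_2$, where $N^{\natural}_2(\mathcal{C})$ is the presheaf of $2$-functors from these $2$-categories into $\mathcal{C}$, and $c^\natural_2$ is the colimit-preserving extension. The derived counit is represented by the ordinary counit of this adjunction, because every $2$-category is fibrant in Lack's model structure and every $t\Delta$-set is cofibrant in the model structure on $\mathcal{S}et^{t\Delta^{\mathrm{op}}}$ for $(\infty,2)$-categories (where cofibrations are monomorphisms). *)

theory Defs
  imports Main "HOL-Library.FuncSet"
begin

section \<open>Strict 2-categories and strict 2-functors\<close>

text \<open>Composition is written in applicative order: \<open>Comp C g f\<close> is $g \circ f$,
  \<open>VComp C b a\<close> is the vertical composite ``first \<open>a\<close>, then \<open>b\<close>'', and \<open>HComp C b a\<close> is the
  horizontal composite of \<open>a\<close> (on the source side) with \<open>b\<close>.  The operations are total functions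
  that carry meaning on composable arguments only.\<close>

record ('o, 'm, 'c) two_cat =
  Ob :: "'o set"
  Mor :: "'m set"
  Cell :: "'c set"
  Src :: "'m \<Rightarrow> 'o"
  Tgt :: "'m \<Rightarrow> 'o"
  Dom :: "'c \<Rightarrow> 'm"
  Cod :: "'c \<Rightarrow> 'm"
  IdM :: "'o \<Rightarrow> 'm"
  IdC :: "'m \<Rightarrow> 'c"
  Comp :: "'m \<Rightarrow> 'm \<Rightarrow> 'm"
  VComp :: "'c \<Rightarrow> 'c \<Rightarrow> 'c"
  HComp :: "'c \<Rightarrow> 'c \<Rightarrow> 'c"

locale two_category =
  fixes C :: "('o, 'm, 'c) two_cat"
  assumes Src_in: "f \<in> Mor C \<Longrightarrow> Src C f \<in> Ob C"
    and Tgt_in: "f \<in> Mor C \<Longrightarrow> Tgt C f \<in> Ob C"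
    and IdM_in: "x \<in> Ob C \<Longrightarrow> IdM C x \<in> Mor C"
    and Src_IdM: "x \<in> Ob C \<Longrightarrow> Src C (IdM C x) = x"
    and Tgt_IdM: "x \<in> Ob C \<Longrightarrow> Tgt C (IdM C x) = x"
    and Comp_in: "\<lbrakk>f \<in> Mor C; g \<in> Mor C; Tgt C f = Src C g\<rbrakk> \<Longrightarrow> Comp C g f \<in> Mor C"
    and Src_Comp: "\<lbrakk>f \<in> Mor C; g \<in> Mor C; Tgt C f = Src C g\<rbrakk> \<Longrightarrow> Src C (Comp C g f) = Src C f"
    and Tgt_Comp: "\<lbrakk>f \<in> Mor C; g \<in> Mor C; Tgt C f = Src C g\<rbrakk> \<Longrightarrow> Tgt C (Comp C g f) = Tgt C g"
    and Comp_IdM_left: "f \<in> Mor C \<Longrightarrow> Comp C (IdM C (Tgt C f)) f = f"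
    and Comp_IdM_right: "f \<in> Mor C \<Longrightarrow> Comp C f (IdM C (Src C f)) = f"
    and Comp_assoc: "\<lbrakk>f \<in> Mor C; g \<in> Mor C; h \<in> Mor C; Tgt C f = Src C g; Tgt C g = Src C h\<rbrakk>
      \<Longrightarrow> Comp C (Comp C h g) f = Comp C h (Comp C g f)"
    and Dom_in: "a \<in> Cell C \<Longrightarrow> Dom C a \<in> Mor C"
    and Cod_in: "a \<in> Cell C \<Longrightarrow> Cod C a \<in> Mor C"
    and Src_Cod: "a \<in> Cell C \<Longrightarrow> Src C (Cod C a) = Src C (Dom C a)"
    and Tgt_Cod: "a \<in> Cell C \<Longrightarrow> Tgt C (Cod C a) = Tgt C (Dom C a)"
    and IdC_in: "f \<in> Mor C \<Longrightarrow> IdC C f \<in> Cell C"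
    and Dom_IdC: "f \<in> Mor C \<Longrightarrow> Dom C (IdC C f) = f"
    and Cod_IdC: "f \<in> Mor C \<Longrightarrow> Cod C (IdC C f) = f"
    and VComp_in: "\<lbrakk>a \<in> Cell C; b \<in> Cell C; Cod C a = Dom C b\<rbrakk> \<Longrightarrow> VComp C b a \<in> Cell C"
    and Dom_VComp: "\<lbrakk>a \<in> Cell C; b \<in> Cell C; Cod C a = Dom C b\<rbrakk> \<Longrightarrow> Dom C (VComp C b a) = Dom C a"
    and Cod_VComp: "\<lbrakk>a \<in> Cell C; b \<in> Cell C; Cod C a = Dom C b\<rbrakk> \<Longrightarrow> Cod C (VComp C b a) = Cod C b"
    and VComp_IdC_left: "a \<in> Cell C \<Longrightarrow> VComp C (IdC C (Cod C a)) a = a"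
    and VComp_IdC_right: "a \<in> Cell C \<Longrightarrow> VComp C a (IdC C (Dom C a)) = a"
    and VComp_assoc: "\<lbrakk>a \<in> Cell C; b \<in> Cell C; c \<in> Cell C; Cod C a = Dom C b; Cod C b = Dom C c\<rbrakk>
      \<Longrightarrow> VComp C (VComp C c b) a = VComp C c (VComp C b a)"
    and HComp_in: "\<lbrakk>a \<in> Cell C; b \<in> Cell C; Tgt C (Dom C a) = Src C (Dom C b)\<rbrakk>
      \<Longrightarrow> HComp C b a \<in> Cell C"
    and Dom_HComp: "\<lbrakk>a \<in> Cell C; b \<in> Cell C; Tgt C (Dom C a) = Src C (Dom C b)\<rbrakk>
      \<Longrightarrow> Dom C (HComp C b a) = Comp C (Dom C b) (Dom C a)"
    and Cod_HComp: "\<lbrakk>a \<in> Cell C; b \<in> Cell C; Tgt C (Dom C a) = Src C (Dom C b)\<rbrakk>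
      \<Longrightarrow> Cod C (HComp C b a) = Comp C (Cod C b) (Cod C a)"
    and HComp_Id_left: "a \<in> Cell C \<Longrightarrow> HComp C (IdC C (IdM C (Tgt C (Dom C a)))) a = a"
    and HComp_Id_right: "a \<in> Cell C \<Longrightarrow> HComp C a (IdC C (IdM C (Src C (Dom C a)))) = a"
    and HComp_assoc: "\<lbrakk>a \<in> Cell C; b \<in> Cell C; c \<in> Cell C;
        Tgt C (Dom C a) = Src C (Dom C b); Tgt C (Dom C b) = Src C (Dom C c)\<rbrakk>
      \<Longrightarrow> HComp C (HComp C c b) a = HComp C c (HComp C b a)"
    and HComp_IdC: "\<lbrakk>f \<in> Mor C; g \<in> Mor C; Tgt C f = Src C g\<rbrakk>
      \<Longrightarrow> HComp C (IdC C g) (IdC C f) = IdC C (Comp C g f)"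
    and interchange: "\<lbrakk>a \<in> Cell C; a' \<in> Cell C; b \<in> Cell C; b' \<in> Cell C;
        Cod C a = Dom C a'; Cod C b = Dom C b'; Tgt C (Dom C a) = Src C (Dom C b)\<rbrakk>
      \<Longrightarrow> HComp C (VComp C b' b) (VComp C a' a) = VComp C (HComp C b' a') (HComp C b a)"

record ('o, 'm, 'c, 'p, 'n, 'd) two_fun =
  Fn0 :: "'o \<Rightarrow> 'p"
  Fn1 :: "'m \<Rightarrow> 'n"
  Fn2 :: "'c \<Rightarrow> 'd"

locale two_functor =
  fixes A :: "('o, 'm, 'c) two_cat" and B :: "('p, 'n, 'd) two_cat"
    and F :: "('o, 'm, 'c, 'p, 'n, 'd) two_fun"
  assumes Fn0_in: "x \<in> Ob A \<Longrightarrow> Fn0 F x \<in> Ob B"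
    and Fn1_in: "f \<in> Mor A \<Longrightarrow> Fn1 F f \<in> Mor B"
    and Fn2_in: "a \<in> Cell A \<Longrightarrow> Fn2 F a \<in> Cell B"
    and Fn_Src: "f \<in> Mor A \<Longrightarrow> Src B (Fn1 F f) = Fn0 F (Src A f)"
    and Fn_Tgt: "f \<in> Mor A \<Longrightarrow> Tgt B (Fn1 F f) = Fn0 F (Tgt A f)"
    and Fn_Dom: "a \<in> Cell A \<Longrightarrow> Dom B (Fn2 F a) = Fn1 F (Dom A a)"
    and Fn_Cod: "a \<in> Cell A \<Longrightarrow> Cod B (Fn2 F a) = Fn1 F (Cod A a)"
    and Fn_IdM: "x \<in> Ob A \<Longrightarrow> Fn1 F (IdM A x) = IdM B (Fn0 F x)"
    and Fn_IdC: "f \<in> Mor A \<Longrightarrow> Fn2 F (IdC A f) = IdC B (Fn1 F f)"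
    and Fn_Comp: "\<lbrakk>f \<in> Mor A; g \<in> Mor A; Tgt A f = Src A g\<rbrakk>
      \<Longrightarrow> Fn1 F (Comp A g f) = Comp B (Fn1 F g) (Fn1 F f)"
    and Fn_VComp: "\<lbrakk>a \<in> Cell A; b \<in> Cell A; Cod A a = Dom A b\<rbrakk>
      \<Longrightarrow> Fn2 F (VComp A b a) = VComp B (Fn2 F b) (Fn2 F a)"
    and Fn_HComp: "\<lbrakk>a \<in> Cell A; b \<in> Cell A; Tgt A (Dom A a) = Src A (Dom A b)\<rbrakk>
      \<Longrightarrow> Fn2 F (HComp A b a) = HComp B (Fn2 F b) (Fn2 F a)"

text \<open>Restricting the three components to the cells of the domain gives every 2-functor a unique
  representative, so that \<open>two_functors A B\<close> is the set of 2-functors and equality of its elements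
  is equality of 2-functors.\<close>

definition restr :: "('o, 'm, 'c) two_cat \<Rightarrow> ('o, 'm, 'c, 'p, 'n, 'd) two_fun
    \<Rightarrow> ('o, 'm, 'c, 'p, 'n, 'd) two_fun" where
  "restr A F = \<lparr>Fn0 = restrict (Fn0 F) (Ob A), Fn1 = restrict (Fn1 F) (Mor A),
     Fn2 = restrict (Fn2 F) (Cell A)\<rparr>"

definition two_functors :: "('o, 'm, 'c) two_cat \<Rightarrow> ('p, 'n, 'd) two_cat
    \<Rightarrow> ('o, 'm, 'c, 'p, 'n, 'd) two_fun set" where
  "two_functors A B = {F. two_functor A B F \<and> restr A F = F}"

definition two_comp :: "('o, 'm, 'c) two_cat \<Rightarrow> ('p, 'n, 'd, 'q, 'l, 'e) two_fun
    \<Rightarrow> ('o, 'm, 'c, 'p, 'n, 'd) two_fun \<Rightarrow> ('o, 'm, 'c, 'q, 'l, 'e) two_fun" where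
  "two_comp A G F = restr A \<lparr>Fn0 = Fn0 G \<circ> Fn0 F, Fn1 = Fn1 G \<circ> Fn1 F, Fn2 = Fn2 G \<circ> Fn2 F\<rparr>"

definition inclusion :: "('o, 'm, 'c) two_cat \<Rightarrow> ('o, 'm, 'c, 'o, 'm, 'c) two_fun" where
  "inclusion A = restr A \<lparr>Fn0 = (\<lambda>x. x), Fn1 = (\<lambda>f. f), Fn2 = (\<lambda>a. a)\<rparr>"

section \<open>Biequivalences and Lack's acyclic fibrations\<close>

definition hom :: "('o, 'm, 'c) two_cat \<Rightarrow> 'o \<Rightarrow> 'o \<Rightarrow> 'm set" where
  "hom C x y = {f \<in> Mor C. Src C f = x \<and> Tgt C f = y}"

definition cells :: "('o, 'm, 'c) two_cat \<Rightarrow> 'm \<Rightarrow> 'm \<Rightarrow> 'c set" where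
  "cells C f g = {a \<in> Cell C. Dom C a = f \<and> Cod C a = g}"

definition isomorphic :: "('o, 'm, 'c) two_cat \<Rightarrow> 'm \<Rightarrow> 'm \<Rightarrow> bool" where
  "isomorphic C f g \<longleftrightarrow> (\<exists>a \<in> cells C f g. \<exists>b \<in> cells C g f.
     VComp C b a = IdC C f \<and> VComp C a b = IdC C g)"

definition equivalent :: "('o, 'm, 'c) two_cat \<Rightarrow> 'o \<Rightarrow> 'o \<Rightarrow> bool" where
  "equivalent C x y \<longleftrightarrow> (\<exists>f \<in> hom C x y. \<exists>g \<in> hom C y x.
     isomorphic C (IdM C x) (Comp C g f) \<and> isomorphic C (Comp C f g) (IdM C y))"

text \<open>A biequivalence is a 2-functor that is surjective on objects up to equivalence and induces
  equivalences of hom-categories (essentially surjective and fully faithful functors).\<close>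

definition biequivalence :: "('o, 'm, 'c) two_cat \<Rightarrow> ('p, 'n, 'd) two_cat
    \<Rightarrow> ('o, 'm, 'c, 'p, 'n, 'd) two_fun \<Rightarrow> bool" where
  "biequivalence A B F \<longleftrightarrow> two_category A \<and> two_category B \<and> F \<in> two_functors A B \<and>
     (\<forall>y \<in> Ob B. \<exists>x \<in> Ob A. equivalent B (Fn0 F x) y) \<and>
     (\<forall>x \<in> Ob A. \<forall>y \<in> Ob A.
        (\<forall>g \<in> hom B (Fn0 F x) (Fn0 F y). \<exists>f \<in> hom A x y. isomorphic B (Fn1 F f) g) \<and>
        (\<forall>f \<in> hom A x y. \<forall>g \<in> hom A x y.
           bij_betw (Fn2 F) (cells A f g) (cells B (Fn1 F f) (Fn1 F g))))"

record ('o, 'a) cat =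
  CObj :: "'o set"
  CArr :: "'a set"
  CDom :: "'a \<Rightarrow> 'o"
  CCod :: "'a \<Rightarrow> 'o"
  CId :: "'o \<Rightarrow> 'a"
  CComp :: "'a \<Rightarrow> 'a \<Rightarrow> 'a"

text \<open>The poset $\{0 < \dots < n-1\}$ as a category: $[m]$ is \<open>ordinal (m + 1)\<close> and $[-1]$ is
  \<open>ordinal 0\<close>.\<close>

definition ordinal :: "nat \<Rightarrow> (nat, nat \<times> nat) cat" where
  "ordinal n = \<lparr>CObj = {..<n}, CArr = {(i, j). i \<le> j \<and> j < n}, CDom = fst, CCod = snd,
     CId = (\<lambda>i. (i, i)), CComp = (\<lambda>(j, k) (i, j'). (i, k))\<rparr>"

text \<open>The coproduct of \<open>n\<close> copies of $[0]$, as a subcategory of \<open>ordinal n\<close>.\<close>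

definition discrete :: "nat \<Rightarrow> (nat, nat \<times> nat) cat" where
  "discrete n = (ordinal n)\<lparr>CArr := {(i, i) |i. i < n}\<rparr>"

fun path :: "('e \<Rightarrow> 'v) \<Rightarrow> ('e \<Rightarrow> 'v) \<Rightarrow> 'v \<Rightarrow> 'e list \<Rightarrow> 'v \<Rightarrow> bool" where
  "path s t x [] y \<longleftrightarrow> x = y"
| "path s t x (e # es) y \<longleftrightarrow> s e = x \<and> path s t (t e) es y"

definition free_cat :: "'v set \<Rightarrow> 'e set \<Rightarrow> ('e \<Rightarrow> 'v) \<Rightarrow> ('e \<Rightarrow> 'v) \<Rightarrow> ('v, 'v \<times> 'e list \<times> 'v) cat" where
  "free_cat V E s t = \<lparr>CObj = V,
     CArr = {(x, es, y). x \<in> V \<and> y \<in> V \<and> set es \<subseteq> E \<and> path s t x es y},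
     CDom = (\<lambda>(x, es, y). x), CCod = (\<lambda>(x, es, y). y), CId = (\<lambda>x. (x, [], x)),
     CComp = (\<lambda>(y', es', z) (x, es, y). (x, es @ es', z))\<rparr>"

definition parallel_arrows :: "(nat, nat \<times> bool list \<times> nat) cat" where
  "parallel_arrows = free_cat {0, 1} UNIV (\<lambda>_. 0) (\<lambda>_. 1)"

definition locally_discrete :: "('o, 'a) cat \<Rightarrow> ('o, 'a, 'a) two_cat" where
  "locally_discrete D = \<lparr>Ob = CObj D, Mor = CArr D, Cell = CArr D, Src = CDom D, Tgt = CCod D,
     Dom = (\<lambda>a. a), Cod = (\<lambda>a. a), IdM = CId D, IdC = (\<lambda>f. f), Comp = CComp D,
     VComp = (\<lambda>b a. b), HComp = CComp D\<rparr>"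

text \<open>The suspension has objects \<open>False\<close> and \<open>True\<close> (the $x$ and $y$ of $\Sigma\mathcal{D}$).\<close>

datatype 'a susp = Id_x | Id_y | Inner 'a

fun susp_comp :: "('a \<Rightarrow> 'a \<Rightarrow> 'a) \<Rightarrow> 'a susp \<Rightarrow> 'a susp \<Rightarrow> 'a susp" where
  "susp_comp k (Inner b) (Inner a) = Inner (k b a)"
| "susp_comp k (Inner b) v = Inner b"
| "susp_comp k u v = v"

definition suspension :: "('o, 'a) cat \<Rightarrow> (bool, 'o susp, 'a susp) two_cat" where
  "suspension D = \<lparr>Ob = UNIV, Mor = {Id_x, Id_y} \<union> Inner ` CObj D,
     Cell = {Id_x, Id_y} \<union> Inner ` CArr D,
     Src = (\<lambda>f. f = Id_y), Tgt = (\<lambda>f. f \<noteq> Id_x),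
     Dom = map_susp (CDom D), Cod = map_susp (CCod D),
     IdM = (\<lambda>u. if u then Id_y else Id_x), IdC = map_susp (CId D),
     Comp = susp_comp (\<lambda>g f. g),
     VComp = susp_comp (CComp D),
     HComp = susp_comp (\<lambda>b a. b)\<rparr>"

definition has_rlp :: "('a, 'b, 'c) two_cat \<Rightarrow> ('a2, 'b2, 'c2) two_cat
    \<Rightarrow> ('a, 'b, 'c, 'a2, 'b2, 'c2) two_fun \<Rightarrow> ('o, 'm, 'k) two_cat \<Rightarrow> ('p, 'n, 'l) two_cat
    \<Rightarrow> ('o, 'm, 'k, 'p, 'n, 'l) two_fun \<Rightarrow> bool" where
  "has_rlp A B i X Y p \<longleftrightarrow>
     (\<forall>u \<in> two_functors A X. \<forall>v \<in> two_functors B Y. two_comp A p u = two_comp A v i \<longrightarrow>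
        (\<exists>h \<in> two_functors B X. two_comp A h i = u \<and> two_comp B p h = v))"

text \<open>The acyclic fibrations of Lack's model structure: the maps with the right lifting property
  against the four generating cofibrations $[-1] \to [0]$, $[0] \amalg [0] \to [1]$,
  $\Sigma([0] \amalg [0]) \to \Sigma[1]$ and $\Sigma[\rightrightarrows] \to \Sigma[1]$.\<close>

definition acyclic_fibration :: "('o, 'm, 'k) two_cat \<Rightarrow> ('p, 'n, 'l) two_cat
    \<Rightarrow> ('o, 'm, 'k, 'p, 'n, 'l) two_fun \<Rightarrow> bool" where
  "acyclic_fibration X Y p \<longleftrightarrow> two_category X \<and> two_category Y \<and> p \<in> two_functors X Y \<and>
     has_rlp (locally_discrete (ordinal 0)) (locally_discrete (ordinal 1))
       (inclusion (locally_discrete (ordinal 0))) X Y p \<and>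
     has_rlp (locally_discrete (discrete 2)) (locally_discrete (ordinal 2))
       (inclusion (locally_discrete (discrete 2))) X Y p \<and>
     has_rlp (suspension (discrete 2)) (suspension (ordinal 2))
       (inclusion (suspension (discrete 2))) X Y p \<and>
     has_rlp (suspension parallel_arrows) (suspension (ordinal 2))
       (restr (suspension parallel_arrows)
         \<lparr>Fn0 = (\<lambda>u. u), Fn1 = (\<lambda>f. f), Fn2 = map_susp (\<lambda>(i, es, j). (i, j))\<rparr>) X Y p"

section \<open>2-categories given by generators and relations\<close>

text \<open>The generators of a presentation may be identified in dimension 0 already, hence sources and
  targets of composable terms have to match only up to the congruence in the lower dimension.
  \<open>Rel0\<close>, \<open>Rel1\<close>, \<open>Rel2\<close> are the imposed relations; a relation between terms that are not well formed
  and parallel is ignored.\<close>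

datatype ('o, 'm) tm1 = Id1 'o | Gen1 'm | Comp1 "('o, 'm) tm1" "('o, 'm) tm1"

datatype ('o, 'm, 'c) tm2 = Id2 "('o, 'm) tm1" | Gen2 'c
  | VComp2 "('o, 'm, 'c) tm2" "('o, 'm, 'c) tm2" | HComp2 "('o, 'm, 'c) tm2" "('o, 'm, 'c) tm2"

record ('o, 'm, 'c) presentation =
  Gens0 :: "'o set"
  Gens1 :: "'m set"
  Gens2 :: "'c set"
  gsrc :: "'m \<Rightarrow> 'o"
  gtgt :: "'m \<Rightarrow> 'o"
  gdom :: "'c \<Rightarrow> ('o, 'm) tm1"
  gcod :: "'c \<Rightarrow> ('o, 'm) tm1"
  Rel0 :: "'o \<Rightarrow> 'o \<Rightarrow> bool"
  Rel1 :: "('o, 'm) tm1 \<Rightarrow> ('o, 'm) tm1 \<Rightarrow> bool"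
  Rel2 :: "('o, 'm, 'c) tm2 \<Rightarrow> ('o, 'm, 'c) tm2 \<Rightarrow> bool"

inductive eq0 for P :: "('o, 'm, 'c) presentation" where
  eq0_rel: "\<lbrakk>Rel0 P x y; x \<in> Gens0 P; y \<in> Gens0 P\<rbrakk> \<Longrightarrow> eq0 P x y"
| eq0_refl: "x \<in> Gens0 P \<Longrightarrow> eq0 P x x"
| eq0_sym: "eq0 P x y \<Longrightarrow> eq0 P y x"
| eq0_trans: "\<lbrakk>eq0 P x y; eq0 P y z\<rbrakk> \<Longrightarrow> eq0 P x z"

fun src1 :: "('o, 'm, 'c) presentation \<Rightarrow> ('o, 'm) tm1 \<Rightarrow> 'o" where
  "src1 P (Id1 x) = x"
| "src1 P (Gen1 f) = gsrc P f"
| "src1 P (Comp1 g f) = src1 P f"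

fun tgt1 :: "('o, 'm, 'c) presentation \<Rightarrow> ('o, 'm) tm1 \<Rightarrow> 'o" where
  "tgt1 P (Id1 x) = x"
| "tgt1 P (Gen1 f) = gtgt P f"
| "tgt1 P (Comp1 g f) = tgt1 P g"

fun wf1 :: "('o, 'm, 'c) presentation \<Rightarrow> ('o, 'm) tm1 \<Rightarrow> bool" where
  "wf1 P (Id1 x) \<longleftrightarrow> x \<in> Gens0 P"
| "wf1 P (Gen1 f) \<longleftrightarrow> f \<in> Gens1 P"
| "wf1 P (Comp1 g f) \<longleftrightarrow> wf1 P g \<and> wf1 P f \<and> eq0 P (tgt1 P f) (src1 P g)"

inductive eq1 for P :: "('o, 'm, 'c) presentation" where
  eq1_rel: "\<lbrakk>Rel1 P f g; wf1 P f; wf1 P g; eq0 P (src1 P f) (src1 P g); eq0 P (tgt1 P f) (tgt1 P g)\<rbrakk>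
    \<Longrightarrow> eq1 P f g"
| eq1_refl: "wf1 P f \<Longrightarrow> eq1 P f f"
| eq1_sym: "eq1 P f g \<Longrightarrow> eq1 P g f"
| eq1_trans: "\<lbrakk>eq1 P f g; eq1 P g h\<rbrakk> \<Longrightarrow> eq1 P f h"
| eq1_Id_cong: "eq0 P x y \<Longrightarrow> eq1 P (Id1 x) (Id1 y)"
| eq1_Comp_cong: "\<lbrakk>eq1 P f f'; eq1 P g g'; wf1 P (Comp1 g f)\<rbrakk> \<Longrightarrow> eq1 P (Comp1 g f) (Comp1 g' f')"
| eq1_unit_left: "wf1 P f \<Longrightarrow> eq1 P (Comp1 (Id1 (tgt1 P f)) f) f"
| eq1_unit_right: "wf1 P f \<Longrightarrow> eq1 P (Comp1 f (Id1 (src1 P f))) f"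
| eq1_assoc: "wf1 P (Comp1 h (Comp1 g f)) \<Longrightarrow> eq1 P (Comp1 (Comp1 h g) f) (Comp1 h (Comp1 g f))"

fun dom2 :: "('o, 'm, 'c) presentation \<Rightarrow> ('o, 'm, 'c) tm2 \<Rightarrow> ('o, 'm) tm1" where
  "dom2 P (Id2 f) = f"
| "dom2 P (Gen2 a) = gdom P a"
| "dom2 P (VComp2 b a) = dom2 P a"
| "dom2 P (HComp2 b a) = Comp1 (dom2 P b) (dom2 P a)"

fun cod2 :: "('o, 'm, 'c) presentation \<Rightarrow> ('o, 'm, 'c) tm2 \<Rightarrow> ('o, 'm) tm1" where
  "cod2 P (Id2 f) = f"
| "cod2 P (Gen2 a) = gcod P a"
| "cod2 P (VComp2 b a) = cod2 P b"
| "cod2 P (HComp2 b a) = Comp1 (cod2 P b) (cod2 P a)"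

fun wf2 :: "('o, 'm, 'c) presentation \<Rightarrow> ('o, 'm, 'c) tm2 \<Rightarrow> bool" where
  "wf2 P (Id2 f) \<longleftrightarrow> wf1 P f"
| "wf2 P (Gen2 a) \<longleftrightarrow> a \<in> Gens2 P"
| "wf2 P (VComp2 b a) \<longleftrightarrow> wf2 P b \<and> wf2 P a \<and> eq1 P (cod2 P a) (dom2 P b)"
| "wf2 P (HComp2 b a) \<longleftrightarrow> wf2 P b \<and> wf2 P a \<and> eq0 P (tgt1 P (dom2 P a)) (src1 P (dom2 P b))"

inductive eq2 for P :: "('o, 'm, 'c) presentation" where
  eq2_rel: "\<lbrakk>Rel2 P a b; wf2 P a; wf2 P b; eq1 P (dom2 P a) (dom2 P b); eq1 P (cod2 P a) (cod2 P b)\<rbrakk>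
    \<Longrightarrow> eq2 P a b"
| eq2_refl: "wf2 P a \<Longrightarrow> eq2 P a a"
| eq2_sym: "eq2 P a b \<Longrightarrow> eq2 P b a"
| eq2_trans: "\<lbrakk>eq2 P a b; eq2 P b c\<rbrakk> \<Longrightarrow> eq2 P a c"
| eq2_Id_cong: "eq1 P f g \<Longrightarrow> eq2 P (Id2 f) (Id2 g)"
| eq2_VComp_cong: "\<lbrakk>eq2 P a a'; eq2 P b b'; wf2 P (VComp2 b a)\<rbrakk> \<Longrightarrow> eq2 P (VComp2 b a) (VComp2 b' a')"
| eq2_HComp_cong: "\<lbrakk>eq2 P a a'; eq2 P b b'; wf2 P (HComp2 b a)\<rbrakk> \<Longrightarrow> eq2 P (HComp2 b a) (HComp2 b' a')"
| eq2_vunit_left: "wf2 P a \<Longrightarrow> eq2 P (VComp2 (Id2 (cod2 P a)) a) a"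
| eq2_vunit_right: "wf2 P a \<Longrightarrow> eq2 P (VComp2 a (Id2 (dom2 P a))) a"
| eq2_vassoc: "wf2 P (VComp2 c (VComp2 b a)) \<Longrightarrow> eq2 P (VComp2 (VComp2 c b) a) (VComp2 c (VComp2 b a))"
| eq2_hunit_left: "wf2 P a \<Longrightarrow> eq2 P (HComp2 (Id2 (Id1 (tgt1 P (dom2 P a)))) a) a"
| eq2_hunit_right: "wf2 P a \<Longrightarrow> eq2 P (HComp2 a (Id2 (Id1 (src1 P (dom2 P a))))) a"
| eq2_hassoc: "wf2 P (HComp2 c (HComp2 b a)) \<Longrightarrow> eq2 P (HComp2 (HComp2 c b) a) (HComp2 c (HComp2 b a))"
| eq2_HComp_Id: "wf1 P (Comp1 g f) \<Longrightarrow> eq2 P (HComp2 (Id2 g) (Id2 f)) (Id2 (Comp1 g f))"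
| eq2_interchange: "wf2 P (HComp2 (VComp2 b' b) (VComp2 a' a))
    \<Longrightarrow> eq2 P (HComp2 (VComp2 b' b) (VComp2 a' a)) (VComp2 (HComp2 b' a') (HComp2 b a))"

definition cls0 :: "('o, 'm, 'c) presentation \<Rightarrow> 'o \<Rightarrow> 'o set" where
  "cls0 P x = {y. eq0 P x y}"

definition cls1 :: "('o, 'm, 'c) presentation \<Rightarrow> ('o, 'm) tm1 \<Rightarrow> ('o, 'm) tm1 set" where
  "cls1 P f = {g. eq1 P f g}"

definition cls2 :: "('o, 'm, 'c) presentation \<Rightarrow> ('o, 'm, 'c) tm2 \<Rightarrow> ('o, 'm, 'c) tm2 set" where
  "cls2 P a = {b. eq2 P a b}"

definition rep :: "'a set \<Rightarrow> 'a" where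
  "rep S = (SOME s. s \<in> S)"

definition presented :: "('o, 'm, 'c) presentation
    \<Rightarrow> ('o set, ('o, 'm) tm1 set, ('o, 'm, 'c) tm2 set) two_cat" where
  "presented P = \<lparr>Ob = cls0 P ` Gens0 P, Mor = cls1 P ` Collect (wf1 P),
     Cell = cls2 P ` Collect (wf2 P),
     Src = (\<lambda>f. cls0 P (src1 P (rep f))), Tgt = (\<lambda>f. cls0 P (tgt1 P (rep f))),
     Dom = (\<lambda>a. cls1 P (dom2 P (rep a))), Cod = (\<lambda>a. cls1 P (cod2 P (rep a))),
     IdM = (\<lambda>x. cls1 P (Id1 (rep x))), IdC = (\<lambda>f. cls2 P (Id2 (rep f))),
     Comp = (\<lambda>g f. cls1 P (Comp1 (rep g) (rep f))),
     VComp = (\<lambda>b a. cls2 P (VComp2 (rep b) (rep a))),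
     HComp = (\<lambda>b a. cls2 P (HComp2 (rep b) (rep a)))\<rparr>"

text \<open>The 2-functor out of a presented 2-category determined by the images of the generators.\<close>

fun eval1 :: "('p, 'n, 'd) two_cat \<Rightarrow> ('o \<Rightarrow> 'p) \<Rightarrow> ('m \<Rightarrow> 'n) \<Rightarrow> ('o, 'm) tm1 \<Rightarrow> 'n" where
  "eval1 D k0 k1 (Id1 x) = IdM D (k0 x)"
| "eval1 D k0 k1 (Gen1 f) = k1 f"
| "eval1 D k0 k1 (Comp1 g f) = Comp D (eval1 D k0 k1 g) (eval1 D k0 k1 f)"

fun eval2 :: "('p, 'n, 'd) two_cat \<Rightarrow> ('o \<Rightarrow> 'p) \<Rightarrow> ('m \<Rightarrow> 'n) \<Rightarrow> ('c \<Rightarrow> 'd)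
    \<Rightarrow> ('o, 'm, 'c) tm2 \<Rightarrow> 'd" where
  "eval2 D k0 k1 k2 (Id2 f) = IdC D (eval1 D k0 k1 f)"
| "eval2 D k0 k1 k2 (Gen2 a) = k2 a"
| "eval2 D k0 k1 k2 (VComp2 b a) = VComp D (eval2 D k0 k1 k2 b) (eval2 D k0 k1 k2 a)"
| "eval2 D k0 k1 k2 (HComp2 b a) = HComp D (eval2 D k0 k1 k2 b) (eval2 D k0 k1 k2 a)"

definition induced :: "('o, 'm, 'c) presentation \<Rightarrow> ('p, 'n, 'd) two_cat
    \<Rightarrow> ('o \<Rightarrow> 'p) \<Rightarrow> ('m \<Rightarrow> 'n) \<Rightarrow> ('c \<Rightarrow> 'd)
    \<Rightarrow> ('o set, ('o, 'm) tm1 set, ('o, 'm, 'c) tm2 set, 'p, 'n, 'd) two_fun" where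
  "induced P D k0 k1 k2 = restr (presented P)
     \<lparr>Fn0 = (\<lambda>x. k0 (rep x)), Fn1 = (\<lambda>f. eval1 D k0 k1 (rep f)),
      Fn2 = (\<lambda>a. eval2 D k0 k1 k2 (rep a))\<rparr>"

text \<open>The relations making the assignment \<open>i0\<close>, \<open>i1\<close>, \<open>i2\<close> of generators to the cells of \<open>A\<close>
  2-functorial.\<close>

inductive functorial1 for A :: "('p, 'n, 'd) two_cat" and i0 :: "'p \<Rightarrow> 'o" and i1 :: "'n \<Rightarrow> 'm" where
  "x \<in> Ob A \<Longrightarrow> functorial1 A i0 i1 (Gen1 (i1 (IdM A x))) (Id1 (i0 x))"
| "\<lbrakk>f \<in> Mor A; g \<in> Mor A; Tgt A f = Src A g\<rbrakk>
    \<Longrightarrow> functorial1 A i0 i1 (Gen1 (i1 (Comp A g f))) (Comp1 (Gen1 (i1 g)) (Gen1 (i1 f)))"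

inductive functorial2 for A :: "('p, 'n, 'd) two_cat" and i1 :: "'n \<Rightarrow> 'm" and i2 :: "'d \<Rightarrow> 'c" where
  "f \<in> Mor A \<Longrightarrow> functorial2 A i1 i2 (Gen2 (i2 (IdC A f))) (Id2 (Gen1 (i1 f)))"
| "\<lbrakk>a \<in> Cell A; b \<in> Cell A; Cod A a = Dom A b\<rbrakk>
    \<Longrightarrow> functorial2 A i1 i2 (Gen2 (i2 (VComp A b a))) (VComp2 (Gen2 (i2 b)) (Gen2 (i2 a)))"
| "\<lbrakk>a \<in> Cell A; b \<in> Cell A; Tgt A (Dom A a) = Src A (Dom A b)\<rbrakk>
    \<Longrightarrow> functorial2 A i1 i2 (Gen2 (i2 (HComp A b a))) (HComp2 (Gen2 (i2 b)) (Gen2 (i2 a)))"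

section \<open>Orientals, the free adjoint equivalence, and the category $t\Delta$\<close>

text \<open>A 1-cell of $\mathcal{O}_2[m]$ from \<open>i\<close> to \<open>j\<close> is a subset of $\{i,\dots,j\}$ containing \<open>i\<close>
  and \<open>j\<close>, so that \<open>i\<close> and \<open>j\<close> are its minimum and maximum; a 2-cell is a pair of such subsets
  in increasing order.\<close>

definition oriental :: "nat \<Rightarrow> (nat, nat set, nat set \<times> nat set) two_cat" where
  "oriental m = \<lparr>Ob = {0..m},
     Mor = {S. \<exists>i j. i \<le> j \<and> j \<le> m \<and> i \<in> S \<and> j \<in> S \<and> S \<subseteq> {i..j}},
     Cell = {(S, T). \<exists>i j. i \<le> j \<and> j \<le> m \<and> i \<in> S \<and> j \<in> S \<and> S \<subseteq> T \<and> T \<subseteq> {i..j}},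
     Src = Min, Tgt = Max, Dom = fst, Cod = snd, IdM = (\<lambda>i. {i}), IdC = (\<lambda>S. (S, S)),
     Comp = (\<lambda>T S. S \<union> T),
     VComp = (\<lambda>(T, U) (S, T'). (S, U)),
     HComp = (\<lambda>(T, T') (S, S'). (S \<union> T, S' \<union> T'))\<rparr>"

datatype adj0 = Adj_x | Adj_y
datatype adj1 = Adj_f | Adj_g
datatype adj2 = Adj_eta | Adj_eta_inv | Adj_eps | Adj_eps_inv

inductive adj_rel :: "(adj0, adj1, adj2) tm2 \<Rightarrow> (adj0, adj1, adj2) tm2 \<Rightarrow> bool" where
  "adj_rel (VComp2 (Gen2 Adj_eta_inv) (Gen2 Adj_eta)) (Id2 (Id1 Adj_x))"
| "adj_rel (VComp2 (Gen2 Adj_eta) (Gen2 Adj_eta_inv)) (Id2 (Comp1 (Gen1 Adj_g) (Gen1 Adj_f)))"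
| "adj_rel (VComp2 (Gen2 Adj_eps_inv) (Gen2 Adj_eps)) (Id2 (Comp1 (Gen1 Adj_f) (Gen1 Adj_g)))"
| "adj_rel (VComp2 (Gen2 Adj_eps) (Gen2 Adj_eps_inv)) (Id2 (Id1 Adj_y))"
| "adj_rel (VComp2 (HComp2 (Gen2 Adj_eps) (Id2 (Gen1 Adj_f))) (HComp2 (Id2 (Gen1 Adj_f)) (Gen2 Adj_eta)))
     (Id2 (Gen1 Adj_f))"
| "adj_rel (VComp2 (HComp2 (Id2 (Gen1 Adj_g)) (Gen2 Adj_eps)) (HComp2 (Gen2 Adj_eta) (Id2 (Gen1 Adj_g))))
     (Id2 (Gen1 Adj_g))"

definition adj_pres :: "(adj0, adj1, adj2) presentation" where
  "adj_pres = \<lparr>Gens0 = UNIV, Gens1 = UNIV, Gens2 = UNIV,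
     gsrc = (\<lambda>f. case f of Adj_f \<Rightarrow> Adj_x | Adj_g \<Rightarrow> Adj_y),
     gtgt = (\<lambda>f. case f of Adj_f \<Rightarrow> Adj_y | Adj_g \<Rightarrow> Adj_x),
     gdom = (\<lambda>a. case a of Adj_eta \<Rightarrow> Id1 Adj_x | Adj_eta_inv \<Rightarrow> Comp1 (Gen1 Adj_g) (Gen1 Adj_f)
       | Adj_eps \<Rightarrow> Comp1 (Gen1 Adj_f) (Gen1 Adj_g) | Adj_eps_inv \<Rightarrow> Id1 Adj_y),
     gcod = (\<lambda>a. case a of Adj_eta \<Rightarrow> Comp1 (Gen1 Adj_g) (Gen1 Adj_f) | Adj_eta_inv \<Rightarrow> Id1 Adj_x
       | Adj_eps \<Rightarrow> Id1 Adj_y | Adj_eps_inv \<Rightarrow> Comp1 (Gen1 Adj_f) (Gen1 Adj_g)),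
     Rel0 = (\<lambda>x y. False), Rel1 = (\<lambda>f g. False), Rel2 = adj_rel\<rparr>"

text \<open>Freely inverting a 2-cell \<open>w\<close> of \<open>A\<close>: the cells \<open>a\<close> of \<open>A\<close> become generators (\<open>Some a\<close> in
  dimension 2), and \<open>None\<close> is a formal inverse of \<open>w\<close>.\<close>

inductive inverse_rel for w :: 'c and f g :: 'm where
  "inverse_rel w f g (VComp2 (Gen2 None) (Gen2 (Some w))) (Id2 (Gen1 f))"
| "inverse_rel w f g (VComp2 (Gen2 (Some w)) (Gen2 None)) (Id2 (Gen1 g))"

definition invert_pres :: "('o, 'm, 'c) two_cat \<Rightarrow> 'c \<Rightarrow> ('o, 'm, 'c option) presentation" where
  "invert_pres A w = \<lparr>Gens0 = Ob A, Gens1 = Mor A, Gens2 = insert None (Some ` Cell A),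
     gsrc = Src A, gtgt = Tgt A,
     gdom = (\<lambda>a. Gen1 (case a of Some b \<Rightarrow> Dom A b | None \<Rightarrow> Cod A w)),
     gcod = (\<lambda>a. Gen1 (case a of Some b \<Rightarrow> Cod A b | None \<Rightarrow> Dom A w)),
     Rel0 = (\<lambda>x y. False),
     Rel1 = functorial1 A (\<lambda>x. x) (\<lambda>f. f),
     Rel2 = (\<lambda>a b. functorial2 A (\<lambda>f. f) Some a b \<or> inverse_rel w (Dom A w) (Cod A w) a b)\<rparr>"

definition inv_pres :: "(nat, nat set, (nat set \<times> nat set) option) presentation" where
  "inv_pres = invert_pres (oriental 2) ({0, 2}, {0, 1, 2})"

text \<open>The values of the functor $t\Delta \to 2\mathcal{C}at$ are tagged copies of $\mathcal{O}_2[m]$,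
  $\mathbb{E}$ and $\mathbb{O}_2[2]$, so that they share one type.\<close>

datatype real0 = Ori0 nat | Adj0 "adj0 set" | Inv0 "nat set"
datatype real1 = Ori1 "nat set" | Adj1 "(adj0, adj1) tm1 set" | Inv1 "(nat, nat set) tm1 set"
datatype real2 = Ori2 "nat set \<times> nat set" | Adj2 "(adj0, adj1, adj2) tm2 set"
  | Inv2 "(nat, nat set, (nat set \<times> nat set) option) tm2 set"

type_synonym ('o, 'm, 'c) tagging = "('o, 'm, 'c, real0, real1, real2) two_fun"

definition ori_tag :: "(nat, nat set, nat set \<times> nat set) tagging" where
  "ori_tag = \<lparr>Fn0 = Ori0, Fn1 = Ori1, Fn2 = Ori2\<rparr>"

definition adj_tag :: "(adj0 set, (adj0, adj1) tm1 set, (adj0, adj1, adj2) tm2 set) tagging" where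
  "adj_tag = \<lparr>Fn0 = Adj0, Fn1 = Adj1, Fn2 = Adj2\<rparr>"

definition inv_tag :: "(nat set, (nat, nat set) tm1 set,
    (nat, nat set, (nat set \<times> nat set) option) tm2 set) tagging" where
  "inv_tag = \<lparr>Fn0 = Inv0, Fn1 = Inv1, Fn2 = Inv2\<rparr>"

definition tag :: "('o, 'm, 'c) tagging \<Rightarrow> ('o, 'm, 'c) two_cat \<Rightarrow> (real0, real1, real2) two_cat" where
  "tag W A = (let u0 = inv (Fn0 W); u1 = inv (Fn1 W); u2 = inv (Fn2 W) in
     \<lparr>Ob = Fn0 W ` Ob A, Mor = Fn1 W ` Mor A, Cell = Fn2 W ` Cell A,
      Src = (\<lambda>f. Fn0 W (Src A (u1 f))), Tgt = (\<lambda>f. Fn0 W (Tgt A (u1 f))),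
      Dom = (\<lambda>a. Fn1 W (Dom A (u2 a))), Cod = (\<lambda>a. Fn1 W (Cod A (u2 a))),
      IdM = (\<lambda>x. Fn1 W (IdM A (u0 x))), IdC = (\<lambda>f. Fn2 W (IdC A (u1 f))),
      Comp = (\<lambda>g f. Fn1 W (Comp A (u1 g) (u1 f))),
      VComp = (\<lambda>b a. Fn2 W (VComp A (u2 b) (u2 a))),
      HComp = (\<lambda>b a. Fn2 W (HComp A (u2 b) (u2 a)))\<rparr>)"

definition tag_fun :: "('o, 'm, 'c) tagging \<Rightarrow> ('p, 'n, 'd) tagging
    \<Rightarrow> ('o, 'm, 'c, 'p, 'n, 'd) two_fun
    \<Rightarrow> (real0, real1, real2, real0, real1, real2) two_fun" where
  "tag_fun V W F = \<lparr>Fn0 = Fn0 W \<circ> Fn0 F \<circ> inv (Fn0 V), Fn1 = Fn1 W \<circ> Fn1 F \<circ> inv (Fn1 V),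
     Fn2 = Fn2 W \<circ> Fn2 F \<circ> inv (Fn2 V)\<rparr>"

text \<open>\<open>Simp m\<close> is $[m]$ and \<open>Mark m\<close> is $[m]_t$, which is an object of $t\Delta$ for $m \ge 1$ only.
  The generating morphisms are \<open>CoF m i\<close> for $d^i\colon [m] \to [m+1]$, \<open>CoD m i\<close> for
  $s^i\colon [m+1] \to [m]$, \<open>Phi m\<close> for $\varphi\colon [m] \to [m]_t$ and \<open>Zeta m i\<close> for
  $\zeta^i\colon [m+1]_t \to [m]$.\<close>

datatype td_obj = Simp nat | Mark nat
datatype td_gen = CoF nat nat | CoD nat nat | Phi nat | Zeta nat nat

fun td_ob :: "td_obj \<Rightarrow> bool" where
  "td_ob (Simp m) \<longleftrightarrow> True"
| "td_ob (Mark m) \<longleftrightarrow> 1 \<le> m"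

fun td_arr :: "td_gen \<Rightarrow> bool" where
  "td_arr (CoF m i) \<longleftrightarrow> i \<le> m + 1"
| "td_arr (CoD m i) \<longleftrightarrow> i \<le> m"
| "td_arr (Phi m) \<longleftrightarrow> 1 \<le> m"
| "td_arr (Zeta m i) \<longleftrightarrow> i \<le> m"

fun td_dom :: "td_gen \<Rightarrow> td_obj" where
  "td_dom (CoF m i) = Simp m"
| "td_dom (CoD m i) = Simp (m + 1)"
| "td_dom (Phi m) = Simp m"
| "td_dom (Zeta m i) = Mark (m + 1)"

fun td_cod :: "td_gen \<Rightarrow> td_obj" where
  "td_cod (CoF m i) = Simp (m + 1)"
| "td_cod (CoD m i) = Simp m"
| "td_cod (Phi m) = Mark m"
| "td_cod (Zeta m i) = Simp m"

text \<open>The defining relations of $t\Delta$ between words in applicative order, \<open>[u, v]\<close> standing for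
  $u \circ v$.\<close>

inductive td_rel :: "td_gen list \<Rightarrow> td_gen list \<Rightarrow> bool" where
  "\<lbrakk>i < j; j \<le> m + 2\<rbrakk> \<Longrightarrow> td_rel [CoF (m + 1) j, CoF m i] [CoF (m + 1) i, CoF m (j - 1)]"
| "\<lbrakk>i \<le> j; j \<le> m\<rbrakk> \<Longrightarrow> td_rel [CoD m j, CoD (m + 1) i] [CoD m i, CoD (m + 1) (j + 1)]"
| "\<lbrakk>i < j; j \<le> m + 1\<rbrakk> \<Longrightarrow> td_rel [CoD (m + 1) j, CoF (m + 1) i] [CoF m i, CoD m (j - 1)]"
| "\<lbrakk>j \<le> m; i = j \<or> i = j + 1\<rbrakk> \<Longrightarrow> td_rel [CoD m j, CoF m i] []"
| "\<lbrakk>j + 1 < i; i \<le> m + 2\<rbrakk> \<Longrightarrow> td_rel [CoD (m + 1) j, CoF (m + 1) i] [CoF m (i - 1), CoD m j]"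
| "i \<le> m \<Longrightarrow> td_rel [Zeta m i, Phi (m + 1)] [CoD m i]"
| "\<lbrakk>i \<le> j; j \<le> m\<rbrakk> \<Longrightarrow> td_rel [CoD m i, Zeta (m + 1) (j + 1)] [CoD m j, Zeta (m + 1) i]"

text \<open>A presheaf on $t\Delta$, given by its values and by the (contravariant) action of the generating
  morphisms.\<close>

record 'x td_presheaf =
  simplices :: "td_obj \<Rightarrow> 'x set"
  act :: "td_gen \<Rightarrow> 'x \<Rightarrow> 'x"

locale td_set =
  fixes X :: "'x td_presheaf"
  assumes act_in: "\<lbrakk>td_arr u; x \<in> simplices X (td_cod u)\<rbrakk> \<Longrightarrow> act X u x \<in> simplices X (td_dom u)"
    and act_rel: "\<lbrakk>td_rel us vs; x \<in> simplices X (td_cod (hd us))\<rbrakk>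
      \<Longrightarrow> fold (act X) us x = fold (act X) vs x"
    and simp_empty: "\<not> td_ob \<theta> \<Longrightarrow> simplices X \<theta> = {}"

definition td_maps :: "'x td_presheaf \<Rightarrow> 'y td_presheaf \<Rightarrow> (td_obj \<Rightarrow> 'x \<Rightarrow> 'y) set" where
  "td_maps X Y = {h. (\<forall>\<theta>. h \<theta> \<in> simplices X \<theta> \<rightarrow>\<^sub>E simplices Y \<theta>) \<and>
     (\<forall>u x. td_arr u \<longrightarrow> x \<in> simplices X (td_cod u)
        \<longrightarrow> h (td_dom u) (act X u x) = act Y u (h (td_cod u) x))}"

subsection \<open>The functor $t\Delta \to 2\mathcal{C}at$\<close>

definition coface :: "nat \<Rightarrow> nat \<Rightarrow> nat" where
  "coface i k = (if k < i then k else k + 1)"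

definition codegen :: "nat \<Rightarrow> nat \<Rightarrow> nat" where
  "codegen i k = (if k \<le> i then k else k - 1)"

definition ori_map :: "(nat \<Rightarrow> nat)
    \<Rightarrow> (nat, nat set, nat set \<times> nat set, nat, nat set, nat set \<times> nat set) two_fun" where
  "ori_map k = \<lparr>Fn0 = k, Fn1 = image k, Fn2 = map_prod (image k) (image k)\<rparr>"

definition phi_adj :: "(nat, nat set, nat set \<times> nat set,
    adj0 set, (adj0, adj1) tm1 set, (adj0, adj1, adj2) tm2 set) two_fun" where
  "phi_adj = (let
     p0 = (\<lambda>i. if i = 0 then Adj_x else Adj_y);
     p1 = (\<lambda>S. if S = {0, 1} then Gen1 Adj_f else Id1 (p0 (Min S)))
   in \<lparr>Fn0 = (\<lambda>i. cls0 adj_pres (p0 i)), Fn1 = (\<lambda>S. cls1 adj_pres (p1 S)),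
       Fn2 = (\<lambda>(S, T). cls2 adj_pres (Id2 (p1 S)))\<rparr>)"

definition phi_inv :: "(nat, nat set, nat set \<times> nat set,
    nat set, (nat, nat set) tm1 set, (nat, nat set, (nat set \<times> nat set) option) tm2 set) two_fun" where
  "phi_inv = \<lparr>Fn0 = (\<lambda>i. cls0 inv_pres i), Fn1 = (\<lambda>S. cls1 inv_pres (Gen1 S)),
     Fn2 = (\<lambda>a. cls2 inv_pres (Gen2 (Some a)))\<rparr>"

definition zeta_adj :: "(adj0 set, (adj0, adj1) tm1 set, (adj0, adj1, adj2) tm2 set,
    nat, nat set, nat set \<times> nat set) two_fun" where
  "zeta_adj = induced adj_pres (oriental 0) (\<lambda>_. 0) (\<lambda>_. {0}) (\<lambda>_. ({0}, {0}))"

text \<open>The codegeneracies $\mathcal{O}_2[2] \to \mathcal{O}_2[1]$ send the non-identity 2-cell to the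
  identity of the 1-cell $\{0, 1\}$.\<close>

definition zeta_inv :: "nat \<Rightarrow> (nat set, (nat, nat set) tm1 set,
    (nat, nat set, (nat set \<times> nat set) option) tm2 set, nat, nat set, nat set \<times> nat set) two_fun" where
  "zeta_inv i = induced inv_pres (oriental 1) (codegen i) (image (codegen i))
     (\<lambda>a. case a of Some b \<Rightarrow> Fn2 (ori_map (codegen i)) b | None \<Rightarrow> ({0, 1}, {0, 1}))"

fun realize :: "td_obj \<Rightarrow> (real0, real1, real2) two_cat" where
  "realize (Simp m) = tag ori_tag (oriental m)"
| "realize (Mark m) = (if m = 1 then tag adj_tag (presented adj_pres)
     else if m = 2 then tag inv_tag (presented inv_pres)
     else tag ori_tag (oriental m))"

fun pre_realize_map :: "td_gen \<Rightarrow> (real0, real1, real2, real0, real1, real2) two_fun" where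
  "pre_realize_map (CoF m i) = tag_fun ori_tag ori_tag (ori_map (coface i))"
| "pre_realize_map (CoD m i) = tag_fun ori_tag ori_tag (ori_map (codegen i))"
| "pre_realize_map (Phi m) =
     (if m = 1 then tag_fun ori_tag adj_tag phi_adj
      else if m = 2 then tag_fun ori_tag inv_tag phi_inv
      else tag_fun ori_tag ori_tag (ori_map (\<lambda>k. k)))"
| "pre_realize_map (Zeta m i) =
     (if m = 0 then tag_fun adj_tag ori_tag zeta_adj
      else if m = 1 then tag_fun inv_tag ori_tag (zeta_inv i)
      else tag_fun ori_tag ori_tag (ori_map (codegen i)))"

definition realize_map :: "td_gen \<Rightarrow> (real0, real1, real2, real0, real1, real2) two_fun" where
  "realize_map u = restr (realize (td_dom u)) (pre_realize_map u)"

section \<open>The natural nerve and its left adjoint\<close>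

definition nerve :: "('o, 'm, 'c) two_cat \<Rightarrow> (real0, real1, real2, 'o, 'm, 'c) two_fun td_presheaf" where
  "nerve C = \<lparr>simplices = (\<lambda>\<theta>. if td_ob \<theta> then two_functors (realize \<theta>) C else {}),
     act = (\<lambda>u x. two_comp (realize (td_dom u)) x (realize_map u))\<rparr>"

text \<open>The colimit-preserving extension of \<open>realize\<close> sends \<open>X\<close> to the colimit of \<open>realize\<close> over the
  category of elements of \<open>X\<close>.  This colimit is presented by a generator \<open>(\<theta>, x, a)\<close> for each element
  \<open>x\<close> of \<open>X\<close> at \<open>\<theta>\<close> and each cell \<open>a\<close> of \<open>realize \<theta>\<close>, subject to 2-functoriality in \<open>a\<close> and to
  compatibility with the morphisms of the category of elements.\<close>

inductive glue :: "'x td_presheaf \<Rightarrow> (td_gen \<Rightarrow> 'a \<Rightarrow> 'a) \<Rightarrow> (td_obj \<Rightarrow> 'a set)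
    \<Rightarrow> td_obj \<times> 'x \<times> 'a \<Rightarrow> td_obj \<times> 'x \<times> 'a \<Rightarrow> bool" for X F S where
  "\<lbrakk>td_arr u; x \<in> simplices X (td_cod u); a \<in> S (td_dom u)\<rbrakk>
    \<Longrightarrow> glue X F S (td_dom u, act X u x, a) (td_cod u, x, F u a)"

definition cat_pres :: "'x td_presheaf
    \<Rightarrow> (td_obj \<times> 'x \<times> real0, td_obj \<times> 'x \<times> real1, td_obj \<times> 'x \<times> real2) presentation" where
  "cat_pres X = \<lparr>
     Gens0 = {(\<theta>, x, a). x \<in> simplices X \<theta> \<and> a \<in> Ob (realize \<theta>)},
     Gens1 = {(\<theta>, x, f). x \<in> simplices X \<theta> \<and> f \<in> Mor (realize \<theta>)},
     Gens2 = {(\<theta>, x, a). x \<in> simplices X \<theta> \<and> a \<in> Cell (realize \<theta>)},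
     gsrc = (\<lambda>(\<theta>, x, f). (\<theta>, x, Src (realize \<theta>) f)),
     gtgt = (\<lambda>(\<theta>, x, f). (\<theta>, x, Tgt (realize \<theta>) f)),
     gdom = (\<lambda>(\<theta>, x, a). Gen1 (\<theta>, x, Dom (realize \<theta>) a)),
     gcod = (\<lambda>(\<theta>, x, a). Gen1 (\<theta>, x, Cod (realize \<theta>) a)),
     Rel0 = glue X (\<lambda>u. Fn0 (realize_map u)) (\<lambda>\<theta>. Ob (realize \<theta>)),
     Rel1 = (\<lambda>s t.
       (\<exists>\<theta> x. x \<in> simplices X \<theta> \<and> functorial1 (realize \<theta>) (\<lambda>a. (\<theta>, x, a)) (\<lambda>f. (\<theta>, x, f)) s t) \<or>
       (\<exists>f g. s = Gen1 f \<and> t = Gen1 g \<and>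
          glue X (\<lambda>u. Fn1 (realize_map u)) (\<lambda>\<theta>. Mor (realize \<theta>)) f g)),
     Rel2 = (\<lambda>s t.
       (\<exists>\<theta> x. x \<in> simplices X \<theta> \<and> functorial2 (realize \<theta>) (\<lambda>f. (\<theta>, x, f)) (\<lambda>a. (\<theta>, x, a)) s t) \<or>
       (\<exists>a b. s = Gen2 a \<and> t = Gen2 b \<and>
          glue X (\<lambda>u. Fn2 (realize_map u)) (\<lambda>\<theta>. Cell (realize \<theta>)) a b))\<rparr>"

definition categorification :: "'x td_presheaf
    \<Rightarrow> ((td_obj \<times> 'x \<times> real0) set, (td_obj \<times> 'x \<times> real0, td_obj \<times> 'x \<times> real1) tm1 set,
        (td_obj \<times> 'x \<times> real0, td_obj \<times> 'x \<times> real1, td_obj \<times> 'x \<times> real2) tm2 set) two_cat" where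
  "categorification X = presented (cat_pres X)"

definition unit_map :: "'x td_presheaf \<Rightarrow> td_obj \<Rightarrow> 'x
    \<Rightarrow> (real0, real1, real2, (td_obj \<times> 'x \<times> real0) set,
        (td_obj \<times> 'x \<times> real0, td_obj \<times> 'x \<times> real1) tm1 set,
        (td_obj \<times> 'x \<times> real0, td_obj \<times> 'x \<times> real1, td_obj \<times> 'x \<times> real2) tm2 set) two_fun" where
  "unit_map X = (\<lambda>\<theta>. \<lambda>x \<in> simplices X \<theta>. restr (realize \<theta>)
     \<lparr>Fn0 = (\<lambda>a. cls0 (cat_pres X) (\<theta>, x, a)), Fn1 = (\<lambda>f. cls1 (cat_pres X) (Gen1 (\<theta>, x, f))),
      Fn2 = (\<lambda>a. cls2 (cat_pres X) (Gen2 (\<theta>, x, a)))\<rparr>)"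

text \<open>The 2-functor \<open>categorification X \<rightarrow> D\<close> adjunct to a map \<open>h\<close> from \<open>X\<close> to the nerve of \<open>D\<close>, and
  the counit as the adjunct of the identity of the nerve.\<close>

definition adjunct :: "'x td_presheaf \<Rightarrow> ('o, 'm, 'c) two_cat
    \<Rightarrow> (td_obj \<Rightarrow> 'x \<Rightarrow> (real0, real1, real2, 'o, 'm, 'c) two_fun)
    \<Rightarrow> ((td_obj \<times> 'x \<times> real0) set, (td_obj \<times> 'x \<times> real0, td_obj \<times> 'x \<times> real1) tm1 set,
        (td_obj \<times> 'x \<times> real0, td_obj \<times> 'x \<times> real1, td_obj \<times> 'x \<times> real2) tm2 set, 'o, 'm, 'c) two_fun" where
  "adjunct X D h = induced (cat_pres X) D
     (\<lambda>(\<theta>, x, a). Fn0 (h \<theta> x) a) (\<lambda>(\<theta>, x, f). Fn1 (h \<theta> x) f) (\<lambda>(\<theta>, x, a). Fn2 (h \<theta> x) a)"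

definition counit where
  "counit C = adjunct (nerve C) C (\<lambda>\<theta> x. x)"

end

theory Submission
  imports Defs
begin

text \<open>Write \<open>K\<close> for the categorification of the nerve of \<open>C\<close> and \<open>\<epsilon>\<close> for the counit from \<open>K\<close> to \<open>C\<close>.
  The proof exhibits \<open>C\<close> as a deformation retract of \<open>K\<close>: there is a pseudofunctor \<open>s\<close> from \<open>C\<close> to
  \<open>K\<close> such that \<open>\<epsilon> s\<close> is the identity, and \<open>s \<epsilon>\<close> is isomorphic to the identity of \<open>K\<close> by an
  isomorphism that is trivial on objects.  This makes \<open>\<epsilon>\<close> surjective on objects, full on 1-cells and
  bijective on 2-cells between fixed 1-cells, which is what the lifting properties against the four
  generating cofibrations ask for (locale \<open>trivial_fibration\<close>).

  The section.  Objects, 1-cells and triangles of \<open>C\<close> are simplices of the nerve, hence give cells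
  \<open>s0 x\<close>, \<open>s1 h\<close> and \<open>T \<alpha> k h\<close> of \<open>K\<close>.  Degenerate triangles give unit laws, and each tetrahedron gives
  one relation; together they yield a normal pseudofunctor (locale
  \<open>triangle_data\<close>).  Its comparison 2-cell \<open>mu k h\<close> is the triangle filled by the identity of the
  composite; it is invertible because this triangle extends to a marked triangle.

  The isomorphism.  It cannot be defined one 1-cell at a time, because a 1-cell of \<open>K\<close> is a class of words
  in the generators.  Instead, let the path object (\<open>path_cat\<close>) have as 1-cells the pairs of a
  1-cell \<open>h\<close> of \<open>C\<close> and an invertible 2-cell of \<open>K\<close> with domain \<open>s1 h\<close>.  It has strict projections \<open>pC\<close> to
  \<open>C\<close> and \<open>pK\<close> to \<open>K\<close>, and a 2-functor \<open>L\<close> from \<open>K\<close> to it with \<open>pC L = \<epsilon>\<close> and \<open>pK L\<close> the identity is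
  precisely the isomorphism wanted.  By the universal property of \<open>K\<close>, such an \<open>L\<close> is given by a lift
  to the path object for every simplex of the nerve, compatibly with the structure maps of \<open>t\<Delta>\<close>.

  The lifts.  A 2-functor out of an oriental is the same as a choice of edges and triangles subject to
  one equation for each tetrahedron (locale \<open>oriental_functor\<close>), so that a simplex has a canonical
  lift in which the isomorphisms over the edges are identities.  For the inverted triangle the lift
  is the same one, whose 2-cell turns out to be invertible.  For the free adjoint equivalence the
  isomorphism over \<open>f\<close> is an identity, while the unit need not send \<open>g\<close> to the value of \<open>s1\<close> on the
  image of \<open>g\<close> in \<open>C\<close>; but both are right adjoint to the same 1-cell, and their comparison (lemma
  \<open>mate\<close>) is the isomorphism over \<open>g\<close>.  Compatibility with the structure maps holds since the canonical lift of an
  oriental is the only one that is strict on edges, and since the adjoint equivalence of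
  identities has an identity as comparison.\<close>

section \<open>2-categories given by generators and relations\<close>

locale wf_presentation =
  fixes P :: "('o, 'm, 'c) presentation"
  assumes gsrc_in: "f \<in> Gens1 P \<Longrightarrow> gsrc P f \<in> Gens0 P"
    and gtgt_in: "f \<in> Gens1 P \<Longrightarrow> gtgt P f \<in> Gens0 P"
    and gdom_wf: "a \<in> Gens2 P \<Longrightarrow> wf1 P (gdom P a)"
    and gcod_wf: "a \<in> Gens2 P \<Longrightarrow> wf1 P (gcod P a)"
    and gens2_src: "a \<in> Gens2 P \<Longrightarrow> eq0 P (src1 P (gdom P a)) (src1 P (gcod P a))"
    and gens2_tgt: "a \<in> Gens2 P \<Longrightarrow> eq0 P (tgt1 P (gdom P a)) (tgt1 P (gcod P a))"

lemma eq0_in: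
  assumes "eq0 P x y"
  shows "x \<in> Gens0 P" "y \<in> Gens0 P"
  using assms by (induction) auto

context wf_presentation
begin

lemma wf1_ends: "wf1 P f \<Longrightarrow> src1 P f \<in> Gens0 P \<and> tgt1 P f \<in> Gens0 P"
  by (induction f) (auto simp: gsrc_in gtgt_in)

lemma eq1_wf:
  assumes "eq1 P f g"
  shows "wf1 P f \<and> wf1 P g \<and> eq0 P (src1 P f) (src1 P g) \<and> eq0 P (tgt1 P f) (tgt1 P g)"
  using assms
proof induction
  case (eq1_Comp_cong f f' g g')
  then show ?case by (auto intro: eq0_sym eq0_trans)
qed (auto intro: eq0_sym eq0_trans eq0_refl dest: eq0_in simp: wf1_ends)

lemma wf2_ends:
  assumes "wf2 P a"
  shows "wf1 P (dom2 P a) \<and> wf1 P (cod2 P a)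
    \<and> eq0 P (src1 P (dom2 P a)) (src1 P (cod2 P a)) \<and> eq0 P (tgt1 P (dom2 P a)) (tgt1 P (cod2 P a))"
  using assms
proof (induction a)
  case (VComp2 b a)
  then have "eq0 P (src1 P (cod2 P a)) (src1 P (dom2 P b))" "eq0 P (tgt1 P (cod2 P a)) (tgt1 P (dom2 P b))"
    using eq1_wf by auto
  with VComp2 show ?case by (auto intro: eq0_trans)
next
  case (HComp2 b a)
  then show ?case by (auto intro: eq0_trans eq0_sym)
qed (auto simp: wf1_ends gdom_wf gcod_wf gens2_src gens2_tgt intro: eq0_refl)

lemma eq2_wf:
  assumes "eq2 P a b"
  shows "wf2 P a \<and> wf2 P b \<and> eq1 P (dom2 P a) (dom2 P b) \<and> eq1 P (cod2 P a) (cod2 P b)"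
  using assms
proof induction
  case (eq2_Id_cong f g)
  then show ?case using eq1_wf by auto
next
  case (eq2_VComp_cong a a' b b')
  then show ?case by (auto intro: eq1_trans eq1_sym)
next
  case (eq2_HComp_cong a a' b b')
  then have 1: "eq0 P (tgt1 P (dom2 P a')) (src1 P (dom2 P b'))"
    using eq1_wf by (meson eq0_sym eq0_trans wf2.simps(4))
  have 2: "eq0 P (tgt1 P (cod2 P a)) (src1 P (cod2 P b))"
    using eq2_HComp_cong wf2_ends by (meson eq0_sym eq0_trans wf2.simps(4))
  show ?case using eq2_HComp_cong 1 2 eq1_wf
    by (auto intro!: eq1_Comp_cong)
next
  case (eq2_vunit_left a)
  then show ?case using wf2_ends by (auto intro: eq1_refl)
next
  case (eq2_vunit_right a)
  then show ?case using wf2_ends by (auto intro: eq1_refl)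
next
  case (eq2_vassoc c b a)
  then show ?case by (auto simp: wf2_ends intro: eq1_refl)
next
  case (eq2_hunit_left a)
  then have e: "eq1 P (Comp1 (Id1 (tgt1 P (cod2 P a))) (cod2 P a)) (cod2 P a)"
    using wf2_ends by (auto intro: eq1_unit_left)
  moreover have "eq1 P (Comp1 (Id1 (tgt1 P (dom2 P a))) (cod2 P a)) (Comp1 (Id1 (tgt1 P (cod2 P a))) (cod2 P a))"
    using eq2_hunit_left wf2_ends[of a] wf1_ends
    by (intro eq1_Comp_cong eq1_Id_cong eq1_refl) (auto intro: eq0_sym)
  ultimately have "eq1 P (Comp1 (Id1 (tgt1 P (dom2 P a))) (cod2 P a)) (cod2 P a)"
    by (rule eq1_trans[rotated])
  then show ?case using eq2_hunit_left wf2_ends[of a] wf1_ends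
    by (auto intro: eq1_unit_left eq0_refl)
next
  case (eq2_hunit_right a)
  then have e: "eq1 P (Comp1 (cod2 P a) (Id1 (src1 P (cod2 P a)))) (cod2 P a)"
    using wf2_ends by (auto intro: eq1_unit_right)
  moreover have "eq1 P (Comp1 (cod2 P a) (Id1 (src1 P (dom2 P a)))) (Comp1 (cod2 P a) (Id1 (src1 P (cod2 P a))))"
    using eq2_hunit_right wf2_ends[of a] wf1_ends
    by (intro eq1_Comp_cong eq1_Id_cong eq1_refl) (auto intro: eq0_sym)
  ultimately have "eq1 P (Comp1 (cod2 P a) (Id1 (src1 P (dom2 P a)))) (cod2 P a)"
    by (rule eq1_trans[rotated])
  then show ?case using eq2_hunit_right wf2_ends[of a] wf1_ends
    by (auto intro: eq1_unit_right eq0_refl)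
next
  case (eq2_hassoc c b a)
  then have w: "wf1 P (Comp1 (dom2 P c) (Comp1 (dom2 P b) (dom2 P a)))"
    "wf1 P (Comp1 (cod2 P c) (Comp1 (cod2 P b) (cod2 P a)))"
    using wf2_ends[of a] wf2_ends[of b] wf2_ends[of c]
    by (auto intro: eq0_trans eq0_sym)
  show ?case using eq2_hassoc eq1_assoc[OF w(1)] eq1_assoc[OF w(2)] by auto
next
  case (eq2_HComp_Id g f)
  then show ?case by (auto intro: eq1_refl)
next
  case (eq2_interchange b' b a' a)
  then have w: "wf2 P a" "wf2 P a'" "wf2 P b" "wf2 P b'"
    "eq1 P (cod2 P a) (dom2 P a')" "eq1 P (cod2 P b) (dom2 P b')"
    "eq0 P (tgt1 P (dom2 P a)) (src1 P (dom2 P b))" by auto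
  have 1: "eq0 P (tgt1 P (cod2 P a)) (src1 P (cod2 P b))"
    using w wf2_ends[of a] wf2_ends[of b] by (meson eq0_sym eq0_trans)
  have 2: "eq0 P (tgt1 P (dom2 P a')) (src1 P (dom2 P b'))"
    using 1 w eq1_wf by (meson eq0_sym eq0_trans)
  have 3: "eq0 P (tgt1 P (cod2 P a')) (src1 P (cod2 P b'))"
    using 2 w wf2_ends[of a'] wf2_ends[of b'] by (meson eq0_sym eq0_trans)
  have 4: "eq1 P (Comp1 (cod2 P b) (cod2 P a)) (Comp1 (dom2 P b') (dom2 P a'))"
    using w 1 wf2_ends by (intro eq1_Comp_cong) auto
  show ?case using w 1 2 3 4 wf2_ends by (auto intro!: eq1_refl)
qed (auto simp: wf2_ends intro: eq1_refl eq1_sym eq1_trans)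

end

lemma cls0_eq_iff: "x \<in> Gens0 P \<Longrightarrow> cls0 P x = cls0 P y \<longleftrightarrow> eq0 P x y"
  by (auto simp: cls0_def intro: eq0_refl eq0_sym eq0_trans)

lemma cls1_eq_iff: "wf1 P x \<Longrightarrow> cls1 P x = cls1 P y \<longleftrightarrow> eq1 P x y"
  by (auto simp: cls1_def intro: eq1_refl eq1_sym eq1_trans)

lemma cls2_eq_iff: "wf2 P x \<Longrightarrow> cls2 P x = cls2 P y \<longleftrightarrow> eq2 P x y"
  by (auto simp: cls2_def intro: eq2_refl eq2_sym eq2_trans)

lemma rep_cls0: "x \<in> Gens0 P \<Longrightarrow> eq0 P x (rep (cls0 P x))"
  unfolding rep_def cls0_def by (rule someI2[of _ x]) (auto intro: eq0_refl)

lemma rep_cls1: "wf1 P x \<Longrightarrow> eq1 P x (rep (cls1 P x))"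
  unfolding rep_def cls1_def by (rule someI2[of _ x]) (auto intro: eq1_refl)

lemma rep_cls2: "wf2 P x \<Longrightarrow> eq2 P x (rep (cls2 P x))"
  unfolding rep_def cls2_def by (rule someI2[of _ x]) (auto intro: eq2_refl)

lemma cls0I: "eq0 P x y \<Longrightarrow> cls0 P x = cls0 P y"
  using cls0_eq_iff eq0_in by metis

lemma presented_carriers [simp]:
  "Ob (presented P) = cls0 P ` Gens0 P" "Mor (presented P) = cls1 P ` Collect (wf1 P)"
  "Cell (presented P) = cls2 P ` Collect (wf2 P)"
  by (simp_all add: presented_def)

context wf_presentation
begin

lemma cls1I: "eq1 P x y \<Longrightarrow> cls1 P x = cls1 P y"
  using cls1_eq_iff eq1_wf by metis

lemma cls2I: "eq2 P x y \<Longrightarrow> cls2 P x = cls2 P y"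
  using cls2_eq_iff eq2_wf by metis

text \<open>On classes of well-formed terms the operations of \<open>presented P\<close> are the term constructors, so
  that the choice of representatives need not be mentioned again.\<close>

lemma presented_simps:
  "wf1 P f \<Longrightarrow> Src (presented P) (cls1 P f) = cls0 P (src1 P f)"
  "wf1 P f \<Longrightarrow> Tgt (presented P) (cls1 P f) = cls0 P (tgt1 P f)"
  "wf2 P a \<Longrightarrow> Dom (presented P) (cls2 P a) = cls1 P (dom2 P a)"
  "wf2 P a \<Longrightarrow> Cod (presented P) (cls2 P a) = cls1 P (cod2 P a)"
  "x \<in> Gens0 P \<Longrightarrow> IdM (presented P) (cls0 P x) = cls1 P (Id1 x)"
  "wf1 P f \<Longrightarrow> IdC (presented P) (cls1 P f) = cls2 P (Id2 f)"
proof -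
  show "wf1 P f \<Longrightarrow> Src (presented P) (cls1 P f) = cls0 P (src1 P f)"
    "wf1 P f \<Longrightarrow> Tgt (presented P) (cls1 P f) = cls0 P (tgt1 P f)"
    using rep_cls1[of P f] eq1_wf by (auto simp: presented_def intro!: cls0I[symmetric])
  show "wf2 P a \<Longrightarrow> Dom (presented P) (cls2 P a) = cls1 P (dom2 P a)"
    "wf2 P a \<Longrightarrow> Cod (presented P) (cls2 P a) = cls1 P (cod2 P a)"
    using rep_cls2[of P a] eq2_wf by (auto simp: presented_def intro!: cls1I[symmetric])
  show "x \<in> Gens0 P \<Longrightarrow> IdM (presented P) (cls0 P x) = cls1 P (Id1 x)"
    using rep_cls0[of x P] by (auto simp: presented_def intro!: cls1I[symmetric] eq1_Id_cong)
  show "wf1 P f \<Longrightarrow> IdC (presented P) (cls1 P f) = cls2 P (Id2 f)"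
    using rep_cls1[of P f] by (auto simp: presented_def intro!: cls2I[symmetric] eq2_Id_cong)
qed

lemma presented_comp:
  "wf1 P (Comp1 g f) \<Longrightarrow> Comp (presented P) (cls1 P g) (cls1 P f) = cls1 P (Comp1 g f)"
  "wf2 P (VComp2 b a) \<Longrightarrow> VComp (presented P) (cls2 P b) (cls2 P a) = cls2 P (VComp2 b a)"
  "wf2 P (HComp2 b a) \<Longrightarrow> HComp (presented P) (cls2 P b) (cls2 P a) = cls2 P (HComp2 b a)"
  by (auto simp: presented_def intro!: cls1I[symmetric] cls2I[symmetric] eq1_Comp_cong
    eq2_VComp_cong eq2_HComp_cong rep_cls1 rep_cls2)

lemma presented_composable:
  "wf1 P f \<Longrightarrow> wf1 P g \<Longrightarrow>
     Tgt (presented P) (cls1 P f) = Src (presented P) (cls1 P g) \<longleftrightarrow> wf1 P (Comp1 g f)"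
  "wf2 P a \<Longrightarrow> wf2 P b \<Longrightarrow>
     Cod (presented P) (cls2 P a) = Dom (presented P) (cls2 P b) \<longleftrightarrow> wf2 P (VComp2 b a)"
  "wf2 P a \<Longrightarrow> wf2 P b \<Longrightarrow>
     Tgt (presented P) (Dom (presented P) (cls2 P a)) = Src (presented P) (Dom (presented P) (cls2 P b))
     \<longleftrightarrow> wf2 P (HComp2 b a)"
  using wf2_ends[of a] wf2_ends[of b]
  by (auto simp: presented_simps cls0_eq_iff cls1_eq_iff wf1_ends)

lemma composable1E:
  assumes "f \<in> Mor (presented P)" "g \<in> Mor (presented P)"
    "Tgt (presented P) f = Src (presented P) g"
  obtains s t where "f = cls1 P s" "g = cls1 P t" "wf1 P (Comp1 t s)"
  using assms presented_composable(1) by (auto simp del: wf1.simps)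

lemma vcomposableE:
  assumes "a \<in> Cell (presented P)" "b \<in> Cell (presented P)"
    "Cod (presented P) a = Dom (presented P) b"
  obtains s t where "a = cls2 P s" "b = cls2 P t" "wf2 P (VComp2 t s)"
  using assms presented_composable(2) by (auto simp del: wf2.simps)

lemma hcomposableE:
  assumes "a \<in> Cell (presented P)" "b \<in> Cell (presented P)"
    "Tgt (presented P) (Dom (presented P) a) = Src (presented P) (Dom (presented P) b)"
  obtains s t where "a = cls2 P s" "b = cls2 P t" "wf2 P (HComp2 t s)"
  using assms presented_composable(3) by (auto simp del: wf2.simps)

lemma two_category_presented: "two_category (presented P)"
proof (rule two_category.intro)
  note [simp] = presented_simps presented_comp wf1_ends wf2_ends eq0_refl eq1_refl
  let ?A = "presented P"
  fix x f g h a b c a' b'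
  show "f \<in> Mor ?A \<Longrightarrow> Src ?A f \<in> Ob ?A" "f \<in> Mor ?A \<Longrightarrow> Tgt ?A f \<in> Ob ?A" by auto
  show "x \<in> Ob ?A \<Longrightarrow> IdM ?A x \<in> Mor ?A" by auto
  show "x \<in> Ob ?A \<Longrightarrow> Src ?A (IdM ?A x) = x" "x \<in> Ob ?A \<Longrightarrow> Tgt ?A (IdM ?A x) = x" by auto
  show "f \<in> Mor ?A \<Longrightarrow> Comp ?A (IdM ?A (Tgt ?A f)) f = f"
    by (auto simp: cls1I[OF eq1_unit_left])
  show "f \<in> Mor ?A \<Longrightarrow> Comp ?A f (IdM ?A (Src ?A f)) = f"
    by (auto simp: cls1I[OF eq1_unit_right])
  show "a \<in> Cell ?A \<Longrightarrow> Dom ?A a \<in> Mor ?A" "a \<in> Cell ?A \<Longrightarrow> Cod ?A a \<in> Mor ?A" by auto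
  show "a \<in> Cell ?A \<Longrightarrow> Src ?A (Cod ?A a) = Src ?A (Dom ?A a)"
    "a \<in> Cell ?A \<Longrightarrow> Tgt ?A (Cod ?A a) = Tgt ?A (Dom ?A a)"
    by (auto simp: cls0I[OF wf2_ends[THEN conjunct2, THEN conjunct2, THEN conjunct1]]
      cls0I[OF wf2_ends[THEN conjunct2, THEN conjunct2, THEN conjunct2]])
  show "f \<in> Mor ?A \<Longrightarrow> IdC ?A f \<in> Cell ?A"
    "f \<in> Mor ?A \<Longrightarrow> Dom ?A (IdC ?A f) = f" "f \<in> Mor ?A \<Longrightarrow> Cod ?A (IdC ?A f) = f" by auto
  show "a \<in> Cell ?A \<Longrightarrow> VComp ?A (IdC ?A (Cod ?A a)) a = a"
    by (auto simp: cls2I[OF eq2_vunit_left])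
  show "a \<in> Cell ?A \<Longrightarrow> VComp ?A a (IdC ?A (Dom ?A a)) = a"
    by (auto simp: cls2I[OF eq2_vunit_right])
  show "a \<in> Cell ?A \<Longrightarrow> HComp ?A (IdC ?A (IdM ?A (Tgt ?A (Dom ?A a)))) a = a"
    by (auto simp: cls2I[OF eq2_hunit_left])
  show "a \<in> Cell ?A \<Longrightarrow> HComp ?A a (IdC ?A (IdM ?A (Src ?A (Dom ?A a)))) = a"
    by (auto simp: cls2I[OF eq2_hunit_right])
  {
    assume "f \<in> Mor ?A" "g \<in> Mor ?A" "Tgt ?A f = Src ?A g"
    then obtain s t where st: "f = cls1 P s" "g = cls1 P t" "wf1 P (Comp1 t s)"
      by (rule composable1E)
    then show "Comp ?A g f \<in> Mor ?A" "Src ?A (Comp ?A g f) = Src ?A f"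
      "Tgt ?A (Comp ?A g f) = Tgt ?A g" "HComp ?A (IdC ?A g) (IdC ?A f) = IdC ?A (Comp ?A g f)"
      using cls2I[OF eq2_HComp_Id[OF st(3)]] by auto
    assume "h \<in> Mor ?A" "Tgt ?A g = Src ?A h"
    then obtain r where r: "h = cls1 P r" "wf1 P r" and "eq0 P (tgt1 P t) (src1 P r)"
      using st by (auto simp: cls0_eq_iff)
    then have "wf1 P (Comp1 r (Comp1 t s))" using st by simp
    from cls1I[OF eq1_assoc[OF this]] this r st
    show "Comp ?A (Comp ?A h g) f = Comp ?A h (Comp ?A g f)" by simp
  }
  {
    assume "a \<in> Cell ?A" "b \<in> Cell ?A" "Cod ?A a = Dom ?A b"
    then obtain s t where st: "a = cls2 P s" "b = cls2 P t" "wf2 P (VComp2 t s)"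
      by (rule vcomposableE)
    then show "VComp ?A b a \<in> Cell ?A" "Dom ?A (VComp ?A b a) = Dom ?A a"
      "Cod ?A (VComp ?A b a) = Cod ?A b"
      by auto
    assume "c \<in> Cell ?A" "Cod ?A b = Dom ?A c"
    then obtain r where r: "c = cls2 P r" "wf2 P r" and "eq1 P (cod2 P t) (dom2 P r)"
      using st by (auto simp: cls1_eq_iff)
    then have "wf2 P (VComp2 r (VComp2 t s))" using st by simp
    from cls2I[OF eq2_vassoc[OF this]] this r st
    show "VComp ?A (VComp ?A c b) a = VComp ?A c (VComp ?A b a)" by simp
  }
  {
    assume "a \<in> Cell ?A" "b \<in> Cell ?A" and e: "Tgt ?A (Dom ?A a) = Src ?A (Dom ?A b)"
    then obtain s t where st: "a = cls2 P s" "b = cls2 P t" "wf2 P (HComp2 t s)"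
      by (rule hcomposableE)
    then have "wf1 P (Comp1 (dom2 P t) (dom2 P s))" "wf1 P (Comp1 (cod2 P t) (cod2 P s))"
      using wf2_ends[OF st(3)] by auto
    with st show "HComp ?A b a \<in> Cell ?A" "Dom ?A (HComp ?A b a) = Comp ?A (Dom ?A b) (Dom ?A a)"
      "Cod ?A (HComp ?A b a) = Comp ?A (Cod ?A b) (Cod ?A a)"
      by auto
    {
      assume "c \<in> Cell ?A" "Tgt ?A (Dom ?A b) = Src ?A (Dom ?A c)"
      then obtain r where r: "c = cls2 P r" "wf2 P r" and "eq0 P (tgt1 P (dom2 P t)) (src1 P (dom2 P r))"
        using st by (auto simp: cls0_eq_iff)
      then have "wf2 P (HComp2 r (HComp2 t s))" using st by simp
      from cls2I[OF eq2_hassoc[OF this]] this r st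
      show "HComp ?A (HComp ?A c b) a = HComp ?A c (HComp ?A b a)" by simp
    }
    assume "a' \<in> Cell ?A" "Cod ?A a = Dom ?A a'"
    then obtain s' where s': "a' = cls2 P s'" "wf2 P (VComp2 s' s)"
      using st by (auto simp: cls1_eq_iff)
    assume "b' \<in> Cell ?A" "Cod ?A b = Dom ?A b'"
    then obtain t' where t': "b' = cls2 P t'" "wf2 P (VComp2 t' t)"
      using st by (auto simp: cls1_eq_iff)
    have w: "wf2 P (HComp2 (VComp2 t' t) (VComp2 s' s))" using st s' t' by simp
    have "wf2 P (HComp2 t' s')" "wf2 P (VComp2 (HComp2 t' s') (HComp2 t s))"
      using eq2_wf[OF eq2_interchange[OF w]] by auto
    then show "HComp ?A (VComp ?A b' b) (VComp ?A a' a) = VComp ?A (HComp ?A b' a') (HComp ?A b a)"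
      using st s' t' w cls2I[OF eq2_interchange[OF w]] by simp
  }
qed

end

text \<open>The universal property of \<open>presented P\<close>: an assignment of cells of \<open>D\<close> to the generators that
  is compatible with the relations extends to all terms by evaluation, and evaluation respects the
  congruences.\<close>

locale presented_functor = wf_presentation P + D: two_category D
  for P :: "('o, 'm, 'c) presentation" and D :: "('p, 'n, 'd) two_cat" +
  fixes k0 :: "'o \<Rightarrow> 'p" and k1 :: "'m \<Rightarrow> 'n" and k2 :: "'c \<Rightarrow> 'd"
  assumes k0_in: "x \<in> Gens0 P \<Longrightarrow> k0 x \<in> Ob D"
    and k1_in: "f \<in> Gens1 P \<Longrightarrow> k1 f \<in> Mor D"
    and Src_k1: "f \<in> Gens1 P \<Longrightarrow> Src D (k1 f) = k0 (gsrc P f)"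
    and Tgt_k1: "f \<in> Gens1 P \<Longrightarrow> Tgt D (k1 f) = k0 (gtgt P f)"
    and k2_in: "a \<in> Gens2 P \<Longrightarrow> k2 a \<in> Cell D"
    and Dom_k2: "a \<in> Gens2 P \<Longrightarrow> Dom D (k2 a) = eval1 D k0 k1 (gdom P a)"
    and Cod_k2: "a \<in> Gens2 P \<Longrightarrow> Cod D (k2 a) = eval1 D k0 k1 (gcod P a)"
    and rel0: "\<lbrakk>Rel0 P x y; x \<in> Gens0 P; y \<in> Gens0 P\<rbrakk> \<Longrightarrow> k0 x = k0 y"
    and rel1: "\<lbrakk>Rel1 P s t; wf1 P s; wf1 P t\<rbrakk> \<Longrightarrow> eval1 D k0 k1 s = eval1 D k0 k1 t"
    and rel2: "\<lbrakk>Rel2 P p q; wf2 P p; wf2 P q\<rbrakk> \<Longrightarrow> eval2 D k0 k1 k2 p = eval2 D k0 k1 k2 q"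
begin

lemma k0_eq0: "eq0 P x y \<Longrightarrow> k0 x = k0 y"
  by (induction rule: eq0.induct) (auto simp: rel0)

abbreviation "ev1 \<equiv> eval1 D k0 k1"
abbreviation "ev2 \<equiv> eval2 D k0 k1 k2"

lemma eval1_in:
  assumes "wf1 P s"
  shows "ev1 s \<in> Mor D \<and> Src D (ev1 s) = k0 (src1 P s) \<and> Tgt D (ev1 s) = k0 (tgt1 P s)"
  using assms
proof (induction s)
  case (Comp1 g f)
  then have "k0 (tgt1 P f) = k0 (src1 P g)" by (auto intro: k0_eq0)
  with Comp1 show ?case by (auto simp: D.Comp_in D.Src_Comp D.Tgt_Comp)
qed (auto simp: k0_in k1_in Src_k1 Tgt_k1 D.IdM_in D.Src_IdM D.Tgt_IdM)

lemma eval1_eq1: "eq1 P s t \<Longrightarrow> ev1 s = ev1 t"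
proof (induction rule: eq1.induct)
  case (eq1_rel f g)
  then show ?case by (simp add: rel1)
next
  case (eq1_unit_left f)
  then show ?case using eval1_in D.Comp_IdM_left[of "ev1 f"] by simp
next
  case (eq1_unit_right f)
  then show ?case using eval1_in D.Comp_IdM_right[of "ev1 f"] by simp
next
  case (eq1_assoc h g f)
  then show ?case using eval1_in k0_eq0 D.Comp_assoc by simp
qed (auto dest: k0_eq0)

lemma eval2_in:
  assumes "wf2 P a"
  shows "ev2 a \<in> Cell D \<and> Dom D (ev2 a) = ev1 (dom2 P a) \<and> Cod D (ev2 a) = ev1 (cod2 P a)"
  using assms
proof (induction a)
  case (VComp2 b a)
  then have "ev1 (cod2 P a) = ev1 (dom2 P b)" using eval1_eq1 by auto
  with VComp2 show ?case by (auto simp: D.VComp_in D.Dom_VComp D.Cod_VComp)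
next
  case (HComp2 b a)
  then have "Tgt D (ev1 (dom2 P a)) = Src D (ev1 (dom2 P b))"
    using eval1_in wf2_ends k0_eq0 by auto
  with HComp2 show ?case by (auto simp: D.HComp_in D.Dom_HComp D.Cod_HComp)
qed (auto simp: eval1_in k2_in Dom_k2 Cod_k2 D.IdC_in D.Dom_IdC D.Cod_IdC)

lemma eval2_hcomposable:
  "wf2 P (HComp2 b a) \<Longrightarrow> Tgt D (ev1 (dom2 P a)) = Src D (ev1 (dom2 P b))"
  using eval1_in wf2_ends k0_eq0 by simp

lemma eval2_eq2: "eq2 P a b \<Longrightarrow> ev2 a = ev2 b"
proof (induction rule: eq2.induct)
  case (eq2_rel a b)
  then show ?case by (simp add: rel2)
next
  case (eq2_Id_cong f g)
  then show ?case by (simp add: eval1_eq1)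
next
  case (eq2_vunit_left a)
  then show ?case using eval2_in D.VComp_IdC_left[of "ev2 a"] by simp
next
  case (eq2_vunit_right a)
  then show ?case using eval2_in D.VComp_IdC_right[of "ev2 a"] by simp
next
  case (eq2_vassoc c b a)
  then show ?case using eval2_in eval1_eq1 D.VComp_assoc by simp
next
  case (eq2_hunit_left a)
  then show ?case using eval2_in eval1_in wf2_ends D.HComp_Id_left[of "ev2 a"] by simp
next
  case (eq2_hunit_right a)
  then show ?case using eval2_in eval1_in wf2_ends D.HComp_Id_right[of "ev2 a"] by simp
next
  case (eq2_hassoc c b a)
  then show ?case using eval2_in eval1_in wf2_ends k0_eq0 D.HComp_assoc by simp
next
  case (eq2_HComp_Id g f)
  then show ?case using eval1_in k0_eq0 D.HComp_IdC by simp
next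
  case (eq2_interchange b' b a' a)
  then show ?case using eval2_in eval1_eq1 eval2_hcomposable[of b a] D.interchange by simp
qed auto

abbreviation "ind \<equiv> induced P D k0 k1 k2"

lemma induced_cls:
  "x \<in> Gens0 P \<Longrightarrow> Fn0 ind (cls0 P x) = k0 x"
  "wf1 P s \<Longrightarrow> Fn1 ind (cls1 P s) = ev1 s"
  "wf2 P a \<Longrightarrow> Fn2 ind (cls2 P a) = ev2 a"
  using k0_eq0[OF rep_cls0] eval1_eq1[OF rep_cls1] eval2_eq2[OF rep_cls2]
  by (auto simp: induced_def restr_def)

lemma two_functor_induced: "two_functor (presented P) D ind"
proof (rule two_functor.intro)
  let ?A = "presented P"
  note [simp] = presented_simps presented_comp wf1_ends wf2_ends induced_cls eval1_in eval2_in
    k0_in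
  fix x f g a b
  show "x \<in> Ob ?A \<Longrightarrow> Fn0 ind x \<in> Ob D" "f \<in> Mor ?A \<Longrightarrow> Fn1 ind f \<in> Mor D"
    "a \<in> Cell ?A \<Longrightarrow> Fn2 ind a \<in> Cell D"
    "f \<in> Mor ?A \<Longrightarrow> Src D (Fn1 ind f) = Fn0 ind (Src ?A f)"
    "f \<in> Mor ?A \<Longrightarrow> Tgt D (Fn1 ind f) = Fn0 ind (Tgt ?A f)"
    "a \<in> Cell ?A \<Longrightarrow> Dom D (Fn2 ind a) = Fn1 ind (Dom ?A a)"
    "a \<in> Cell ?A \<Longrightarrow> Cod D (Fn2 ind a) = Fn1 ind (Cod ?A a)"
    "x \<in> Ob ?A \<Longrightarrow> Fn1 ind (IdM ?A x) = IdM D (Fn0 ind x)"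
    "f \<in> Mor ?A \<Longrightarrow> Fn2 ind (IdC ?A f) = IdC D (Fn1 ind f)"
    by auto
  show "Fn1 ind (Comp ?A g f) = Comp D (Fn1 ind g) (Fn1 ind f)"
    if "f \<in> Mor ?A" "g \<in> Mor ?A" "Tgt ?A f = Src ?A g"
    using that by (rule composable1E) auto
  show "Fn2 ind (VComp ?A b a) = VComp D (Fn2 ind b) (Fn2 ind a)"
    if "a \<in> Cell ?A" "b \<in> Cell ?A" "Cod ?A a = Dom ?A b"
    using that by (rule vcomposableE) auto
  show "Fn2 ind (HComp ?A b a) = HComp D (Fn2 ind b) (Fn2 ind a)"
    if "a \<in> Cell ?A" "b \<in> Cell ?A" "Tgt ?A (Dom ?A a) = Src ?A (Dom ?A b)"
    using that by (rule hcomposableE) auto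
qed

end

context wf_presentation
begin

text \<open>A 2-functor out of a presented 2-category evaluates terms, hence it is determined by its values on the
  generators.\<close>

lemma two_functor_eval:
  assumes "two_functor (presented P) D F"
  shows "wf1 P s \<Longrightarrow>
      Fn1 F (cls1 P s) = eval1 D (\<lambda>x. Fn0 F (cls0 P x)) (\<lambda>f. Fn1 F (cls1 P (Gen1 f))) s"
    and "wf2 P a \<Longrightarrow> Fn2 F (cls2 P a) = eval2 D (\<lambda>x. Fn0 F (cls0 P x))
      (\<lambda>f. Fn1 F (cls1 P (Gen1 f))) (\<lambda>a. Fn2 F (cls2 P (Gen2 a))) a"
proof -
  interpret F: two_functor "presented P" D F by fact
  show 1: "Fn1 F (cls1 P s) = eval1 D (\<lambda>x. Fn0 F (cls0 P x)) (\<lambda>f. Fn1 F (cls1 P (Gen1 f))) s"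
    if "wf1 P s" for s
    using that
  proof (induction s)
    case (Id1 x)
    then show ?case using F.Fn_IdM[of "cls0 P x"] by (simp add: presented_simps)
  next
    case (Comp1 g f)
    then have "wf1 P g" "wf1 P f" by auto
    then show ?case
      using F.Fn_Comp[of "cls1 P f" "cls1 P g"] Comp1 presented_composable(1)[of f g]
      by (simp only: presented_carriers presented_comp) simp
  qed simp
  show "Fn2 F (cls2 P a) = eval2 D (\<lambda>x. Fn0 F (cls0 P x))
      (\<lambda>f. Fn1 F (cls1 P (Gen1 f))) (\<lambda>a. Fn2 F (cls2 P (Gen2 a))) a" if "wf2 P a"
    using that
  proof (induction a)
    case (Id2 f)
    then show ?case using F.Fn_IdC[of "cls1 P f"] by (simp add: presented_simps 1)
  next
    case (VComp2 b a)
    then have "wf2 P b" "wf2 P a" by auto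
    then show ?case
      using F.Fn_VComp[of "cls2 P a" "cls2 P b"] VComp2 presented_composable(2)[of a b]
      by (simp only: presented_carriers presented_comp) simp
  next
    case (HComp2 b a)
    then have "wf2 P b" "wf2 P a" by auto
    then show ?case
      using F.Fn_HComp[of "cls2 P a" "cls2 P b"] HComp2 presented_composable(3)[of a b]
      by (simp only: presented_carriers presented_comp) simp
  qed simp
qed

lemma eval_cong:
  assumes "\<And>x. x \<in> Gens0 P \<Longrightarrow> k0 x = k0' x" "\<And>f. f \<in> Gens1 P \<Longrightarrow> k1 f = k1' f"
  shows "wf1 P s \<Longrightarrow> eval1 D k0 k1 s = eval1 D k0' k1' s"
    and "(\<And>a. a \<in> Gens2 P \<Longrightarrow> k2 a = k2' a) \<Longrightarrow> wf2 P a \<Longrightarrow> eval2 D k0 k1 k2 a = eval2 D k0' k1' k2' a"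
proof -
  show 1: "wf1 P s \<Longrightarrow> eval1 D k0 k1 s = eval1 D k0' k1' s" for s
    by (induction s) (auto simp: assms)
  show "(\<And>a. a \<in> Gens2 P \<Longrightarrow> k2 a = k2' a) \<Longrightarrow> wf2 P a \<Longrightarrow> eval2 D k0 k1 k2 a = eval2 D k0' k1' k2' a"
    by (induction a) (auto simp: 1)
qed

lemma functor_eq_on_presented:
  assumes F: "two_functor (presented P) D F" and G: "two_functor (presented P) D G"
    and 0: "\<And>x. x \<in> Gens0 P \<Longrightarrow> Fn0 F (cls0 P x) = Fn0 G (cls0 P x)"
    and 1: "\<And>f. f \<in> Gens1 P \<Longrightarrow> Fn1 F (cls1 P (Gen1 f)) = Fn1 G (cls1 P (Gen1 f))"
  shows "f \<in> Mor (presented P) \<Longrightarrow> Fn1 F f = Fn1 G f"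
    and "(\<And>a. a \<in> Gens2 P \<Longrightarrow> Fn2 F (cls2 P (Gen2 a)) = Fn2 G (cls2 P (Gen2 a)))
      \<Longrightarrow> b \<in> Cell (presented P) \<Longrightarrow> Fn2 F b = Fn2 G b"
proof -
  show "Fn1 F f = Fn1 G f" if "f \<in> Mor (presented P)"
  proof -
    from that obtain s where "f = cls1 P s" "wf1 P s" by auto
    with 0 1 show ?thesis
      by (simp only: two_functor_eval(1)[OF F] two_functor_eval(1)[OF G]) (rule eval_cong(1))
  qed
  show "Fn2 F b = Fn2 G b"
    if 2: "\<And>a. a \<in> Gens2 P \<Longrightarrow> Fn2 F (cls2 P (Gen2 a)) = Fn2 G (cls2 P (Gen2 a))"
      and "b \<in> Cell (presented P)"
  proof -
    from that obtain s where "b = cls2 P s" "wf2 P s" by auto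
    with 0 1 2 show ?thesis
      by (simp only: two_functor_eval(2)[OF F] two_functor_eval(2)[OF G]) (rule eval_cong(2))
  qed
qed

end

section \<open>Calculus in a 2-category\<close>

notation VComp (infixr "\<cdot>\<index>" 65)
notation HComp (infixr "\<star>\<index>" 75)
notation Comp (infixr "\<odot>\<index>" 75)
notation IdC ("\<iota>\<index>")

context two_category
begin

lemmas typing = Src_in Tgt_in IdM_in Src_IdM Tgt_IdM Comp_in Src_Comp Tgt_Comp Dom_in Cod_in
  Src_Cod Tgt_Cod IdC_in Dom_IdC Cod_IdC VComp_in Dom_VComp Cod_VComp HComp_in Dom_HComp Cod_HComp

lemma whisker_left_VComp:
  assumes "a \<in> Cell C" "b \<in> Cell C" "Cod C a = Dom C b" "h \<in> Mor C" "Tgt C (Dom C a) = Src C h"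
  shows "\<iota>\<^bsub>C\<^esub> h \<star>\<^bsub>C\<^esub> (b \<cdot>\<^bsub>C\<^esub> a) = (\<iota>\<^bsub>C\<^esub> h \<star>\<^bsub>C\<^esub> b) \<cdot>\<^bsub>C\<^esub> (\<iota>\<^bsub>C\<^esub> h \<star>\<^bsub>C\<^esub> a)"
  using assms interchange[of a b "\<iota>\<^bsub>C\<^esub> h" "\<iota>\<^bsub>C\<^esub> h"] VComp_IdC_left[of "\<iota>\<^bsub>C\<^esub> h"]
  by (simp add: typing)

lemma whisker_right_VComp:
  assumes "a \<in> Cell C" "b \<in> Cell C" "Cod C a = Dom C b" "h \<in> Mor C" "Tgt C h = Src C (Dom C a)"
  shows "(b \<cdot>\<^bsub>C\<^esub> a) \<star>\<^bsub>C\<^esub> \<iota>\<^bsub>C\<^esub> h = (b \<star>\<^bsub>C\<^esub> \<iota>\<^bsub>C\<^esub> h) \<cdot>\<^bsub>C\<^esub> (a \<star>\<^bsub>C\<^esub> \<iota>\<^bsub>C\<^esub> h)"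
  using assms interchange[of "\<iota>\<^bsub>C\<^esub> h" "\<iota>\<^bsub>C\<^esub> h" a b] VComp_IdC_left[of "\<iota>\<^bsub>C\<^esub> h"]
  by (simp add: typing)

lemma whisker_left_Comp:
  assumes "a \<in> Cell C" "g \<in> Mor C" "h \<in> Mor C" "Tgt C (Dom C a) = Src C g" "Tgt C g = Src C h"
  shows "\<iota>\<^bsub>C\<^esub> h \<star>\<^bsub>C\<^esub> (\<iota>\<^bsub>C\<^esub> g \<star>\<^bsub>C\<^esub> a) = \<iota>\<^bsub>C\<^esub> (h \<odot>\<^bsub>C\<^esub> g) \<star>\<^bsub>C\<^esub> a"
  using assms HComp_assoc[of a "\<iota>\<^bsub>C\<^esub> g" "\<iota>\<^bsub>C\<^esub> h"] by (simp add: typing HComp_IdC)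

lemma whisker_right_Comp:
  assumes "a \<in> Cell C" "g \<in> Mor C" "h \<in> Mor C" "Tgt C g = Src C (Dom C a)" "Tgt C h = Src C g"
  shows "(a \<star>\<^bsub>C\<^esub> \<iota>\<^bsub>C\<^esub> g) \<star>\<^bsub>C\<^esub> \<iota>\<^bsub>C\<^esub> h = a \<star>\<^bsub>C\<^esub> \<iota>\<^bsub>C\<^esub> (g \<odot>\<^bsub>C\<^esub> h)"
  using assms HComp_assoc[of "\<iota>\<^bsub>C\<^esub> h" "\<iota>\<^bsub>C\<^esub> g" a] by (simp add: typing HComp_IdC)

lemma HComp_as_whiskers:
  assumes "a \<in> Cell C" "b \<in> Cell C" "Tgt C (Dom C a) = Src C (Dom C b)"
  shows "(b \<star>\<^bsub>C\<^esub> \<iota>\<^bsub>C\<^esub> (Cod C a)) \<cdot>\<^bsub>C\<^esub> (\<iota>\<^bsub>C\<^esub> (Dom C b) \<star>\<^bsub>C\<^esub> a) = b \<star>\<^bsub>C\<^esub> a"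
    and "(\<iota>\<^bsub>C\<^esub> (Cod C b) \<star>\<^bsub>C\<^esub> a) \<cdot>\<^bsub>C\<^esub> (b \<star>\<^bsub>C\<^esub> \<iota>\<^bsub>C\<^esub> (Dom C a)) = b \<star>\<^bsub>C\<^esub> a"
  using assms interchange[of a "\<iota>\<^bsub>C\<^esub> (Cod C a)" "\<iota>\<^bsub>C\<^esub> (Dom C b)" b]
    interchange[of "\<iota>\<^bsub>C\<^esub> (Dom C a)" a b "\<iota>\<^bsub>C\<^esub> (Cod C b)"]
  by (simp_all add: typing VComp_IdC_left VComp_IdC_right)

end

lemma two_functor_comp:
  assumes "two_functor A B F" "two_functor B D G" "two_category A"
  shows "two_functor A D \<lparr>Fn0 = Fn0 G \<circ> Fn0 F, Fn1 = Fn1 G \<circ> Fn1 F, Fn2 = Fn2 G \<circ> Fn2 F\<rparr>"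
proof -
  interpret F: two_functor A B F by fact
  interpret G: two_functor B D G by fact
  interpret A: two_category A by fact
  show ?thesis
    by unfold_locales (simp_all add: A.typing F.Fn0_in F.Fn1_in F.Fn2_in F.Fn_Src F.Fn_Tgt F.Fn_Dom F.Fn_Cod
      F.Fn_IdM F.Fn_IdC F.Fn_Comp F.Fn_VComp F.Fn_HComp
      G.Fn0_in G.Fn1_in G.Fn2_in G.Fn_Src G.Fn_Tgt G.Fn_Dom G.Fn_Cod
      G.Fn_IdM G.Fn_IdC G.Fn_Comp G.Fn_VComp G.Fn_HComp)
qed

lemma two_functor_cong:
  assumes "two_functor A B F" "two_category A"
    and "\<And>x. x \<in> Ob A \<Longrightarrow> Fn0 G x = Fn0 F x" "\<And>f. f \<in> Mor A \<Longrightarrow> Fn1 G f = Fn1 F f"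
    and "\<And>a. a \<in> Cell A \<Longrightarrow> Fn2 G a = Fn2 F a"
  shows "two_functor A B G"
proof -
  interpret F: two_functor A B F by fact
  interpret A: two_category A by fact
  show ?thesis
    by unfold_locales (simp_all add: assms A.typing F.Fn0_in F.Fn1_in F.Fn2_in F.Fn_Src F.Fn_Tgt
      F.Fn_Dom F.Fn_Cod F.Fn_IdM F.Fn_IdC F.Fn_Comp F.Fn_VComp F.Fn_HComp)
qed

lemma restr_simps [simp]:
  "x \<in> Ob A \<Longrightarrow> Fn0 (restr A F) x = Fn0 F x" "f \<in> Mor A \<Longrightarrow> Fn1 (restr A F) f = Fn1 F f"
  "a \<in> Cell A \<Longrightarrow> Fn2 (restr A F) a = Fn2 F a"
  by (simp_all add: restr_def)

lemma restr_restr [simp]: "restr A (restr A F) = restr A F"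
  by (simp add: restr_def)

lemma restr_in_two_functors:
  "two_functor A B F \<Longrightarrow> two_category A \<Longrightarrow> restr A F \<in> two_functors A B"
  by (auto simp: two_functors_def intro: two_functor_cong)

lemma two_functors_eqI:
  assumes "F \<in> two_functors A B" "G \<in> two_functors A B"
    and "\<And>x. x \<in> Ob A \<Longrightarrow> Fn0 F x = Fn0 G x" "\<And>f. f \<in> Mor A \<Longrightarrow> Fn1 F f = Fn1 G f"
    and "\<And>a. a \<in> Cell A \<Longrightarrow> Fn2 F a = Fn2 G a"
  shows "F = G"
proof -
  have "restr A F = restr A G" using assms(3-5) by (simp add: restr_def restrict_def fun_eq_iff)
  with assms(1,2) show ?thesis by (simp add: two_functors_def)
qed

section \<open>Orientals\<close>

lemma oriental_simps [simp]:
  "Ob (oriental m) = {0..m}" "Src (oriental m) = Min" "Tgt (oriental m) = Max"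
  "Dom (oriental m) = fst" "Cod (oriental m) = snd"
  "IdM (oriental m) i = {i}" "IdC (oriental m) S = (S, S)"
  "Comp (oriental m) T S = S \<union> T"
  "VComp (oriental m) (T, U) (S, T') = (S, U)"
  "HComp (oriental m) (T, T'') (S, S') = (S \<union> T, S' \<union> T'')"
  by (simp_all add: oriental_def)

text \<open>A 1-cell determines its ends as its minimum and its maximum.\<close>

lemma Mor_oriental: "S \<in> Mor (oriental m) \<longleftrightarrow> S \<noteq> {} \<and> S \<subseteq> {0..m}"
proof
  assume "S \<noteq> {} \<and> S \<subseteq> {0..m}"
  moreover from this have "finite S" using finite_subset by auto
  ultimately have "Min S \<le> Max S" "Max S \<le> m" "Min S \<in> S" "Max S \<in> S" "S \<subseteq> {Min S..Max S}"
    by auto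
  then show "S \<in> Mor (oriental m)" unfolding oriental_def by auto
qed (force simp: oriental_def)

definition ocell :: "nat \<Rightarrow> nat set \<Rightarrow> nat set \<Rightarrow> bool" where
  "ocell m S T \<longleftrightarrow> S \<noteq> {} \<and> S \<subseteq> T \<and> T \<subseteq> {0..m} \<and> Min S = Min T \<and> Max S = Max T"

lemma ocellD:
  assumes "ocell m S T"
  shows "finite S" "finite T" "S \<noteq> {}" "T \<noteq> {}" "S \<subseteq> T" "S \<subseteq> {0..m}" "T \<subseteq> {0..m}"
    "Min S = Min T" "Max S = Max T"
  using assms finite_subset[of _ "{0..m}"] unfolding ocell_def by auto

lemma Cell_oriental: "(S, T) \<in> Cell (oriental m) \<longleftrightarrow> ocell m S T"
proof
  assume c: "ocell m S T"
  note d = ocellD[OF c]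
  then have "Min T \<in> S" "Max T \<in> S" by (metis Min_in Max_in)+
  moreover have "T \<subseteq> {Min T..Max T}" using d by auto
  moreover have "Min T \<le> Max T" "Max T \<le> m" using d by auto
  ultimately show "(S, T) \<in> Cell (oriental m)" using d(5) unfolding oriental_def by auto
next
  assume "(S, T) \<in> Cell (oriental m)"
  then obtain i j where ij: "i \<le> j" "j \<le> m" "i \<in> S" "j \<in> S" "S \<subseteq> T" "T \<subseteq> {i..j}"
    unfolding oriental_def by auto
  then have f: "finite S" "finite T" using finite_subset[of _ "{i..j}"] by (auto intro: finite_subset)
  with ij have "Min S = i" "Min T = i" by (auto intro!: Min_eqI)
  moreover from f ij have "Max S = j" "Max T = j" by (auto intro!: Max_eqI)
  ultimately show "ocell m S T" using ij unfolding ocell_def by auto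
qed

lemma ocell_refl: "S \<noteq> {} \<Longrightarrow> S \<subseteq> {0..m} \<Longrightarrow> ocell m S S"
  by (simp add: ocell_def)

lemma ocell_trans: "ocell m S T \<Longrightarrow> ocell m T U \<Longrightarrow> ocell m S U"
  by (auto simp: ocell_def)

lemma Min_Un_chain:
  fixes S T :: "nat set"
  assumes "finite S" "finite T" "S \<noteq> {}" "T \<noteq> {}" "Max S = Min T"
  shows "Min (S \<union> T) = Min S" "Max (S \<union> T) = Max T"
proof -
  have "Min S \<le> Max S" "Min T \<le> Max T"
    using Min_le[OF assms(1) Max_in] Min_le[OF assms(2) Max_in] assms by simp_all
  moreover have "Min (S \<union> T) = min (Min S) (Min T)" "Max (S \<union> T) = max (Max S) (Max T)"
    using assms by (simp_all add: Min_Un Max_Un)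
  ultimately show "Min (S \<union> T) = Min S" "Max (S \<union> T) = Max T"
    using assms(5) by linarith+
qed

lemma ocell_Un:
  assumes "ocell m S S'" "ocell m T T'" "Max S = Min T"
  shows "ocell m (S \<union> T) (S' \<union> T')"
  using ocellD[OF assms(1)] ocellD[OF assms(2)] assms(3)
  by (auto simp: ocell_def Min_Un_chain)

lemma two_category_oriental: "two_category (oriental m)"
proof (rule two_category.intro)
  let ?A = "oriental m"
  have fin: "S \<noteq> {} \<Longrightarrow> S \<subseteq> {0..m} \<Longrightarrow> finite S" for S
    using finite_subset by auto
  note [simp] = Mor_oriental Cell_oriental Min_Un_chain fin ocell_refl
  fix x f g h a b c a' b'
  show "f \<in> Mor ?A \<Longrightarrow> Src ?A f \<in> Ob ?A" "f \<in> Mor ?A \<Longrightarrow> Tgt ?A f \<in> Ob ?A"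
    using subsetD[OF _ Min_in, of f "{0..m}"] subsetD[OF _ Max_in, of f "{0..m}"]
    by (simp_all del: Min_le_iff Max_le_iff)
  show "x \<in> Ob ?A \<Longrightarrow> IdM ?A x \<in> Mor ?A"
    "x \<in> Ob ?A \<Longrightarrow> Src ?A (IdM ?A x) = x" "x \<in> Ob ?A \<Longrightarrow> Tgt ?A (IdM ?A x) = x" by auto
  show "\<lbrakk>f \<in> Mor ?A; g \<in> Mor ?A; Tgt ?A f = Src ?A g\<rbrakk> \<Longrightarrow> Comp ?A g f \<in> Mor ?A"
    "\<lbrakk>f \<in> Mor ?A; g \<in> Mor ?A; Tgt ?A f = Src ?A g\<rbrakk> \<Longrightarrow> Src ?A (Comp ?A g f) = Src ?A f"
    "\<lbrakk>f \<in> Mor ?A; g \<in> Mor ?A; Tgt ?A f = Src ?A g\<rbrakk> \<Longrightarrow> Tgt ?A (Comp ?A g f) = Tgt ?A g"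
    by auto
  show "f \<in> Mor ?A \<Longrightarrow> Comp ?A (IdM ?A (Tgt ?A f)) f = f"
    "f \<in> Mor ?A \<Longrightarrow> Comp ?A f (IdM ?A (Src ?A f)) = f"
    by (auto simp: insert_absorb)
  show "\<lbrakk>f \<in> Mor ?A; g \<in> Mor ?A; h \<in> Mor ?A; Tgt ?A f = Src ?A g; Tgt ?A g = Src ?A h\<rbrakk>
      \<Longrightarrow> Comp ?A (Comp ?A h g) f = Comp ?A h (Comp ?A g f)" by auto
  show "a \<in> Cell ?A \<Longrightarrow> Dom ?A a \<in> Mor ?A" "a \<in> Cell ?A \<Longrightarrow> Cod ?A a \<in> Mor ?A"
    by (cases a; auto simp: ocell_def)+
  show "a \<in> Cell ?A \<Longrightarrow> Src ?A (Cod ?A a) = Src ?A (Dom ?A a)"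
    "a \<in> Cell ?A \<Longrightarrow> Tgt ?A (Cod ?A a) = Tgt ?A (Dom ?A a)"
    by (cases a; auto simp: ocell_def)+
  show "f \<in> Mor ?A \<Longrightarrow> IdC ?A f \<in> Cell ?A" "f \<in> Mor ?A \<Longrightarrow> Dom ?A (IdC ?A f) = f"
    "f \<in> Mor ?A \<Longrightarrow> Cod ?A (IdC ?A f) = f" by auto
  show "\<lbrakk>a \<in> Cell ?A; b \<in> Cell ?A; Cod ?A a = Dom ?A b\<rbrakk> \<Longrightarrow> VComp ?A b a \<in> Cell ?A"
    "\<lbrakk>a \<in> Cell ?A; b \<in> Cell ?A; Cod ?A a = Dom ?A b\<rbrakk> \<Longrightarrow> Dom ?A (VComp ?A b a) = Dom ?A a"
    "\<lbrakk>a \<in> Cell ?A; b \<in> Cell ?A; Cod ?A a = Dom ?A b\<rbrakk> \<Longrightarrow> Cod ?A (VComp ?A b a) = Cod ?A b"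
    by (cases a; cases b; auto intro: ocell_trans)+
  show "a \<in> Cell ?A \<Longrightarrow> VComp ?A (IdC ?A (Cod ?A a)) a = a"
    "a \<in> Cell ?A \<Longrightarrow> VComp ?A a (IdC ?A (Dom ?A a)) = a"
    by (cases a; auto)+
  show "\<lbrakk>a \<in> Cell ?A; b \<in> Cell ?A; c \<in> Cell ?A; Cod ?A a = Dom ?A b; Cod ?A b = Dom ?A c\<rbrakk>
      \<Longrightarrow> VComp ?A (VComp ?A c b) a = VComp ?A c (VComp ?A b a)"
    by (cases a; cases b; cases c; auto)
  show "\<lbrakk>a \<in> Cell ?A; b \<in> Cell ?A; Tgt ?A (Dom ?A a) = Src ?A (Dom ?A b)\<rbrakk> \<Longrightarrow> HComp ?A b a \<in> Cell ?A"
    "\<lbrakk>a \<in> Cell ?A; b \<in> Cell ?A; Tgt ?A (Dom ?A a) = Src ?A (Dom ?A b)\<rbrakk>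
      \<Longrightarrow> Dom ?A (HComp ?A b a) = Comp ?A (Dom ?A b) (Dom ?A a)"
    "\<lbrakk>a \<in> Cell ?A; b \<in> Cell ?A; Tgt ?A (Dom ?A a) = Src ?A (Dom ?A b)\<rbrakk>
      \<Longrightarrow> Cod ?A (HComp ?A b a) = Comp ?A (Cod ?A b) (Cod ?A a)"
    by (cases a; cases b; auto intro: ocell_Un)+
  show "HComp ?A (IdC ?A (IdM ?A (Tgt ?A (Dom ?A a)))) a = a" if "a \<in> Cell ?A"
  proof -
    obtain S T where a: "a = (S, T)" "ocell m S T" using \<open>a \<in> Cell ?A\<close> by (cases a) auto
    note d = ocellD[OF a(2)]
    have "Max S \<in> S" "Max S \<in> T" using Max_in[OF d(1,3)] d(5) by auto
    with a(1) show ?thesis by (simp add: insert_absorb)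
  qed
  show "HComp ?A a (IdC ?A (IdM ?A (Src ?A (Dom ?A a)))) = a" if "a \<in> Cell ?A"
  proof -
    obtain S T where a: "a = (S, T)" "ocell m S T" using \<open>a \<in> Cell ?A\<close> by (cases a) auto
    note d = ocellD[OF a(2)]
    have "Min S \<in> S" "Min S \<in> T" using Min_in[OF d(1,3)] d(5) by auto
    with a(1) show ?thesis by (simp add: insert_absorb)
  qed
  show "\<lbrakk>a \<in> Cell ?A; b \<in> Cell ?A; c \<in> Cell ?A;
        Tgt ?A (Dom ?A a) = Src ?A (Dom ?A b); Tgt ?A (Dom ?A b) = Src ?A (Dom ?A c)\<rbrakk>
      \<Longrightarrow> HComp ?A (HComp ?A c b) a = HComp ?A c (HComp ?A b a)"
    by (cases a; cases b; cases c; auto)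
  show "\<lbrakk>f \<in> Mor ?A; g \<in> Mor ?A; Tgt ?A f = Src ?A g\<rbrakk>
      \<Longrightarrow> HComp ?A (IdC ?A g) (IdC ?A f) = IdC ?A (Comp ?A g f)" by auto
  show "\<lbrakk>a \<in> Cell ?A; a' \<in> Cell ?A; b \<in> Cell ?A; b' \<in> Cell ?A;
        Cod ?A a = Dom ?A a'; Cod ?A b = Dom ?A b'; Tgt ?A (Dom ?A a) = Src ?A (Dom ?A b)\<rbrakk>
      \<Longrightarrow> HComp ?A (VComp ?A b' b) (VComp ?A a' a) = VComp ?A (HComp ?A b' a') (HComp ?A b a)"
    by (cases a; cases a'; cases b; cases b'; auto)
qed

text \<open>A 2-functor out of an oriental is a normal oplax functor out of the poset \<open>{0..m}\<close>: it is
  determined by its values \<open>e i j\<close> on the 1-cells \<open>{i, j}\<close> and \<open>t i j k\<close> on the 2-cells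
  from \<open>{i, k}\<close> to \<open>{i, j, k}\<close>, and these may be prescribed freely subject to unit laws and to
  one coherence law for each chain of four elements.\<close>

locale oriental_functor = D: two_category D
  for D :: "('o, 'n, 'd) two_cat" (structure) +
  fixes m :: nat and p :: "nat \<Rightarrow> 'o" and e :: "nat \<Rightarrow> nat \<Rightarrow> 'n" and t :: "nat \<Rightarrow> nat \<Rightarrow> nat \<Rightarrow> 'd"
  assumes p_in: "i \<le> m \<Longrightarrow> p i \<in> Ob D"
    and e_typing: "\<lbrakk>i \<le> j; j \<le> m\<rbrakk> \<Longrightarrow> e i j \<in> Mor D \<and> Src D (e i j) = p i \<and> Tgt D (e i j) = p j"
    and e_unit: "i \<le> m \<Longrightarrow> e i i = IdM D (p i)"
    and t_typing: "\<lbrakk>i \<le> j; j \<le> k; k \<le> m\<rbrakk>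
      \<Longrightarrow> t i j k \<in> Cell D \<and> Dom D (t i j k) = e i k \<and> Cod D (t i j k) = e j k \<odot> e i j"
    and t_unit_left: "\<lbrakk>i \<le> k; k \<le> m\<rbrakk> \<Longrightarrow> t i i k = \<iota> (e i k)"
    and t_unit_right: "\<lbrakk>i \<le> k; k \<le> m\<rbrakk> \<Longrightarrow> t i k k = \<iota> (e i k)"
    and t_coassoc: "\<lbrakk>i \<le> j; j \<le> k; k \<le> l; l \<le> m\<rbrakk>
      \<Longrightarrow> (t j k l \<star> \<iota> (e i j)) \<cdot> t i j l = (\<iota> (e k l) \<star> t i j k) \<cdot> t i k l"
begin

text \<open>The image of a 1-cell \<open>S\<close> is the composite of the edges between consecutive elements of \<open>S\<close>.\<close>

fun word :: "nat list \<Rightarrow> 'n" where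
  "word [] = undefined"
| "word [i] = IdM D (p i)"
| "word (i # j # r) = word (j # r) \<odot> e i j"

definition F1 :: "nat set \<Rightarrow> 'n" where
  "F1 S = word (sorted_list_of_set S)"

text \<open>The image of a 2-cell from \<open>S\<close> to \<open>T\<close> inserts the elements of \<open>T\<close> into \<open>S\<close> in increasing order.
  Let \<open>i\<close> and \<open>j\<close> be the first two elements of \<open>T\<close>, so that \<open>i\<close> is also the first element of \<open>S\<close>, and
  let \<open>k\<close> be the second element of \<open>S\<close>.  First \<open>t i j k\<close> splits the edge from \<open>i\<close> to \<open>k\<close> at \<open>j\<close> (if
  \<open>j = k\<close> it is an identity); the rest happens between the elements from \<open>j\<close> on, whiskered by the edge
  from \<open>i\<close> to \<open>j\<close>.\<close>

fun wcell :: "nat set \<Rightarrow> nat list \<Rightarrow> 'd" where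
  "wcell S [] = undefined"
| "wcell S [i] = \<iota> (IdM D (p i))"
| "wcell S (i # j # r) = (wcell (insert j (S - {i})) (j # r) \<star> \<iota> (e i j))
     \<cdot> (\<iota> (F1 (S - {i})) \<star> t i j (Min (S - {i})))"

definition F2 :: "nat set \<Rightarrow> nat set \<Rightarrow> 'd" where
  "F2 S T = wcell S (sorted_list_of_set T)"

definition ofun :: "(nat, nat set, nat set \<times> nat set, 'o, 'n, 'd) two_fun" where
  "ofun = \<lparr>Fn0 = p, Fn1 = F1, Fn2 = (\<lambda>(S, T). F2 S T)\<rparr>"

lemma sorted_insert_min:
  assumes "finite T" "T \<noteq> {}" "i < Min T"
  shows "sorted_list_of_set (insert i T) = i # sorted_list_of_set T"
    "\<exists>r. sorted_list_of_set T = Min T # r"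
proof -
  have "i \<notin> T" using assms by auto
  moreover have "\<forall>x \<in> T. i \<le> x" using assms by auto
  ultimately show "sorted_list_of_set (insert i T) = i # sorted_list_of_set T"
    using assms(1) by (simp add: insort_is_Cons)
  show "\<exists>r. sorted_list_of_set T = Min T # r"
    using assms by (simp add: sorted_list_of_set_nonempty)
qed

lemma F1_singleton: "F1 {i} = IdM D (p i)"
  by (simp add: F1_def)

lemma F1_insert: "finite T \<Longrightarrow> T \<noteq> {} \<Longrightarrow> i < Min T \<Longrightarrow> F1 (insert i T) = F1 T \<odot> e i (Min T)"
  using sorted_insert_min[of T i] by (auto simp: F1_def)

lemma F2_singleton: "F2 S {i} = \<iota> (IdM D (p i))"
  by (simp add: F2_def)

lemma F2_insert:
  assumes "finite T" "T \<noteq> {}" "i < Min T" "i \<notin> S"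
  shows "F2 (insert i S) (insert i T) = (F2 (insert (Min T) S) T \<star> \<iota> (e i (Min T)))
    \<cdot> (\<iota> (F1 S) \<star> t i (Min T) (Min S))"
  using sorted_insert_min[of T i] assms by (auto simp: F2_def)

end

lemma Min_insert_less: "finite T \<Longrightarrow> T \<noteq> {} \<Longrightarrow> i < Min T \<Longrightarrow> Min (insert i T) = (i::nat)"
  by (auto intro!: Min_eqI simp del: Min_insert)

lemma Max_insert_less:
  assumes "finite T" "T \<noteq> {}" "i < Min T"
  shows "Max (insert i T) = Max (T :: nat set)"
proof -
  have "i < Max T" using assms Min_le[OF assms(1) Max_in] by simp
  then show ?thesis using assms by simp
qed

text \<open>Everything about orientals below is proved by this induction: the recursions peel off minima.\<close>

lemma min_induct [consumes 2, case_names singleton insert]: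
  fixes T :: "nat set"
  assumes "finite T" "T \<noteq> {}" "\<And>i. Q {i}"
    "\<And>i T. \<lbrakk>finite T; T \<noteq> {}; i < Min T; Q T\<rbrakk> \<Longrightarrow> Q (insert i T)"
  shows "Q T"
  using assms(1,2)
proof (induction rule: finite_linorder_min_induct)
  case (insert b A)
  show ?case
  proof (cases "A = {}")
    case True
    then show ?thesis using assms(3) by simp
  next
    case False
    with insert show ?thesis using assms(4)[of A b] by simp
  qed
qed simp

text \<open>The induction step for a 2-cell: since \<open>i\<close> is the minimum of both ends, removing it leaves a pair that
  becomes a 2-cell again once \<open>Min T\<close> is added to the smaller set.\<close>

lemma ocell_insertE:
  assumes c: "ocell m S (insert i T)" and T: "T \<noteq> {}" "i < Min T"
  obtains S' where "S = insert i S'" "i \<notin> S'" "S' \<noteq> {}" "finite S'" "S' \<subseteq> T" "finite T" "T \<subseteq> {0..m}"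
    "i < Min S'" "Min T \<le> Min S'" "Max S' = Max T" "ocell m (insert (Min T) S') T"
    "ocell m S' S'" "i \<le> m"
proof -
  note d = ocellD[OF c]
  have fT: "finite T" using d(2) by simp
  have 1: "Min (insert i T) = i" "Max (insert i T) = Max T"
    using Min_insert_less[OF fT T] Max_insert_less[OF fT T] by auto
  have "i \<in> S" using d(8) 1(1) Min_in[OF d(1,3)] by simp
  define S' where "S' = S - {i}"
  have S: "S = insert i S'" "i \<notin> S'" using \<open>i \<in> S\<close> by (auto simp: S'_def)
  have "Max T \<in> S" using d(9) 1(2) Max_in[OF d(1,3)] by simp
  moreover have "i < Max T" using Min_le[OF fT Max_in[OF fT T(1)]] T(2) by simp
  ultimately have M: "Max T \<in> S'" by (simp add: S'_def)
  have fS: "finite S'" using d(1) by (simp add: S'_def)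
  have sub: "S' \<subseteq> T" using d(5) by (auto simp: S'_def)
  have ne: "S' \<noteq> {}" using M by auto
  have "Min T \<le> Min S'" using sub fT ne by (simp add: Min_antimono)
  moreover have mx: "Max S' = Max T"
    using M sub fT fS by (intro Max_eqI) auto
  moreover have "Min (insert (Min T) S') = Min T"
    using fS ne \<open>Min T \<le> Min S'\<close> by simp
  moreover have "Max (insert (Min T) S') = Max T"
    using fS ne mx Min_le[OF fT Max_in[OF fT T(1)]] by simp
  ultimately show ?thesis
    using S sub fT d(7) ne fS T by (intro that[of S']) (auto simp: ocell_def)
qed

lemma Min_Max_le:
  assumes "S \<noteq> {}" "S \<subseteq> {0..m}"
  shows "Min S \<le> m" "Max S \<le> (m :: nat)"
  using assms finite_subset[OF assms(2)] Min_in[of S] Max_in[of S] by (meson atLeastAtMost_iff finite_atLeastAtMost subsetD)+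

declare Min_gr_iff [simp del] Min.bounded_iff [simp del] Max_less_iff [simp del] Max.bounded_iff [simp del]

context oriental_functor
begin

lemma F1_typing:
  assumes "S \<noteq> {}" "S \<subseteq> {0..m}"
  shows "F1 S \<in> Mor D \<and> Src D (F1 S) = p (Min S) \<and> Tgt D (F1 S) = p (Max S)"
proof -
  have "finite S" using assms finite_subset by auto
  then show ?thesis using assms
  proof (induction rule: min_induct)
    case (singleton i)
    then show ?case by (simp add: F1_singleton D.typing p_in)
  next
    case (insert i T)
    then have "Min T \<le> m" using Min_Max_le[of T m] by auto
    with insert have "e i (Min T) \<in> Mor D \<and> Src D (e i (Min T)) = p i \<and> Tgt D (e i (Min T)) = p (Min T)"
      by (intro e_typing) auto
    with insert show ?case
      by (simp add: F1_insert D.typing Min_insert_less Max_insert_less del: Min_insert Max_insert)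
  qed
qed

lemma F1_pair: "i \<le> j \<Longrightarrow> j \<le> m \<Longrightarrow> F1 {i, j} = e i j"
proof (cases "i = j")
  case False
  moreover assume "i \<le> j" "j \<le> m"
  ultimately show ?thesis
    using F1_insert[of "{j}" i] D.Comp_IdM_left[of "e i j"] e_typing[of i j] by (simp add: F1_singleton)
qed (simp add: F1_singleton e_unit)

lemma F1_Un:
  assumes "S \<noteq> {}" "S \<subseteq> {0..m}" "T \<noteq> {}" "T \<subseteq> {0..m}" "Max S = Min T"
  shows "F1 (S \<union> T) = F1 T \<odot> F1 S"
proof -
  have fT: "finite T" and "finite S" using assms finite_subset by auto
  from this(2) show ?thesis using assms(1,2,5)
  proof (induction rule: min_induct)
    case (singleton i)
    then have "i \<in> T" using Min_in[OF fT assms(3)] by simp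
    then show ?case using singleton F1_typing[OF assms(3,4)] D.Comp_IdM_right[of "F1 T"]
      by (simp add: F1_singleton insert_absorb)
  next
    case (insert i S)
    have 1: "Max S = Min T" using insert Max_insert_less by metis
    then have 2: "Min (S \<union> T) = Min S" using Min_Un_chain insert fT assms(3) by metis
    have "F1 (insert i S \<union> T) = F1 (S \<union> T) \<odot> e i (Min S)"
      using F1_insert[of "S \<union> T" i] insert 2 fT by simp
    also have "F1 (S \<union> T) = F1 T \<odot> F1 S" using insert 1 by simp
    finally show ?case
      using insert F1_typing[of S] F1_typing[OF assms(3,4)] 1 Min_in[of S] e_typing[of i "Min S"]
      by (simp add: F1_insert D.Comp_assoc subset_iff del: Min_in)
  qed
qed

lemma F1_insert_le:
  assumes "finite S" "S \<noteq> {}" "S \<subseteq> {0..m}" "u \<le> Min S"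
  shows "F1 (insert u S) = F1 S \<odot> e u (Min S)"
proof (cases "u = Min S")
  case True
  moreover from this have "u \<in> S" using Min_in assms by simp
  ultimately show ?thesis
    using F1_typing[of S] assms D.Comp_IdM_right[of "F1 S"] e_unit[of u]
      Min_Max_le[of S m]
    by (auto simp: insert_absorb)
qed (use assms F1_insert in simp)

lemma F2_typing:
  assumes "ocell m S T"
  shows "F2 S T \<in> Cell D \<and> Dom D (F2 S T) = F1 S \<and> Cod D (F2 S T) = F1 T"
proof -
  have "finite T" "T \<noteq> {}" using ocellD[OF assms] by auto
  then show ?thesis using assms
  proof (induction arbitrary: S rule: min_induct)
    case (singleton i)
    then have "S = {i}" "i \<le> m" by (auto simp: ocell_def)
    then show ?case by (simp add: F2_singleton F1_singleton D.typing p_in)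
  next
    case (insert i T)
    obtain S' where S': "S = insert i S'" "i \<notin> S'" "S' \<noteq> {}" "finite S'" "S' \<subseteq> T" "finite T" "T \<subseteq> {0..m}"
      "i < Min S'" "Min T \<le> Min S'" "Max S' = Max T" "ocell m (insert (Min T) S') T" "ocell m S' S'" "i \<le> m"
      using ocell_insertE[OF insert.prems insert.hyps(2,3)] by metis
    let ?u = "Min T" and ?s = "Min S'"
    have s: "?s \<le> m" using ocellD(6)[OF S'(12)] Min_in[OF S'(4,3)] by auto
    have ty: "F1 S' \<in> Mor D" "Src D (F1 S') = p ?s"
      "e i ?u \<in> Mor D" "Src D (e i ?u) = p i" "Tgt D (e i ?u) = p ?u"
      "e ?u ?s \<in> Mor D" "Src D (e ?u ?s) = p ?u" "Tgt D (e ?u ?s) = p ?s"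
      "t i ?u ?s \<in> Cell D" "Dom D (t i ?u ?s) = e i ?s" "Cod D (t i ?u ?s) = e ?u ?s \<odot> e i ?u"
      "e i ?s \<in> Mor D" "Src D (e i ?s) = p i" "Tgt D (e i ?s) = p ?s"
      "F1 T \<in> Mor D" "Src D (F1 T) = p ?u"
      using F1_typing[of S'] F1_typing[of T] S' insert.hyps s
        e_typing[of i ?u] e_typing[of ?u ?s] t_typing[of i ?u ?s] e_typing[of i ?s] by auto
    have u: "F1 (insert ?u S') = F1 S' \<odot> e ?u ?s"
      using F1_insert_le[of S' ?u] S' by auto
    have IH: "F2 (insert ?u S') T \<in> Cell D" "Dom D (F2 (insert ?u S') T) = F1 (insert ?u S')"
      "Cod D (F2 (insert ?u S') T) = F1 T"
      using insert.IH[OF S'(11)] by auto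
    show ?case
      unfolding S'(1) F2_insert[OF insert.hyps S'(2)] F1_insert[OF insert.hyps] F1_insert[OF S'(4,3,8)]
      by (simp add: D.typing ty IH u D.Comp_assoc)
  qed
qed

lemma F2_refl:
  assumes "S \<noteq> {}" "S \<subseteq> {0..m}"
  shows "F2 S S = \<iota> (F1 S)"
proof -
  have "finite S" using assms finite_subset by auto
  then show ?thesis using assms
  proof (induction rule: min_induct)
    case (singleton i)
    then show ?case by (simp add: F2_singleton F1_singleton)
  next
    case (insert i T)
    let ?u = "Min T"
    have "?u \<in> T" using insert by simp
    moreover have "i \<notin> T" using insert by (auto simp: Min_gr_iff)
    ultimately have u: "i \<notin> T" "insert ?u T = T" "?u \<le> m" using insert.prems by auto
    have ty: "e i ?u \<in> Mor D \<and> Src D (e i ?u) = p i \<and> Tgt D (e i ?u) = p ?u"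
      "F1 T \<in> Mor D \<and> Src D (F1 T) = p ?u \<and> Tgt D (F1 T) = p (Max T)"
      using e_typing[of i ?u] F1_typing[of T] insert u by auto
    have "t i ?u ?u = \<iota> (e i ?u)" using t_unit_right[of i ?u] insert u by auto
    then show ?case using insert ty u D.VComp_IdC_left[of "\<iota> (F1 T \<odot> e i ?u)"]
      by (simp add: F2_insert F1_insert D.typing D.HComp_IdC)
  qed
qed

text \<open>One insertion only is a whiskered triangle.\<close>

lemma F2_insert_two:
  assumes "finite S" "S \<noteq> {}" "S \<subseteq> {0..m}" "u \<le> v" "v \<le> Min S"
  shows "F2 (insert u S) (insert u (insert v S)) = \<iota> (F1 S) \<star> t u v (Min S)"
proof -
  have m: "Min S \<le> m" using assms Min_Max_le by auto
  have ty: "e u v \<in> Mor D \<and> Src D (e u v) = p u \<and> Tgt D (e u v) = p v"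
    "e v (Min S) \<in> Mor D \<and> Src D (e v (Min S)) = p v \<and> Tgt D (e v (Min S)) = p (Min S)"
    "F1 S \<in> Mor D \<and> Src D (F1 S) = p (Min S) \<and> Tgt D (F1 S) = p (Max S)"
    "t u v (Min S) \<in> Cell D \<and> Dom D (t u v (Min S)) = e u (Min S)
      \<and> Cod D (t u v (Min S)) = e v (Min S) \<odot> e u v"
    "e u (Min S) \<in> Mor D \<and> Src D (e u (Min S)) = p u \<and> Tgt D (e u (Min S)) = p (Min S)"
    using assms m e_typing[of u v] e_typing[of u "Min S"] e_typing[of v "Min S"] F1_typing[of S] t_typing[of u v "Min S"] by auto
  show ?thesis
  proof (cases "u = v")
    case True
    have "F2 (insert u S) (insert u S) = \<iota> (F1 S \<odot> e u (Min S))"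
      using F2_refl[of "insert u S"] assms m F1_insert_le[of S u] True by auto
    then show ?thesis using True t_unit_left[of u "Min S"] assms m ty by (simp add: D.HComp_IdC)
  next
    case False
    have 1: "Min (insert v S) = v" using assms by (simp add: min_def)
    have "u \<notin> S" using assms False by (auto simp: Min.bounded_iff)
    then have "F2 (insert u S) (insert u (insert v S)) = (F2 (insert v S) (insert v S) \<star> \<iota> (e u v))
        \<cdot> (\<iota> (F1 S) \<star> t u v (Min S))"
      using F2_insert[of "insert v S" u S] 1 assms False by simp
    also have "F2 (insert v S) (insert v S) = \<iota> (F1 S \<odot> e v (Min S))"
      using F2_refl[of "insert v S"] assms m F1_insert_le[of S v] by auto
    finally have "F2 (insert u S) (insert u (insert v S))
        = \<iota> (F1 S \<odot> e v (Min S) \<odot> e u v) \<cdot> (\<iota> (F1 S) \<star> t u v (Min S))"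
      using ty by (simp add: D.HComp_IdC D.typing D.Comp_assoc)
    moreover have "\<iota> (F1 S) \<star> t u v (Min S) \<in> Cell D"
      "Cod D (\<iota> (F1 S) \<star> t u v (Min S)) = F1 S \<odot> e v (Min S) \<odot> e u v"
      using ty by (simp_all add: D.typing)
    ultimately show ?thesis
      using D.VComp_IdC_left[of "\<iota> (F1 S) \<star> t u v (Min S)"] by simp
  qed
qed

text \<open>Elements are inserted from the left, so the induction is on the left factor, and the right factor is
  carried along by the interchange law.\<close>

lemma F2_HComp:
  assumes c: "ocell m S S'" and b: "ocell m T T'" and "Max S' = Min T'"
  shows "F2 (S \<union> T) (S' \<union> T') = F2 T T' \<star> F2 S S'"
proof -
  note d = ocellD[OF b]
  have bT: "F2 T T' \<in> Cell D" "Dom D (F2 T T') = F1 T" "Cod D (F2 T T') = F1 T'"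
    using F2_typing[OF b] by auto
  have tT: "F1 T \<in> Mor D" "Src D (F1 T) = p (Min T')"
    "F1 T' \<in> Mor D" "Src D (F1 T') = p (Min T')"
    using F1_typing[of T] F1_typing[of T'] d by auto
  have "finite S'" "S' \<noteq> {}" using ocellD[OF c] by auto
  then show ?thesis using c assms(3)
  proof (induction arbitrary: S rule: min_induct)
    case (singleton i)
    then have S: "S = {i}" "i \<le> m" by (auto simp: ocell_def)
    have "i \<in> T" "i \<in> T'" using Min_in[OF d(1,3)] Min_in[OF d(2,4)] singleton d(8) by auto
    then show ?case using S singleton bT tT D.HComp_Id_right[of "F2 T T'"]
      by (simp add: F2_singleton insert_absorb)
  next
    case (insert i U)
    obtain S' where S': "S = insert i S'" "i \<notin> S'" "S' \<noteq> {}" "finite S'" "S' \<subseteq> U" "finite U" "U \<subseteq> {0..m}"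
      "i < Min S'" "Min U \<le> Min S'" "Max S' = Max U" "ocell m (insert (Min U) S') U" "ocell m S' S'" "i \<le> m"
      using ocell_insertE[OF insert.prems(1) insert.hyps(2,3)] by metis
    let ?u = "Min U" and ?s = "Min S'"
    have M: "Max U = Min T'" using insert.prems(2) Max_insert_less[OF insert.hyps] by simp
    have s: "?s \<le> m" using ocellD(6)[OF S'(12)] Min_in[OF S'(4,3)] by auto
    have sT: "Max S' = Min T" using S'(10) M d(8) by simp
    have mm: "Min (U \<union> T') = ?u" "Min (S' \<union> T) = ?s"
      using Min_Un_chain[OF insert.hyps(1) d(2) insert.hyps(2) d(4) M]
        Min_Un_chain[OF S'(4) d(1) S'(3) d(3) sT] by auto
    have ni: "i \<notin> S' \<union> T"
    proof -
      have "i < Min (S' \<union> T)" using mm S'(8) by simp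
      then show ?thesis using S'(3,4) d(1) by (auto simp: Min_gr_iff)
    qed
    have ty: "F1 S' \<in> Mor D" "Src D (F1 S') = p ?s" "Tgt D (F1 S') = p (Min T')"
      "e i ?u \<in> Mor D" "Src D (e i ?u) = p i" "Tgt D (e i ?u) = p ?u"
      "e ?u ?s \<in> Mor D" "Src D (e ?u ?s) = p ?u" "Tgt D (e ?u ?s) = p ?s"
      "t i ?u ?s \<in> Cell D" "Dom D (t i ?u ?s) = e i ?s" "Cod D (t i ?u ?s) = e ?u ?s \<odot> e i ?u"
      "e i ?s \<in> Mor D" "Src D (e i ?s) = p i" "Tgt D (e i ?s) = p ?s"
      using F1_typing[of S'] M S' insert.hyps s
        e_typing[of i ?u] e_typing[of ?u ?s] t_typing[of i ?u ?s] e_typing[of i ?s] by auto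
    have u: "F1 (insert ?u S') = F1 S' \<odot> e ?u ?s"
      using F1_insert_le[of S' ?u] S' by auto
    have ty2: "F2 (insert ?u S') U \<in> Cell D" "Dom D (F2 (insert ?u S') U) = F1 (insert ?u S')"
      "Cod D (F2 (insert ?u S') U) = F1 U"
      using F2_typing[OF S'(11)] by auto
    have "F2 (S \<union> T) (insert i U \<union> T') = (F2 (insert ?u S' \<union> T) (U \<union> T') \<star> \<iota> (e i ?u))
        \<cdot> (\<iota> (F1 (S' \<union> T)) \<star> t i ?u ?s)"
      using F2_insert[of "U \<union> T'" i "S' \<union> T"] mm insert.hyps d ni by (simp add: S'(1))
    also have "F2 (insert ?u S' \<union> T) (U \<union> T') = F2 T T' \<star> F2 (insert ?u S') U"
      using insert.IH[OF S'(11) M] .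
    also have "F1 (S' \<union> T) = F1 T \<odot> F1 S'"
      using F1_Un[of S' T] S' d sT by auto
    also have "((F2 T T' \<star> F2 (insert ?u S') U) \<star> \<iota> (e i ?u)) \<cdot> (\<iota> (F1 T \<odot> F1 S') \<star> t i ?u ?s)
      = (F2 T T' \<star> (F2 (insert ?u S') U \<star> \<iota> (e i ?u))) \<cdot> (\<iota> (F1 T) \<star> (\<iota> (F1 S') \<star> t i ?u ?s))"
      using D.HComp_assoc[of "\<iota> (e i ?u)" "F2 (insert ?u S') U" "F2 T T'"]
        D.whisker_left_Comp[of "t i ?u ?s" "F1 S'" "F1 T"]
      by (simp add: D.typing ty ty2 u bT tT)
    also have "\<dots> = (F2 T T' \<cdot> \<iota> (F1 T)) \<star> ((F2 (insert ?u S') U \<star> \<iota> (e i ?u)) \<cdot> (\<iota> (F1 S') \<star> t i ?u ?s))"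
      by (rule D.interchange[symmetric]) (simp_all add: D.typing ty ty2 u bT tT D.Comp_assoc)
    also have "F2 T T' \<cdot> \<iota> (F1 T) = F2 T T'" using D.VComp_IdC_right[of "F2 T T'"] bT by simp
    also have "(F2 (insert ?u S') U \<star> \<iota> (e i ?u)) \<cdot> (\<iota> (F1 S') \<star> t i ?u ?s) = F2 S (insert i U)"
      using F2_insert[OF insert.hyps S'(2)] by (simp add: S'(1))
    finally show ?case .
  qed
qed


text \<open>Passing from \<open>S\<close> to \<open>T\<close> to \<open>U\<close> involves, next to the minimum \<open>i\<close>, the second elements \<open>w\<close>, \<open>v\<close>, \<open>u\<close> of
  these sets.  Splitting the first edge at \<open>v\<close> and then at \<open>u\<close> is compared with splitting at \<open>u\<close> first by the
  coherence law for \<open>i\<close>, \<open>u\<close>, \<open>v\<close>, \<open>w\<close>; this leaves 2-cells between the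
  elements from \<open>u\<close> on, whiskered by the edge from \<open>i\<close> to \<open>u\<close>, to which the induction hypothesis applies twice.\<close>

lemma F2_VComp:
  assumes "ocell m S T" "ocell m T U"
  shows "F2 T U \<cdot> F2 S T = F2 S U"
proof -
  have "finite U" "U \<noteq> {}" using ocellD[OF assms(2)] by auto
  then show ?thesis using assms
  proof (induction arbitrary: S T rule: min_induct)
    case (singleton i)
    then have "S = {i}" "T = {i}" "i \<le> m" by (auto simp: ocell_def)
    then show ?case using D.VComp_IdC_left[of "\<iota> (IdM D (p i))"]
      by (simp add: F2_singleton D.typing p_in)
  next
    case (insert i U)
    obtain T' where T': "T = insert i T'" "i \<notin> T'" "T' \<noteq> {}" "finite T'" "i < Min T'" "Min U \<le> Min T'"
      "ocell m (insert (Min U) T') U" "ocell m T' T'" "U \<subseteq> {0..m}"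
      using ocell_insertE[OF insert.prems(2) insert.hyps(2,3)] by metis
    obtain S' where S': "S = insert i S'" "i \<notin> S'" "S' \<noteq> {}" "finite S'" "i < Min S'" "Min T' \<le> Min S'"
      "ocell m (insert (Min T') S') T'" "ocell m S' S'"
      using ocell_insertE[OF insert.prems(1)[unfolded T'(1)] T'(3,5)] by metis
    define u v w where "u = Min U" and "v = Min T'" and "w = Min S'"
    have le: "i \<le> u" "u \<le> v" "v \<le> w" "w \<le> m" "v \<le> m" "i < u"
      using insert.hyps T'(5,6) S'(5,6) ocellD(6)[OF S'(8)] Min_Max_le[of S' m] S'(3)
      by (auto simp: u_def v_def w_def)
    define A B Bu G where "A = F2 (insert u T') U" and "B = F2 (insert v S') T'"
      and "Bu = F2 (insert u (insert v S')) (insert u T')"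
      and "G = F2 (insert u S') (insert u (insert v S'))"
    have sub: "S' \<subseteq> {0..m}" "T' \<subseteq> {0..m}" using ocellD[OF T'(8)] ocellD[OF S'(8)] by auto
    have "v \<in> T'" using Min_in T' by (simp add: v_def)
    then have iT: "insert v T' = T'" by auto
    have Muv: "Min {u, v} = u" "Max {u, v} = v" using le by auto
    have Bcell: "ocell m (insert v S') T'" using S'(7) by (simp add: v_def)
    have Mins: "Min (insert v S') = v" "Min T' = v" "Min S' = w"
      using S'(3,4,6) by (auto simp: v_def w_def min_def)
    have "ocell m ({u, v} \<union> insert v S') ({u, v} \<union> T')"
      by (rule ocell_Un[OF _ Bcell]) (use le Muv Mins in \<open>auto simp: ocell_def\<close>)
    then have Bucell: "ocell m (insert u (insert v S')) (insert u T')" using iT by (simp add: insert_commute)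
    have Gcell: "ocell m (insert u S') (insert u (insert v S'))"
      unfolding ocell_def using sub S'(3,4,6) le
      by (auto simp: v_def w_def Min_insert Max_insert min_def max_def dest: Min_le[OF S'(4) Max_in[OF S'(4,3)], THEN order_trans[rotated]])
    have Acell: "ocell m (insert u T') U" using T'(7) by (simp add: u_def)
    have ty [simp]: "e i u \<in> Mor D" "Src D (e i u) = p i" "Tgt D (e i u) = p u"
      "e u v \<in> Mor D" "Src D (e u v) = p u" "Tgt D (e u v) = p v"
      "e i v \<in> Mor D" "Src D (e i v) = p i" "Tgt D (e i v) = p v"
      "e i w \<in> Mor D" "Src D (e i w) = p i" "Tgt D (e i w) = p w"
      "e v w \<in> Mor D" "Src D (e v w) = p v" "Tgt D (e v w) = p w"
      "e u w \<in> Mor D" "Src D (e u w) = p u" "Tgt D (e u w) = p w"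
      "F1 S' \<in> Mor D" "Src D (F1 S') = p w" "F1 T' \<in> Mor D" "Src D (F1 T') = p v"
      using e_typing[of i u] e_typing[of u v] e_typing[of i v] e_typing[of i w] e_typing[of v w]
        e_typing[of u w] F1_typing[of S'] F1_typing[of T'] le sub S'(3) T'(3)
      by (simp_all add: v_def w_def)
    have tt [simp]: "t i u v \<in> Cell D" "Dom D (t i u v) = e i v" "Cod D (t i u v) = e u v \<odot> e i u"
      "t i v w \<in> Cell D" "Dom D (t i v w) = e i w" "Cod D (t i v w) = e v w \<odot> e i v"
      "t u v w \<in> Cell D" "Dom D (t u v w) = e u w" "Cod D (t u v w) = e v w \<odot> e u v"
      "t i u w \<in> Cell D" "Dom D (t i u w) = e i w" "Cod D (t i u w) = e u w \<odot> e i u"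
      using t_typing[of i u v] t_typing[of i v w] t_typing[of u v w] t_typing[of i u w] le by simp_all
    have F1s [simp]: "F1 (insert u T') = F1 T' \<odot> e u v" "F1 (insert v S') = F1 S' \<odot> e v w"
      "F1 (insert u S') = F1 S' \<odot> e u w" "F1 (insert u (insert v S')) = (F1 S' \<odot> e v w) \<odot> e u v"
      using F1_insert_le[of T' u] F1_insert_le[of S' v] F1_insert_le[of S' u] F1_insert_le[of "insert v S'" u]
        le sub S'(3,4) T'(3,4) Mins
      by (simp_all del: Min_insert)
    have cc [simp]: "A \<in> Cell D" "Dom D A = F1 T' \<odot> e u v" "B \<in> Cell D" "Dom D B = F1 S' \<odot> e v w"
      "Cod D B = F1 T'" "Bu \<in> Cell D" "Dom D Bu = (F1 S' \<odot> e v w) \<odot> e u v" "Cod D Bu = F1 T' \<odot> e u v"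
      "G \<in> Cell D" "Dom D G = F1 S' \<odot> e u w" "Cod D G = (F1 S' \<odot> e v w) \<odot> e u v"
      using F2_typing[OF Acell] F2_typing[OF Bcell] F2_typing[OF Bucell] F2_typing[OF Gcell]
      by (simp_all add: A_def B_def Bu_def G_def)
    note [simp] = D.typing
    have G: "G = \<iota> (F1 S') \<star> t u v w"
      unfolding G_def w_def using F2_insert_two[of S' u v] S' sub le by (simp add: w_def)
    have Bu: "Bu = B \<star> \<iota> (e u v)"
    proof -
      have "F2 ({u, v} \<union> insert v S') ({u, v} \<union> T') = B \<star> F2 {u, v} {u, v}"
        unfolding B_def by (rule F2_HComp[OF ocell_refl Bcell]) (use le Muv Mins in auto)
      also have "F2 {u, v} {u, v} = \<iota> (e u v)" using F2_refl[of "{u, v}"] F1_pair[of u v] le by simp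
      finally show ?thesis using iT by (simp add: Bu_def insert_commute)
    qed
    have TU: "F2 T (insert i U) = (A \<star> \<iota> (e i u)) \<cdot> (\<iota> (F1 T') \<star> t i u v)"
      using F2_insert[OF insert.hyps T'(2)] by (simp add: T'(1) A_def u_def v_def)
    have ST: "F2 S T = (B \<star> \<iota> (e i v)) \<cdot> (\<iota> (F1 S') \<star> t i v w)"
      using F2_insert[OF T'(4,3,5) S'(2)] by (simp add: S'(1) T'(1) B_def v_def w_def)
    \<comment> \<open>Splitting the first edge commutes with the insertions \<open>B\<close> into the tail.\<close>
    have swap: "(\<iota> (F1 T') \<star> t i u v) \<cdot> (B \<star> \<iota> (e i v))
        = (Bu \<star> \<iota> (e i u)) \<cdot> (\<iota> (F1 S') \<star> (\<iota> (e v w) \<star> t i u v))"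
      using D.HComp_as_whiskers[of "t i u v" B] D.whisker_right_Comp[of B "e u v" "e i u"]
        D.whisker_left_Comp[of "t i u v" "e v w" "F1 S'"]
      by (simp add: Bu)
    have coassoc: "(\<iota> (F1 S') \<star> (\<iota> (e v w) \<star> t i u v)) \<cdot> (\<iota> (F1 S') \<star> t i v w)
        = (G \<star> \<iota> (e i u)) \<cdot> (\<iota> (F1 S') \<star> t i u w)"
      using t_coassoc[of i u v w] le
        D.whisker_left_VComp[of "t i v w" "\<iota> (e v w) \<star> t i u v" "F1 S'"]
        D.whisker_left_VComp[of "t i u w" "t u v w \<star> \<iota> (e i u)" "F1 S'"]
        D.HComp_assoc[of "\<iota> (e i u)" "t u v w" "\<iota> (F1 S')"]
      by (simp add: G D.Comp_assoc)
    have "F2 T (insert i U) \<cdot> F2 S T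
        = (A \<star> \<iota> (e i u)) \<cdot> ((\<iota> (F1 T') \<star> t i u v) \<cdot> (B \<star> \<iota> (e i v))) \<cdot> (\<iota> (F1 S') \<star> t i v w)"
      unfolding TU ST by (simp add: D.VComp_assoc D.Comp_assoc)
    also have "\<dots> = (A \<star> \<iota> (e i u)) \<cdot> (Bu \<star> \<iota> (e i u)) \<cdot> (G \<star> \<iota> (e i u)) \<cdot> (\<iota> (F1 S') \<star> t i u w)"
      unfolding swap by (simp add: D.VComp_assoc D.Comp_assoc coassoc)
    also have "\<dots> = ((A \<cdot> Bu \<cdot> G) \<star> \<iota> (e i u)) \<cdot> (\<iota> (F1 S') \<star> t i u w)"
      by (simp add: D.whisker_right_VComp D.VComp_assoc D.Comp_assoc)
    also have "A \<cdot> Bu \<cdot> G = (A \<cdot> Bu) \<cdot> G" by (simp add: D.VComp_assoc)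
    also have "A \<cdot> Bu = F2 (insert u (insert v S')) U"
      unfolding A_def Bu_def by (rule insert.IH[OF Bucell Acell])
    also have "\<dots> \<cdot> G = F2 (insert u S') U"
      unfolding G_def by (rule insert.IH[OF Gcell ocell_trans[OF Bucell Acell]])
    also have "(F2 (insert u S') U \<star> \<iota> (e i u)) \<cdot> (\<iota> (F1 S') \<star> t i u w) = F2 S (insert i U)"
      using F2_insert[OF insert.hyps S'(2)] by (simp add: S'(1) u_def w_def)
    finally show ?case .
  qed
qed

lemma two_functor_ofun: "two_functor (oriental m) D ofun"
proof (rule two_functor.intro)
  let ?A = "oriental m"
  note [simp] = ofun_def Mor_oriental Cell_oriental F1_typing p_in F2_typing F1_singleton F2_refl
  fix x f g a b
  show "x \<in> Ob ?A \<Longrightarrow> Fn0 ofun x \<in> Ob D" "f \<in> Mor ?A \<Longrightarrow> Fn1 ofun f \<in> Mor D"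
    "f \<in> Mor ?A \<Longrightarrow> Src D (Fn1 ofun f) = Fn0 ofun (Src ?A f)"
    "f \<in> Mor ?A \<Longrightarrow> Tgt D (Fn1 ofun f) = Fn0 ofun (Tgt ?A f)"
    "x \<in> Ob ?A \<Longrightarrow> Fn1 ofun (IdM ?A x) = IdM D (Fn0 ofun x)"
    "f \<in> Mor ?A \<Longrightarrow> Fn2 ofun (IdC ?A f) = \<iota> (Fn1 ofun f)"
    by auto
  show "a \<in> Cell ?A \<Longrightarrow> Fn2 ofun a \<in> Cell D"
    "a \<in> Cell ?A \<Longrightarrow> Dom D (Fn2 ofun a) = Fn1 ofun (Dom ?A a)"
    "a \<in> Cell ?A \<Longrightarrow> Cod D (Fn2 ofun a) = Fn1 ofun (Cod ?A a)"
    by (cases a; auto)+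
  show "\<lbrakk>f \<in> Mor ?A; g \<in> Mor ?A; Tgt ?A f = Src ?A g\<rbrakk> \<Longrightarrow> Fn1 ofun (Comp ?A g f) = Fn1 ofun g \<odot> Fn1 ofun f"
    by (auto simp: F1_Un)
  show "\<lbrakk>a \<in> Cell ?A; b \<in> Cell ?A; Cod ?A a = Dom ?A b\<rbrakk> \<Longrightarrow> Fn2 ofun (VComp ?A b a) = Fn2 ofun b \<cdot> Fn2 ofun a"
    by (cases a; cases b; auto simp: F2_VComp)
  show "\<lbrakk>a \<in> Cell ?A; b \<in> Cell ?A; Tgt ?A (Dom ?A a) = Src ?A (Dom ?A b)\<rbrakk>
      \<Longrightarrow> Fn2 ofun (HComp ?A b a) = Fn2 ofun b \<star> Fn2 ofun a"
    by (cases a; cases b) (auto intro!: F2_HComp simp: ocell_def)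
qed

lemma ofun_values:
  "Fn0 ofun i = p i"
  "i \<le> j \<Longrightarrow> j \<le> m \<Longrightarrow> Fn1 ofun {i, j} = e i j"
  "i \<le> j \<Longrightarrow> j \<le> k \<Longrightarrow> k \<le> m \<Longrightarrow> Fn2 ofun ({i, k}, {i, j, k}) = t i j k"
proof -
  show "Fn0 ofun i = p i" "i \<le> j \<Longrightarrow> j \<le> m \<Longrightarrow> Fn1 ofun {i, j} = e i j"
    by (auto simp: ofun_def F1_pair)
  assume *: "i \<le> j" "j \<le> k" "k \<le> m"
  then have "t i j k \<in> Cell D" "Tgt D (Dom D (t i j k)) = p k"
    using t_typing[of i j k] e_typing[of i k] by auto
  then show "Fn2 ofun ({i, k}, {i, j, k}) = t i j k"
    using F2_insert_two[of "{k}" i j] * D.HComp_Id_left[of "t i j k"]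
    by (simp add: ofun_def F1_singleton)
qed

end

text \<open>Conversely, the recursion used above is forced by functoriality: each step of it writes a 2-cell
  of the oriental as a composite of whiskered smaller ones.\<close>

lemma ofun_unique:
  assumes "two_functor (oriental m) D F" "two_functor (oriental m) D G"
    and D: "two_category D"
    and 0: "\<And>i. i \<le> m \<Longrightarrow> Fn0 F i = Fn0 G i"
    and 1: "\<And>i j. i < j \<Longrightarrow> j \<le> m \<Longrightarrow> Fn1 F {i, j} = Fn1 G {i, j}"
  shows "S \<in> Mor (oriental m) \<Longrightarrow> Fn1 F S = Fn1 G S"
    and "(\<And>i j k. i < j \<Longrightarrow> j < k \<Longrightarrow> k \<le> m \<Longrightarrow> Fn2 F ({i, k}, {i, j, k}) = Fn2 G ({i, k}, {i, j, k}))
      \<Longrightarrow> a \<in> Cell (oriental m) \<Longrightarrow> Fn2 F a = Fn2 G a"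
proof -
  interpret F: two_functor "oriental m" D F by fact
  interpret G: two_functor "oriental m" D G by fact
  show m: "Fn1 F S = Fn1 G S" if "S \<in> Mor (oriental m)" for S
  proof -
    have "finite S" "S \<noteq> {}" "S \<subseteq> {0..m}" using that finite_subset by (auto simp: Mor_oriental)
    then show ?thesis
    proof (induction rule: min_induct)
      case (singleton i)
      then show ?case using F.Fn_IdM[of i] G.Fn_IdM[of i] 0 by simp
    next
      case (insert i T)
      let ?u = "Min T"
      have T: "?u \<in> T" "?u \<le> m" "i \<le> m" "T \<subseteq> {0..m}" using insert Min_Max_le[of T m] by auto
      then have "insert i T = Comp (oriental m) T {i, ?u}" by auto
      moreover have "Max {i, ?u} = ?u" using insert by simp
      ultimately show ?case
        using F.Fn_Comp[of "{i, ?u}" T] G.Fn_Comp[of "{i, ?u}" T] insert T 1[of i ?u]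
        by (simp add: Mor_oriental del: oriental_simps(8) Max_insert)
    qed
  qed
  assume 2: "\<And>i j k. i < j \<Longrightarrow> j < k \<Longrightarrow> k \<le> m \<Longrightarrow> Fn2 F ({i, k}, {i, j, k}) = Fn2 G ({i, k}, {i, j, k})"
  have id: "Fn2 F (S, S) = Fn2 G (S, S)" if "S \<in> Mor (oriental m)" for S
    using F.Fn_IdC[OF that] G.Fn_IdC[OF that] m[OF that] by simp
  assume "a \<in> Cell (oriental m)"
  then obtain S T where a: "a = (S, T)" "ocell m S T" by (cases a) (auto simp: Cell_oriental)
  have "finite T" "T \<noteq> {}" using ocellD[OF a(2)] by auto
  then have "Fn2 F (S, T) = Fn2 G (S, T)" using a(2)
  proof (induction arbitrary: S rule: min_induct)
    case (singleton i)
    then have "S = {i}" "i \<le> m" by (auto simp: ocell_def)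
    then show ?case using id[of "{i}"] by (simp add: Mor_oriental)
  next
    case (insert i T)
    obtain S' where S': "S = insert i S'" "i \<notin> S'" "S' \<noteq> {}" "finite S'" "S' \<subseteq> T" "finite T" "T \<subseteq> {0..m}"
      "i < Min S'" "Min T \<le> Min S'" "Max S' = Max T" "ocell m (insert (Min T) S') T" "ocell m S' S'" "i \<le> m"
      using ocell_insertE[OF insert.prems insert.hyps(2,3)] by metis
    let ?u = "Min T" and ?s = "Min S'"
    have s: "?s \<le> m" "?s \<in> S'" "?u \<in> T" using Min_Max_le[of S' m] ocellD(6)[OF S'(12)] S'(3,4) insert.hyps by auto
    let ?b = "HComp (oriental m) (insert ?u S', T) ({i, ?u}, {i, ?u})"
    let ?c = "HComp (oriental m) (S', S') ({i, ?s}, {i, ?u, ?s})"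
    have eq: "(S, insert i T) = VComp (oriental m) ?b ?c"
      using s S'(1) by (auto simp: insert_commute insert_absorb)
    have us: "i < ?u" "?u \<le> ?s" by fact+
    have MM: "Min {i, ?u} = i" "Max {i, ?u} = ?u" "Min {i, ?s} = i" "Max {i, ?s} = ?s"
      "Min {i, ?u, ?s} = i" "Max {i, ?u, ?s} = ?s" "Min (insert ?u S') = ?u"
      using us S'(3,4) by auto
    have c1: "({i, ?u}, {i, ?u}) \<in> Cell (oriental m)" "({i, ?s}, {i, ?u, ?s}) \<in> Cell (oriental m)"
      "(S', S') \<in> Cell (oriental m)" "(insert ?u S', T) \<in> Cell (oriental m)"
      using us s S' MM by (auto simp: Cell_oriental ocell_def)
    interpret A: two_category "oriental m" by (rule two_category_oriental)
    have c2: "?b \<in> Cell (oriental m)" "?c \<in> Cell (oriental m)"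
      using c1 MM by (auto intro!: A.HComp_in simp del: oriental_simps(10) Min_insert Max_insert)
    have c3: "Cod (oriental m) ?c = Dom (oriental m) ?b" using s by auto
    have t: "Fn2 F ({i, ?s}, {i, ?u, ?s}) = Fn2 G ({i, ?s}, {i, ?u, ?s})"
    proof (cases "?u = ?s")
      case True
      then show ?thesis using id[of "{i, ?s}"] s S'(13) by (simp add: Mor_oriental)
    next
      case False
      then show ?thesis using 2[of i ?u ?s] us s by simp
    qed
    have h: "Fn2 F ?b = Fn2 G ?b" "Fn2 F ?c = Fn2 G ?c"
      using F.Fn_HComp[OF c1(1,4)] G.Fn_HComp[OF c1(1,4)] F.Fn_HComp[OF c1(2,3)] G.Fn_HComp[OF c1(2,3)]
        insert.IH[OF S'(11)] t id[of "{i, ?u}"] id[of S'] MM us s S'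
      by (auto simp: Mor_oriental subset_iff simp del: oriental_simps(10) Min_insert Max_insert)
    show ?case unfolding eq
      using F.Fn_VComp[OF c2(2,1) c3] G.Fn_VComp[OF c2(2,1) c3] h by (simp del: oriental_simps(9,10))
  qed
  then show "Fn2 F a = Fn2 G a" using a(1) by simp
qed

section \<open>Normal pseudofunctors and their path objects\<close>

definition inverse_cells :: "('o, 'm, 'c) two_cat \<Rightarrow> 'c \<Rightarrow> 'c \<Rightarrow> bool" where
  "inverse_cells K a b \<longleftrightarrow> a \<in> Cell K \<and> b \<in> Cell K \<and> Dom K b = Cod K a \<and> Cod K b = Dom K a
     \<and> VComp K b a = IdC K (Dom K a) \<and> VComp K a b = IdC K (Cod K a)"

definition iso_cell :: "('o, 'm, 'c) two_cat \<Rightarrow> 'c \<Rightarrow> bool" where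
  "iso_cell K a \<longleftrightarrow> (\<exists>b. inverse_cells K a b)"

lemma iso_cell_in: "iso_cell K a \<Longrightarrow> a \<in> Cell K"
  by (auto simp: iso_cell_def inverse_cells_def)

lemma inverse_cells_sym: "inverse_cells K a b \<Longrightarrow> inverse_cells K b a"
  by (auto simp: inverse_cells_def)

lemma inverse_cells_functor:
  assumes F: "two_functor A B F" and A: "two_category A" and "inverse_cells A a b"
  shows "inverse_cells B (Fn2 F a) (Fn2 F b)"
proof -
  interpret F: two_functor A B F by fact
  interpret A: two_category A by fact
  have d: "a \<in> Cell A" "b \<in> Cell A" "Dom A b = Cod A a" "Cod A b = Dom A a"
    and v: "b \<cdot>\<^bsub>A\<^esub> a = \<iota>\<^bsub>A\<^esub> (Dom A a)" "a \<cdot>\<^bsub>A\<^esub> b = \<iota>\<^bsub>A\<^esub> (Cod A a)"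
    using assms(3) by (auto simp: inverse_cells_def)
  have "Fn2 F b \<cdot>\<^bsub>B\<^esub> Fn2 F a = \<iota>\<^bsub>B\<^esub> (Fn1 F (Dom A a))"
    unfolding F.Fn_VComp[OF d(1,2) d(3)[symmetric], symmetric] v by (rule F.Fn_IdC) (simp add: d A.typing)
  moreover have "Fn2 F a \<cdot>\<^bsub>B\<^esub> Fn2 F b = \<iota>\<^bsub>B\<^esub> (Fn1 F (Cod A a))"
    unfolding F.Fn_VComp[OF d(2,1,4), symmetric] v by (rule F.Fn_IdC) (simp add: d A.typing)
  ultimately show ?thesis
    unfolding inverse_cells_def F.Fn_Dom[OF d(1)] F.Fn_Dom[OF d(2)] F.Fn_Cod[OF d(1)] F.Fn_Cod[OF d(2)]
    by (simp add: d F.Fn2_in)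
qed

context two_category
begin

lemma iso_cell_IdC: "f \<in> Mor C \<Longrightarrow> iso_cell C (\<iota>\<^bsub>C\<^esub> f)"
  unfolding iso_cell_def inverse_cells_def
  by (rule exI[of _ "\<iota>\<^bsub>C\<^esub> f"]) (use VComp_IdC_left[of "\<iota>\<^bsub>C\<^esub> f"] in \<open>simp add: typing\<close>)

lemma inverse_cellsD:
  assumes "inverse_cells C a b"
  shows "a \<in> Cell C" "b \<in> Cell C" "Dom C b = Cod C a" "Cod C b = Dom C a"
    "b \<cdot>\<^bsub>C\<^esub> a = \<iota>\<^bsub>C\<^esub> (Dom C a)" "a \<cdot>\<^bsub>C\<^esub> b = \<iota>\<^bsub>C\<^esub> (Cod C a)"
  using assms by (auto simp: inverse_cells_def)

lemma inverse_cells_VComp: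
  assumes i: "inverse_cells C a a'" "inverse_cells C b b'" and e: "Cod C a = Dom C b"
  shows "inverse_cells C (b \<cdot>\<^bsub>C\<^esub> a) (a' \<cdot>\<^bsub>C\<^esub> b')"
proof -
  note d = inverse_cellsD[OF i(1)] and d' = inverse_cellsD[OF i(2)]
  have ty: "a \<in> Cell C" "a' \<in> Cell C" "b \<in> Cell C" "b' \<in> Cell C" "Cod C a = Dom C b" "Cod C b' = Dom C b"
    "Dom C a' = Dom C b" "Cod C a' = Dom C a" "Dom C b' = Cod C b"
    using d(1-4) d'(1-4) e by simp_all
  have "(a' \<cdot>\<^bsub>C\<^esub> b') \<cdot>\<^bsub>C\<^esub> (b \<cdot>\<^bsub>C\<^esub> a) = a' \<cdot>\<^bsub>C\<^esub> ((b' \<cdot>\<^bsub>C\<^esub> b) \<cdot>\<^bsub>C\<^esub> a)"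
    by (simp add: ty typing VComp_assoc)
  also have "\<dots> = \<iota>\<^bsub>C\<^esub> (Dom C a)" using VComp_IdC_left[of a] d(5) d'(5) ty by simp
  finally have 1: "(a' \<cdot>\<^bsub>C\<^esub> b') \<cdot>\<^bsub>C\<^esub> (b \<cdot>\<^bsub>C\<^esub> a) = \<iota>\<^bsub>C\<^esub> (Dom C a)" .
  have "(b \<cdot>\<^bsub>C\<^esub> a) \<cdot>\<^bsub>C\<^esub> (a' \<cdot>\<^bsub>C\<^esub> b') = b \<cdot>\<^bsub>C\<^esub> ((a \<cdot>\<^bsub>C\<^esub> a') \<cdot>\<^bsub>C\<^esub> b')"
    by (simp add: ty typing VComp_assoc)
  also have "\<dots> = \<iota>\<^bsub>C\<^esub> (Cod C b)" using VComp_IdC_left[of b'] d(6) d'(6) ty by simp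
  finally show ?thesis using 1 unfolding inverse_cells_def by (simp add: ty typing)
qed

lemma inverse_cells_HComp:
  assumes i: "inverse_cells C a a'" "inverse_cells C b b'" and e: "Tgt C (Dom C a) = Src C (Dom C b)"
  shows "inverse_cells C (b \<star>\<^bsub>C\<^esub> a) (b' \<star>\<^bsub>C\<^esub> a')"
proof -
  note d = inverse_cellsD[OF i(1)] and d' = inverse_cellsD[OF i(2)]
  have t: "Tgt C (Cod C a) = Src C (Cod C b)" using d(1) d'(1) e Src_Cod[of b] Tgt_Cod[of a] by simp
  have 1: "(b' \<star>\<^bsub>C\<^esub> a') \<cdot>\<^bsub>C\<^esub> (b \<star>\<^bsub>C\<^esub> a) = \<iota>\<^bsub>C\<^esub> (Dom C b \<odot>\<^bsub>C\<^esub> Dom C a)"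
    using interchange[OF d(1,2) d'(1,2) d(3)[symmetric] d'(3)[symmetric] e]
    unfolding d(5) d'(5) by (simp add: HComp_IdC d(1) d'(1) Dom_in e)
  have "Tgt C (Dom C a') = Src C (Dom C b')" using t d(3) d'(3) by simp
  then have 2: "(b \<star>\<^bsub>C\<^esub> a) \<cdot>\<^bsub>C\<^esub> (b' \<star>\<^bsub>C\<^esub> a') = \<iota>\<^bsub>C\<^esub> (Cod C b \<odot>\<^bsub>C\<^esub> Cod C a)"
    using interchange[OF d(2,1) d'(2,1) d(4) d'(4)]
    unfolding d(6) d'(6) by (simp add: HComp_IdC d(1) d'(1) Cod_in t)
  show ?thesis unfolding inverse_cells_def using 1 2 d(1-4) d'(1-4) e t by (simp add: typing del: Src_Cod Tgt_Cod)
qed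

lemma iso_cell_VComp: "iso_cell C a \<Longrightarrow> iso_cell C b \<Longrightarrow> Cod C a = Dom C b \<Longrightarrow> iso_cell C (b \<cdot>\<^bsub>C\<^esub> a)"
  unfolding iso_cell_def using inverse_cells_VComp by blast

lemma iso_cell_HComp:
  "iso_cell C a \<Longrightarrow> iso_cell C b \<Longrightarrow> Tgt C (Dom C a) = Src C (Dom C b) \<Longrightarrow> iso_cell C (b \<star>\<^bsub>C\<^esub> a)"
  unfolding iso_cell_def using inverse_cells_HComp by blast

lemma iso_cell_cancel_right:
  assumes "iso_cell C a" "x \<in> Cell C" "y \<in> Cell C" "Dom C x = Cod C a" "Dom C y = Cod C a"
    "x \<cdot>\<^bsub>C\<^esub> a = y \<cdot>\<^bsub>C\<^esub> a"
  shows "x = y"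
proof -
  obtain b where b: "inverse_cells C a b" using assms by (auto simp: iso_cell_def)
  note d = inverse_cellsD[OF b]
  have "(z \<cdot>\<^bsub>C\<^esub> a) \<cdot>\<^bsub>C\<^esub> b = z" if z: "z \<in> Cell C" "Dom C z = Cod C a" for z
    using VComp_assoc[OF d(2,1) z(1) d(4) z(2)[symmetric]] VComp_IdC_right[OF z(1)] z d(6) by simp
  from this[OF assms(2,4)] this[OF assms(3,5)] show ?thesis unfolding assms(6) by (rule trans[OF sym])
qed

end

locale normal_pseudofunctor = C: two_category C + K: two_category K
  for C :: "('o, 'm, 'c) two_cat" and K :: "('p, 'n, 'd) two_cat" +
  fixes s0 :: "'o \<Rightarrow> 'p" and s1 :: "'m \<Rightarrow> 'n" and s2 :: "'c \<Rightarrow> 'd" and mu :: "'m \<Rightarrow> 'm \<Rightarrow> 'd"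
  assumes s0_in: "x \<in> Ob C \<Longrightarrow> s0 x \<in> Ob K"
    and s1_typing: "h \<in> Mor C \<Longrightarrow> s1 h \<in> Mor K" "h \<in> Mor C \<Longrightarrow> Src K (s1 h) = s0 (Src C h)"
      "h \<in> Mor C \<Longrightarrow> Tgt K (s1 h) = s0 (Tgt C h)"
    and s1_IdM: "x \<in> Ob C \<Longrightarrow> s1 (IdM C x) = IdM K (s0 x)"
    and s2_typing: "a \<in> Cell C \<Longrightarrow> s2 a \<in> Cell K" "a \<in> Cell C \<Longrightarrow> Dom K (s2 a) = s1 (Dom C a)"
      "a \<in> Cell C \<Longrightarrow> Cod K (s2 a) = s1 (Cod C a)"
    and s2_IdC: "h \<in> Mor C \<Longrightarrow> s2 (\<iota>\<^bsub>C\<^esub> h) = \<iota>\<^bsub>K\<^esub> (s1 h)"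
    and s2_VComp: "\<lbrakk>a \<in> Cell C; b \<in> Cell C; Cod C a = Dom C b\<rbrakk> \<Longrightarrow> s2 (b \<cdot>\<^bsub>C\<^esub> a) = s2 b \<cdot>\<^bsub>K\<^esub> s2 a"
    and mu_iso: "\<lbrakk>h \<in> Mor C; k \<in> Mor C; Tgt C h = Src C k\<rbrakk> \<Longrightarrow> iso_cell K (mu k h)"
    and mu_Dom: "\<lbrakk>h \<in> Mor C; k \<in> Mor C; Tgt C h = Src C k\<rbrakk> \<Longrightarrow> Dom K (mu k h) = s1 (k \<odot>\<^bsub>C\<^esub> h)"
    and mu_Cod: "\<lbrakk>h \<in> Mor C; k \<in> Mor C; Tgt C h = Src C k\<rbrakk> \<Longrightarrow> Cod K (mu k h) = s1 k \<odot>\<^bsub>K\<^esub> s1 h"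
    and mu_unit_left: "h \<in> Mor C \<Longrightarrow> mu (IdM C (Tgt C h)) h = \<iota>\<^bsub>K\<^esub> (s1 h)"
    and mu_unit_right: "h \<in> Mor C \<Longrightarrow> mu h (IdM C (Src C h)) = \<iota>\<^bsub>K\<^esub> (s1 h)"
    and mu_assoc: "\<lbrakk>h \<in> Mor C; k \<in> Mor C; l \<in> Mor C; Tgt C h = Src C k; Tgt C k = Src C l\<rbrakk>
      \<Longrightarrow> (mu l k \<star>\<^bsub>K\<^esub> \<iota>\<^bsub>K\<^esub> (s1 h)) \<cdot>\<^bsub>K\<^esub> mu (l \<odot>\<^bsub>C\<^esub> k) h
        = (\<iota>\<^bsub>K\<^esub> (s1 l) \<star>\<^bsub>K\<^esub> mu k h) \<cdot>\<^bsub>K\<^esub> mu l (k \<odot>\<^bsub>C\<^esub> h)"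
    and mu_natural: "\<lbrakk>a \<in> Cell C; b \<in> Cell C; Tgt C (Dom C a) = Src C (Dom C b)\<rbrakk>
      \<Longrightarrow> mu (Cod C b) (Cod C a) \<cdot>\<^bsub>K\<^esub> s2 (b \<star>\<^bsub>C\<^esub> a) = (s2 b \<star>\<^bsub>K\<^esub> s2 a) \<cdot>\<^bsub>K\<^esub> mu (Dom C b) (Dom C a)"
begin

lemma mu_in: "\<lbrakk>h \<in> Mor C; k \<in> Mor C; Tgt C h = Src C k\<rbrakk> \<Longrightarrow> mu k h \<in> Cell K"
  by (rule iso_cell_in) (rule mu_iso)

lemmas typing = C.typing K.typing s0_in s1_typing s2_typing mu_in mu_Dom mu_Cod

text \<open>The path object.  A 1-cell \<open>(h, \<kappa>)\<close> is a 1-cell \<open>h\<close> of \<open>C\<close> with an invertible 2-cell \<open>\<kappa>\<close> from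
  \<open>s1 h\<close> to some 1-cell of \<open>K\<close>, and a 2-cell is a pair of parallel 2-cells of \<open>C\<close> and of \<open>K\<close> that
  are compatible with the invertible 2-cells at its ends.  A lift of a pair of 2-functors
  \<open>A \<rightarrow> C\<close>, \<open>A \<rightarrow> K\<close> to the path object is the same as an invertible pseudonatural transformation, with
  identity components on objects, from the composite of the first with the pseudofunctor to the second;
  the point of the encoding is that its existence can be deduced from the universal property of \<open>A\<close>.\<close>

definition pmor :: "('m \<times> 'd) set" where
  "pmor = {(h, \<kappa>). h \<in> Mor C \<and> iso_cell K \<kappa> \<and> Dom K \<kappa> = s1 h}"

definition pcell :: "(('m \<times> 'd) \<times> ('m \<times> 'd) \<times> 'c \<times> 'd) set" where
  "pcell = {(f, g, \<alpha>, a). f \<in> pmor \<and> g \<in> pmor \<and> \<alpha> \<in> Cell C \<and> a \<in> Cell K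
     \<and> Dom C \<alpha> = fst f \<and> Cod C \<alpha> = fst g \<and> Dom K a = Cod K (snd f) \<and> Cod K a = Cod K (snd g)
     \<and> snd g \<cdot>\<^bsub>K\<^esub> s2 \<alpha> = a \<cdot>\<^bsub>K\<^esub> snd f}"

definition pcomp :: "'m \<times> 'd \<Rightarrow> 'm \<times> 'd \<Rightarrow> 'm \<times> 'd" where
  "pcomp g f = (fst g \<odot>\<^bsub>C\<^esub> fst f, (snd g \<star>\<^bsub>K\<^esub> snd f) \<cdot>\<^bsub>K\<^esub> mu (fst g) (fst f))"

definition path_cat :: "('o, 'm \<times> 'd, ('m \<times> 'd) \<times> ('m \<times> 'd) \<times> 'c \<times> 'd) two_cat" where
  "path_cat = \<lparr>Ob = Ob C, Mor = pmor, Cell = pcell,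
     Src = Src C \<circ> fst, Tgt = Tgt C \<circ> fst, Dom = fst, Cod = (\<lambda>a. fst (snd a)),
     IdM = (\<lambda>x. (IdM C x, \<iota>\<^bsub>K\<^esub> (IdM K (s0 x)))),
     IdC = (\<lambda>f. (f, f, \<iota>\<^bsub>C\<^esub> (fst f), \<iota>\<^bsub>K\<^esub> (Cod K (snd f)))),
     Comp = pcomp,
     VComp = (\<lambda>(g, k, \<beta>, b) (f, g', \<alpha>, a). (f, k, \<beta> \<cdot>\<^bsub>C\<^esub> \<alpha>, b \<cdot>\<^bsub>K\<^esub> a)),
     HComp = (\<lambda>(f', g', \<beta>, b) (f, g, \<alpha>, a). (pcomp f' f, pcomp g' g, \<beta> \<star>\<^bsub>C\<^esub> \<alpha>, b \<star>\<^bsub>K\<^esub> a))\<rparr>"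

lemma path_cat_simps [simp]:
  "Ob path_cat = Ob C" "Mor path_cat = pmor" "Cell path_cat = pcell"
  "Src path_cat f = Src C (fst f)" "Tgt path_cat f = Tgt C (fst f)"
  "Dom path_cat = fst" "Cod path_cat c = fst (snd c)"
  "IdM path_cat x = (IdM C x, \<iota>\<^bsub>K\<^esub> (IdM K (s0 x)))"
  "IdC path_cat f = (f, f, \<iota>\<^bsub>C\<^esub> (fst f), \<iota>\<^bsub>K\<^esub> (Cod K (snd f)))"
  "Comp path_cat = pcomp"
  "VComp path_cat (g, k, \<beta>, b) (f, g', \<alpha>, a) = (f, k, \<beta> \<cdot>\<^bsub>C\<^esub> \<alpha>, b \<cdot>\<^bsub>K\<^esub> a)"
  "HComp path_cat (f', g'', \<beta>, b) (f, g', \<alpha>, a) = (pcomp f' f, pcomp g'' g', \<beta> \<star>\<^bsub>C\<^esub> \<alpha>, b \<star>\<^bsub>K\<^esub> a)"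
  by (simp_all add: path_cat_def)

lemma pmorD:
  assumes "f \<in> pmor"
  shows "fst f \<in> Mor C" "iso_cell K (snd f)" "snd f \<in> Cell K" "Dom K (snd f) = s1 (fst f)"
    "Src K (Cod K (snd f)) = s0 (Src C (fst f))" "Tgt K (Cod K (snd f)) = s0 (Tgt C (fst f))"
  using assms iso_cell_in[of K "snd f"] K.Src_Cod[of "snd f"] K.Tgt_Cod[of "snd f"]
  by (auto simp: pmor_def s1_typing)

lemma pcomp_in:
  assumes "f \<in> pmor" "g \<in> pmor" "Tgt C (fst f) = Src C (fst g)"
  shows "pcomp g f \<in> pmor" "Cod K (snd (pcomp g f)) = Cod K (snd g) \<odot>\<^bsub>K\<^esub> Cod K (snd f)"
  using assms pmorD[OF assms(1)] pmorD[OF assms(2)]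
  by (auto simp: pmor_def pcomp_def typing intro!: K.iso_cell_VComp K.iso_cell_HComp mu_iso)

lemma fst_pcomp [simp]: "fst (pcomp g f) = fst g \<odot>\<^bsub>C\<^esub> fst f"
  by (simp add: pcomp_def)

text \<open>Associativity is where the coherence law \<open>mu_assoc\<close> enters.\<close>

lemma pcomp_assoc:
  assumes "f \<in> pmor" "g \<in> pmor" "h \<in> pmor" "Tgt C (fst f) = Src C (fst g)" "Tgt C (fst g) = Src C (fst h)"
  shows "pcomp (pcomp h g) f = pcomp h (pcomp g f)"
proof -
  note [simp] = typing pmorD[OF assms(1)] pmorD[OF assms(2)] pmorD[OF assms(3)] assms(4,5)
  define u v w where "u = fst f" and "v = fst g" and "w = fst h"
  define a b c where "a = snd f" and "b = snd g" and "c = snd h"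
  have ty [simp]: "u \<in> Mor C" "v \<in> Mor C" "w \<in> Mor C" "Tgt C u = Src C v" "Tgt C v = Src C w"
    "a \<in> Cell K" "b \<in> Cell K" "c \<in> Cell K" "Dom K a = s1 u" "Dom K b = s1 v" "Dom K c = s1 w"
    by (simp_all add: u_def v_def w_def a_def b_def c_def)
  have l: "((c \<star>\<^bsub>K\<^esub> b) \<cdot>\<^bsub>K\<^esub> mu w v) \<star>\<^bsub>K\<^esub> a = ((c \<star>\<^bsub>K\<^esub> b) \<star>\<^bsub>K\<^esub> a) \<cdot>\<^bsub>K\<^esub> (mu w v \<star>\<^bsub>K\<^esub> \<iota>\<^bsub>K\<^esub> (s1 u))"
    using K.interchange[of "\<iota>\<^bsub>K\<^esub> (s1 u)" a "mu w v" "c \<star>\<^bsub>K\<^esub> b"] K.VComp_IdC_right[of a] by simp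
  have r: "c \<star>\<^bsub>K\<^esub> ((b \<star>\<^bsub>K\<^esub> a) \<cdot>\<^bsub>K\<^esub> mu v u) = (c \<star>\<^bsub>K\<^esub> (b \<star>\<^bsub>K\<^esub> a)) \<cdot>\<^bsub>K\<^esub> (\<iota>\<^bsub>K\<^esub> (s1 w) \<star>\<^bsub>K\<^esub> mu v u)"
    using K.interchange[of "mu v u" "b \<star>\<^bsub>K\<^esub> a" "\<iota>\<^bsub>K\<^esub> (s1 w)" c] K.VComp_IdC_right[of c] by simp
  have "(((c \<star>\<^bsub>K\<^esub> b) \<cdot>\<^bsub>K\<^esub> mu w v) \<star>\<^bsub>K\<^esub> a) \<cdot>\<^bsub>K\<^esub> mu (w \<odot>\<^bsub>C\<^esub> v) u
      = (c \<star>\<^bsub>K\<^esub> (b \<star>\<^bsub>K\<^esub> a)) \<cdot>\<^bsub>K\<^esub> ((mu w v \<star>\<^bsub>K\<^esub> \<iota>\<^bsub>K\<^esub> (s1 u)) \<cdot>\<^bsub>K\<^esub> mu (w \<odot>\<^bsub>C\<^esub> v) u)"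
    unfolding l by (simp add: K.HComp_assoc K.VComp_assoc K.Comp_assoc)
  also have "\<dots> = (c \<star>\<^bsub>K\<^esub> ((b \<star>\<^bsub>K\<^esub> a) \<cdot>\<^bsub>K\<^esub> mu v u)) \<cdot>\<^bsub>K\<^esub> mu w (v \<odot>\<^bsub>C\<^esub> u)"
    unfolding r by (simp add: mu_assoc K.VComp_assoc C.Comp_assoc)
  finally show ?thesis
    by (simp add: pcomp_def C.Comp_assoc u_def v_def w_def a_def b_def c_def)
qed

lemma pcellI:
  assumes "f \<in> pmor" "g \<in> pmor" "\<alpha> \<in> Cell C" "a \<in> Cell K" "Dom C \<alpha> = fst f" "Cod C \<alpha> = fst g"
    "Dom K a = Cod K (snd f)" "Cod K a = Cod K (snd g)" "snd g \<cdot>\<^bsub>K\<^esub> s2 \<alpha> = a \<cdot>\<^bsub>K\<^esub> snd f"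
  shows "(f, g, \<alpha>, a) \<in> pcell"
  using assms by (simp add: pcell_def)

lemma pcellD:
  assumes "(f, g, \<alpha>, a) \<in> pcell"
  shows "f \<in> pmor" "g \<in> pmor" "\<alpha> \<in> Cell C" "a \<in> Cell K" "Dom C \<alpha> = fst f" "Cod C \<alpha> = fst g"
    "Dom K a = Cod K (snd f)" "Cod K a = Cod K (snd g)" "snd g \<cdot>\<^bsub>K\<^esub> s2 \<alpha> = a \<cdot>\<^bsub>K\<^esub> snd f"
    "Src C (fst g) = Src C (fst f)" "Tgt C (fst g) = Tgt C (fst f)"
  using assms C.Src_Cod[of \<alpha>] C.Tgt_Cod[of \<alpha>] by (auto simp: pcell_def)

lemma pcell_typing:
  assumes "(f, g, \<alpha>, a) \<in> pcell"
  shows "f \<in> pmor \<and> g \<in> pmor \<and> \<alpha> \<in> Cell C \<and> a \<in> Cell K \<and> Dom C \<alpha> = fst f \<and> Cod C \<alpha> = fst g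
    \<and> Dom K a = Cod K (snd f) \<and> Cod K a = Cod K (snd g) \<and> Src C (fst g) = Src C (fst f)
    \<and> Tgt C (fst g) = Tgt C (fst f)
    \<and> Src K (Cod K (snd f)) = s0 (Src C (fst f)) \<and> Tgt K (Cod K (snd f)) = s0 (Tgt C (fst f))"
  using pcellD[OF assms] pmorD[of f] by simp

lemma pcell_VComp:
  assumes "(f, g, \<alpha>, a) \<in> pcell" "(g, k, \<beta>, b) \<in> pcell"
  shows "(f, k, \<beta> \<cdot>\<^bsub>C\<^esub> \<alpha>, b \<cdot>\<^bsub>K\<^esub> a) \<in> pcell"
proof (rule pcellI)
  note d = pcellD[OF assms(1)] pcellD[OF assms(2)]
  note [simp] = typing d(1-8,10-19,21,22) pmorD[OF d(1)] pmorD[OF d(2)] pmorD[OF d(13)]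
  have "snd k \<cdot>\<^bsub>K\<^esub> s2 (\<beta> \<cdot>\<^bsub>C\<^esub> \<alpha>) = (snd k \<cdot>\<^bsub>K\<^esub> s2 \<beta>) \<cdot>\<^bsub>K\<^esub> s2 \<alpha>"
    by (simp add: s2_VComp K.VComp_assoc)
  also have "\<dots> = b \<cdot>\<^bsub>K\<^esub> (snd g \<cdot>\<^bsub>K\<^esub> s2 \<alpha>)" unfolding d(20) by (subst K.VComp_assoc) simp_all
  also have "\<dots> = (b \<cdot>\<^bsub>K\<^esub> a) \<cdot>\<^bsub>K\<^esub> snd f" unfolding d(9) by (subst K.VComp_assoc) simp_all
  finally show "snd k \<cdot>\<^bsub>K\<^esub> s2 (\<beta> \<cdot>\<^bsub>C\<^esub> \<alpha>) = (b \<cdot>\<^bsub>K\<^esub> a) \<cdot>\<^bsub>K\<^esub> snd f" .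
qed (use pcellD[OF assms(1)] pcellD[OF assms(2)] in \<open>simp_all add: typing\<close>)

text \<open>Closure under horizontal composition is the naturality of \<open>mu\<close> with respect to 2-cells.\<close>

lemma pcell_HComp:
  assumes "(f, g, \<alpha>, a) \<in> pcell" "(f', g', \<beta>, b) \<in> pcell" "Tgt C (fst f) = Src C (fst f')"
  shows "(pcomp f' f, pcomp g' g, \<beta> \<star>\<^bsub>C\<^esub> \<alpha>, b \<star>\<^bsub>K\<^esub> a) \<in> pcell"
proof (rule pcellI)
  note d = pcellD[OF assms(1)] pcellD[OF assms(2)] assms(3)
  note p = pmorD[OF d(1)] pmorD[OF d(2)] pmorD[OF d(12)] pmorD[OF d(13)]
  define u v u' v' where "u = fst f" and "v = fst g" and "u' = fst f'" and "v' = fst g'"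
  define x y x' y' where "x = snd f" and "y = snd g" and "x' = snd f'" and "y' = snd g'"
  note defs = u_def v_def u'_def v'_def x_def y_def x'_def y'_def
  have e: "Src C v = Src C u" "Tgt C v = Tgt C u" "Src C v' = Src C u'" "Tgt C v' = Tgt C u'"
    "Tgt C u = Src C u'"
    using d by (simp_all add: defs)
  have ty: "u \<in> Mor C" "v \<in> Mor C" "u' \<in> Mor C" "v' \<in> Mor C"
    "x \<in> Cell K" "y \<in> Cell K" "x' \<in> Cell K" "y' \<in> Cell K"
    "Dom K x = s1 u" "Dom K y = s1 v" "Dom K x' = s1 u'" "Dom K y' = s1 v'"
    "\<alpha> \<in> Cell C" "a \<in> Cell K" "Dom C \<alpha> = u" "Cod C \<alpha> = v" "Dom K a = Cod K x" "Cod K a = Cod K y"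
    "\<beta> \<in> Cell C" "b \<in> Cell K" "Dom C \<beta> = u'" "Cod C \<beta> = v'" "Dom K b = Cod K x'" "Cod K b = Cod K y'"
    using d p by (simp_all add: defs)
  have tt: "Src K (Cod K x) = s0 (Src C u)" "Src K (Cod K y) = s0 (Src C u)"
     "Src K (Cod K x') = s0 (Src C u')" "Src K (Cod K y') = s0 (Src C u')"
     "Tgt K (Cod K x) = s0 (Src C u')" "Tgt K (Cod K y) = s0 (Src C u')"
    using p e by (simp_all add: defs)
  note [simp] = typing e ty tt
  show "pcomp f' f \<in> pmor" "pcomp g' g \<in> pmor" using pcomp_in d by simp_all
  show "\<beta> \<star>\<^bsub>C\<^esub> \<alpha> \<in> Cell C" "b \<star>\<^bsub>K\<^esub> a \<in> Cell K" by simp_all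
  show "Dom C (\<beta> \<star>\<^bsub>C\<^esub> \<alpha>) = fst (pcomp f' f)" "Cod C (\<beta> \<star>\<^bsub>C\<^esub> \<alpha>) = fst (pcomp g' g)"
    "Dom K (b \<star>\<^bsub>K\<^esub> a) = Cod K (snd (pcomp f' f))" "Cod K (b \<star>\<^bsub>K\<^esub> a) = Cod K (snd (pcomp g' g))"
    using pcomp_in d by (simp_all add: defs[symmetric])
  have q: "y \<cdot>\<^bsub>K\<^esub> s2 \<alpha> = a \<cdot>\<^bsub>K\<^esub> x" "y' \<cdot>\<^bsub>K\<^esub> s2 \<beta> = b \<cdot>\<^bsub>K\<^esub> x'" using d by (simp_all add: defs)
  have "((y' \<star>\<^bsub>K\<^esub> y) \<cdot>\<^bsub>K\<^esub> mu v' v) \<cdot>\<^bsub>K\<^esub> s2 (\<beta> \<star>\<^bsub>C\<^esub> \<alpha>)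
      = (y' \<star>\<^bsub>K\<^esub> y) \<cdot>\<^bsub>K\<^esub> ((s2 \<beta> \<star>\<^bsub>K\<^esub> s2 \<alpha>) \<cdot>\<^bsub>K\<^esub> mu u' u)"
    using mu_natural[of \<alpha> \<beta>] by (simp add: K.VComp_assoc)
  also have "\<dots> = ((y' \<cdot>\<^bsub>K\<^esub> s2 \<beta>) \<star>\<^bsub>K\<^esub> (y \<cdot>\<^bsub>K\<^esub> s2 \<alpha>)) \<cdot>\<^bsub>K\<^esub> mu u' u"
    by (simp add: K.interchange K.VComp_assoc)
  also have "\<dots> = ((b \<star>\<^bsub>K\<^esub> a) \<cdot>\<^bsub>K\<^esub> (x' \<star>\<^bsub>K\<^esub> x)) \<cdot>\<^bsub>K\<^esub> mu u' u"
    unfolding q by (simp add: K.interchange)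
  also have "\<dots> = (b \<star>\<^bsub>K\<^esub> a) \<cdot>\<^bsub>K\<^esub> ((x' \<star>\<^bsub>K\<^esub> x) \<cdot>\<^bsub>K\<^esub> mu u' u)"
    by (simp add: K.VComp_assoc)
  finally show "snd (pcomp g' g) \<cdot>\<^bsub>K\<^esub> s2 (\<beta> \<star>\<^bsub>C\<^esub> \<alpha>) = (b \<star>\<^bsub>K\<^esub> a) \<cdot>\<^bsub>K\<^esub> snd (pcomp f' f)"
    by (simp add: pcomp_def defs)
qed

lemma two_category_path_cat: "two_category path_cat"
proof (rule two_category.intro)
  let ?A = path_cat
  note [simp] = typing
  fix x f g h a b c a' b'
  show "f \<in> Mor ?A \<Longrightarrow> Src ?A f \<in> Ob ?A" "f \<in> Mor ?A \<Longrightarrow> Tgt ?A f \<in> Ob ?A"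
    by (auto simp: pmorD)
  show "x \<in> Ob ?A \<Longrightarrow> IdM ?A x \<in> Mor ?A"
    by (auto simp: pmor_def s1_IdM intro: K.iso_cell_IdC)
  show "x \<in> Ob ?A \<Longrightarrow> Src ?A (IdM ?A x) = x" "x \<in> Ob ?A \<Longrightarrow> Tgt ?A (IdM ?A x) = x" by auto
  show "\<lbrakk>f \<in> Mor ?A; g \<in> Mor ?A; Tgt ?A f = Src ?A g\<rbrakk> \<Longrightarrow> Comp ?A g f \<in> Mor ?A"
    "\<lbrakk>f \<in> Mor ?A; g \<in> Mor ?A; Tgt ?A f = Src ?A g\<rbrakk> \<Longrightarrow> Src ?A (Comp ?A g f) = Src ?A f"
    "\<lbrakk>f \<in> Mor ?A; g \<in> Mor ?A; Tgt ?A f = Src ?A g\<rbrakk> \<Longrightarrow> Tgt ?A (Comp ?A g f) = Tgt ?A g"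
    by (auto simp: pcomp_in pmorD)
  show "Comp ?A (IdM ?A (Tgt ?A f)) f = f" "Comp ?A f (IdM ?A (Src ?A f)) = f" if "f \<in> Mor ?A"
  proof -
    note d = pmorD[OF that[simplified]]
    show "Comp ?A (IdM ?A (Tgt ?A f)) f = f" "Comp ?A f (IdM ?A (Src ?A f)) = f"
      using K.HComp_Id_left[of "snd f"] K.HComp_Id_right[of "snd f"] K.VComp_IdC_right[of "snd f"] d
      by (simp_all add: pcomp_def mu_unit_left mu_unit_right C.Comp_IdM_left C.Comp_IdM_right prod_eq_iff)
  qed
  show "\<lbrakk>f \<in> Mor ?A; g \<in> Mor ?A; h \<in> Mor ?A; Tgt ?A f = Src ?A g; Tgt ?A g = Src ?A h\<rbrakk>
      \<Longrightarrow> Comp ?A (Comp ?A h g) f = Comp ?A h (Comp ?A g f)"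
    by (simp add: pcomp_assoc)
  show "a \<in> Cell ?A \<Longrightarrow> Dom ?A a \<in> Mor ?A" "a \<in> Cell ?A \<Longrightarrow> Cod ?A a \<in> Mor ?A"
    "a \<in> Cell ?A \<Longrightarrow> Src ?A (Cod ?A a) = Src ?A (Dom ?A a)"
    "a \<in> Cell ?A \<Longrightarrow> Tgt ?A (Cod ?A a) = Tgt ?A (Dom ?A a)"
    by (cases a; auto dest!: pcell_typing)+
  show "IdC ?A f \<in> Cell ?A" if "f \<in> Mor ?A"
    using that pmorD[of f] K.VComp_IdC_left[of "snd f"] K.VComp_IdC_right[of "snd f"]
    by (auto intro!: pcellI simp: s2_IdC)
  show "f \<in> Mor ?A \<Longrightarrow> Dom ?A (IdC ?A f) = f"
    "f \<in> Mor ?A \<Longrightarrow> Cod ?A (IdC ?A f) = f" by auto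
  show "\<lbrakk>a \<in> Cell ?A; b \<in> Cell ?A; Cod ?A a = Dom ?A b\<rbrakk> \<Longrightarrow> VComp ?A b a \<in> Cell ?A"
    "\<lbrakk>a \<in> Cell ?A; b \<in> Cell ?A; Cod ?A a = Dom ?A b\<rbrakk> \<Longrightarrow> Dom ?A (VComp ?A b a) = Dom ?A a"
    "\<lbrakk>a \<in> Cell ?A; b \<in> Cell ?A; Cod ?A a = Dom ?A b\<rbrakk> \<Longrightarrow> Cod ?A (VComp ?A b a) = Cod ?A b"
    by (cases a; cases b; auto intro: pcell_VComp)+
  show "\<lbrakk>a \<in> Cell ?A; b \<in> Cell ?A; c \<in> Cell ?A; Cod ?A a = Dom ?A b; Cod ?A b = Dom ?A c\<rbrakk>
      \<Longrightarrow> VComp ?A (VComp ?A c b) a = VComp ?A c (VComp ?A b a)"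
    by (cases a; cases b; cases c; auto dest!: pcell_typing simp: C.VComp_assoc K.VComp_assoc)
  show "\<lbrakk>a \<in> Cell ?A; b \<in> Cell ?A; Tgt ?A (Dom ?A a) = Src ?A (Dom ?A b)\<rbrakk> \<Longrightarrow> HComp ?A b a \<in> Cell ?A"
    "\<lbrakk>a \<in> Cell ?A; b \<in> Cell ?A; Tgt ?A (Dom ?A a) = Src ?A (Dom ?A b)\<rbrakk>
      \<Longrightarrow> Dom ?A (HComp ?A b a) = Comp ?A (Dom ?A b) (Dom ?A a)"
    "\<lbrakk>a \<in> Cell ?A; b \<in> Cell ?A; Tgt ?A (Dom ?A a) = Src ?A (Dom ?A b)\<rbrakk>
      \<Longrightarrow> Cod ?A (HComp ?A b a) = Comp ?A (Cod ?A b) (Cod ?A a)"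
    by (cases a; cases b; auto intro: pcell_HComp)+
  {
    assume "a \<in> Cell ?A"
    then obtain f g \<alpha> x where a: "a = (f, g, \<alpha>, x)" "(f, g, \<alpha>, x) \<in> pcell" by (cases a) auto
    note d = pcellD[OF a(2)]
    have l: "pcomp (IdM C (Tgt C (fst f)), \<iota>\<^bsub>K\<^esub> (IdM K (s0 (Tgt C (fst f))))) f = f"
      "pcomp f (IdM C (Src C (fst f)), \<iota>\<^bsub>K\<^esub> (IdM K (s0 (Src C (fst f))))) = f" if "f \<in> pmor" for f
    proof -
      note d = pmorD[OF that]
      show "pcomp (IdM C (Tgt C (fst f)), \<iota>\<^bsub>K\<^esub> (IdM K (s0 (Tgt C (fst f))))) f = f"
        "pcomp f (IdM C (Src C (fst f)), \<iota>\<^bsub>K\<^esub> (IdM K (s0 (Src C (fst f))))) = f"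
        using K.HComp_Id_left[of "snd f"] K.HComp_Id_right[of "snd f"] K.VComp_IdC_right[of "snd f"] d
        by (simp_all add: pcomp_def mu_unit_left mu_unit_right C.Comp_IdM_left C.Comp_IdM_right prod_eq_iff)
    qed
    show "VComp ?A (IdC ?A (Cod ?A a)) a = a" "VComp ?A a (IdC ?A (Dom ?A a)) = a"
      using a(1) d C.VComp_IdC_left[of \<alpha>] C.VComp_IdC_right[of \<alpha>] K.VComp_IdC_left[of x] K.VComp_IdC_right[of x]
      by simp_all
    show "HComp ?A (IdC ?A (IdM ?A (Tgt ?A (Dom ?A a)))) a = a"
      "HComp ?A a (IdC ?A (IdM ?A (Src ?A (Dom ?A a)))) = a"
      using a(1) d pmorD[OF d(1)] l[OF d(1)] l[OF d(2)] C.HComp_Id_left[of \<alpha>] C.HComp_Id_right[of \<alpha>]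
        K.HComp_Id_left[of x] K.HComp_Id_right[of x] by simp_all
  }
  show "\<lbrakk>a \<in> Cell ?A; b \<in> Cell ?A; c \<in> Cell ?A;
        Tgt ?A (Dom ?A a) = Src ?A (Dom ?A b); Tgt ?A (Dom ?A b) = Src ?A (Dom ?A c)\<rbrakk>
      \<Longrightarrow> HComp ?A (HComp ?A c b) a = HComp ?A c (HComp ?A b a)"
    by (cases a; cases b; cases c) (auto dest!: pcell_typing simp: pcomp_assoc C.HComp_assoc K.HComp_assoc pmorD)
  show "\<lbrakk>f \<in> Mor ?A; g \<in> Mor ?A; Tgt ?A f = Src ?A g\<rbrakk>
      \<Longrightarrow> HComp ?A (IdC ?A g) (IdC ?A f) = IdC ?A (Comp ?A g f)"
    by (simp add: C.HComp_IdC K.HComp_IdC pmorD pcomp_in)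
  show "\<lbrakk>a \<in> Cell ?A; a' \<in> Cell ?A; b \<in> Cell ?A; b' \<in> Cell ?A;
        Cod ?A a = Dom ?A a'; Cod ?A b = Dom ?A b'; Tgt ?A (Dom ?A a) = Src ?A (Dom ?A b)\<rbrakk>
      \<Longrightarrow> HComp ?A (VComp ?A b' b) (VComp ?A a' a) = VComp ?A (HComp ?A b' a') (HComp ?A b a)"
    by (cases a; cases a'; cases b; cases b') (auto dest!: pcell_typing simp: C.interchange K.interchange pmorD)
qed

definition pC :: "('o, 'm \<times> 'd, ('m \<times> 'd) \<times> ('m \<times> 'd) \<times> 'c \<times> 'd, 'o, 'm, 'c) two_fun" where
  "pC = \<lparr>Fn0 = (\<lambda>x. x), Fn1 = fst, Fn2 = (\<lambda>(f, g, \<alpha>, a). \<alpha>)\<rparr>"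

definition pK :: "('o, 'm \<times> 'd, ('m \<times> 'd) \<times> ('m \<times> 'd) \<times> 'c \<times> 'd, 'p, 'n, 'd) two_fun" where
  "pK = \<lparr>Fn0 = s0, Fn1 = Cod K \<circ> snd, Fn2 = (\<lambda>(f, g, \<alpha>, a). a)\<rparr>"

lemma two_functor_pC: "two_functor path_cat C pC"
  by unfold_locales (auto simp: pC_def pmorD dest!: pcell_typing)

lemma two_functor_pK: "two_functor path_cat K pK"
  by unfold_locales (auto simp: pK_def pmorD typing pcomp_in s1_IdM dest!: pcell_typing)

end

section \<open>Adjoint equivalences and inverted 2-cells\<close>

definition adjoint_equivalence ::
  "('o, 'm, 'c) two_cat \<Rightarrow> 'o \<Rightarrow> 'o \<Rightarrow> 'm \<Rightarrow> 'm \<Rightarrow> 'c \<Rightarrow> 'c \<Rightarrow> 'c \<Rightarrow> 'c \<Rightarrow> bool" where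
  "adjoint_equivalence D x y f g \<eta> \<eta>' \<epsilon> \<epsilon>' \<longleftrightarrow> x \<in> Ob D \<and> y \<in> Ob D
     \<and> f \<in> Mor D \<and> Src D f = x \<and> Tgt D f = y \<and> g \<in> Mor D \<and> Src D g = y \<and> Tgt D g = x
     \<and> Dom D \<eta> = IdM D x \<and> Cod D \<eta> = g \<odot>\<^bsub>D\<^esub> f \<and> inverse_cells D \<eta> \<eta>'
     \<and> Dom D \<epsilon> = f \<odot>\<^bsub>D\<^esub> g \<and> Cod D \<epsilon> = IdM D y \<and> inverse_cells D \<epsilon> \<epsilon>'
     \<and> (\<epsilon> \<star>\<^bsub>D\<^esub> \<iota>\<^bsub>D\<^esub> f) \<cdot>\<^bsub>D\<^esub> (\<iota>\<^bsub>D\<^esub> f \<star>\<^bsub>D\<^esub> \<eta>) = \<iota>\<^bsub>D\<^esub> f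
     \<and> (\<iota>\<^bsub>D\<^esub> g \<star>\<^bsub>D\<^esub> \<epsilon>) \<cdot>\<^bsub>D\<^esub> (\<eta> \<star>\<^bsub>D\<^esub> \<iota>\<^bsub>D\<^esub> g) = \<iota>\<^bsub>D\<^esub> g"

lemma adj_pres_simps [simp]:
  "Gens0 adj_pres = UNIV" "Gens1 adj_pres = UNIV" "Gens2 adj_pres = UNIV"
  "gsrc adj_pres Adj_f = Adj_x" "gsrc adj_pres Adj_g = Adj_y"
  "gtgt adj_pres Adj_f = Adj_y" "gtgt adj_pres Adj_g = Adj_x"
  "gdom adj_pres Adj_eta = Id1 Adj_x" "gcod adj_pres Adj_eta = Comp1 (Gen1 Adj_g) (Gen1 Adj_f)"
  "gcod adj_pres Adj_eta_inv = Id1 Adj_x" "gdom adj_pres Adj_eta_inv = Comp1 (Gen1 Adj_g) (Gen1 Adj_f)"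
  "gcod adj_pres Adj_eps = Id1 Adj_y" "gdom adj_pres Adj_eps = Comp1 (Gen1 Adj_f) (Gen1 Adj_g)"
  "gdom adj_pres Adj_eps_inv = Id1 Adj_y" "gcod adj_pres Adj_eps_inv = Comp1 (Gen1 Adj_f) (Gen1 Adj_g)"
  "\<not> Rel0 adj_pres x y" "\<not> Rel1 adj_pres s t" "Rel2 adj_pres = adj_rel"
  by (simp_all add: adj_pres_def)

lemma eq0_adj_refl: "eq0 adj_pres x x"
  by (simp add: eq0_refl)

interpretation adj_pres: wf_presentation adj_pres
proof
  fix a :: adj2
  show "wf1 adj_pres (gdom adj_pres a)" "wf1 adj_pres (gcod adj_pres a)"
    "eq0 adj_pres (src1 adj_pres (gdom adj_pres a)) (src1 adj_pres (gcod adj_pres a))"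
    "eq0 adj_pres (tgt1 adj_pres (gdom adj_pres a)) (tgt1 adj_pres (gcod adj_pres a))"
    by (cases a; simp add: eq0_adj_refl)+
qed simp_all

lemma presented_functor_adj:
  assumes D: "two_category D" and a: "adjoint_equivalence D x y f g \<eta> \<eta>' \<epsilon> \<epsilon>'"
  shows "presented_functor adj_pres D (case_adj0 x y) (case_adj1 f g) (case_adj2 \<eta> \<eta>' \<epsilon> \<epsilon>')"
proof -
  interpret D: two_category D by fact
  note d = a[unfolded adjoint_equivalence_def inverse_cells_def]
  show ?thesis
  proof
    fix u :: adj0 and v :: adj1 and w :: adj2
    show "case_adj0 x y u \<in> Ob D" using d by (cases u) auto
    show "case_adj1 f g v \<in> Mor D" "Src D (case_adj1 f g v) = case_adj0 x y (gsrc adj_pres v)"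
      "Tgt D (case_adj1 f g v) = case_adj0 x y (gtgt adj_pres v)" using d by (cases v; auto)+
    show "case_adj2 \<eta> \<eta>' \<epsilon> \<epsilon>' w \<in> Cell D"
      "Dom D (case_adj2 \<eta> \<eta>' \<epsilon> \<epsilon>' w) = eval1 D (case_adj0 x y) (case_adj1 f g) (gdom adj_pres w)"
      "Cod D (case_adj2 \<eta> \<eta>' \<epsilon> \<epsilon>' w) = eval1 D (case_adj0 x y) (case_adj1 f g) (gcod adj_pres w)"
      using d by (cases w; auto)+
    fix p q assume "Rel2 adj_pres p q"
    then show "eval2 D (case_adj0 x y) (case_adj1 f g) (case_adj2 \<eta> \<eta>' \<epsilon> \<epsilon>') p
        = eval2 D (case_adj0 x y) (case_adj1 f g) (case_adj2 \<eta> \<eta>' \<epsilon> \<epsilon>') q"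
      unfolding adj_pres_simps by cases (use d in auto)
  qed simp_all
qed

text \<open>2-functors preserve the relations of the free adjoint equivalence, which hold between its
  generators.\<close>

lemma adjoint_equivalence_of_functor:
  assumes F: "two_functor (presented adj_pres) D F" and D: "two_category D"
  shows "adjoint_equivalence D (Fn0 F (cls0 adj_pres Adj_x)) (Fn0 F (cls0 adj_pres Adj_y))
    (Fn1 F (cls1 adj_pres (Gen1 Adj_f))) (Fn1 F (cls1 adj_pres (Gen1 Adj_g)))
    (Fn2 F (cls2 adj_pres (Gen2 Adj_eta))) (Fn2 F (cls2 adj_pres (Gen2 Adj_eta_inv)))
    (Fn2 F (cls2 adj_pres (Gen2 Adj_eps))) (Fn2 F (cls2 adj_pres (Gen2 Adj_eps_inv)))"
proof -
  let ?A = "presented adj_pres"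
  interpret F: two_functor ?A D F by fact
  note [simp] = eq0_adj_refl
  let ?k0 = "\<lambda>x. Fn0 F (cls0 adj_pres x)" and ?k1 = "\<lambda>f. Fn1 F (cls1 adj_pres (Gen1 f))"
    and ?k2 = "\<lambda>a. Fn2 F (cls2 adj_pres (Gen2 a))"
  note ev = adj_pres.two_functor_eval[OF F]
  have rel: "eval2 D ?k0 ?k1 ?k2 p = eval2 D ?k0 ?k1 ?k2 q"
    if "adj_rel p q" "wf2 adj_pres p" "wf2 adj_pres q" "eq1 adj_pres (dom2 adj_pres p) (dom2 adj_pres q)"
      "eq1 adj_pres (cod2 adj_pres p) (cod2 adj_pres q)" for p q
  proof -
    have "cls2 adj_pres p = cls2 adj_pres q"
      using that by (intro adj_pres.cls2I eq2_rel) simp_all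
    then show ?thesis using ev(2)[OF that(2)] ev(2)[OF that(3)] by simp
  qed
  have as: "eq1 adj_pres (Comp1 (Gen1 Adj_f) (Comp1 (Gen1 Adj_g) (Gen1 Adj_f)))
      (Comp1 (Comp1 (Gen1 Adj_f) (Gen1 Adj_g)) (Gen1 Adj_f))"
    "eq1 adj_pres (Comp1 (Comp1 (Gen1 Adj_g) (Gen1 Adj_f)) (Gen1 Adj_g))
      (Comp1 (Gen1 Adj_g) (Comp1 (Gen1 Adj_f) (Gen1 Adj_g)))"
    by (rule eq1_sym, rule eq1_assoc, simp) (rule eq1_assoc, simp)
  have un: "eq1 adj_pres (Comp1 (Gen1 Adj_f) (Id1 Adj_x)) (Gen1 Adj_f)"
    "eq1 adj_pres (Comp1 (Id1 Adj_x) (Gen1 Adj_g)) (Gen1 Adj_g)"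
    "eq1 adj_pres (Comp1 (Id1 Adj_y) (Gen1 Adj_f)) (Gen1 Adj_f)"
    "eq1 adj_pres (Comp1 (Gen1 Adj_g) (Id1 Adj_y)) (Gen1 Adj_g)"
    using eq1_unit_right[of adj_pres "Gen1 Adj_f"] eq1_unit_left[of adj_pres "Gen1 Adj_g"]
      eq1_unit_left[of adj_pres "Gen1 Adj_f"] eq1_unit_right[of adj_pres "Gen1 Adj_g"] by simp_all
  have cell: "cls2 adj_pres (Gen2 a) \<in> Cell ?A" for a by simp
  have 0: "Fn0 F (cls0 adj_pres x) \<in> Ob D" for x using F.Fn0_in by simp
  have 1: "Fn1 F (cls1 adj_pres (Gen1 f)) \<in> Mor D"
    "Src D (Fn1 F (cls1 adj_pres (Gen1 f))) = Fn0 F (cls0 adj_pres (gsrc adj_pres f))"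
    "Tgt D (Fn1 F (cls1 adj_pres (Gen1 f))) = Fn0 F (cls0 adj_pres (gtgt adj_pres f))" for f
    using F.Fn1_in F.Fn_Src[of "cls1 adj_pres (Gen1 f)"] F.Fn_Tgt[of "cls1 adj_pres (Gen1 f)"]
    by (simp_all add: adj_pres.presented_simps)
  have 2: "Fn2 F (cls2 adj_pres (Gen2 a)) \<in> Cell D"
    "Dom D (Fn2 F (cls2 adj_pres (Gen2 a))) = Fn1 F (cls1 adj_pres (gdom adj_pres a))"
    "Cod D (Fn2 F (cls2 adj_pres (Gen2 a))) = Fn1 F (cls1 adj_pres (gcod adj_pres a))" for a
    using F.Fn2_in F.Fn_Dom[OF cell[of a]] F.Fn_Cod[OF cell[of a]]
    by (simp_all add: adj_pres.presented_simps)
  have d: "Dom D (Fn2 F (cls2 adj_pres (Gen2 a))) = eval1 D ?k0 ?k1 (gdom adj_pres a)"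
    "Cod D (Fn2 F (cls2 adj_pres (Gen2 a))) = eval1 D ?k0 ?k1 (gcod adj_pres a)" for a
    using ev(1)[OF adj_pres.gdom_wf] ev(1)[OF adj_pres.gcod_wf] by (simp_all add: 2)
  note r = adj_rel.intros[THEN rel]
  show ?thesis
    unfolding adjoint_equivalence_def inverse_cells_def
    using r as un by (simp add: 0 1 2(1) d eq1_refl)
qed

lemma Gens_invert_pres [simp]:
  "Gens0 (invert_pres A w) = Ob A" "Gens1 (invert_pres A w) = Mor A"
  "Gens2 (invert_pres A w) = insert None (Some ` Cell A)"
  "gsrc (invert_pres A w) = Src A" "gtgt (invert_pres A w) = Tgt A"
  "gdom (invert_pres A w) None = Gen1 (Cod A w)" "gdom (invert_pres A w) (Some a) = Gen1 (Dom A a)"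
  "gcod (invert_pres A w) None = Gen1 (Dom A w)" "gcod (invert_pres A w) (Some a) = Gen1 (Cod A a)"
  "\<not> Rel0 (invert_pres A w) x y" "Rel1 (invert_pres A w) = functorial1 A (\<lambda>x. x) (\<lambda>f. f)"
  "Rel2 (invert_pres A w) p q \<longleftrightarrow> functorial2 A (\<lambda>f. f) Some p q \<or> inverse_rel w (Dom A w) (Cod A w) p q"
  by (simp_all add: invert_pres_def)

text \<open>The 2-category obtained from \<open>A\<close> by inverting \<open>w\<close> has the universal property of a localization: a
  2-functor out of it is a 2-functor out of \<open>A\<close> together with an inverse of the image of \<open>w\<close>.\<close>

locale inverted_cell = A: two_category A for A :: "('o, 'm, 'c) two_cat" +
  fixes w :: 'c
  assumes w_in: "w \<in> Cell A"
begin

abbreviation "I \<equiv> invert_pres A w"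

sublocale wf_presentation I
  by unfold_locales (auto simp: A.typing w_in eq0_refl)

definition localization ::
  "('o, 'm, 'c, 'o set, ('o, 'm) tm1 set, ('o, 'm, 'c option) tm2 set) two_fun" where
  "localization = \<lparr>Fn0 = cls0 I, Fn1 = (\<lambda>f. cls1 I (Gen1 f)), Fn2 = (\<lambda>a. cls2 I (Gen2 (Some a)))\<rparr>"

lemma two_functor_localization: "two_functor A (presented I) localization"
proof
  note [simp] = localization_def presented_simps presented_comp A.typing eq0_refl eq1_refl
  have f1: "cls1 I s = cls1 I t" if "functorial1 A (\<lambda>x. x) (\<lambda>f. f) s t" for s t
    using that by (intro cls1I eq1_rel) (auto elim!: functorial1.cases)
  have e: "eq1 I s t" if "functorial1 A (\<lambda>x. x) (\<lambda>f. f) s t" for s t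
    using that by (intro eq1_rel) (auto elim!: functorial1.cases)
  have e2: "eq1 I (Gen1 (g \<odot>\<^bsub>A\<^esub> f)) (Comp1 (Gen1 g) (Gen1 f))"
    if "f \<in> Mor A" "g \<in> Mor A" "Tgt A f = Src A g" for f g
    using e[OF functorial1.intros(2)] that by simp
  have f2: "cls2 I s = cls2 I t" if "functorial2 A (\<lambda>f. f) Some s t" for s t
    using that by (intro cls2I eq2_rel) (auto elim!: functorial2.cases simp: e2)
  fix x f g a b
  show "x \<in> Ob A \<Longrightarrow> Fn0 localization x \<in> Ob (presented I)" "f \<in> Mor A \<Longrightarrow> Fn1 localization f \<in> Mor (presented I)"
    "a \<in> Cell A \<Longrightarrow> Fn2 localization a \<in> Cell (presented I)"
    "f \<in> Mor A \<Longrightarrow> Src (presented I) (Fn1 localization f) = Fn0 localization (Src A f)"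
    "f \<in> Mor A \<Longrightarrow> Tgt (presented I) (Fn1 localization f) = Fn0 localization (Tgt A f)"
    "a \<in> Cell A \<Longrightarrow> Dom (presented I) (Fn2 localization a) = Fn1 localization (Dom A a)"
    "a \<in> Cell A \<Longrightarrow> Cod (presented I) (Fn2 localization a) = Fn1 localization (Cod A a)"
    by auto
  show "x \<in> Ob A \<Longrightarrow> Fn1 localization (IdM A x) = IdM (presented I) (Fn0 localization x)"
    using f1[OF functorial1.intros(1)] by simp
  show "f \<in> Mor A \<Longrightarrow> Fn2 localization (IdC A f) = IdC (presented I) (Fn1 localization f)"
    using f2[OF functorial2.intros(1)] by simp
  show "\<lbrakk>f \<in> Mor A; g \<in> Mor A; Tgt A f = Src A g\<rbrakk>
      \<Longrightarrow> Fn1 localization (Comp A g f) = Comp (presented I) (Fn1 localization g) (Fn1 localization f)"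
    using f1[OF functorial1.intros(2)] by simp
  show "\<lbrakk>a \<in> Cell A; b \<in> Cell A; Cod A a = Dom A b\<rbrakk>
      \<Longrightarrow> Fn2 localization (VComp A b a) = VComp (presented I) (Fn2 localization b) (Fn2 localization a)"
    using f2[OF functorial2.intros(2)] by simp
  show "\<lbrakk>a \<in> Cell A; b \<in> Cell A; Tgt A (Dom A a) = Src A (Dom A b)\<rbrakk>
      \<Longrightarrow> Fn2 localization (HComp A b a) = HComp (presented I) (Fn2 localization b) (Fn2 localization a)"
    using f2[OF functorial2.intros(3)] by simp
qed

lemma inverse_in_localization:
  "inverse_cells (presented I) (Fn2 localization w) (cls2 I (Gen2 None))"
proof -
  note [simp] = localization_def presented_simps presented_comp A.typing eq0_refl eq1_refl w_in
  have "cls2 I s = cls2 I t" if "inverse_rel w (Dom A w) (Cod A w) s t" for s t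
    using that by (intro cls2I eq2_rel) (auto elim!: inverse_rel.cases)
  from inverse_rel.intros[THEN this] show ?thesis
    by (auto simp: inverse_cells_def)
qed

lemma presented_functor_invert:
  assumes D: "two_category D" and F: "two_functor A D F" and v: "inverse_cells D (Fn2 F w) v"
  shows "presented_functor I D (Fn0 F) (Fn1 F) (case_option v (Fn2 F))"
proof -
  interpret D: two_category D by fact
  interpret F: two_functor A D F by fact
  note [simp] = F.Fn0_in F.Fn1_in F.Fn2_in F.Fn_Src F.Fn_Tgt F.Fn_Dom F.Fn_Cod A.typing w_in
  note v' = D.inverse_cellsD[OF v]
  show ?thesis
  proof
    fix a assume "a \<in> Gens2 I"
    then show "case_option v (Fn2 F) a \<in> Cell D"
      "Dom D (case_option v (Fn2 F) a) = eval1 D (Fn0 F) (Fn1 F) (gdom I a)"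
      "Cod D (case_option v (Fn2 F) a) = eval1 D (Fn0 F) (Fn1 F) (gcod I a)"
      using v'(2-4) by auto
  next
    fix s t assume "Rel1 I s t"
    then show "eval1 D (Fn0 F) (Fn1 F) s = eval1 D (Fn0 F) (Fn1 F) t"
      by (auto elim!: functorial1.cases simp: F.Fn_IdM F.Fn_Comp)
  next
    fix s t assume "Rel2 I s t"
    then show "eval2 D (Fn0 F) (Fn1 F) (case_option v (Fn2 F)) s = eval2 D (Fn0 F) (Fn1 F) (case_option v (Fn2 F)) t"
      using v'(5,6) by (auto elim!: functorial2.cases inverse_rel.cases simp: F.Fn_IdC F.Fn_VComp F.Fn_HComp)
  qed auto
qed

end

interpretation inv_pres: inverted_cell "oriental 2" "({0, 2}, {0, 1, 2})"
  rewrites "invert_pres (oriental 2) ({0, 2}, {0, 1, 2}) = inv_pres"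
proof -
  interpret two_category "oriental 2" by (rule two_category_oriental)
  show "inverted_cell (oriental 2) ({0, 2}, {0, 1, 2})"
    by unfold_locales (auto simp: Cell_oriental ocell_def)
qed (simp add: inv_pres_def)

section \<open>Lifting to the path object\<close>

lemma (in two_category) inverse_cells_unique:
  assumes "inverse_cells C a b" "inverse_cells C a b'"
  shows "b = b'"
proof -
  note d = inverse_cellsD[OF assms(1)] and d' = inverse_cellsD[OF assms(2)]
  have "b = b \<cdot>\<^bsub>C\<^esub> (a \<cdot>\<^bsub>C\<^esub> b')"
    using VComp_IdC_right[OF d(2)] d(3) d'(6) by simp
  also have "\<dots> = (b \<cdot>\<^bsub>C\<^esub> a) \<cdot>\<^bsub>C\<^esub> b'"
    using VComp_assoc[OF d'(2) d(1,2) d'(4) d(3)[symmetric]] by simp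
  also have "\<dots> = b'"
    using VComp_IdC_left[OF d'(2)] d'(4) d(5) by simp
  finally show ?thesis .
qed

text \<open>The edges and triangles of a 2-functor out of an oriental satisfy the conditions under which edges
  and triangles may be prescribed.\<close>

locale oriental_diagram = D: two_category D + G: two_functor "oriental m" D G
  for D :: "('o, 'n, 'd) two_cat" and m G
begin

lemma edge:
  assumes "i \<le> j" "j \<le> m"
  shows "Fn1 G {i, j} \<in> Mor D" "Src D (Fn1 G {i, j}) = Fn0 G i" "Tgt D (Fn1 G {i, j}) = Fn0 G j"
proof -
  have 1: "{i, j} \<in> Mor (oriental m)" "Min {i, j} = i" "Max {i, j} = j"
    using assms by (auto simp: Mor_oriental)
  then show "Fn1 G {i, j} \<in> Mor D" "Src D (Fn1 G {i, j}) = Fn0 G i" "Tgt D (Fn1 G {i, j}) = Fn0 G j"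
    using G.Fn1_in[OF 1(1)] G.Fn_Src[OF 1(1)] G.Fn_Tgt[OF 1(1)] by (simp_all del: Min_insert Max_insert)
qed

lemma ocell_triangle: "i \<le> j \<Longrightarrow> j \<le> k \<Longrightarrow> k \<le> m \<Longrightarrow> ({i, k}, {i, j, k}) \<in> Cell (oriental m)"
  by (auto simp: Cell_oriental ocell_def)

lemma tri:
  assumes "i \<le> j" "j \<le> k" "k \<le> m"
  shows "Fn2 G ({i, k}, {i, j, k}) \<in> Cell D" "Dom D (Fn2 G ({i, k}, {i, j, k})) = Fn1 G {i, k}"
    "Cod D (Fn2 G ({i, k}, {i, j, k})) = Fn1 G {j, k} \<odot>\<^bsub>D\<^esub> Fn1 G {i, j}"
proof -
  note c = ocell_triangle[OF assms]
  have e: "{i, j} \<in> Mor (oriental m)" "{j, k} \<in> Mor (oriental m)" "Tgt (oriental m) {i, j} = Src (oriental m) {j, k}"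
    "Comp (oriental m) {j, k} {i, j} = {i, j, k}"
    using assms by (auto simp: Mor_oriental)
  show "Fn2 G ({i, k}, {i, j, k}) \<in> Cell D" "Dom D (Fn2 G ({i, k}, {i, j, k})) = Fn1 G {i, k}"
    "Cod D (Fn2 G ({i, k}, {i, j, k})) = Fn1 G {j, k} \<odot>\<^bsub>D\<^esub> Fn1 G {i, j}"
    using G.Fn2_in[OF c] G.Fn_Dom[OF c] G.Fn_Cod[OF c] G.Fn_Comp[OF e(1-3)] e(4) by simp_all
qed

lemma edge_refl: "i \<le> m \<Longrightarrow> Fn1 G {i, i} = IdM D (Fn0 G i)"
  using G.Fn_IdM[of i] by simp

lemma tri_refl:
  assumes "i \<le> k" "k \<le> m"
  shows "Fn2 G ({i, k}, {i, k}) = \<iota>\<^bsub>D\<^esub> (Fn1 G {i, k})"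
  using G.Fn_IdC[of "{i, k}"] assms by (simp add: Mor_oriental)

lemma tetrahedron:
  assumes "i \<le> j" "j \<le> k" "k \<le> l" "l \<le> m"
  shows "(Fn2 G ({j, l}, {j, k, l}) \<star>\<^bsub>D\<^esub> \<iota>\<^bsub>D\<^esub> (Fn1 G {i, j})) \<cdot>\<^bsub>D\<^esub> Fn2 G ({i, l}, {i, j, l})
    = (\<iota>\<^bsub>D\<^esub> (Fn1 G {k, l}) \<star>\<^bsub>D\<^esub> Fn2 G ({i, k}, {i, j, k})) \<cdot>\<^bsub>D\<^esub> Fn2 G ({i, l}, {i, k, l})"
proof -
  interpret A: two_category "oriental m" by (rule two_category_oriental)
  have c: "({j, l}, {j, k, l}) \<in> Cell (oriental m)" "({i, j}, {i, j}) \<in> Cell (oriental m)"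
    "({i, l}, {i, j, l}) \<in> Cell (oriental m)" "({k, l}, {k, l}) \<in> Cell (oriental m)"
    "({i, k}, {i, j, k}) \<in> Cell (oriental m)" "({i, l}, {i, k, l}) \<in> Cell (oriental m)"
    "({i, j, l}, {i, j, k, l}) \<in> Cell (oriental m)" "({i, k, l}, {i, j, k, l}) \<in> Cell (oriental m)"
    using assms by (auto simp: Cell_oriental ocell_def)
  have h: "Fn2 G ({i, j, l}, {i, j, k, l}) = Fn2 G ({j, l}, {j, k, l}) \<star>\<^bsub>D\<^esub> Fn2 G ({i, j}, {i, j})"
    "Fn2 G ({i, k, l}, {i, j, k, l}) = Fn2 G ({k, l}, {k, l}) \<star>\<^bsub>D\<^esub> Fn2 G ({i, k}, {i, j, k})"
    using G.Fn_HComp[OF c(2,1)] G.Fn_HComp[OF c(5,4)] assms by (simp_all add: insert_commute)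
  have "Fn2 G ({i, j, l}, {i, j, k, l}) \<cdot>\<^bsub>D\<^esub> Fn2 G ({i, l}, {i, j, l})
      = Fn2 G ({i, k, l}, {i, j, k, l}) \<cdot>\<^bsub>D\<^esub> Fn2 G ({i, l}, {i, k, l})"
    using G.Fn_VComp[OF c(3,7)] G.Fn_VComp[OF c(6,8)] by simp
  then show ?thesis unfolding h using assms by (simp add: tri_refl)
qed

end

text \<open>Two right adjoints \<open>g\<close> and \<open>h\<close> of \<open>f\<close> are compared by the mate \<open>\<kappa>\<close>, formed from the unit \<open>u\<close> of the
  second and the counit \<open>c\<close> of the first adjunction, and invertible because these two are.  The triangle
  identities make it compatible with both units and both counits.\<close>

lemma (in two_category) mate:
  fixes f g h c d u v
  defines "\<kappa> \<equiv> (\<iota>\<^bsub>C\<^esub> h \<star>\<^bsub>C\<^esub> c) \<cdot>\<^bsub>C\<^esub> (u \<star>\<^bsub>C\<^esub> \<iota>\<^bsub>C\<^esub> g)"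
  assumes f: "f \<in> Mor C" "Src C f = x" "Tgt C f = y" and g: "g \<in> Mor C" "Src C g = y" "Tgt C g = x"
    and h: "h \<in> Mor C" "Src C h = y" "Tgt C h = x"
    and d: "d \<in> Cell C" "Dom C d = IdM C x" "Cod C d = g \<odot>\<^bsub>C\<^esub> f"
    and c: "iso_cell C c" "Dom C c = f \<odot>\<^bsub>C\<^esub> g" "Cod C c = IdM C y"
    and u: "iso_cell C u" "Dom C u = IdM C x" "Cod C u = h \<odot>\<^bsub>C\<^esub> f"
    and v: "v \<in> Cell C" "Dom C v = f \<odot>\<^bsub>C\<^esub> h" "Cod C v = IdM C y"
    and tri: "(c \<star>\<^bsub>C\<^esub> \<iota>\<^bsub>C\<^esub> f) \<cdot>\<^bsub>C\<^esub> (\<iota>\<^bsub>C\<^esub> f \<star>\<^bsub>C\<^esub> d) = \<iota>\<^bsub>C\<^esub> f"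
      "(v \<star>\<^bsub>C\<^esub> \<iota>\<^bsub>C\<^esub> f) \<cdot>\<^bsub>C\<^esub> (\<iota>\<^bsub>C\<^esub> f \<star>\<^bsub>C\<^esub> u) = \<iota>\<^bsub>C\<^esub> f"
  shows "iso_cell C \<kappa>" "Dom C \<kappa> = g" "Cod C \<kappa> = h"
    "(\<kappa> \<star>\<^bsub>C\<^esub> \<iota>\<^bsub>C\<^esub> f) \<cdot>\<^bsub>C\<^esub> d = u" "v \<cdot>\<^bsub>C\<^esub> (\<iota>\<^bsub>C\<^esub> f \<star>\<^bsub>C\<^esub> \<kappa>) = c"
proof -
  have xy: "x \<in> Ob C" "y \<in> Ob C" using f Src_in Tgt_in by auto
  have in': "c \<in> Cell C" "u \<in> Cell C" using iso_cell_in[OF c(1)] iso_cell_in[OF u(1)] .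
  note [simp] = typing f g h d c(2,3) u(2,3) v xy in'
  have id: "IdM C y \<odot>\<^bsub>C\<^esub> f = f" "f \<odot>\<^bsub>C\<^esub> IdM C x = f" "IdM C x \<odot>\<^bsub>C\<^esub> g = g" "g \<odot>\<^bsub>C\<^esub> IdM C y = g"
    "h \<odot>\<^bsub>C\<^esub> IdM C y = h" "IdM C x \<odot>\<^bsub>C\<^esub> h = h"
    "IdM C x \<odot>\<^bsub>C\<^esub> (g \<odot>\<^bsub>C\<^esub> f) = g \<odot>\<^bsub>C\<^esub> f" "IdM C x \<odot>\<^bsub>C\<^esub> (h \<odot>\<^bsub>C\<^esub> f) = h \<odot>\<^bsub>C\<^esub> f"
    "IdM C y \<odot>\<^bsub>C\<^esub> (f \<odot>\<^bsub>C\<^esub> g) = f \<odot>\<^bsub>C\<^esub> g" "IdM C y \<odot>\<^bsub>C\<^esub> (f \<odot>\<^bsub>C\<^esub> h) = f \<odot>\<^bsub>C\<^esub> h"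
    using Comp_IdM_left[of f] Comp_IdM_right[of f] Comp_IdM_left[of g] Comp_IdM_right[of g]
      Comp_IdM_left[of h] Comp_IdM_right[of h] Comp_IdM_left[of "g \<odot>\<^bsub>C\<^esub> f"] Comp_IdM_left[of "h \<odot>\<^bsub>C\<^esub> f"]
      Comp_IdM_left[of "f \<odot>\<^bsub>C\<^esub> g"] Comp_IdM_left[of "f \<odot>\<^bsub>C\<^esub> h"] by simp_all
  show "Dom C \<kappa> = g" "Cod C \<kappa> = h" by (simp_all add: \<kappa>_def id Comp_assoc)
  show "iso_cell C \<kappa>" unfolding \<kappa>_def
    using c(1) u(1) by (intro iso_cell_VComp iso_cell_HComp iso_cell_IdC) (simp_all add: Comp_assoc)
  have 1: "\<kappa> \<star>\<^bsub>C\<^esub> \<iota>\<^bsub>C\<^esub> f = (\<iota>\<^bsub>C\<^esub> h \<star>\<^bsub>C\<^esub> (c \<star>\<^bsub>C\<^esub> \<iota>\<^bsub>C\<^esub> f)) \<cdot>\<^bsub>C\<^esub> (u \<star>\<^bsub>C\<^esub> \<iota>\<^bsub>C\<^esub> (g \<odot>\<^bsub>C\<^esub> f))"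
    unfolding \<kappa>_def by (simp add: whisker_right_VComp whisker_right_Comp HComp_assoc Comp_assoc HComp_IdC)
  have 2: "(u \<star>\<^bsub>C\<^esub> \<iota>\<^bsub>C\<^esub> (g \<odot>\<^bsub>C\<^esub> f)) \<cdot>\<^bsub>C\<^esub> d = (\<iota>\<^bsub>C\<^esub> (h \<odot>\<^bsub>C\<^esub> f) \<star>\<^bsub>C\<^esub> d) \<cdot>\<^bsub>C\<^esub> u"
    using HComp_as_whiskers[of d u] HComp_Id_left[of d] HComp_Id_right[of u] by simp
  have "(\<kappa> \<star>\<^bsub>C\<^esub> \<iota>\<^bsub>C\<^esub> f) \<cdot>\<^bsub>C\<^esub> d
      = (\<iota>\<^bsub>C\<^esub> h \<star>\<^bsub>C\<^esub> (c \<star>\<^bsub>C\<^esub> \<iota>\<^bsub>C\<^esub> f)) \<cdot>\<^bsub>C\<^esub> ((u \<star>\<^bsub>C\<^esub> \<iota>\<^bsub>C\<^esub> (g \<odot>\<^bsub>C\<^esub> f)) \<cdot>\<^bsub>C\<^esub> d)"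
    unfolding 1 by (rule VComp_assoc) (simp_all add: Comp_assoc id)
  also have "\<dots> = ((\<iota>\<^bsub>C\<^esub> h \<star>\<^bsub>C\<^esub> (c \<star>\<^bsub>C\<^esub> \<iota>\<^bsub>C\<^esub> f)) \<cdot>\<^bsub>C\<^esub> (\<iota>\<^bsub>C\<^esub> h \<star>\<^bsub>C\<^esub> (\<iota>\<^bsub>C\<^esub> f \<star>\<^bsub>C\<^esub> d))) \<cdot>\<^bsub>C\<^esub> u"
    unfolding 2 by (simp add: VComp_assoc whisker_left_Comp Comp_assoc id)
  also have "(\<iota>\<^bsub>C\<^esub> h \<star>\<^bsub>C\<^esub> (c \<star>\<^bsub>C\<^esub> \<iota>\<^bsub>C\<^esub> f)) \<cdot>\<^bsub>C\<^esub> (\<iota>\<^bsub>C\<^esub> h \<star>\<^bsub>C\<^esub> (\<iota>\<^bsub>C\<^esub> f \<star>\<^bsub>C\<^esub> d)) = \<iota>\<^bsub>C\<^esub> (h \<odot>\<^bsub>C\<^esub> f)"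
    using whisker_left_VComp[of "\<iota>\<^bsub>C\<^esub> f \<star>\<^bsub>C\<^esub> d" "c \<star>\<^bsub>C\<^esub> \<iota>\<^bsub>C\<^esub> f" h] tri(1)
    by (simp add: HComp_IdC Comp_assoc id)
  also have "\<iota>\<^bsub>C\<^esub> (h \<odot>\<^bsub>C\<^esub> f) \<cdot>\<^bsub>C\<^esub> u = u" using VComp_IdC_left[of u] by simp
  finally show "(\<kappa> \<star>\<^bsub>C\<^esub> \<iota>\<^bsub>C\<^esub> f) \<cdot>\<^bsub>C\<^esub> d = u" .
  have 3: "\<iota>\<^bsub>C\<^esub> f \<star>\<^bsub>C\<^esub> \<kappa> = (\<iota>\<^bsub>C\<^esub> (f \<odot>\<^bsub>C\<^esub> h) \<star>\<^bsub>C\<^esub> c) \<cdot>\<^bsub>C\<^esub> ((\<iota>\<^bsub>C\<^esub> f \<star>\<^bsub>C\<^esub> u) \<star>\<^bsub>C\<^esub> \<iota>\<^bsub>C\<^esub> g)"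
    unfolding \<kappa>_def by (simp add: whisker_left_VComp whisker_left_Comp HComp_assoc Comp_assoc)
  have 4: "v \<cdot>\<^bsub>C\<^esub> (\<iota>\<^bsub>C\<^esub> (f \<odot>\<^bsub>C\<^esub> h) \<star>\<^bsub>C\<^esub> c) = c \<cdot>\<^bsub>C\<^esub> (v \<star>\<^bsub>C\<^esub> \<iota>\<^bsub>C\<^esub> (f \<odot>\<^bsub>C\<^esub> g))"
    using HComp_as_whiskers[of c v] HComp_Id_left[of c] HComp_Id_right[of v] by simp
  have "v \<cdot>\<^bsub>C\<^esub> (\<iota>\<^bsub>C\<^esub> f \<star>\<^bsub>C\<^esub> \<kappa>)
      = (v \<cdot>\<^bsub>C\<^esub> (\<iota>\<^bsub>C\<^esub> (f \<odot>\<^bsub>C\<^esub> h) \<star>\<^bsub>C\<^esub> c)) \<cdot>\<^bsub>C\<^esub> ((\<iota>\<^bsub>C\<^esub> f \<star>\<^bsub>C\<^esub> u) \<star>\<^bsub>C\<^esub> \<iota>\<^bsub>C\<^esub> g)"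
    unfolding 3 by (rule VComp_assoc[symmetric]) (simp_all add: Comp_assoc id)
  also have "\<dots> = c \<cdot>\<^bsub>C\<^esub> (((v \<star>\<^bsub>C\<^esub> \<iota>\<^bsub>C\<^esub> f) \<star>\<^bsub>C\<^esub> \<iota>\<^bsub>C\<^esub> g) \<cdot>\<^bsub>C\<^esub> ((\<iota>\<^bsub>C\<^esub> f \<star>\<^bsub>C\<^esub> u) \<star>\<^bsub>C\<^esub> \<iota>\<^bsub>C\<^esub> g))"
    unfolding 4 by (simp add: VComp_assoc whisker_right_Comp Comp_assoc id)
  also have "((v \<star>\<^bsub>C\<^esub> \<iota>\<^bsub>C\<^esub> f) \<star>\<^bsub>C\<^esub> \<iota>\<^bsub>C\<^esub> g) \<cdot>\<^bsub>C\<^esub> ((\<iota>\<^bsub>C\<^esub> f \<star>\<^bsub>C\<^esub> u) \<star>\<^bsub>C\<^esub> \<iota>\<^bsub>C\<^esub> g) = \<iota>\<^bsub>C\<^esub> (f \<odot>\<^bsub>C\<^esub> g)"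
    using whisker_right_VComp[of "\<iota>\<^bsub>C\<^esub> f \<star>\<^bsub>C\<^esub> u" "v \<star>\<^bsub>C\<^esub> \<iota>\<^bsub>C\<^esub> f" g] tri(2)
    by (simp add: HComp_IdC Comp_assoc id)
  also have "c \<cdot>\<^bsub>C\<^esub> \<iota>\<^bsub>C\<^esub> (f \<odot>\<^bsub>C\<^esub> g) = c" using VComp_IdC_right[of c] by simp
  finally show "v \<cdot>\<^bsub>C\<^esub> (\<iota>\<^bsub>C\<^esub> f \<star>\<^bsub>C\<^esub> \<kappa>) = c" .
qed

definition inverse_cell :: "('o, 'm, 'c) two_cat \<Rightarrow> 'c \<Rightarrow> 'c" where
  "inverse_cell K a = (SOME b. inverse_cells K a b)"

lemma inverse_cell: "iso_cell K a \<Longrightarrow> inverse_cells K a (inverse_cell K a)"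
  unfolding iso_cell_def inverse_cell_def by (rule someI_ex)

context normal_pseudofunctor
begin

interpretation P: two_category path_cat by (rule two_category_path_cat)

text \<open>The component of a 2-cell in \<open>K\<close> can be recovered by cancelling the invertible 2-cell of its domain.\<close>

lemma pcell_unique: "(f, g, \<alpha>, a) \<in> pcell \<Longrightarrow> (f, g, \<alpha>, b) \<in> pcell \<Longrightarrow> a = b"
  using pcellD[of f g \<alpha> a] pcellD[of f g \<alpha> b] pmorD[of f]
  by (intro K.iso_cell_cancel_right[of "snd f" a b]) simp_all

text \<open>Because its 2-cells are determined by their component in \<open>C\<close>, a 2-functor to the path object is
  determined by its effect on 1-cells and its projection to \<open>C\<close>.\<close>

lemma path_functor_eq:
  assumes L: "two_functor A path_cat L" "two_functor A path_cat L'" and A: "two_category A"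
    and 1: "\<And>f. f \<in> Mor A \<Longrightarrow> Fn1 L f = Fn1 L' f"
    and 2: "\<And>a. a \<in> Cell A \<Longrightarrow> Fn2 pC (Fn2 L a) = Fn2 pC (Fn2 L' a)"
    and a: "a \<in> Cell A"
  shows "Fn2 L a = Fn2 L' a"
proof -
  interpret L: two_functor A path_cat L by fact
  interpret L': two_functor A path_cat L' by fact
  interpret A: two_category A by fact
  obtain f g \<alpha> x where 3: "Fn2 L a = (f, g, \<alpha>, x)" by (cases "Fn2 L a") auto
  obtain f' g' \<alpha>' x' where 4: "Fn2 L' a = (f', g', \<alpha>', x')" by (cases "Fn2 L' a") auto
  have "f = f'" "g = g'"
    using L.Fn_Dom[OF a] L'.Fn_Dom[OF a] L.Fn_Cod[OF a] L'.Fn_Cod[OF a] 1 A.Dom_in[OF a] A.Cod_in[OF a] 3 4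
    by auto
  moreover have "\<alpha> = \<alpha>'" using 2[OF a] 3 4 by (simp add: pC_def)
  moreover have "(f, g, \<alpha>, x) \<in> pcell" "(f', g', \<alpha>', x') \<in> pcell"
    using L.Fn2_in[OF a] L'.Fn2_in[OF a] 3 4 by auto
  ultimately show ?thesis using pcell_unique 3 4 by auto
qed

text \<open>Over a 1-cell \<open>h\<close> of \<open>C\<close> there is the 1-cell of the path object with identity 2-cell.  Composites of
  such 1-cells carry \<open>mu\<close>, which determines the 2-cell over a triangle \<open>\<alpha>\<close>.\<close>

definition strict :: "'m \<Rightarrow> 'm \<times> 'd" where
  "strict h = (h, \<iota>\<^bsub>K\<^esub> (s1 h))"

definition triangle :: "'c \<Rightarrow> 'm \<Rightarrow> 'm \<Rightarrow> ('m \<times> 'd) \<times> ('m \<times> 'd) \<times> 'c \<times> 'd" where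
  "triangle \<alpha> k h = (strict (Dom C \<alpha>), pcomp (strict k) (strict h), \<alpha>, mu k h \<cdot>\<^bsub>K\<^esub> s2 \<alpha>)"

lemma strict_in: "h \<in> Mor C \<Longrightarrow> strict h \<in> pmor"
  by (simp add: strict_def pmor_def typing K.iso_cell_IdC)

lemma strict_IdM: "x \<in> Ob C \<Longrightarrow> strict (IdM C x) = IdM path_cat x"
  by (simp add: strict_def s1_IdM)

lemma pcomp_strict:
  assumes "h \<in> Mor C" "k \<in> Mor C" "Tgt C h = Src C k"
  shows "pcomp (strict k) (strict h) = (k \<odot>\<^bsub>C\<^esub> h, mu k h)"
  using assms K.VComp_IdC_left[of "mu k h"] by (simp add: pcomp_def strict_def K.HComp_IdC typing)

lemma triangle_in:
  assumes "h \<in> Mor C" "k \<in> Mor C" "Tgt C h = Src C k" "\<alpha> \<in> Cell C" "Cod C \<alpha> = k \<odot>\<^bsub>C\<^esub> h"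
  shows "triangle \<alpha> k h \<in> pcell"
  unfolding triangle_def
proof (rule pcellI)
  show "strict (Dom C \<alpha>) \<in> pmor" "pcomp (strict k) (strict h) \<in> pmor"
    using assms strict_in pcomp_in by (simp_all add: strict_def typing)
qed (use assms K.VComp_IdC_right[of "mu k h \<cdot>\<^bsub>K\<^esub> s2 \<alpha>"] in \<open>simp_all add: pcomp_strict typing\<close>,
     simp_all add: strict_def typing)

lemma triangle_degenerate:
  assumes "h \<in> Mor C"
  shows "triangle (\<iota>\<^bsub>C\<^esub> h) h (IdM C (Src C h)) = IdC path_cat (strict h)"
    "triangle (\<iota>\<^bsub>C\<^esub> h) (IdM C (Tgt C h)) h = IdC path_cat (strict h)"
  using assms K.VComp_IdC_left[of "\<iota>\<^bsub>K\<^esub> (s1 h)"]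
  by (simp_all add: triangle_def pcomp_strict typing C.Comp_IdM_right C.Comp_IdM_left mu_unit_right
      mu_unit_left s2_IdC)
    (simp_all add: strict_def typing)

definition olift :: "(nat, nat set, nat set \<times> nat set, 'o, 'm, 'c) two_fun
    \<Rightarrow> (nat, nat set, nat set \<times> nat set, 'o, 'm \<times> 'd, ('m \<times> 'd) \<times> ('m \<times> 'd) \<times> 'c \<times> 'd) two_fun" where
  "olift G = oriental_functor.ofun path_cat (Fn0 G) (\<lambda>i j. strict (Fn1 G {i, j}))
     (\<lambda>i j k. triangle (Fn2 G ({i, k}, {i, j, k})) (Fn1 G {j, k}) (Fn1 G {i, j}))"

end

locale oriental_lift = normal_pseudofunctor C K s0 s1 s2 mu + oriental_diagram C m G
  for C :: "('o, 'm, 'c) two_cat" and K :: "('p, 'n, 'd) two_cat" and s0 s1 s2 mu m G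
begin

interpretation P: two_category path_cat by (rule two_category_path_cat)

text \<open>The equation for a tetrahedron holds in the path object because it holds in \<open>C\<close>, and because 2-cells
  of the path object are determined by their component in \<open>C\<close>.\<close>

sublocale L: oriental_functor path_cat m "Fn0 G" "\<lambda>i j. strict (Fn1 G {i, j})"
  "\<lambda>i j k. triangle (Fn2 G ({i, k}, {i, j, k})) (Fn1 G {j, k}) (Fn1 G {i, j})"
proof (rule oriental_functor.intro, rule two_category_path_cat, unfold_locales)
  fix i j k l :: nat
  show "i \<le> m \<Longrightarrow> Fn0 G i \<in> Ob path_cat" using G.Fn0_in[of i] by simp
  show "i \<le> j \<Longrightarrow> j \<le> m \<Longrightarrow> strict (Fn1 G {i, j}) \<in> Mor path_cat
      \<and> Src path_cat (strict (Fn1 G {i, j})) = Fn0 G i \<and> Tgt path_cat (strict (Fn1 G {i, j})) = Fn0 G j"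
    using edge[of i j] strict_in by (simp add: strict_def)
  show "i \<le> m \<Longrightarrow> strict (Fn1 G {i, i}) = IdM path_cat (Fn0 G i)"
    using edge_refl[of i] strict_IdM G.Fn0_in[of i] by simp
  show "i \<le> j \<Longrightarrow> j \<le> k \<Longrightarrow> k \<le> m \<Longrightarrow> triangle (Fn2 G ({i, k}, {i, j, k})) (Fn1 G {j, k}) (Fn1 G {i, j}) \<in> Cell path_cat
      \<and> Dom path_cat (triangle (Fn2 G ({i, k}, {i, j, k})) (Fn1 G {j, k}) (Fn1 G {i, j})) = strict (Fn1 G {i, k})
      \<and> Cod path_cat (triangle (Fn2 G ({i, k}, {i, j, k})) (Fn1 G {j, k}) (Fn1 G {i, j}))
        = Comp path_cat (strict (Fn1 G {j, k})) (strict (Fn1 G {i, j}))"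
    using edge[of i j] edge[of j k] tri[of i j k]
      triangle_in[of "Fn1 G {i, j}" "Fn1 G {j, k}" "Fn2 G ({i, k}, {i, j, k})"] by (simp add: triangle_def)
  show "i \<le> k \<Longrightarrow> k \<le> m \<Longrightarrow> triangle (Fn2 G ({i, k}, {i, i, k})) (Fn1 G {i, k}) (Fn1 G {i, i})
      = IdC path_cat (strict (Fn1 G {i, k}))"
    using edge[of i k] edge_refl[of i] tri_refl[of i k] triangle_degenerate(1)[of "Fn1 G {i, k}"] by simp
  show "i \<le> k \<Longrightarrow> k \<le> m \<Longrightarrow> triangle (Fn2 G ({i, k}, {i, k, k})) (Fn1 G {k, k}) (Fn1 G {i, k})
      = IdC path_cat (strict (Fn1 G {i, k}))"
    using edge[of i k] edge_refl[of k] tri_refl[of i k] triangle_degenerate(2)[of "Fn1 G {i, k}"] by simp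
  let ?e = "\<lambda>i j. strict (Fn1 G {i, j})"
  let ?t = "\<lambda>i j k. triangle (Fn2 G ({i, k}, {i, j, k})) (Fn1 G {j, k}) (Fn1 G {i, j})"
  assume le: "i \<le> j" "j \<le> k" "k \<le> l" "l \<le> m"
  have e: "?e i j \<in> Mor path_cat" "?e k l \<in> Mor path_cat" "?e j k \<in> Mor path_cat" "?e j l \<in> Mor path_cat" "?e i k \<in> Mor path_cat"
    using le edge[of i j] edge[of j k] edge[of k l] edge[of j l] edge[of i k] strict_in by simp_all
  have e': "Tgt C (fst (?e i j)) = Src C (fst (?e j k))" "Tgt C (fst (?e j k)) = Src C (fst (?e k l))"
    using le edge[of i j] edge[of j k] edge[of k l] by (simp_all add: strict_def)
  have t: "?t j k l \<in> Cell path_cat" "?t i j l \<in> Cell path_cat" "?t i j k \<in> Cell path_cat" "?t i k l \<in> Cell path_cat"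
    using le edge[of i j] edge[of j k] edge[of k l] edge[of j l] edge[of i k] tri[of j k l] tri[of i j l] tri[of i j k] tri[of i k l]
      triangle_in by simp_all
  have td: "Dom path_cat (?t j k l) = ?e j l" "Cod path_cat (?t j k l) = Comp path_cat (?e k l) (?e j k)"
    "Dom path_cat (?t i j l) = ?e i l" "Cod path_cat (?t i j l) = Comp path_cat (?e j l) (?e i j)"
    "Dom path_cat (?t i j k) = ?e i k" "Cod path_cat (?t i j k) = Comp path_cat (?e j k) (?e i j)"
    "Dom path_cat (?t i k l) = ?e i l" "Cod path_cat (?t i k l) = Comp path_cat (?e k l) (?e i k)"
    using le by (simp_all add: triangle_def tri)
  have st: "Src path_cat (?e i j) = Fn0 G i" "Tgt path_cat (?e i j) = Fn0 G j"
    "Src path_cat (?e j k) = Fn0 G j" "Tgt path_cat (?e j k) = Fn0 G k"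
    "Src path_cat (?e k l) = Fn0 G k" "Tgt path_cat (?e k l) = Fn0 G l"
    "Src path_cat (?e j l) = Fn0 G j" "Tgt path_cat (?e j l) = Fn0 G l"
    "Src path_cat (?e i k) = Fn0 G i" "Tgt path_cat (?e i k) = Fn0 G k"
    using le edge[of i j] edge[of j k] edge[of k l] edge[of j l] edge[of i k] by (simp_all add: strict_def)
  let ?X = "VComp path_cat (HComp path_cat (?t j k l) (IdC path_cat (?e i j))) (?t i j l)"
  let ?Y = "VComp path_cat (HComp path_cat (IdC path_cat (?e k l)) (?t i j k)) (?t i k l)"
  have in': "?X \<in> Cell path_cat" "?Y \<in> Cell path_cat"
    using P.typing e t td st by (simp_all del: path_cat_simps)
  obtain a b where ab: "?X = (?e i l, pcomp (pcomp (?e k l) (?e j k)) (?e i j),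
      (Fn2 G ({j, l}, {j, k, l}) \<star>\<^bsub>C\<^esub> \<iota>\<^bsub>C\<^esub> (Fn1 G {i, j})) \<cdot>\<^bsub>C\<^esub> Fn2 G ({i, l}, {i, j, l}), a)"
    "?Y = (?e i l, pcomp (?e k l) (pcomp (?e j k) (?e i j)),
      (\<iota>\<^bsub>C\<^esub> (Fn1 G {k, l}) \<star>\<^bsub>C\<^esub> Fn2 G ({i, k}, {i, j, k})) \<cdot>\<^bsub>C\<^esub> Fn2 G ({i, l}, {i, k, l}), b)"
    using le by (simp add: triangle_def tri) (simp add: strict_def)
  have "pcomp (pcomp (?e k l) (?e j k)) (?e i j) = pcomp (?e k l) (pcomp (?e j k) (?e i j))"
    using pcomp_assoc[OF e(1,3,2)[simplified] e'] .
  then show "?X = ?Y" using in' pcell_unique unfolding ab tetrahedron[OF le] by simp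
qed

lemma two_functor_olift: "two_functor (oriental m) path_cat (olift G)"
  unfolding olift_def by (rule L.two_functor_ofun)

lemma olift_edge: "i \<le> j \<Longrightarrow> j \<le> m \<Longrightarrow> Fn1 (olift G) {i, j} = strict (Fn1 G {i, j})"
  unfolding olift_def by (rule L.ofun_values)

lemma olift_tri: "i \<le> j \<Longrightarrow> j \<le> k \<Longrightarrow> k \<le> m \<Longrightarrow> Fn2 (olift G) ({i, k}, {i, j, k})
    = triangle (Fn2 G ({i, k}, {i, j, k})) (Fn1 G {j, k}) (Fn1 G {i, j})"
  unfolding olift_def by (rule L.ofun_values)

lemma Fn0_olift: "Fn0 (olift G) = Fn0 G"
  unfolding olift_def by (simp add: L.ofun_def)

lemma pC_olift:
  "S \<in> Mor (oriental m) \<Longrightarrow> Fn1 pC (Fn1 (olift G) S) = Fn1 G S"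
  "a \<in> Cell (oriental m) \<Longrightarrow> Fn2 pC (Fn2 (olift G) a) = Fn2 G a"
proof -
  note F = two_functor_comp[OF two_functor_olift two_functor_pC two_category_oriental]
  note u = ofun_unique[OF F G.two_functor_axioms C.two_category_axioms]
  show "S \<in> Mor (oriental m) \<Longrightarrow> Fn1 pC (Fn1 (olift G) S) = Fn1 G S"
    "a \<in> Cell (oriental m) \<Longrightarrow> Fn2 pC (Fn2 (olift G) a) = Fn2 G a"
    using u(1)[of S] u(2)[of a]
    by (simp_all add: Fn0_olift olift_edge olift_tri pC_def strict_def triangle_def)
qed

text \<open>The second projection of the lift has the edges and triangles of \<open>H\<close>, so it is \<open>H\<close>.\<close>

lemma pK_olift:
  assumes H: "two_functor (oriental m) K H"
    and 0: "\<And>i. i \<le> m \<Longrightarrow> Fn0 H i = s0 (Fn0 G i)"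
    and 1: "\<And>i j. i < j \<Longrightarrow> j \<le> m \<Longrightarrow> Fn1 H {i, j} = s1 (Fn1 G {i, j})"
    and 2: "\<And>i j k. i < j \<Longrightarrow> j < k \<Longrightarrow> k \<le> m \<Longrightarrow> Fn2 H ({i, k}, {i, j, k})
      = mu (Fn1 G {j, k}) (Fn1 G {i, j}) \<cdot>\<^bsub>K\<^esub> s2 (Fn2 G ({i, k}, {i, j, k}))"
  shows "S \<in> Mor (oriental m) \<Longrightarrow> Fn1 pK (Fn1 (olift G) S) = Fn1 H S"
    "a \<in> Cell (oriental m) \<Longrightarrow> Fn2 pK (Fn2 (olift G) a) = Fn2 H a"
proof -
  note F = two_functor_comp[OF two_functor_olift two_functor_pK two_category_oriental]
  note u = ofun_unique[OF F H K.two_category_axioms]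
  show "S \<in> Mor (oriental m) \<Longrightarrow> Fn1 pK (Fn1 (olift G) S) = Fn1 H S"
    "a \<in> Cell (oriental m) \<Longrightarrow> Fn2 pK (Fn2 (olift G) a) = Fn2 H a"
    using u(1)[of S] u(2)[of a]
    by (simp_all add: Fn0_olift olift_edge olift_tri pK_def strict_def triangle_def 0 1 2 typing edge)
qed

text \<open>Strictness on edges determines a lift of \<open>G\<close>, since its 2-cells are determined by their component in
  \<open>C\<close>.  All compatibilities between lifts of orientals are instances of this.\<close>

lemma olift_unique:
  assumes L: "two_functor (oriental m) path_cat L"
    and 0: "\<And>i. i \<le> m \<Longrightarrow> Fn0 L i = Fn0 G i"
    and 1: "\<And>i j. i < j \<Longrightarrow> j \<le> m \<Longrightarrow> Fn1 L {i, j} = strict (Fn1 G {i, j})"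
    and 2: "\<And>a. a \<in> Cell (oriental m) \<Longrightarrow> Fn2 pC (Fn2 L a) = Fn2 G a"
  shows "S \<in> Mor (oriental m) \<Longrightarrow> Fn1 L S = Fn1 (olift G) S"
    "a \<in> Cell (oriental m) \<Longrightarrow> Fn2 L a = Fn2 (olift G) a"
proof -
  show m: "S \<in> Mor (oriental m) \<Longrightarrow> Fn1 L S = Fn1 (olift G) S" for S
    using ofun_unique(1)[OF L two_functor_olift two_category_path_cat, of S] 0 1
    by (simp add: Fn0_olift olift_edge)
  show "a \<in> Cell (oriental m) \<Longrightarrow> Fn2 L a = Fn2 (olift G) a"
    using path_functor_eq[OF L two_functor_olift two_category_oriental m] 2 pC_olift(2) by simp
qed

end

context normal_pseudofunctor
begin

interpretation P: two_category path_cat by (rule two_category_path_cat)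

text \<open>The mate, for the adjunctions of \<open>s1 f\<close> with \<open>s1 g\<close> and with \<open>h\<close>.  The counit of the former is
  \<open>s2 \<epsilon>\<close> preceded by the inverse of the comparison 2-cell of \<open>f\<close> and \<open>g\<close>, and \<open>u\<close> is the unit of the latter.\<close>

definition mate :: "'m \<Rightarrow> 'm \<Rightarrow> 'c \<Rightarrow> 'n \<Rightarrow> 'd \<Rightarrow> 'd" where
  "mate f g \<epsilon> h u = (\<iota>\<^bsub>K\<^esub> h \<star>\<^bsub>K\<^esub> (s2 \<epsilon> \<cdot>\<^bsub>K\<^esub> inverse_cell K (mu f g))) \<cdot>\<^bsub>K\<^esub> (u \<star>\<^bsub>K\<^esub> \<iota>\<^bsub>K\<^esub> (s1 g))"

lemma iso_cell_s2: "inverse_cells C a b \<Longrightarrow> inverse_cells K (s2 a) (s2 b)"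
  using s2_VComp[of a b] s2_VComp[of b a] s2_IdC[of "Dom C a"] s2_IdC[of "Cod C a"]
  by (simp add: inverse_cells_def s2_typing C.typing)

text \<open>Pseudofunctors preserve adjunctions; this is the triangle identity that enters the comparison of
  \<open>s1 g\<close> with \<open>h\<close>.\<close>

lemma pseudofunctor_triangle:
  assumes "f \<in> Mor C" "g \<in> Mor C" "Src C g = Tgt C f" "Tgt C g = Src C f"
    and \<eta>: "\<eta> \<in> Cell C" "Dom C \<eta> = IdM C (Src C f)" "Cod C \<eta> = g \<odot>\<^bsub>C\<^esub> f"
    and \<epsilon>: "\<epsilon> \<in> Cell C" "Dom C \<epsilon> = f \<odot>\<^bsub>C\<^esub> g" "Cod C \<epsilon> = IdM C (Tgt C f)"
    and tri: "(\<epsilon> \<star>\<^bsub>C\<^esub> \<iota>\<^bsub>C\<^esub> f) \<cdot>\<^bsub>C\<^esub> (\<iota>\<^bsub>C\<^esub> f \<star>\<^bsub>C\<^esub> \<eta>) = \<iota>\<^bsub>C\<^esub> f"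
  shows "((s2 \<epsilon> \<cdot>\<^bsub>K\<^esub> inverse_cell K (mu f g)) \<star>\<^bsub>K\<^esub> \<iota>\<^bsub>K\<^esub> (s1 f)) \<cdot>\<^bsub>K\<^esub> (\<iota>\<^bsub>K\<^esub> (s1 f) \<star>\<^bsub>K\<^esub> (mu g f \<cdot>\<^bsub>K\<^esub> s2 \<eta>))
    = \<iota>\<^bsub>K\<^esub> (s1 f)"
proof -
  let ?M = "inverse_cell K (mu f g)"
  note i = K.inverse_cellsD[OF inverse_cell[OF mu_iso[of g f]]]
  note [simp] = typing assms(1-4) \<eta> \<epsilon>
  have M [simp]: "?M \<in> Cell K" "Dom K ?M = s1 f \<odot>\<^bsub>K\<^esub> s1 g" "Cod K ?M = s1 (f \<odot>\<^bsub>C\<^esub> g)"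
    using i by simp_all
  have MM: "?M \<cdot>\<^bsub>K\<^esub> mu f g = \<iota>\<^bsub>K\<^esub> (s1 (f \<odot>\<^bsub>C\<^esub> g))" using i(5) by simp
  have idl: "f \<odot>\<^bsub>C\<^esub> IdM C (Src C f) = f" "IdM C (Tgt C f) \<odot>\<^bsub>C\<^esub> f = f"
    "s1 f \<odot>\<^bsub>K\<^esub> s1 (IdM C (Src C f)) = s1 f" "s1 (IdM C (Tgt C f)) \<odot>\<^bsub>K\<^esub> s1 f = s1 f"
    using C.Comp_IdM_right[of f] C.Comp_IdM_left[of f] K.Comp_IdM_right[of "s1 f"] K.Comp_IdM_left[of "s1 f"]
    by (simp_all add: s1_IdM)
  have a: "\<iota>\<^bsub>K\<^esub> (s1 f) \<star>\<^bsub>K\<^esub> s2 \<eta> = mu f (g \<odot>\<^bsub>C\<^esub> f) \<cdot>\<^bsub>K\<^esub> s2 (\<iota>\<^bsub>C\<^esub> f \<star>\<^bsub>C\<^esub> \<eta>)"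
    using mu_natural[of \<eta> "\<iota>\<^bsub>C\<^esub> f"] K.VComp_IdC_right[of "\<iota>\<^bsub>K\<^esub> (s1 f) \<star>\<^bsub>K\<^esub> s2 \<eta>"]
    by (simp add: s2_IdC mu_unit_right idl)
  have b: "s2 (\<epsilon> \<star>\<^bsub>C\<^esub> \<iota>\<^bsub>C\<^esub> f) = (s2 \<epsilon> \<star>\<^bsub>K\<^esub> \<iota>\<^bsub>K\<^esub> (s1 f)) \<cdot>\<^bsub>K\<^esub> mu (f \<odot>\<^bsub>C\<^esub> g) f"
    using mu_natural[of "\<iota>\<^bsub>C\<^esub> f" \<epsilon>] K.VComp_IdC_left[of "s2 (\<epsilon> \<star>\<^bsub>C\<^esub> \<iota>\<^bsub>C\<^esub> f)"]
    by (simp add: s2_IdC mu_unit_left idl)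
  have c: "(?M \<star>\<^bsub>K\<^esub> \<iota>\<^bsub>K\<^esub> (s1 f)) \<cdot>\<^bsub>K\<^esub> ((\<iota>\<^bsub>K\<^esub> (s1 f) \<star>\<^bsub>K\<^esub> mu g f) \<cdot>\<^bsub>K\<^esub> mu f (g \<odot>\<^bsub>C\<^esub> f)) = mu (f \<odot>\<^bsub>C\<^esub> g) f"
  proof -
    have "(?M \<star>\<^bsub>K\<^esub> \<iota>\<^bsub>K\<^esub> (s1 f)) \<cdot>\<^bsub>K\<^esub> ((\<iota>\<^bsub>K\<^esub> (s1 f) \<star>\<^bsub>K\<^esub> mu g f) \<cdot>\<^bsub>K\<^esub> mu f (g \<odot>\<^bsub>C\<^esub> f))
        = (?M \<star>\<^bsub>K\<^esub> \<iota>\<^bsub>K\<^esub> (s1 f)) \<cdot>\<^bsub>K\<^esub> ((mu f g \<star>\<^bsub>K\<^esub> \<iota>\<^bsub>K\<^esub> (s1 f)) \<cdot>\<^bsub>K\<^esub> mu (f \<odot>\<^bsub>C\<^esub> g) f)"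
      by (simp add: mu_assoc)
    also have "\<dots> = ((?M \<star>\<^bsub>K\<^esub> \<iota>\<^bsub>K\<^esub> (s1 f)) \<cdot>\<^bsub>K\<^esub> (mu f g \<star>\<^bsub>K\<^esub> \<iota>\<^bsub>K\<^esub> (s1 f))) \<cdot>\<^bsub>K\<^esub> mu (f \<odot>\<^bsub>C\<^esub> g) f"
      by (rule K.VComp_assoc[symmetric]) simp_all
    also have "(?M \<star>\<^bsub>K\<^esub> \<iota>\<^bsub>K\<^esub> (s1 f)) \<cdot>\<^bsub>K\<^esub> (mu f g \<star>\<^bsub>K\<^esub> \<iota>\<^bsub>K\<^esub> (s1 f)) = \<iota>\<^bsub>K\<^esub> (s1 (f \<odot>\<^bsub>C\<^esub> g)) \<star>\<^bsub>K\<^esub> \<iota>\<^bsub>K\<^esub> (s1 f)"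
      using K.whisker_right_VComp[of "mu f g" ?M "s1 f"] MM by simp
    also have "\<dots> \<cdot>\<^bsub>K\<^esub> mu (f \<odot>\<^bsub>C\<^esub> g) f = mu (f \<odot>\<^bsub>C\<^esub> g) f"
      using K.VComp_IdC_left[of "mu (f \<odot>\<^bsub>C\<^esub> g) f"] by (simp add: K.HComp_IdC)
    finally show ?thesis .
  qed
  have "((s2 \<epsilon> \<cdot>\<^bsub>K\<^esub> ?M) \<star>\<^bsub>K\<^esub> \<iota>\<^bsub>K\<^esub> (s1 f)) \<cdot>\<^bsub>K\<^esub> (\<iota>\<^bsub>K\<^esub> (s1 f) \<star>\<^bsub>K\<^esub> (mu g f \<cdot>\<^bsub>K\<^esub> s2 \<eta>))
    = (s2 \<epsilon> \<star>\<^bsub>K\<^esub> \<iota>\<^bsub>K\<^esub> (s1 f)) \<cdot>\<^bsub>K\<^esub> (((?M \<star>\<^bsub>K\<^esub> \<iota>\<^bsub>K\<^esub> (s1 f)) \<cdot>\<^bsub>K\<^esub> ((\<iota>\<^bsub>K\<^esub> (s1 f) \<star>\<^bsub>K\<^esub> mu g f) \<cdot>\<^bsub>K\<^esub> mu f (g \<odot>\<^bsub>C\<^esub> f)))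
        \<cdot>\<^bsub>K\<^esub> s2 (\<iota>\<^bsub>C\<^esub> f \<star>\<^bsub>C\<^esub> \<eta>))"
    by (simp add: K.whisker_left_VComp K.whisker_right_VComp a K.VComp_assoc K.Comp_assoc C.Comp_assoc)
  also have "\<dots> = s2 (\<epsilon> \<star>\<^bsub>C\<^esub> \<iota>\<^bsub>C\<^esub> f) \<cdot>\<^bsub>K\<^esub> s2 (\<iota>\<^bsub>C\<^esub> f \<star>\<^bsub>C\<^esub> \<eta>)"
    unfolding c b by (rule K.VComp_assoc[symmetric]) (simp_all add: C.Comp_assoc idl)
  also have "\<dots> = s2 ((\<epsilon> \<star>\<^bsub>C\<^esub> \<iota>\<^bsub>C\<^esub> f) \<cdot>\<^bsub>C\<^esub> (\<iota>\<^bsub>C\<^esub> f \<star>\<^bsub>C\<^esub> \<eta>))"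
    by (rule s2_VComp[symmetric]) (simp_all add: C.Comp_assoc)
  also have "\<dots> = \<iota>\<^bsub>K\<^esub> (s1 f)" unfolding tri by (simp add: s2_IdC)
  finally show ?thesis .
qed

lemma inverse_cells_path:
  assumes p: "(f, g, \<alpha>, a) \<in> pcell" and i: "inverse_cells C \<alpha> \<beta>" "inverse_cells K a b"
  shows "inverse_cells path_cat (f, g, \<alpha>, a) (g, f, \<beta>, b)"
proof -
  note d = pcellD[OF p] and ci = C.inverse_cellsD[OF i(1)] and ki = K.inverse_cellsD[OF i(2)]
  note pf = pmorD[OF d(1)] pmorD[OF d(2)]
  have "snd f \<cdot>\<^bsub>K\<^esub> s2 \<beta> = (b \<cdot>\<^bsub>K\<^esub> (a \<cdot>\<^bsub>K\<^esub> snd f)) \<cdot>\<^bsub>K\<^esub> s2 \<beta>"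
    using K.VComp_assoc[of "snd f" a b] K.VComp_IdC_left[of "snd f"] d(4,7) ki pf by simp
  also have "\<dots> = (b \<cdot>\<^bsub>K\<^esub> (snd g \<cdot>\<^bsub>K\<^esub> s2 \<alpha>)) \<cdot>\<^bsub>K\<^esub> s2 \<beta>" using d(9) by simp
  also have "\<dots> = b \<cdot>\<^bsub>K\<^esub> (snd g \<cdot>\<^bsub>K\<^esub> (s2 \<alpha> \<cdot>\<^bsub>K\<^esub> s2 \<beta>))"
    using d(3-8) ci(1-4) ki(1-4) pf by (simp add: K.VComp_assoc typing)
  also have "s2 \<alpha> \<cdot>\<^bsub>K\<^esub> s2 \<beta> = \<iota>\<^bsub>K\<^esub> (Dom K (snd g))"
    using s2_VComp[OF ci(2,1,4)] ci(6) d(6) s2_IdC[OF pf(7)] pf(10) by simp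
  also have "snd g \<cdot>\<^bsub>K\<^esub> \<iota>\<^bsub>K\<^esub> (Dom K (snd g)) = snd g" using K.VComp_IdC_right pf(9) by simp
  finally have "(g, f, \<beta>, b) \<in> pcell"
    using d(1-8) ci(1-4) ki(1-4) by (intro pcellI) simp_all
  then show ?thesis using p d ci ki by (simp add: inverse_cells_def)
qed

text \<open>Compatibility of the mate with the units and counits is exactly the condition that the pairs \<open>(\<eta>, u)\<close>
  and \<open>(\<epsilon>, e)\<close> are 2-cells of the path object.  The remaining conditions can be checked after projecting
  to \<open>C\<close> and \<open>K\<close>.\<close>

lemma adjoint_equivalence_path:
  assumes C: "adjoint_equivalence C x y f g \<eta> \<eta>' \<epsilon> \<epsilon>'"
    and K: "adjoint_equivalence K (s0 x) (s0 y) (s1 f) h u u' e e'"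
  defines "k \<equiv> (g, mate f g \<epsilon> h u)"
  defines "xx \<equiv> (IdM C x, \<iota>\<^bsub>K\<^esub> (IdM K (s0 x)))" and "yy \<equiv> (IdM C y, \<iota>\<^bsub>K\<^esub> (IdM K (s0 y)))"
  shows "adjoint_equivalence path_cat x y (strict f) k
    (xx, pcomp k (strict f), \<eta>, u) (pcomp k (strict f), xx, \<eta>', u')
    (pcomp (strict f) k, yy, \<epsilon>, e) (yy, pcomp (strict f) k, \<epsilon>', e')"
    and "Cod K (mate f g \<epsilon> h u) = h"
proof -
  note c = C[unfolded adjoint_equivalence_def] and kk = K[unfolded adjoint_equivalence_def]
  have i: "inverse_cells C \<eta> \<eta>'" "inverse_cells C \<epsilon> \<epsilon>'" "inverse_cells K u u'" "inverse_cells K e e'"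
    using c kk by auto
  note [simp] = C.inverse_cellsD(1)[OF i(1)] C.inverse_cellsD(1)[OF i(2)] K.inverse_cellsD(1)[OF i(3)] K.inverse_cellsD(1)[OF i(4)]
  have cc [simp]: "x \<in> Ob C" "y \<in> Ob C" "f \<in> Mor C" "Src C f = x" "Tgt C f = y" "g \<in> Mor C" "Src C g = y" "Tgt C g = x"
    "Dom C \<eta> = IdM C x" "Cod C \<eta> = g \<odot>\<^bsub>C\<^esub> f" "Dom C \<epsilon> = f \<odot>\<^bsub>C\<^esub> g" "Cod C \<epsilon> = IdM C y"
    and hh [simp]: "h \<in> Mor K" "Src K h = s0 y" "Tgt K h = s0 x"
    "Dom K u = IdM K (s0 x)" "Cod K u = h \<odot>\<^bsub>K\<^esub> s1 f" "Dom K e = s1 f \<odot>\<^bsub>K\<^esub> h" "Cod K e = IdM K (s0 y)"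
    using c kk by auto
  note [simp] = typing s1_IdM
  let ?M = "inverse_cell K (mu f g)" and ?k = "mate f g \<epsilon> h u"
  have Mi: "inverse_cells K (mu f g) ?M" by (rule inverse_cell, rule mu_iso) simp_all
  have M [simp]: "?M \<in> Cell K" "Dom K ?M = s1 f \<odot>\<^bsub>K\<^esub> s1 g" "Cod K ?M = s1 (f \<odot>\<^bsub>C\<^esub> g)"
    "?M \<cdot>\<^bsub>K\<^esub> mu f g = \<iota>\<^bsub>K\<^esub> (s1 (f \<odot>\<^bsub>C\<^esub> g))"
    using K.inverse_cellsD[OF Mi] by simp_all
  have isoc: "iso_cell K (s2 \<epsilon> \<cdot>\<^bsub>K\<^esub> ?M)"
    by (rule K.iso_cell_VComp) (use inverse_cells_sym[OF Mi] iso_cell_s2[OF i(2)] in \<open>auto simp: iso_cell_def\<close>)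
  have tri: "((s2 \<epsilon> \<cdot>\<^bsub>K\<^esub> ?M) \<star>\<^bsub>K\<^esub> \<iota>\<^bsub>K\<^esub> (s1 f)) \<cdot>\<^bsub>K\<^esub> (\<iota>\<^bsub>K\<^esub> (s1 f) \<star>\<^bsub>K\<^esub> (mu g f \<cdot>\<^bsub>K\<^esub> s2 \<eta>)) = \<iota>\<^bsub>K\<^esub> (s1 f)"
    by (rule pseudofunctor_triangle) (use c in auto)
  have m: "iso_cell K ?k" "Dom K ?k = s1 g" "Cod K ?k = h"
    "(?k \<star>\<^bsub>K\<^esub> \<iota>\<^bsub>K\<^esub> (s1 f)) \<cdot>\<^bsub>K\<^esub> (mu g f \<cdot>\<^bsub>K\<^esub> s2 \<eta>) = u"
    "e \<cdot>\<^bsub>K\<^esub> (\<iota>\<^bsub>K\<^esub> (s1 f) \<star>\<^bsub>K\<^esub> ?k) = s2 \<epsilon> \<cdot>\<^bsub>K\<^esub> ?M"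
    unfolding mate_def
    by (rule K.mate[where x = "s0 x" and y = "s0 y" and v = e], insert isoc tri kk i, auto simp: iso_cell_def)+
  show "Cod K ?k = h" by fact
  have [simp]: "?k \<in> Cell K" using m(1) by (rule iso_cell_in)
  note [simp] = m(2,3)
  have k: "k \<in> pmor" "strict f \<in> pmor" "fst k = g" "snd k = ?k" "fst (strict f) = f" "snd (strict f) = \<iota>\<^bsub>K\<^esub> (s1 f)"
    subgoal using m by (simp add: k_def pmor_def)
    by (simp_all add: strict_in) (simp_all add: k_def strict_def)
  have P: "IdM path_cat x = xx" "IdM path_cat y = yy" by (simp_all add: xx_def yy_def)
  have id: "xx \<in> pmor" "yy \<in> pmor" using P.IdM_in[of x] P.IdM_in[of y] P by simp_all
  have kf: "pcomp k (strict f) \<in> pmor" "Cod K (snd (pcomp k (strict f))) = h \<odot>\<^bsub>K\<^esub> s1 f"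
    and fk: "pcomp (strict f) k \<in> pmor" "Cod K (snd (pcomp (strict f) k)) = s1 f \<odot>\<^bsub>K\<^esub> h"
    using pcomp_in[of "strict f" k] pcomp_in[of k "strict f"] k by simp_all
  have pe: "(xx, pcomp k (strict f), \<eta>, u) \<in> pcell"
  proof (rule pcellI[OF id(1) kf(1)])
    have "((?k \<star>\<^bsub>K\<^esub> \<iota>\<^bsub>K\<^esub> (s1 f)) \<cdot>\<^bsub>K\<^esub> mu g f) \<cdot>\<^bsub>K\<^esub> s2 \<eta> = u"
      using m(4) by (simp add: K.VComp_assoc)
    then show "snd (pcomp k (strict f)) \<cdot>\<^bsub>K\<^esub> s2 \<eta> = u \<cdot>\<^bsub>K\<^esub> snd xx"
      using K.VComp_IdC_right[of u] by (simp add: xx_def pcomp_def k)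
  qed (simp_all add: kf k xx_def)
  have pp: "(pcomp (strict f) k, yy, \<epsilon>, e) \<in> pcell"
  proof (rule pcellI[OF fk(1) id(2)])
    have "e \<cdot>\<^bsub>K\<^esub> ((\<iota>\<^bsub>K\<^esub> (s1 f) \<star>\<^bsub>K\<^esub> ?k) \<cdot>\<^bsub>K\<^esub> mu f g) = (e \<cdot>\<^bsub>K\<^esub> (\<iota>\<^bsub>K\<^esub> (s1 f) \<star>\<^bsub>K\<^esub> ?k)) \<cdot>\<^bsub>K\<^esub> mu f g"
      by (rule K.VComp_assoc[symmetric]) simp_all
    also have "\<dots> = s2 \<epsilon>"
      unfolding m(5) using K.VComp_IdC_right[of "s2 \<epsilon>"] by (simp add: K.VComp_assoc)
    finally show "snd yy \<cdot>\<^bsub>K\<^esub> s2 \<epsilon> = e \<cdot>\<^bsub>K\<^esub> snd (pcomp (strict f) k)"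
      using K.VComp_IdC_left[of "s2 \<epsilon>"] by (simp add: yy_def pcomp_def k)
  qed (simp_all add: fk k yy_def)
  have unit: "pcomp f' xx = f'" "pcomp yy f' = f'" if "f' \<in> pmor" "Src C (fst f') = x" "Tgt C (fst f') = y" for f'
    using P.Comp_IdM_right[of f'] P.Comp_IdM_left[of f'] that by (simp_all add: xx_def yy_def)
  have unit': "pcomp f' yy = f'" "pcomp xx f' = f'" if "f' \<in> pmor" "Src C (fst f') = y" "Tgt C (fst f') = x" for f'
    using P.Comp_IdM_right[of f'] P.Comp_IdM_left[of f'] that by (simp_all add: xx_def yy_def)
  show "adjoint_equivalence path_cat x y (strict f) k
    (xx, pcomp k (strict f), \<eta>, u) (pcomp k (strict f), xx, \<eta>', u')
    (pcomp (strict f) k, yy, \<epsilon>, e) (yy, pcomp (strict f) k, \<epsilon>', e')"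
    unfolding adjoint_equivalence_def
    using inverse_cells_path[OF pe i(1,3)] inverse_cells_path[OF pp i(2,4)] c kk
    by (simp add: k P unit unit' del: path_cat_simps(8))
qed

text \<open>This makes the lifts of marked edges compatible with the degeneracy \<open>[1]\<^sub>t \<rightarrow> [0]\<close>.\<close>

lemma mate_degenerate:
  assumes "x \<in> Ob C"
  shows "mate (IdM C x) (IdM C x) (\<iota>\<^bsub>C\<^esub> (IdM C x)) (IdM K (s0 x)) (\<iota>\<^bsub>K\<^esub> (IdM K (s0 x))) = \<iota>\<^bsub>K\<^esub> (IdM K (s0 x))"
proof -
  let ?i = "\<iota>\<^bsub>K\<^esub> (IdM K (s0 x))"
  have x: "s0 x \<in> Ob K" using assms by (rule s0_in)
  have ii: "?i \<cdot>\<^bsub>K\<^esub> ?i = ?i" "?i \<star>\<^bsub>K\<^esub> ?i = ?i"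
    using K.VComp_IdC_left[of ?i] K.HComp_Id_left[of ?i] x by (simp_all add: typing)
  have mu: "mu (IdM C x) (IdM C x) = ?i"
    using mu_unit_left[of "IdM C x"] assms by (simp add: typing s1_IdM)
  have "inverse_cells K ?i ?i" using ii x by (simp add: inverse_cells_def typing)
  then have "inverse_cell K ?i = ?i"
    using K.inverse_cells_unique[OF inverse_cell] by (auto simp: iso_cell_def)
  then show ?thesis using ii assms by (simp add: mate_def mu s1_IdM s2_IdC typing)
qed

end

section \<open>The values of the cosimplicial object\<close>

text \<open>Relabelling the cells of a 2-category injectively gives an isomorphic 2-category.\<close>

definition inj_tag :: "('o, 'm, 'c) tagging \<Rightarrow> bool" where
  "inj_tag W \<longleftrightarrow> inj (Fn0 W) \<and> inj (Fn1 W) \<and> inj (Fn2 W)"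

definition untag :: "('o, 'm, 'c) tagging \<Rightarrow> (real0, real1, real2, 'o, 'm, 'c) two_fun" where
  "untag W = \<lparr>Fn0 = inv (Fn0 W), Fn1 = inv (Fn1 W), Fn2 = inv (Fn2 W)\<rparr>"

lemma inj_tags [simp]: "inj_tag ori_tag" "inj_tag adj_tag" "inj_tag inv_tag"
  by (simp_all add: inj_tag_def ori_tag_def adj_tag_def inv_tag_def inj_def)

lemma untag_simps [simp]:
  assumes "inj_tag W"
  shows "Fn0 (untag W) (Fn0 W x) = x" "Fn1 (untag W) (Fn1 W f) = f" "Fn2 (untag W) (Fn2 W a) = a"
  using assms by (simp_all add: inj_tag_def untag_def)

lemma tag_simps [simp]:
  assumes "inj_tag W"
  shows "Ob (tag W A) = Fn0 W ` Ob A" "Mor (tag W A) = Fn1 W ` Mor A" "Cell (tag W A) = Fn2 W ` Cell A"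
    "Src (tag W A) (Fn1 W f) = Fn0 W (Src A f)" "Tgt (tag W A) (Fn1 W f) = Fn0 W (Tgt A f)"
    "Dom (tag W A) (Fn2 W a) = Fn1 W (Dom A a)" "Cod (tag W A) (Fn2 W a) = Fn1 W (Cod A a)"
    "IdM (tag W A) (Fn0 W x) = Fn1 W (IdM A x)" "IdC (tag W A) (Fn1 W f) = Fn2 W (IdC A f)"
    "Comp (tag W A) (Fn1 W g) (Fn1 W f) = Fn1 W (Comp A g f)"
    "VComp (tag W A) (Fn2 W b) (Fn2 W a) = Fn2 W (VComp A b a)"
    "HComp (tag W A) (Fn2 W b) (Fn2 W a) = Fn2 W (HComp A b a)"
  using assms by (simp_all add: tag_def Let_def inj_tag_def)

lemma tag_eq_iff [simp]:
  assumes "inj_tag W"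
  shows "Fn0 W x = Fn0 W y \<longleftrightarrow> x = y" "Fn1 W f = Fn1 W g \<longleftrightarrow> f = g" "Fn2 W a = Fn2 W b \<longleftrightarrow> a = b"
  using assms by (auto simp: inj_tag_def inj_def)

lemma two_category_tag:
  assumes W: "inj_tag W" and A: "two_category A"
  shows "two_category (tag W A)"
proof -
  interpret A: two_category A by fact
  note [simp] = W
  show ?thesis
    by unfold_locales (auto simp: A.typing A.Comp_IdM_left A.Comp_IdM_right A.Comp_assoc
      A.VComp_IdC_left A.VComp_IdC_right A.VComp_assoc A.HComp_Id_left A.HComp_Id_right A.HComp_assoc
      A.HComp_IdC A.interchange)
qed

lemma two_functor_tag:
  assumes "inj_tag W"
  shows "two_functor A (tag W A) W" "two_functor (tag W A) A (untag W)"
proof -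
  note [simp] = assms
  show "two_functor A (tag W A) W" by unfold_locales auto
  show "two_functor (tag W A) A (untag W)" by unfold_locales auto
qed

lemma two_functor_tag_fun:
  assumes "two_functor A B F" "inj_tag V" "inj_tag W" "two_category A"
  shows "two_functor (tag V A) (tag W B) (tag_fun V W F)"
  using two_functor_comp[OF two_functor_comp[OF two_functor_tag(2)[OF assms(2)] assms(1) two_category_tag[OF assms(2,4)]]
      two_functor_tag(1)[OF assms(3)] two_category_tag[OF assms(2,4)]]
  by (simp add: tag_fun_def untag_def comp_assoc)

lemma tag_fun_simps [simp]:
  assumes "inj_tag V"
  shows "Fn0 (tag_fun V W F) (Fn0 V x) = Fn0 W (Fn0 F x)" "Fn1 (tag_fun V W F) (Fn1 V f) = Fn1 W (Fn1 F f)"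
    "Fn2 (tag_fun V W F) (Fn2 V a) = Fn2 W (Fn2 F a)"
  using assms by (simp_all add: tag_fun_def inj_tag_def)

lemma two_functor_ori_map:
  assumes k: "mono k" "\<And>i. i \<le> m \<Longrightarrow> k i \<le> n"
  shows "two_functor (oriental m) (oriental n) (ori_map k)"
proof (rule two_functor.intro)
  let ?A = "oriental m" and ?B = "oriental n" and ?F = "ori_map k"
  have sub: "k ` S \<subseteq> {0..n}" if "S \<subseteq> {0..m}" for S using that k(2) by (auto simp: subset_iff)
  have mM: "Min (k ` S) = k (Min S)" "Max (k ` S) = k (Max S)" if "S \<subseteq> {0..m}" "S \<noteq> {}" for S
    using mono_Min_commute[OF k(1), of S] mono_Max_commute[OF k(1), of S] that finite_subset[of S "{0..m}"] by auto
  have oc: "ocell n (k ` S) (k ` T)" if "ocell m S T" for S T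
    using ocellD[OF that] sub mM[of S] mM[of T] by (auto simp: ocell_def)
  note [simp] = ori_map_def Mor_oriental Cell_oriental
  fix x f g a b
  show "x \<in> Ob ?A \<Longrightarrow> Fn0 ?F x \<in> Ob ?B" "f \<in> Mor ?A \<Longrightarrow> Fn1 ?F f \<in> Mor ?B"
    "f \<in> Mor ?A \<Longrightarrow> Src ?B (Fn1 ?F f) = Fn0 ?F (Src ?A f)"
    "f \<in> Mor ?A \<Longrightarrow> Tgt ?B (Fn1 ?F f) = Fn0 ?F (Tgt ?A f)"
    "x \<in> Ob ?A \<Longrightarrow> Fn1 ?F (IdM ?A x) = IdM ?B (Fn0 ?F x)"
    "f \<in> Mor ?A \<Longrightarrow> Fn2 ?F (IdC ?A f) = IdC ?B (Fn1 ?F f)"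
    using sub mM k(2) by auto
  show "a \<in> Cell ?A \<Longrightarrow> Fn2 ?F a \<in> Cell ?B" by (cases a) (simp add: oc)
  show "a \<in> Cell ?A \<Longrightarrow> Dom ?B (Fn2 ?F a) = Fn1 ?F (Dom ?A a)"
    "a \<in> Cell ?A \<Longrightarrow> Cod ?B (Fn2 ?F a) = Fn1 ?F (Cod ?A a)"
    by (cases a; simp)+
  show "\<lbrakk>f \<in> Mor ?A; g \<in> Mor ?A; Tgt ?A f = Src ?A g\<rbrakk> \<Longrightarrow> Fn1 ?F (Comp ?A g f) = Comp ?B (Fn1 ?F g) (Fn1 ?F f)"
    by (simp add: image_Un)
  show "\<lbrakk>a \<in> Cell ?A; b \<in> Cell ?A; Cod ?A a = Dom ?A b\<rbrakk> \<Longrightarrow> Fn2 ?F (VComp ?A b a) = VComp ?B (Fn2 ?F b) (Fn2 ?F a)"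
    "\<lbrakk>a \<in> Cell ?A; b \<in> Cell ?A; Tgt ?A (Dom ?A a) = Src ?A (Dom ?A b)\<rbrakk>
      \<Longrightarrow> Fn2 ?F (HComp ?A b a) = HComp ?B (Fn2 ?F b) (Fn2 ?F a)"
    by (cases a; cases b; simp add: image_Un)+
qed

lemma mono_coface: "mono (coface i)" and mono_codegen: "mono (codegen i)"
  by (auto simp: mono_def coface_def codegen_def)

lemma Mor_oriental_1: "S \<in> Mor (oriental 1) \<longleftrightarrow> S = {0} \<or> S = {1} \<or> S = {0, 1}"
proof -
  have "{0..1} = {0, 1 :: nat}" by auto
  then have "S \<subseteq> {0..1} \<longleftrightarrow> S \<in> Pow {0, 1}" by simp
  also have "\<dots> \<longleftrightarrow> S = {} \<or> S = {0} \<or> S = {1} \<or> S = {0, 1}"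
    by (simp only: Pow_insert Pow_empty) auto
  finally show ?thesis by (auto simp: Mor_oriental)
qed

lemma ocell_1: "ocell 1 S T \<Longrightarrow> S = T \<and> S \<in> Mor (oriental 1)"
proof -
  assume c: "ocell 1 S T"
  note d = ocellD[OF c]
  have "S \<in> Mor (oriental 1)" "T \<in> Mor (oriental 1)" using d by (auto simp: Mor_oriental)
  then show ?thesis using d(8,9) \<open>S \<in> Mor (oriental 1)\<close> unfolding Mor_oriental_1 by auto
qed

lemma two_functor_phi_adj: "two_functor (oriental 1) (presented adj_pres) phi_adj"
proof -
  interpret E: two_category "presented adj_pres" by (rule adj_pres.two_category_presented)
  interpret A: two_category "oriental 1" by (rule two_category_oriental)
  define p0 where "p0 = (\<lambda>i::nat. if i = 0 then Adj_x else Adj_y)"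
  define p1 where "p1 = (\<lambda>S. if S = {0, 1} then Gen1 Adj_f else Id1 (p0 (Min S)))"
  have phi: "phi_adj = \<lparr>Fn0 = (\<lambda>i. cls0 adj_pres (p0 i)), Fn1 = (\<lambda>S. cls1 adj_pres (p1 S)),
       Fn2 = (\<lambda>(S, T). cls2 adj_pres (Id2 (p1 S)))\<rparr>"
    unfolding phi_adj_def Let_def p1_def p0_def by (rule refl)
  have p1: "p1 {0} = Id1 Adj_x" "p1 {1} = Id1 Adj_y" "p1 {0, 1} = Gen1 Adj_f"
    by (simp_all add: p1_def p0_def)
  have w: "wf1 adj_pres (p1 S)" for S by (simp add: p1_def)
  note [simp] = phi adj_pres.presented_simps w
  note One_nat_def [simp del]
  have st: "src1 adj_pres (p1 S) = p0 (Min S)" "tgt1 adj_pres (p1 S) = p0 (Max S)" if "S \<in> Mor (oriental 1)" for S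
    using that unfolding Mor_oriental_1 by (auto simp: p1_def p0_def)
  have id1: "cls1 adj_pres (p1 {i}) = cls1 adj_pres (Id1 (p0 i))" for i
    by (auto simp: p1_def)
  have cell: "a \<in> Cell (oriental 1) \<longleftrightarrow> (\<exists>S \<in> Mor (oriental 1). a = (S, S))" for a
  proof -
    obtain S T where a: "a = (S, T)" by (cases a)
    have "S \<in> Mor (oriental 1) \<Longrightarrow> ocell 1 S S" by (rule ocell_refl) (simp_all add: Mor_oriental)
    then show ?thesis using ocell_1[of S T] by (auto simp only: a Cell_oriental prod.inject)
  qed
  have fin: "finite S" "S \<noteq> {}" if "S \<in> Mor (oriental 1)" for S
    using that finite_subset[of S "{0..1}"] by (simp_all add: Mor_oriental)
  have comp: "cls1 adj_pres (p1 (S \<union> T)) = Comp (presented adj_pres) (cls1 adj_pres (p1 T)) (cls1 adj_pres (p1 S))"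
    if S: "S \<in> Mor (oriental 1)" and T: "T \<in> Mor (oriental 1)" and e: "Max S = Min T" for S T
  proof -
    have m: "cls1 adj_pres (p1 U) \<in> Mor (presented adj_pres)" for U by simp
    have se: "S = {Max S} \<or> T = {Min T}" using S T e unfolding Mor_oriental_1 by auto
    show ?thesis using se
    proof
      assume s: "S = {Max S}"
      have "Max S \<in> T" using e Min_in[OF fin[OF T]] by simp
      then have "S \<union> T = T" by (subst s) auto
      moreover have "cls1 adj_pres (p1 S) = IdM (presented adj_pres) (Src (presented adj_pres) (cls1 adj_pres (p1 T)))"
        using e st[OF T] id1[of "Max S"] s by simp
      ultimately show ?thesis using E.Comp_IdM_right[OF m[of T]] by simp
    next
      assume s: "T = {Min T}"
      have "Min T \<in> S" using e Max_in[OF fin[OF S]] by simp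
      then have "S \<union> T = S" by (subst s) auto
      moreover have "cls1 adj_pres (p1 T) = IdM (presented adj_pres) (Tgt (presented adj_pres) (cls1 adj_pres (p1 S)))"
        using e st[OF S] id1[of "Min T"] s by simp
      ultimately show ?thesis using E.Comp_IdM_left[OF m[of S]] by simp
    qed
  qed
  show ?thesis
  proof (rule two_functor.intro)
    let ?A = "oriental 1" and ?B = "presented adj_pres" and ?F = phi_adj
    fix x f g a b
    show "x \<in> Ob ?A \<Longrightarrow> Fn0 ?F x \<in> Ob ?B" "f \<in> Mor ?A \<Longrightarrow> Fn1 ?F f \<in> Mor ?B" by auto
    show "a \<in> Cell ?A \<Longrightarrow> Fn2 ?F a \<in> Cell ?B" by (auto simp: cell)
    show "f \<in> Mor ?A \<Longrightarrow> Src ?B (Fn1 ?F f) = Fn0 ?F (Src ?A f)"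
      "f \<in> Mor ?A \<Longrightarrow> Tgt ?B (Fn1 ?F f) = Fn0 ?F (Tgt ?A f)" by (simp_all add: st)
    show "a \<in> Cell ?A \<Longrightarrow> Dom ?B (Fn2 ?F a) = Fn1 ?F (Dom ?A a)"
      "a \<in> Cell ?A \<Longrightarrow> Cod ?B (Fn2 ?F a) = Fn1 ?F (Cod ?A a)" by (auto simp: cell)
    show "x \<in> Ob ?A \<Longrightarrow> Fn1 ?F (IdM ?A x) = IdM ?B (Fn0 ?F x)" by (simp add: id1)
    show "f \<in> Mor ?A \<Longrightarrow> Fn2 ?F (IdC ?A f) = IdC ?B (Fn1 ?F f)" by simp
    show "\<lbrakk>f \<in> Mor ?A; g \<in> Mor ?A; Tgt ?A f = Src ?A g\<rbrakk> \<Longrightarrow> Fn1 ?F (Comp ?A g f) = Comp ?B (Fn1 ?F g) (Fn1 ?F f)"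
      using comp by simp
    have idc: "cls2 adj_pres (Id2 (p1 S)) = IdC ?B (cls1 adj_pres (p1 S))" for S by simp
    have m: "cls1 adj_pres (p1 S) \<in> Mor ?B" for S by simp
    show "\<lbrakk>a \<in> Cell ?A; b \<in> Cell ?A; Cod ?A a = Dom ?A b\<rbrakk> \<Longrightarrow> Fn2 ?F (VComp ?A b a) = VComp ?B (Fn2 ?F b) (Fn2 ?F a)"
      using E.VComp_IdC_left[OF E.IdC_in[OF m]] E.Cod_IdC[OF m] by (auto simp: cell idc simp del: adj_pres.presented_simps(6))
    show "\<lbrakk>a \<in> Cell ?A; b \<in> Cell ?A; Tgt ?A (Dom ?A a) = Src ?A (Dom ?A b)\<rbrakk>
      \<Longrightarrow> Fn2 ?F (HComp ?A b a) = HComp ?B (Fn2 ?F b) (Fn2 ?F a)"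
      using comp st E.HComp_IdC[OF m m] adj_pres.presented_simps(1,2)[OF w]
      by (auto simp: cell idc simp del: adj_pres.presented_simps(6))
  qed
qed

lemma phi_inv_eq: "phi_inv = inv_pres.localization"
  unfolding phi_inv_def inv_pres.localization_def ..

lemma phi_inv_simps [simp]:
  "Fn0 phi_inv i = cls0 inv_pres i" "Fn1 phi_inv S = cls1 inv_pres (Gen1 S)"
  "Fn2 phi_inv c = cls2 inv_pres (Gen2 (Some c))"
  by (simp_all add: phi_inv_def)

lemma Gens_inv_pres [simp]:
  "Gens0 inv_pres = {0..2}" "Gens1 inv_pres = Mor (oriental 2)"
  "Gens2 inv_pres = insert None (Some ` Cell (oriental 2))"
  by (simp_all add: inv_pres_def)

lemmas two_functor_phi_inv = inv_pres.two_functor_localization[folded phi_inv_eq]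
lemmas inverse_phi_inv = inv_pres.inverse_in_localization[folded phi_inv_eq]

interpretation zeta_adj: presented_functor adj_pres "oriental 0" "\<lambda>_. 0" "\<lambda>_. {0}" "\<lambda>_. ({0}, {0})"
proof -
  have const: "case_adj0 a a = (\<lambda>_. a)" "case_adj1 b b = (\<lambda>_. b)" "case_adj2 c c c c = (\<lambda>_. c)"
    for a :: nat and b :: "nat set" and c :: "nat set \<times> nat set"
    by (simp_all add: fun_eq_iff split: adj0.split adj1.split adj2.split)
  have "adjoint_equivalence (oriental 0) 0 0 {0} {0} ({0}, {0}) ({0}, {0}) ({0}, {0}) ({0}, {0})"
    by (simp add: adjoint_equivalence_def inverse_cells_def Mor_oriental Cell_oriental ocell_refl)
  from presented_functor_adj[OF two_category_oriental this]
  show "presented_functor adj_pres (oriental 0) (\<lambda>_. 0) (\<lambda>_. {0}) (\<lambda>_. ({0}, {0}))"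
    unfolding const .
qed

lemma presented_functor_zeta_inv:
  assumes "i \<le> 1"
  shows "presented_functor inv_pres (oriental 1) (codegen i) (image (codegen i))
     (\<lambda>a. case a of Some b \<Rightarrow> Fn2 (ori_map (codegen i)) b | None \<Rightarrow> ({0, 1}, {0, 1}))"
proof -
  have F: "two_functor (oriental 2) (oriental 1) (ori_map (codegen i))"
    by (rule two_functor_ori_map[OF mono_codegen]) (use assms in \<open>auto simp: codegen_def\<close>)
  have "codegen i 0 = 0" "codegen i 1 = i" "codegen i 2 = 1"
    using assms by (auto simp: codegen_def)
  then have "codegen i ` {0, 2} = {0, 1}" "codegen i ` {0, 1, 2} = {0, 1}"
    using assms by (auto simp del: One_nat_def)
  then have w: "Fn2 (ori_map (codegen i)) ({0, 2}, {0, 1, 2}) = ({0, 1}, {0, 1})"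
    unfolding ori_map_def by (simp del: image_insert)
  have "inverse_cells (oriental 1) (Fn2 (ori_map (codegen i)) ({0, 2}, {0, 1, 2})) ({0, 1}, {0, 1})"
    unfolding w by (simp add: inverse_cells_def Cell_oriental ocell_def)
  moreover have "Fn0 (ori_map k) = k" "Fn1 (ori_map k) = image k" for k
    by (simp_all add: ori_map_def)
  ultimately show ?thesis
    using inv_pres.presented_functor_invert[OF two_category_oriental F] by simp
qed

lemma two_category_realize: "two_category (realize \<theta>)"
  by (cases \<theta>) (auto intro!: two_category_tag two_category_oriental adj_pres.two_category_presented
    inv_pres.two_category_presented)

lemma two_functor_pre_realize_map:
  assumes "td_arr u"
  shows "two_functor (realize (td_dom u)) (realize (td_cod u)) (pre_realize_map u)"
proof (cases u)
  case (CoF m i)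
  have "two_functor (oriental m) (oriental (m + 1)) (ori_map (coface i))"
    by (rule two_functor_ori_map[OF mono_coface]) (simp add: coface_def)
  then show ?thesis by (simp add: CoF two_functor_tag_fun two_category_oriental)
next
  case (CoD m i)
  have "two_functor (oriental (m + 1)) (oriental m) (ori_map (codegen i))"
    by (rule two_functor_ori_map[OF mono_codegen]) (use assms CoD in \<open>auto simp: codegen_def\<close>)
  then show ?thesis by (simp add: CoD two_functor_tag_fun two_category_oriental)
next
  case (Phi m)
  have "two_functor (oriental m) (oriental m) (ori_map (\<lambda>k. k))"
    by (rule two_functor_ori_map) (auto simp: mono_def)
  then show ?thesis
    using two_functor_phi_adj two_functor_phi_inv
    by (auto simp: Phi intro!: two_functor_tag_fun two_category_oriental)
next
  case (Zeta m i)
  then have i: "i \<le> m" using assms by simp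
  have "two_functor (oriental (m + 1)) (oriental m) (ori_map (codegen i))"
    by (rule two_functor_ori_map[OF mono_codegen]) (use i in \<open>auto simp: codegen_def\<close>)
  moreover have "two_functor (presented adj_pres) (oriental 0) zeta_adj"
    unfolding zeta_adj_def by (rule zeta_adj.two_functor_induced)
  moreover have "m = 1 \<Longrightarrow> two_functor (presented inv_pres) (oriental 1) (zeta_inv i)"
    unfolding zeta_inv_def
    by (rule presented_functor.two_functor_induced, rule presented_functor_zeta_inv) (use i in simp)
  ultimately show ?thesis
    by (auto simp: Zeta intro!: two_functor_tag_fun two_category_oriental adj_pres.two_category_presented
      inv_pres.two_category_presented)
qed

lemma two_functor_realize_map:
  "td_arr u \<Longrightarrow> two_functor (realize (td_dom u)) (realize (td_cod u)) (realize_map u)"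
  using two_functor_cong[OF two_functor_pre_realize_map two_category_realize]
  by (simp add: realize_map_def)

section \<open>Simplices of a 2-category\<close>

text \<open>A 2-functor out of an oriental may be prescribed on the nondegenerate simplices only.\<close>

locale simplex = D: two_category D
  for D :: "('o, 'n, 'd) two_cat" (structure) +
  fixes m :: nat and p :: "nat \<Rightarrow> 'o" and e :: "nat \<Rightarrow> nat \<Rightarrow> 'n" and t :: "nat \<Rightarrow> nat \<Rightarrow> nat \<Rightarrow> 'd"
  assumes p_in: "i \<le> m \<Longrightarrow> p i \<in> Ob D"
    and e_typing: "\<lbrakk>i < j; j \<le> m\<rbrakk> \<Longrightarrow> e i j \<in> Mor D \<and> Src D (e i j) = p i \<and> Tgt D (e i j) = p j"
    and t_typing: "\<lbrakk>i < j; j < k; k \<le> m\<rbrakk>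
      \<Longrightarrow> t i j k \<in> Cell D \<and> Dom D (t i j k) = e i k \<and> Cod D (t i j k) = e j k \<odot> e i j"
    and t_coassoc: "\<lbrakk>i < j; j < k; k < l; l \<le> m\<rbrakk>
      \<Longrightarrow> (t j k l \<star> \<iota> (e i j)) \<cdot> t i j l = (\<iota> (e k l) \<star> t i j k) \<cdot> t i k l"
begin

definition e' :: "nat \<Rightarrow> nat \<Rightarrow> 'n" where
  "e' i j = (if i < j then e i j else IdM D (p i))"

definition t' :: "nat \<Rightarrow> nat \<Rightarrow> nat \<Rightarrow> 'd" where
  "t' i j k = (if i < j \<and> j < k then t i j k else \<iota> (e' i k))"

lemma e'_typing: "\<lbrakk>i \<le> j; j \<le> m\<rbrakk> \<Longrightarrow> e' i j \<in> Mor D \<and> Src D (e' i j) = p i \<and> Tgt D (e' i j) = p j"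
  using e_typing[of i j] p_in[of i] by (cases "i = j") (auto simp: e'_def D.typing)

lemma e'_unit: "i \<le> j \<Longrightarrow> j \<le> m \<Longrightarrow> e' i j \<odot> IdM D (p i) = e' i j"
  "i \<le> j \<Longrightarrow> j \<le> m \<Longrightarrow> IdM D (p j) \<odot> e' i j = e' i j"
  using e'_typing[of i j] D.Comp_IdM_left[of "e' i j"] D.Comp_IdM_right[of "e' i j"] by auto

lemma t'_typing:
  assumes "i \<le> j" "j \<le> k" "k \<le> m"
  shows "t' i j k \<in> Cell D \<and> Dom D (t' i j k) = e' i k \<and> Cod D (t' i j k) = e' j k \<odot> e' i j"
proof -
  consider "i < j" "j < k" | "i = j" | "j = k" using assms by linarith
  then show ?thesis
  proof cases
    case 1
    then show ?thesis using t_typing[of i j k] assms by (simp add: t'_def e'_def)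
  next
    case 2
    then show ?thesis using e'_typing[of i k] e'_unit[of i k] assms by (simp add: t'_def D.typing e'_def[of j j])
  next
    case 3
    then show ?thesis using e'_typing[of i k] e'_unit[of i k] assms by (simp add: t'_def D.typing e'_def[of k k])
  qed
qed

lemma oriental_functor: "oriental_functor D m p e' t'"
proof
  fix i j k l :: nat
  show "i \<le> m \<Longrightarrow> p i \<in> Ob D" by (rule p_in)
  show "\<lbrakk>i \<le> j; j \<le> m\<rbrakk> \<Longrightarrow> e' i j \<in> Mor D \<and> Src D (e' i j) = p i \<and> Tgt D (e' i j) = p j" by (rule e'_typing)
  show "i \<le> m \<Longrightarrow> e' i i = IdM D (p i)" by (simp add: e'_def)
  show "\<lbrakk>i \<le> j; j \<le> k; k \<le> m\<rbrakk>
      \<Longrightarrow> t' i j k \<in> Cell D \<and> Dom D (t' i j k) = e' i k \<and> Cod D (t' i j k) = e' j k \<odot> e' i j"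
    by (rule t'_typing)
  show "\<lbrakk>i \<le> k; k \<le> m\<rbrakk> \<Longrightarrow> t' i i k = \<iota> (e' i k)" "\<lbrakk>i \<le> k; k \<le> m\<rbrakk> \<Longrightarrow> t' i k k = \<iota> (e' i k)"
    by (simp_all add: t'_def)
  assume le: "i \<le> j" "j \<le> k" "k \<le> l" "l \<le> m"
  note ty = t'_typing[of j k l] t'_typing[of i j l] t'_typing[of i j k] t'_typing[of i k l]
    e'_typing[of i j] e'_typing[of j k] e'_typing[of k l] e'_typing[of i k] e'_typing[of j l] e'_typing[of i l]
  consider "i < j" "j < k" "k < l" | "i = j" | "j = k" | "k = l" using le by linarith
  then show "(t' j k l \<star> \<iota> (e' i j)) \<cdot> t' i j l = (\<iota> (e' k l) \<star> t' i j k) \<cdot> t' i k l"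
  proof cases
    case 1
    then show ?thesis using t_coassoc[of i j k l] le by (simp add: t'_def e'_def)
  next
    case 2
    have "t' i k l \<star> \<iota> (IdM D (p i)) = t' i k l"
      using D.HComp_Id_right[of "t' i k l"] ty le 2 by simp
    moreover have "t' i k l \<cdot> \<iota> (e' i l) = t' i k l" "\<iota> (e' k l \<odot> e' i k) \<cdot> t' i k l = t' i k l"
      using D.VComp_IdC_right[of "t' i k l"] D.VComp_IdC_left[of "t' i k l"] ty le 2 by simp_all
    ultimately show ?thesis using 2 ty le by (simp add: t'_def[of j j] e'_def[of j j] D.HComp_IdC)
  next
    case 3
    then show ?thesis using ty le by (simp add: t'_def[of _ k k] t'_def[of k k] D.HComp_IdC e'_def[of k k] e'_unit)
  next
    case 4
    have "\<iota> (IdM D (p l)) \<star> t' i j l = t' i j l"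
      using D.HComp_Id_left[of "t' i j l"] ty le 4 by simp
    moreover have "t' i j l \<cdot> \<iota> (e' i l) = t' i j l" "\<iota> (e' j l \<odot> e' i j) \<cdot> t' i j l = t' i j l"
      using D.VComp_IdC_right[of "t' i j l"] D.VComp_IdC_left[of "t' i j l"] ty le 4 by simp_all
    ultimately show ?thesis using 4 ty le by (simp add: t'_def[of _ l l] e'_def[of l l] D.HComp_IdC)
  qed
qed

definition diagram :: "(nat, nat set, nat set \<times> nat set, 'o, 'n, 'd) two_fun" where
  "diagram = oriental_functor.ofun D p e' t'"

lemma two_functor_diagram: "two_functor (oriental m) D diagram"
  unfolding diagram_def by (rule oriental_functor.two_functor_ofun[OF oriental_functor])

lemma diagram_values:
  "Fn0 diagram i = p i"
  "i < j \<Longrightarrow> j \<le> m \<Longrightarrow> Fn1 diagram {i, j} = e i j"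
  "i < j \<Longrightarrow> j < k \<Longrightarrow> k \<le> m \<Longrightarrow> Fn2 diagram ({i, k}, {i, j, k}) = t i j k"
  unfolding diagram_def using oriental_functor.ofun_values[OF oriental_functor]
  by (simp_all add: e'_def t'_def)

end

section \<open>Pseudofunctors from triangles\<close>

text \<open>A normal pseudofunctor can be assembled from a 2-cell \<open>T \<alpha> k h\<close> for each triangle \<open>\<alpha>\<close> from a
  1-cell to the composite of \<open>k\<close> and \<open>h\<close>, subject to one relation for each tetrahedron: 2-cells
  are triangles whose first edge is an identity, and the comparison 2-cells are the triangles
  filled by an identity.\<close>

locale triangle_data = C: two_category C + K: two_category K
  for C :: "('o, 'm, 'c) two_cat" and K :: "('p, 'n, 'd) two_cat" +
  fixes s0 :: "'o \<Rightarrow> 'p" and s1 :: "'m \<Rightarrow> 'n" and T :: "'c \<Rightarrow> 'm \<Rightarrow> 'm \<Rightarrow> 'd"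
  assumes s0_in: "x \<in> Ob C \<Longrightarrow> s0 x \<in> Ob K"
    and s1_typing: "h \<in> Mor C \<Longrightarrow> s1 h \<in> Mor K" "h \<in> Mor C \<Longrightarrow> Src K (s1 h) = s0 (Src C h)"
      "h \<in> Mor C \<Longrightarrow> Tgt K (s1 h) = s0 (Tgt C h)"
    and s1_IdM: "x \<in> Ob C \<Longrightarrow> s1 (IdM C x) = IdM K (s0 x)"
    and T_typing: "\<lbrakk>h \<in> Mor C; k \<in> Mor C; Tgt C h = Src C k; \<alpha> \<in> Cell C; Cod C \<alpha> = k \<odot>\<^bsub>C\<^esub> h\<rbrakk>
      \<Longrightarrow> T \<alpha> k h \<in> Cell K \<and> Dom K (T \<alpha> k h) = s1 (Dom C \<alpha>) \<and> Cod K (T \<alpha> k h) = s1 k \<odot>\<^bsub>K\<^esub> s1 h"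
    and T_iso: "\<lbrakk>h \<in> Mor C; k \<in> Mor C; Tgt C h = Src C k\<rbrakk> \<Longrightarrow> iso_cell K (T (\<iota>\<^bsub>C\<^esub> (k \<odot>\<^bsub>C\<^esub> h)) k h)"
    and T_unit_left: "h \<in> Mor C \<Longrightarrow> T (\<iota>\<^bsub>C\<^esub> h) (IdM C (Tgt C h)) h = \<iota>\<^bsub>K\<^esub> (s1 h)"
    and T_unit_right: "h \<in> Mor C \<Longrightarrow> T (\<iota>\<^bsub>C\<^esub> h) h (IdM C (Src C h)) = \<iota>\<^bsub>K\<^esub> (s1 h)"
    and T_tetrahedron: "\<lbrakk>f01 \<in> Mor C; f12 \<in> Mor C; f23 \<in> Mor C; Tgt C f01 = Src C f12; Tgt C f12 = Src C f23;
        a012 \<in> Cell C; Cod C a012 = f12 \<odot>\<^bsub>C\<^esub> f01; a123 \<in> Cell C; Cod C a123 = f23 \<odot>\<^bsub>C\<^esub> f12;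
        a013 \<in> Cell C; Cod C a013 = Dom C a123 \<odot>\<^bsub>C\<^esub> f01; a023 \<in> Cell C; Cod C a023 = f23 \<odot>\<^bsub>C\<^esub> Dom C a012;
        Dom C a023 = Dom C a013;
        (a123 \<star>\<^bsub>C\<^esub> \<iota>\<^bsub>C\<^esub> f01) \<cdot>\<^bsub>C\<^esub> a013 = (\<iota>\<^bsub>C\<^esub> f23 \<star>\<^bsub>C\<^esub> a012) \<cdot>\<^bsub>C\<^esub> a023\<rbrakk>
      \<Longrightarrow> (T a123 f23 f12 \<star>\<^bsub>K\<^esub> \<iota>\<^bsub>K\<^esub> (s1 f01)) \<cdot>\<^bsub>K\<^esub> T a013 (Dom C a123) f01
        = (\<iota>\<^bsub>K\<^esub> (s1 f23) \<star>\<^bsub>K\<^esub> T a012 f12 f01) \<cdot>\<^bsub>K\<^esub> T a023 f23 (Dom C a012)"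
begin

definition s2 :: "'c \<Rightarrow> 'd" where
  "s2 \<alpha> = T \<alpha> (Cod C \<alpha>) (IdM C (Src C (Dom C \<alpha>)))"

definition mu :: "'m \<Rightarrow> 'm \<Rightarrow> 'd" where
  "mu k h = T (\<iota>\<^bsub>C\<^esub> (k \<odot>\<^bsub>C\<^esub> h)) k h"

lemma s1_unit:
  "h \<in> Mor C \<Longrightarrow> s1 h \<odot>\<^bsub>K\<^esub> IdM K (s0 (Src C h)) = s1 h" "h \<in> Mor C \<Longrightarrow> IdM K (s0 (Tgt C h)) \<odot>\<^bsub>K\<^esub> s1 h = s1 h"
  using K.Comp_IdM_right[of "s1 h"] K.Comp_IdM_left[of "s1 h"] by (simp_all add: s1_typing)

lemma s2_typing: "a \<in> Cell C \<Longrightarrow> s2 a \<in> Cell K \<and> Dom K (s2 a) = s1 (Dom C a) \<and> Cod K (s2 a) = s1 (Cod C a)"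
  using T_typing[of "IdM C (Src C (Dom C a))" "Cod C a" a] s1_unit(1)[of "Cod C a"] C.Comp_IdM_right[of "Cod C a"]
  by (simp add: s2_def C.typing s1_IdM)

lemma mu_typing: "\<lbrakk>h \<in> Mor C; k \<in> Mor C; Tgt C h = Src C k\<rbrakk>
    \<Longrightarrow> mu k h \<in> Cell K \<and> Dom K (mu k h) = s1 (k \<odot>\<^bsub>C\<^esub> h) \<and> Cod K (mu k h) = s1 k \<odot>\<^bsub>K\<^esub> s1 h"
  using T_typing[of h k "\<iota>\<^bsub>C\<^esub> (k \<odot>\<^bsub>C\<^esub> h)"] by (simp add: mu_def C.typing)

lemmas typing = C.typing K.typing s0_in s1_typing s2_typing mu_typing

lemma right_unit: "a \<in> Cell K \<Longrightarrow> x \<in> Ob C \<Longrightarrow> Src K (Dom K a) = s0 x \<Longrightarrow> a \<star>\<^bsub>K\<^esub> \<iota>\<^bsub>K\<^esub> (IdM K (s0 x)) = a"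
  using K.HComp_Id_right[of a] by simp

text \<open>The tetrahedron with edge \<open>{0, 1}\<close> and triangle \<open>{0, 1, 2}\<close> degenerate: a triangle factors through
  the one filled by an identity.\<close>

lemma T_eq:
  assumes "g \<in> Mor C" "k \<in> Mor C" "Tgt C g = Src C k" "\<alpha> \<in> Cell C" "Cod C \<alpha> = k \<odot>\<^bsub>C\<^esub> g"
  shows "T \<alpha> k g = mu k g \<cdot>\<^bsub>K\<^esub> s2 \<alpha>"
proof -
  let ?i = "IdM C (Src C g)"
  note [simp] = typing assms
  have st: "Src C (Dom C \<alpha>) = Src C g" using C.Src_Cod[of \<alpha>] by simp
  have u: "g \<odot>\<^bsub>C\<^esub> ?i = g" "(k \<odot>\<^bsub>C\<^esub> g) \<odot>\<^bsub>C\<^esub> ?i = k \<odot>\<^bsub>C\<^esub> g" "k \<odot>\<^bsub>C\<^esub> (g \<odot>\<^bsub>C\<^esub> ?i) = k \<odot>\<^bsub>C\<^esub> g"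
    using C.Comp_IdM_right[of g] C.Comp_IdM_right[of "k \<odot>\<^bsub>C\<^esub> g"] by simp_all
  have T: "T \<alpha> k g \<in> Cell K" "Cod K (T \<alpha> k g) = s1 k \<odot>\<^bsub>K\<^esub> s1 g" using T_typing[of g k \<alpha>] by simp_all
  have "(T (\<iota>\<^bsub>C\<^esub> (k \<odot>\<^bsub>C\<^esub> g)) k g \<star>\<^bsub>K\<^esub> \<iota>\<^bsub>K\<^esub> (s1 ?i)) \<cdot>\<^bsub>K\<^esub> T \<alpha> (Dom C (\<iota>\<^bsub>C\<^esub> (k \<odot>\<^bsub>C\<^esub> g))) ?i
      = (\<iota>\<^bsub>K\<^esub> (s1 k) \<star>\<^bsub>K\<^esub> T (\<iota>\<^bsub>C\<^esub> g) g ?i) \<cdot>\<^bsub>K\<^esub> T \<alpha> k (Dom C (\<iota>\<^bsub>C\<^esub> g))"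
    using u by (intro T_tetrahedron) (simp_all add: C.HComp_IdC)
  then show ?thesis
    using right_unit[of "mu k g" "Src C g"] K.VComp_IdC_left[of "T \<alpha> k g"] T
    by (simp add: T_unit_right K.HComp_IdC s1_IdM s2_def st) (simp add: mu_def)
qed

text \<open>The tetrahedron with edges \<open>{0, 1}\<close> and \<open>{1, 2}\<close> degenerate, in which three faces are 2-cells.\<close>

lemma s2_VComp:
  assumes "a \<in> Cell C" "b \<in> Cell C" "Cod C a = Dom C b"
  shows "s2 (b \<cdot>\<^bsub>C\<^esub> a) = s2 b \<cdot>\<^bsub>K\<^esub> s2 a"
proof -
  let ?x = "Src C (Dom C a)"
  let ?i = "IdM C ?x"
  note [simp] = typing assms
  have st [simp]: "Src C (Dom C b) = ?x" using C.Src_Cod[of a] by simp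
  have u: "?i \<odot>\<^bsub>C\<^esub> ?i = ?i" "Cod C b \<odot>\<^bsub>C\<^esub> ?i = Cod C b" "Dom C b \<odot>\<^bsub>C\<^esub> ?i = Dom C b"
    using C.Comp_IdM_right[of ?i] C.Comp_IdM_right[of "Cod C b"] C.Comp_IdM_right[of "Dom C b"] by simp_all
  have bb: "b \<star>\<^bsub>C\<^esub> \<iota>\<^bsub>C\<^esub> ?i = b" using C.HComp_Id_right[of b] by simp
  have v: "\<iota>\<^bsub>C\<^esub> (Cod C b) \<cdot>\<^bsub>C\<^esub> (b \<cdot>\<^bsub>C\<^esub> a) = b \<cdot>\<^bsub>C\<^esub> a" using C.VComp_IdC_left[of "b \<cdot>\<^bsub>C\<^esub> a"] by simp
  have "(T b (Cod C b) ?i \<star>\<^bsub>K\<^esub> \<iota>\<^bsub>K\<^esub> (s1 ?i)) \<cdot>\<^bsub>K\<^esub> T a (Dom C b) ?i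
      = (\<iota>\<^bsub>K\<^esub> (s1 (Cod C b)) \<star>\<^bsub>K\<^esub> T (\<iota>\<^bsub>C\<^esub> ?i) ?i ?i) \<cdot>\<^bsub>K\<^esub> T (b \<cdot>\<^bsub>C\<^esub> a) (Cod C b) (Dom C (\<iota>\<^bsub>C\<^esub> ?i))"
    by (rule T_tetrahedron) (simp_all add: u bb v C.HComp_IdC)
  moreover have "T (\<iota>\<^bsub>C\<^esub> ?i) ?i ?i = \<iota>\<^bsub>K\<^esub> (IdM K (s0 ?x))"
    using T_unit_left[of ?i] by (simp add: s1_IdM)
  moreover have "T b (Cod C b) ?i = s2 b" "T a (Dom C b) ?i = s2 a" "T (b \<cdot>\<^bsub>C\<^esub> a) (Cod C b) ?i = s2 (b \<cdot>\<^bsub>C\<^esub> a)"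
    by (simp_all add: s2_def)
  ultimately show ?thesis
    using right_unit[of "s2 b" ?x] K.VComp_IdC_left[of "s2 (b \<cdot>\<^bsub>C\<^esub> a)"] s1_unit(1)[of "Cod C b"]
    by (simp add: s1_IdM K.HComp_IdC)
qed

text \<open>The tetrahedron with edge \<open>{0, 1}\<close> degenerate and triangle \<open>{0, 1, 2}\<close> given by \<open>a\<close>.\<close>

lemma mu_natural_right:
  assumes "a \<in> Cell C" "k \<in> Mor C" "Tgt C (Dom C a) = Src C k"
  shows "mu k (Cod C a) \<cdot>\<^bsub>K\<^esub> s2 (\<iota>\<^bsub>C\<^esub> k \<star>\<^bsub>C\<^esub> a) = (\<iota>\<^bsub>K\<^esub> (s1 k) \<star>\<^bsub>K\<^esub> s2 a) \<cdot>\<^bsub>K\<^esub> mu k (Dom C a)"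
proof -
  let ?x = "Src C (Dom C a)"
  let ?i = "IdM C ?x" and ?kg = "k \<odot>\<^bsub>C\<^esub> Dom C a" and ?kg' = "k \<odot>\<^bsub>C\<^esub> Cod C a"
  note [simp] = typing assms
  have u: "Cod C a \<odot>\<^bsub>C\<^esub> ?i = Cod C a" "?kg' \<odot>\<^bsub>C\<^esub> ?i = ?kg'" "\<iota>\<^bsub>C\<^esub> ?kg' \<cdot>\<^bsub>C\<^esub> (\<iota>\<^bsub>C\<^esub> k \<star>\<^bsub>C\<^esub> a) = \<iota>\<^bsub>C\<^esub> k \<star>\<^bsub>C\<^esub> a"
    "(\<iota>\<^bsub>C\<^esub> k \<star>\<^bsub>C\<^esub> a) \<cdot>\<^bsub>C\<^esub> \<iota>\<^bsub>C\<^esub> ?kg = \<iota>\<^bsub>C\<^esub> k \<star>\<^bsub>C\<^esub> a"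
    using C.Comp_IdM_right[of "Cod C a"] C.Comp_IdM_right[of ?kg'] C.VComp_IdC_left[of "\<iota>\<^bsub>C\<^esub> k \<star>\<^bsub>C\<^esub> a"]
      C.VComp_IdC_right[of "\<iota>\<^bsub>C\<^esub> k \<star>\<^bsub>C\<^esub> a"] by simp_all
  have "(T (\<iota>\<^bsub>C\<^esub> ?kg') k (Cod C a) \<star>\<^bsub>K\<^esub> \<iota>\<^bsub>K\<^esub> (s1 ?i)) \<cdot>\<^bsub>K\<^esub> T (\<iota>\<^bsub>C\<^esub> k \<star>\<^bsub>C\<^esub> a) (Dom C (\<iota>\<^bsub>C\<^esub> ?kg')) ?i
      = (\<iota>\<^bsub>K\<^esub> (s1 k) \<star>\<^bsub>K\<^esub> T a (Cod C a) ?i) \<cdot>\<^bsub>K\<^esub> T (\<iota>\<^bsub>C\<^esub> ?kg) k (Dom C a)"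
    using u by (intro T_tetrahedron) (simp_all add: C.HComp_IdC)
  moreover have "T (\<iota>\<^bsub>C\<^esub> k \<star>\<^bsub>C\<^esub> a) ?kg' ?i = s2 (\<iota>\<^bsub>C\<^esub> k \<star>\<^bsub>C\<^esub> a)" "T a (Cod C a) ?i = s2 a"
    by (simp_all add: s2_def)
  ultimately show ?thesis
    using right_unit[of "mu k (Cod C a)" ?x] by (simp add: s1_IdM mu_def[symmetric])
qed

text \<open>The tetrahedron with edge \<open>{1, 2}\<close> degenerate and triangle \<open>{1, 2, 3}\<close> given by \<open>b\<close>.\<close>

lemma mu_natural_left:
  assumes "b \<in> Cell C" "g \<in> Mor C" "Tgt C g = Src C (Dom C b)"
  shows "mu (Cod C b) g \<cdot>\<^bsub>K\<^esub> s2 (b \<star>\<^bsub>C\<^esub> \<iota>\<^bsub>C\<^esub> g) = (s2 b \<star>\<^bsub>K\<^esub> \<iota>\<^bsub>K\<^esub> (s1 g)) \<cdot>\<^bsub>K\<^esub> mu (Dom C b) g"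
proof -
  let ?x = "Tgt C g"
  let ?i = "IdM C ?x" and ?kg = "Dom C b \<odot>\<^bsub>C\<^esub> g"
  note [simp] = typing assms(1,2) assms(3)[symmetric]
  have st [simp]: "Src C (Cod C b) = ?x" by simp
  have u: "?i \<odot>\<^bsub>C\<^esub> g = g" "Cod C b \<odot>\<^bsub>C\<^esub> ?i = Cod C b" "\<iota>\<^bsub>C\<^esub> (Cod C b \<odot>\<^bsub>C\<^esub> g) \<cdot>\<^bsub>C\<^esub> (b \<star>\<^bsub>C\<^esub> \<iota>\<^bsub>C\<^esub> g) = b \<star>\<^bsub>C\<^esub> \<iota>\<^bsub>C\<^esub> g"
    "(b \<star>\<^bsub>C\<^esub> \<iota>\<^bsub>C\<^esub> g) \<cdot>\<^bsub>C\<^esub> \<iota>\<^bsub>C\<^esub> ?kg = b \<star>\<^bsub>C\<^esub> \<iota>\<^bsub>C\<^esub> g"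
    using C.Comp_IdM_left[of g] C.Comp_IdM_right[of "Cod C b"] C.VComp_IdC_left[of "b \<star>\<^bsub>C\<^esub> \<iota>\<^bsub>C\<^esub> g"]
      C.VComp_IdC_right[of "b \<star>\<^bsub>C\<^esub> \<iota>\<^bsub>C\<^esub> g"] by simp_all
  have "(T b (Cod C b) ?i \<star>\<^bsub>K\<^esub> \<iota>\<^bsub>K\<^esub> (s1 g)) \<cdot>\<^bsub>K\<^esub> T (\<iota>\<^bsub>C\<^esub> ?kg) (Dom C b) g
      = (\<iota>\<^bsub>K\<^esub> (s1 (Cod C b)) \<star>\<^bsub>K\<^esub> T (\<iota>\<^bsub>C\<^esub> g) ?i g) \<cdot>\<^bsub>K\<^esub> T (b \<star>\<^bsub>C\<^esub> \<iota>\<^bsub>C\<^esub> g) (Cod C b) (Dom C (\<iota>\<^bsub>C\<^esub> g))"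
    using u by (intro T_tetrahedron) (simp_all add: C.HComp_IdC)
  moreover have "T b (Cod C b) ?i = s2 b" by (simp add: s2_def)
  moreover have "T (b \<star>\<^bsub>C\<^esub> \<iota>\<^bsub>C\<^esub> g) (Cod C b) g = mu (Cod C b) g \<cdot>\<^bsub>K\<^esub> s2 (b \<star>\<^bsub>C\<^esub> \<iota>\<^bsub>C\<^esub> g)"
    by (rule T_eq) simp_all
  ultimately show ?thesis
    using K.VComp_IdC_left[of "mu (Cod C b) g \<cdot>\<^bsub>K\<^esub> s2 (b \<star>\<^bsub>C\<^esub> \<iota>\<^bsub>C\<^esub> g)"] T_unit_left[of g]
    by (simp add: K.HComp_IdC mu_def[symmetric])
qed

text \<open>Associativity is the tetrahedron with all faces filled by identities.  Naturality of \<open>mu\<close> in both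
  variables follows from naturality in each of them.\<close>

sublocale normal_pseudofunctor C K s0 s1 s2 mu
proof
  fix x h k l a b
  show "x \<in> Ob C \<Longrightarrow> s0 x \<in> Ob K" "h \<in> Mor C \<Longrightarrow> s1 h \<in> Mor K" "h \<in> Mor C \<Longrightarrow> Src K (s1 h) = s0 (Src C h)"
    "h \<in> Mor C \<Longrightarrow> Tgt K (s1 h) = s0 (Tgt C h)" "x \<in> Ob C \<Longrightarrow> s1 (IdM C x) = IdM K (s0 x)"
    "a \<in> Cell C \<Longrightarrow> s2 a \<in> Cell K" "a \<in> Cell C \<Longrightarrow> Dom K (s2 a) = s1 (Dom C a)"
    "a \<in> Cell C \<Longrightarrow> Cod K (s2 a) = s1 (Cod C a)"
    by (simp_all add: typing s1_IdM)
  show "h \<in> Mor C \<Longrightarrow> s2 (\<iota>\<^bsub>C\<^esub> h) = \<iota>\<^bsub>K\<^esub> (s1 h)" by (simp add: s2_def C.typing T_unit_right)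
  show "\<lbrakk>a \<in> Cell C; b \<in> Cell C; Cod C a = Dom C b\<rbrakk> \<Longrightarrow> s2 (b \<cdot>\<^bsub>C\<^esub> a) = s2 b \<cdot>\<^bsub>K\<^esub> s2 a" by (rule s2_VComp)
  show "\<lbrakk>h \<in> Mor C; k \<in> Mor C; Tgt C h = Src C k\<rbrakk> \<Longrightarrow> iso_cell K (mu k h)" by (simp add: mu_def T_iso)
  show "\<lbrakk>h \<in> Mor C; k \<in> Mor C; Tgt C h = Src C k\<rbrakk> \<Longrightarrow> Dom K (mu k h) = s1 (k \<odot>\<^bsub>C\<^esub> h)"
    "\<lbrakk>h \<in> Mor C; k \<in> Mor C; Tgt C h = Src C k\<rbrakk> \<Longrightarrow> Cod K (mu k h) = s1 k \<odot>\<^bsub>K\<^esub> s1 h"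
    by (simp_all add: mu_typing)
  show "h \<in> Mor C \<Longrightarrow> mu (IdM C (Tgt C h)) h = \<iota>\<^bsub>K\<^esub> (s1 h)" "h \<in> Mor C \<Longrightarrow> mu h (IdM C (Src C h)) = \<iota>\<^bsub>K\<^esub> (s1 h)"
    by (simp_all add: mu_def C.Comp_IdM_left C.Comp_IdM_right T_unit_left T_unit_right)
  show "(mu l k \<star>\<^bsub>K\<^esub> \<iota>\<^bsub>K\<^esub> (s1 h)) \<cdot>\<^bsub>K\<^esub> mu (l \<odot>\<^bsub>C\<^esub> k) h = (\<iota>\<^bsub>K\<^esub> (s1 l) \<star>\<^bsub>K\<^esub> mu k h) \<cdot>\<^bsub>K\<^esub> mu l (k \<odot>\<^bsub>C\<^esub> h)"
    if "h \<in> Mor C" "k \<in> Mor C" "l \<in> Mor C" "Tgt C h = Src C k" "Tgt C k = Src C l"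
    using T_tetrahedron[of h k l "\<iota>\<^bsub>C\<^esub> (k \<odot>\<^bsub>C\<^esub> h)" "\<iota>\<^bsub>C\<^esub> (l \<odot>\<^bsub>C\<^esub> k)" "\<iota>\<^bsub>C\<^esub> (l \<odot>\<^bsub>C\<^esub> k \<odot>\<^bsub>C\<^esub> h)" "\<iota>\<^bsub>C\<^esub> (l \<odot>\<^bsub>C\<^esub> k \<odot>\<^bsub>C\<^esub> h)"] that
    by (simp add: mu_def C.typing C.Comp_assoc C.HComp_IdC)
  show "mu (Cod C b) (Cod C a) \<cdot>\<^bsub>K\<^esub> s2 (b \<star>\<^bsub>C\<^esub> a) = (s2 b \<star>\<^bsub>K\<^esub> s2 a) \<cdot>\<^bsub>K\<^esub> mu (Dom C b) (Dom C a)"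
    if ab: "a \<in> Cell C" "b \<in> Cell C" "Tgt C (Dom C a) = Src C (Dom C b)"
  proof -
    note [simp] = typing ab
    have "s2 (b \<star>\<^bsub>C\<^esub> a) = s2 (b \<star>\<^bsub>C\<^esub> \<iota>\<^bsub>C\<^esub> (Cod C a)) \<cdot>\<^bsub>K\<^esub> s2 (\<iota>\<^bsub>C\<^esub> (Dom C b) \<star>\<^bsub>C\<^esub> a)"
      using s2_VComp[of "\<iota>\<^bsub>C\<^esub> (Dom C b) \<star>\<^bsub>C\<^esub> a" "b \<star>\<^bsub>C\<^esub> \<iota>\<^bsub>C\<^esub> (Cod C a)"] C.HComp_as_whiskers(1)[OF ab] by simp
    then have "mu (Cod C b) (Cod C a) \<cdot>\<^bsub>K\<^esub> s2 (b \<star>\<^bsub>C\<^esub> a)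
        = (mu (Cod C b) (Cod C a) \<cdot>\<^bsub>K\<^esub> s2 (b \<star>\<^bsub>C\<^esub> \<iota>\<^bsub>C\<^esub> (Cod C a))) \<cdot>\<^bsub>K\<^esub> s2 (\<iota>\<^bsub>C\<^esub> (Dom C b) \<star>\<^bsub>C\<^esub> a)"
      by (simp add: K.VComp_assoc)
    also have "\<dots> = (s2 b \<star>\<^bsub>K\<^esub> \<iota>\<^bsub>K\<^esub> (s1 (Cod C a))) \<cdot>\<^bsub>K\<^esub> (mu (Dom C b) (Cod C a) \<cdot>\<^bsub>K\<^esub> s2 (\<iota>\<^bsub>C\<^esub> (Dom C b) \<star>\<^bsub>C\<^esub> a))"
      by (simp add: mu_natural_left K.VComp_assoc)
    also have "\<dots> = ((s2 b \<star>\<^bsub>K\<^esub> \<iota>\<^bsub>K\<^esub> (s1 (Cod C a))) \<cdot>\<^bsub>K\<^esub> (\<iota>\<^bsub>K\<^esub> (s1 (Dom C b)) \<star>\<^bsub>K\<^esub> s2 a)) \<cdot>\<^bsub>K\<^esub> mu (Dom C b) (Dom C a)"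
      by (simp add: mu_natural_right K.VComp_assoc)
    also have "(s2 b \<star>\<^bsub>K\<^esub> \<iota>\<^bsub>K\<^esub> (s1 (Cod C a))) \<cdot>\<^bsub>K\<^esub> (\<iota>\<^bsub>K\<^esub> (s1 (Dom C b)) \<star>\<^bsub>K\<^esub> s2 a) = s2 b \<star>\<^bsub>K\<^esub> s2 a"
      using K.HComp_as_whiskers(1)[of "s2 a" "s2 b"] by simp
    finally show ?thesis .
  qed
qed

end

section \<open>The categorification of a presheaf\<close>

lemma cat_pres_simps [simp]:
  "(\<theta>, x, a) \<in> Gens0 (cat_pres X) \<longleftrightarrow> x \<in> simplices X \<theta> \<and> a \<in> Ob (realize \<theta>)"
  "(\<theta>, x, f) \<in> Gens1 (cat_pres X) \<longleftrightarrow> x \<in> simplices X \<theta> \<and> f \<in> Mor (realize \<theta>)"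
  "(\<theta>, x, c) \<in> Gens2 (cat_pres X) \<longleftrightarrow> x \<in> simplices X \<theta> \<and> c \<in> Cell (realize \<theta>)"
  "gsrc (cat_pres X) (\<theta>, x, f) = (\<theta>, x, Src (realize \<theta>) f)"
  "gtgt (cat_pres X) (\<theta>, x, f) = (\<theta>, x, Tgt (realize \<theta>) f)"
  "gdom (cat_pres X) (\<theta>, x, c) = Gen1 (\<theta>, x, Dom (realize \<theta>) c)"
  "gcod (cat_pres X) (\<theta>, x, c) = Gen1 (\<theta>, x, Cod (realize \<theta>) c)"
  by (simp_all add: cat_pres_def)

interpretation cat_pres: wf_presentation "cat_pres X" for X
proof
  fix f assume "f \<in> Gens1 (cat_pres X)"
  then show "gsrc (cat_pres X) f \<in> Gens0 (cat_pres X)" "gtgt (cat_pres X) f \<in> Gens0 (cat_pres X)"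
    by (cases f; simp add: two_category.typing[OF two_category_realize])+
next
  fix c assume "c \<in> Gens2 (cat_pres X)"
  then show "wf1 (cat_pres X) (gdom (cat_pres X) c)" "wf1 (cat_pres X) (gcod (cat_pres X) c)"
    "eq0 (cat_pres X) (src1 (cat_pres X) (gdom (cat_pres X) c)) (src1 (cat_pres X) (gcod (cat_pres X) c))"
    "eq0 (cat_pres X) (tgt1 (cat_pres X) (gdom (cat_pres X) c)) (tgt1 (cat_pres X) (gcod (cat_pres X) c))"
    by (cases c; simp add: two_category.typing[OF two_category_realize] eq0_refl)+
qed

lemma two_category_categorification: "two_category (categorification X)"
  unfolding categorification_def by (rule cat_pres.two_category_presented)

text \<open>The unit of the adjunction at the simplex \<open>x\<close>, that is, the coprojection to the colimit defining the
  categorification.\<close>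

definition unit :: "'x td_presheaf \<Rightarrow> td_obj \<Rightarrow> 'x
    \<Rightarrow> (real0, real1, real2, (td_obj \<times> 'x \<times> real0) set,
        (td_obj \<times> 'x \<times> real0, td_obj \<times> 'x \<times> real1) tm1 set,
        (td_obj \<times> 'x \<times> real0, td_obj \<times> 'x \<times> real1, td_obj \<times> 'x \<times> real2) tm2 set) two_fun" where
  "unit X \<theta> x = \<lparr>Fn0 = (\<lambda>a. cls0 (cat_pres X) (\<theta>, x, a)),
     Fn1 = (\<lambda>f. cls1 (cat_pres X) (Gen1 (\<theta>, x, f))), Fn2 = (\<lambda>c. cls2 (cat_pres X) (Gen2 (\<theta>, x, c)))\<rparr>"

lemma unit_simps:
  "Fn0 (unit X \<theta> x) a = cls0 (cat_pres X) (\<theta>, x, a)"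
  "Fn1 (unit X \<theta> x) f = cls1 (cat_pres X) (Gen1 (\<theta>, x, f))"
  "Fn2 (unit X \<theta> x) c = cls2 (cat_pres X) (Gen2 (\<theta>, x, c))"
  by (simp_all add: unit_def)

lemma two_functor_unit:
  assumes x: "x \<in> simplices X \<theta>"
  shows "two_functor (realize \<theta>) (categorification X) (unit X \<theta> x)"
  unfolding categorification_def
proof
  let ?A = "realize \<theta>" and ?P = "cat_pres X" and ?B = "presented (cat_pres X)"
  let ?i0 = "\<lambda>a. (\<theta>, x, a)" and ?i1 = "\<lambda>f. (\<theta>, x, f)" and ?i2 = "\<lambda>c. (\<theta>, x, c)"
  interpret A: two_category ?A by (rule two_category_realize)
  note [simp] = unit_simps cat_pres.presented_simps cat_pres.presented_comp A.typing eq0_refl eq1_refl x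
  have r1: "Rel1 ?P s t" if "functorial1 ?A ?i0 ?i1 s t" for s t
    using that x by (auto simp: cat_pres_def)
  have r2: "Rel2 ?P s t" if "functorial2 ?A ?i1 ?i2 s t" for s t
    using that x by (auto simp: cat_pres_def)
  have e: "eq1 ?P s t" if "functorial1 ?A ?i0 ?i1 s t" for s t
    using that by (intro eq1_rel r1) (auto elim!: functorial1.cases)
  have e2: "eq1 ?P (Gen1 (?i1 (g \<odot>\<^bsub>?A\<^esub> f))) (Comp1 (Gen1 (?i1 g)) (Gen1 (?i1 f)))"
    if "f \<in> Mor ?A" "g \<in> Mor ?A" "Tgt ?A f = Src ?A g" for f g
    using e[OF functorial1.intros(2)] that by simp
  have f2: "cls2 ?P s = cls2 ?P t" if "functorial2 ?A ?i1 ?i2 s t" for s t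
    using that by (intro cat_pres.cls2I eq2_rel r2) (auto elim!: functorial2.cases simp: e2)
  fix y f g a b
  show "y \<in> Ob ?A \<Longrightarrow> Fn0 (unit X \<theta> x) y \<in> Ob ?B" "f \<in> Mor ?A \<Longrightarrow> Fn1 (unit X \<theta> x) f \<in> Mor ?B"
    "a \<in> Cell ?A \<Longrightarrow> Fn2 (unit X \<theta> x) a \<in> Cell ?B"
    "f \<in> Mor ?A \<Longrightarrow> Src ?B (Fn1 (unit X \<theta> x) f) = Fn0 (unit X \<theta> x) (Src ?A f)"
    "f \<in> Mor ?A \<Longrightarrow> Tgt ?B (Fn1 (unit X \<theta> x) f) = Fn0 (unit X \<theta> x) (Tgt ?A f)"
    "a \<in> Cell ?A \<Longrightarrow> Dom ?B (Fn2 (unit X \<theta> x) a) = Fn1 (unit X \<theta> x) (Dom ?A a)"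
    "a \<in> Cell ?A \<Longrightarrow> Cod ?B (Fn2 (unit X \<theta> x) a) = Fn1 (unit X \<theta> x) (Cod ?A a)"
    by auto
  show "y \<in> Ob ?A \<Longrightarrow> Fn1 (unit X \<theta> x) (IdM ?A y) = IdM ?B (Fn0 (unit X \<theta> x) y)"
    using cat_pres.cls1I[OF e[OF functorial1.intros(1)]] by simp
  show "f \<in> Mor ?A \<Longrightarrow> Fn2 (unit X \<theta> x) (IdC ?A f) = IdC ?B (Fn1 (unit X \<theta> x) f)"
    using f2[OF functorial2.intros(1)] by simp
  show "\<lbrakk>f \<in> Mor ?A; g \<in> Mor ?A; Tgt ?A f = Src ?A g\<rbrakk>
      \<Longrightarrow> Fn1 (unit X \<theta> x) (Comp ?A g f) = Comp ?B (Fn1 (unit X \<theta> x) g) (Fn1 (unit X \<theta> x) f)"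
    using cat_pres.cls1I[OF e2] by simp
  show "\<lbrakk>a \<in> Cell ?A; b \<in> Cell ?A; Cod ?A a = Dom ?A b\<rbrakk>
      \<Longrightarrow> Fn2 (unit X \<theta> x) (VComp ?A b a) = VComp ?B (Fn2 (unit X \<theta> x) b) (Fn2 (unit X \<theta> x) a)"
    using f2[OF functorial2.intros(2)] by simp
  show "\<lbrakk>a \<in> Cell ?A; b \<in> Cell ?A; Tgt ?A (Dom ?A a) = Src ?A (Dom ?A b)\<rbrakk>
      \<Longrightarrow> Fn2 (unit X \<theta> x) (HComp ?A b a) = HComp ?B (Fn2 (unit X \<theta> x) b) (Fn2 (unit X \<theta> x) a)"
    using f2[OF functorial2.intros(3)] by simp
qed

lemma unit_glue:
  assumes u: "td_arr u" and x: "x \<in> simplices X (td_cod u)" "act X u x \<in> simplices X (td_dom u)"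
  shows "a \<in> Ob (realize (td_dom u)) \<Longrightarrow>
      Fn0 (unit X (td_dom u) (act X u x)) a = Fn0 (unit X (td_cod u) x) (Fn0 (realize_map u) a)"
    and "f \<in> Mor (realize (td_dom u)) \<Longrightarrow>
      Fn1 (unit X (td_dom u) (act X u x)) f = Fn1 (unit X (td_cod u) x) (Fn1 (realize_map u) f)"
    and "c \<in> Cell (realize (td_dom u)) \<Longrightarrow>
      Fn2 (unit X (td_dom u) (act X u x)) c = Fn2 (unit X (td_cod u) x) (Fn2 (realize_map u) c)"
proof -
  interpret F: two_functor "realize (td_dom u)" "realize (td_cod u)" "realize_map u"
    by (rule two_functor_realize_map[OF u])
  interpret A: two_category "realize (td_dom u)" by (rule two_category_realize)
  have 0: "eq0 (cat_pres X) (td_dom u, act X u x, a) (td_cod u, x, Fn0 (realize_map u) a)"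
    if "a \<in> Ob (realize (td_dom u))" for a
    using that x u by (intro eq0_rel) (auto simp: F.Fn0_in cat_pres_def intro: glue.intros)
  have 1: "eq1 (cat_pres X) (Gen1 (td_dom u, act X u x, f)) (Gen1 (td_cod u, x, Fn1 (realize_map u) f))"
    if "f \<in> Mor (realize (td_dom u))" for f
  proof (rule eq1_rel)
    show "Rel1 (cat_pres X) (Gen1 (td_dom u, act X u x, f)) (Gen1 (td_cod u, x, Fn1 (realize_map u) f))"
      using that x u glue.intros[of u x X f "\<lambda>\<theta>. Mor (realize \<theta>)" "\<lambda>u. Fn1 (realize_map u)"]
      by (simp add: cat_pres_def)
  qed (use that x 0 in \<open>simp_all add: F.Fn1_in F.Fn_Src F.Fn_Tgt A.typing\<close>)
  have 2: "eq2 (cat_pres X) (Gen2 (td_dom u, act X u x, c)) (Gen2 (td_cod u, x, Fn2 (realize_map u) c))"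
    if "c \<in> Cell (realize (td_dom u))" for c
  proof (rule eq2_rel)
    show "Rel2 (cat_pres X) (Gen2 (td_dom u, act X u x, c)) (Gen2 (td_cod u, x, Fn2 (realize_map u) c))"
      using that x u glue.intros[of u x X c "\<lambda>\<theta>. Cell (realize \<theta>)" "\<lambda>u. Fn2 (realize_map u)"]
      by (simp add: cat_pres_def)
  qed (use that x 1 in \<open>simp_all add: F.Fn2_in F.Fn_Dom F.Fn_Cod A.typing\<close>)
  show "a \<in> Ob (realize (td_dom u)) \<Longrightarrow>
      Fn0 (unit X (td_dom u) (act X u x)) a = Fn0 (unit X (td_cod u) x) (Fn0 (realize_map u) a)"
    using cls0I[OF 0] by (simp add: unit_simps)
  show "f \<in> Mor (realize (td_dom u)) \<Longrightarrow>
      Fn1 (unit X (td_dom u) (act X u x)) f = Fn1 (unit X (td_cod u) x) (Fn1 (realize_map u) f)"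
    using cat_pres.cls1I[OF 1] by (simp add: unit_simps)
  show "c \<in> Cell (realize (td_dom u)) \<Longrightarrow>
      Fn2 (unit X (td_dom u) (act X u x)) c = Fn2 (unit X (td_cod u) x) (Fn2 (realize_map u) c)"
    using cat_pres.cls2I[OF 2] by (simp add: unit_simps)
qed

lemma Fn_two_comp [simp]:
  "x \<in> Ob A \<Longrightarrow> Fn0 (two_comp A G F) x = Fn0 G (Fn0 F x)"
  "f \<in> Mor A \<Longrightarrow> Fn1 (two_comp A G F) f = Fn1 G (Fn1 F f)"
  "c \<in> Cell A \<Longrightarrow> Fn2 (two_comp A G F) c = Fn2 G (Fn2 F c)"
  by (simp_all add: two_comp_def restr_def)

lemma two_comp_in:
  assumes "two_functor A B F" "two_functor B D G" "two_category A"
  shows "two_comp A G F \<in> two_functors A D"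
  unfolding two_comp_def by (rule restr_in_two_functors[OF two_functor_comp[OF assms] assms(3)])

text \<open>The universal property of the categorification as a colimit over the category of elements: the
  premises describe a cocone.\<close>

lemma presented_functor_cat_pres:
  assumes D: "two_category D"
    and F: "\<And>\<theta> x. x \<in> simplices X \<theta> \<Longrightarrow> two_functor (realize \<theta>) D (F \<theta> x)"
    and glue0: "\<And>u x a. \<lbrakk>td_arr u; x \<in> simplices X (td_cod u); act X u x \<in> simplices X (td_dom u); a \<in> Ob (realize (td_dom u))\<rbrakk>
      \<Longrightarrow> Fn0 (F (td_dom u) (act X u x)) a = Fn0 (F (td_cod u) x) (Fn0 (realize_map u) a)"
    and glue1: "\<And>u x f. \<lbrakk>td_arr u; x \<in> simplices X (td_cod u); act X u x \<in> simplices X (td_dom u); f \<in> Mor (realize (td_dom u))\<rbrakk>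
      \<Longrightarrow> Fn1 (F (td_dom u) (act X u x)) f = Fn1 (F (td_cod u) x) (Fn1 (realize_map u) f)"
    and glue2: "\<And>u x c. \<lbrakk>td_arr u; x \<in> simplices X (td_cod u); act X u x \<in> simplices X (td_dom u); c \<in> Cell (realize (td_dom u))\<rbrakk>
      \<Longrightarrow> Fn2 (F (td_dom u) (act X u x)) c = Fn2 (F (td_cod u) x) (Fn2 (realize_map u) c)"
  shows "presented_functor (cat_pres X) D (\<lambda>(\<theta>, x, a). Fn0 (F \<theta> x) a) (\<lambda>(\<theta>, x, f). Fn1 (F \<theta> x) f)
    (\<lambda>(\<theta>, x, c). Fn2 (F \<theta> x) c)"
proof -
  interpret D: two_category D by fact
  let ?k0 = "\<lambda>(\<theta>, x, a). Fn0 (F \<theta> x) a" and ?k1 = "\<lambda>(\<theta>, x, f). Fn1 (F \<theta> x) f"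
    and ?k2 = "\<lambda>(\<theta>, x, c). Fn2 (F \<theta> x) c"
  note f = two_functor.Fn0_in[OF F] two_functor.Fn1_in[OF F] two_functor.Fn2_in[OF F]
    two_functor.Fn_Src[OF F] two_functor.Fn_Tgt[OF F] two_functor.Fn_Dom[OF F] two_functor.Fn_Cod[OF F]
  show ?thesis
  proof
    fix g assume "g \<in> Gens0 (cat_pres X)"
    then show "?k0 g \<in> Ob D" by (cases g) (simp add: f)
  next
    fix g assume "g \<in> Gens1 (cat_pres X)"
    then show "?k1 g \<in> Mor D" "Src D (?k1 g) = ?k0 (gsrc (cat_pres X) g)" "Tgt D (?k1 g) = ?k0 (gtgt (cat_pres X) g)"
      by (cases g; simp add: f)+
  next
    fix g assume "g \<in> Gens2 (cat_pres X)"
    then show "?k2 g \<in> Cell D" "Dom D (?k2 g) = eval1 D ?k0 ?k1 (gdom (cat_pres X) g)"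
      "Cod D (?k2 g) = eval1 D ?k0 ?k1 (gcod (cat_pres X) g)"
      by (cases g; simp add: f)+
  next
    fix x y assume "Rel0 (cat_pres X) x y" "x \<in> Gens0 (cat_pres X)"
    then show "?k0 x = ?k0 y"
      by (auto simp: cat_pres_def elim!: glue.cases intro!: glue0)
  next
    fix s t assume r: "Rel1 (cat_pres X) s t" and w: "wf1 (cat_pres X) s" "wf1 (cat_pres X) t"
    from r consider \<theta> x where "x \<in> simplices X \<theta>" "functorial1 (realize \<theta>) (\<lambda>a. (\<theta>, x, a)) (\<lambda>f. (\<theta>, x, f)) s t"
      | f g where "s = Gen1 f" "t = Gen1 g" "glue X (\<lambda>u. Fn1 (realize_map u)) (\<lambda>\<theta>. Mor (realize \<theta>)) f g"
      by (auto simp: cat_pres_def)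
    then show "eval1 D ?k0 ?k1 s = eval1 D ?k0 ?k1 t"
    proof cases
      case 1
      then show ?thesis
        using two_functor.Fn_IdM[OF F] two_functor.Fn_Comp[OF F] by (auto elim!: functorial1.cases)
    next
      case 2
      then show ?thesis using w by (auto elim!: glue.cases intro!: glue1)
    qed
  next
    fix s t assume r: "Rel2 (cat_pres X) s t" and w: "wf2 (cat_pres X) s" "wf2 (cat_pres X) t"
    from r consider \<theta> x where "x \<in> simplices X \<theta>" "functorial2 (realize \<theta>) (\<lambda>f. (\<theta>, x, f)) (\<lambda>c. (\<theta>, x, c)) s t"
      | f g where "s = Gen2 f" "t = Gen2 g" "glue X (\<lambda>u. Fn2 (realize_map u)) (\<lambda>\<theta>. Cell (realize \<theta>)) f g"
      by (auto simp: cat_pres_def)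
    then show "eval2 D ?k0 ?k1 ?k2 s = eval2 D ?k0 ?k1 ?k2 t"
    proof cases
      case 1
      then show ?thesis
        using two_functor.Fn_IdC[OF F] two_functor.Fn_VComp[OF F] two_functor.Fn_HComp[OF F]
        by (auto elim!: functorial2.cases)
    next
      case 2
      then show ?thesis using w by (auto elim!: glue.cases intro!: glue2)
    qed
  qed
qed

section \<open>The natural nerve\<close>

lemma simplices_nerve: "simplices (nerve C) \<theta> = (if td_ob \<theta> then two_functors (realize \<theta>) C else {})"
  and act_nerve: "act (nerve C) u x = two_comp (realize (td_dom u)) x (realize_map u)"
  by (simp_all add: nerve_def)

lemma simplex_functor: "x \<in> simplices (nerve C) \<theta> \<Longrightarrow> two_functor (realize \<theta>) C x"
  by (auto simp: simplices_nerve two_functors_def split: if_splits)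

lemma td_ob_dom: "td_arr u \<Longrightarrow> td_ob (td_dom u)"
  by (cases u) auto

lemma act_nerve_in:
  assumes "td_arr u" "x \<in> simplices (nerve C) (td_cod u)"
  shows "act (nerve C) u x \<in> simplices (nerve C) (td_dom u)"
  using two_comp_in[OF two_functor_realize_map[OF assms(1)] simplex_functor[OF assms(2)] two_category_realize]
    td_ob_dom[OF assms(1)]
  by (simp add: act_nerve simplices_nerve)

lemma presented_functor_counit:
  assumes "two_category C"
  shows "presented_functor (cat_pres (nerve C)) C
    (\<lambda>(\<theta>, x, a). Fn0 x a) (\<lambda>(\<theta>, x, f). Fn1 x f) (\<lambda>(\<theta>, x, c). Fn2 x c)"
  by (rule presented_functor_cat_pres[where F = "\<lambda>\<theta> x. x", OF assms simplex_functor])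
    (simp_all add: act_nerve)

text \<open>The simplex of the nerve given by a 2-functor out of the untagged value at \<open>\<theta>\<close>.\<close>

definition tagged :: "td_obj \<Rightarrow> ('o1, 'm1, 'c1) tagging \<Rightarrow> ('o1, 'm1, 'c1, 'o, 'm, 'c) two_fun
    \<Rightarrow> (real0, real1, real2, 'o, 'm, 'c) two_fun" where
  "tagged \<theta> W G = restr (realize \<theta>)
     \<lparr>Fn0 = Fn0 G \<circ> Fn0 (untag W), Fn1 = Fn1 G \<circ> Fn1 (untag W), Fn2 = Fn2 G \<circ> Fn2 (untag W)\<rparr>"

lemma tagged:
  assumes W: "inj_tag W" and A: "realize \<theta> = tag W A" "two_category A" and G: "two_functor A C G" and "td_ob \<theta>"
  shows "tagged \<theta> W G \<in> simplices (nerve C) \<theta>"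
    "a \<in> Ob A \<Longrightarrow> Fn0 (tagged \<theta> W G) (Fn0 W a) = Fn0 G a"
    "f \<in> Mor A \<Longrightarrow> Fn1 (tagged \<theta> W G) (Fn1 W f) = Fn1 G f"
    "c \<in> Cell A \<Longrightarrow> Fn2 (tagged \<theta> W G) (Fn2 W c) = Fn2 G c"
proof -
  note [simp] = W
  show "tagged \<theta> W G \<in> simplices (nerve C) \<theta>"
    unfolding tagged_def simplices_nerve using \<open>td_ob \<theta>\<close>
    by (simp add: A(1) restr_in_two_functors[OF two_functor_comp[OF two_functor_tag(2)[OF W] G two_category_tag[OF W A(2)]]
      two_category_tag[OF W A(2)]])
  show "a \<in> Ob A \<Longrightarrow> Fn0 (tagged \<theta> W G) (Fn0 W a) = Fn0 G a"
    "f \<in> Mor A \<Longrightarrow> Fn1 (tagged \<theta> W G) (Fn1 W f) = Fn1 G f"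
    "c \<in> Cell A \<Longrightarrow> Fn2 (tagged \<theta> W G) (Fn2 W c) = Fn2 G c"
    by (simp_all add: tagged_def A(1))
qed

lemma simplex_eqI:
  assumes W: "inj_tag W" and A: "realize \<theta> = tag W A"
    and x: "x \<in> simplices (nerve C) \<theta>" "y \<in> simplices (nerve C) \<theta>"
    and "\<And>a. a \<in> Ob A \<Longrightarrow> Fn0 x (Fn0 W a) = Fn0 y (Fn0 W a)"
    and "\<And>f. f \<in> Mor A \<Longrightarrow> Fn1 x (Fn1 W f) = Fn1 y (Fn1 W f)"
    and "\<And>c. c \<in> Cell A \<Longrightarrow> Fn2 x (Fn2 W c) = Fn2 y (Fn2 W c)"
  shows "x = y"
proof (rule two_functors_eqI)
  show "x \<in> two_functors (realize \<theta>) C" "y \<in> two_functors (realize \<theta>) C"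
    using x by (auto simp: simplices_nerve split: if_splits)
qed (use assms in auto)

section \<open>The pseudofunctor to the categorified nerve\<close>

text \<open>The base of the induction in \<open>unit_at_injective\<close>.\<close>

lemma increasing_endo:
  assumes "\<And>i j. i < j \<Longrightarrow> j \<le> k \<Longrightarrow> \<phi> i < (\<phi> j :: nat)" "\<And>i. i \<le> k \<Longrightarrow> \<phi> i \<le> k" "i \<le> k"
  shows "\<phi> i = i"
proof -
  have "i \<le> \<phi> i" if "i \<le> k" for i
    using that
  proof (induction i)
    case (Suc i)
    then show ?case using assms(1)[of i "Suc i"] by simp
  qed simp
  moreover have "\<phi> (k - j) \<le> k - j" if "j \<le> k" for j
    using that
  proof (induction j)
    case (Suc j)
    then have "\<phi> (k - Suc j) < \<phi> (k - j)" by (intro assms(1)) auto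
    with Suc show ?case by simp
  qed (simp add: assms(2))
  from this[of "k - i"] have "\<phi> i \<le> i" using assms(3) by simp
  ultimately show ?thesis using assms(3) by (simp add: le_antisym)
qed

lemma ocell_subset: "ocell m S T \<Longrightarrow> S \<subseteq> {0..m} \<and> T \<subseteq> {0..m}"
  by (simp add: ocellD)

definition ocomp :: "(nat, nat set, nat set \<times> nat set, 'o, 'm, 'c) two_fun \<Rightarrow> (nat \<Rightarrow> nat)
    \<Rightarrow> (nat, nat set, nat set \<times> nat set, 'o, 'm, 'c) two_fun" where
  "ocomp G \<phi> = \<lparr>Fn0 = Fn0 G \<circ> \<phi>, Fn1 = Fn1 G \<circ> image \<phi>, Fn2 = Fn2 G \<circ> map_prod (image \<phi>) (image \<phi>)\<rparr>"

lemma ocomp_simps [simp]: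
  "Fn0 (ocomp G \<phi>) i = Fn0 G (\<phi> i)" "Fn1 (ocomp G \<phi>) S = Fn1 G (\<phi> ` S)"
  "Fn2 (ocomp G \<phi>) (S, T) = Fn2 G (\<phi> ` S, \<phi> ` T)"
  by (simp_all add: ocomp_def)

lemma two_functor_ocomp:
  assumes "two_functor (oriental m) C G" "mono \<phi>" "\<And>i. i \<le> k \<Longrightarrow> \<phi> i \<le> m"
  shows "two_functor (oriental k) C (ocomp G \<phi>)"
  using two_functor_comp[OF two_functor_ori_map[OF assms(2,3)] assms(1) two_category_oriental]
  by (simp add: ocomp_def ori_map_def)

definition osimplex :: "nat \<Rightarrow> (nat, nat set, nat set \<times> nat set, 'o, 'm, 'c) two_fun
    \<Rightarrow> (real0, real1, real2, 'o, 'm, 'c) two_fun" where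
  "osimplex m G = tagged (Simp m) ori_tag G"

text \<open>The unit at the simplex given by an untagged 2-functor.\<close>

definition unit_at :: "('o, 'm, 'c) two_cat \<Rightarrow> nat \<Rightarrow> (nat, nat set, nat set \<times> nat set, 'o, 'm, 'c) two_fun \<Rightarrow> _" where
  "unit_at C m G = \<lparr>Fn0 = Fn0 (unit (nerve C) (Simp m) (osimplex m G)) \<circ> Ori0,
     Fn1 = Fn1 (unit (nerve C) (Simp m) (osimplex m G)) \<circ> Ori1,
     Fn2 = Fn2 (unit (nerve C) (Simp m) (osimplex m G)) \<circ> Ori2\<rparr>"

lemma ori_tag_simps [simp]: "Fn0 ori_tag = Ori0" "Fn1 ori_tag = Ori1" "Fn2 ori_tag = Ori2"
  by (simp_all add: ori_tag_def)

lemma osimplex: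
  assumes "two_functor (oriental m) C G"
  shows "osimplex m G \<in> simplices (nerve C) (Simp m)"
    "i \<in> Ob (oriental m) \<Longrightarrow> Fn0 (osimplex m G) (Ori0 i) = Fn0 G i"
    "S \<in> Mor (oriental m) \<Longrightarrow> Fn1 (osimplex m G) (Ori1 S) = Fn1 G S"
    "c \<in> Cell (oriental m) \<Longrightarrow> Fn2 (osimplex m G) (Ori2 c) = Fn2 G c"
  using tagged[of ori_tag "Simp m" "oriental m" C G] assms two_category_oriental
  by (simp_all add: osimplex_def)

lemma two_functor_unit_at:
  assumes "two_functor (oriental m) C G"
  shows "two_functor (oriental m) (categorification (nerve C)) (unit_at C m G)"
  using two_functor_comp[OF two_functor_tag(1)[OF inj_tags(1)] two_functor_unit[OF osimplex(1)[OF assms], unfolded realize.simps]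
    two_category_oriental]
  by (simp add: unit_at_def)

lemma osimplex_cong:
  assumes "two_functor (oriental m) C G" "two_functor (oriental m) C G'"
    and "\<And>i. i \<le> m \<Longrightarrow> Fn0 G i = Fn0 G' i" "\<And>S. S \<in> Mor (oriental m) \<Longrightarrow> Fn1 G S = Fn1 G' S"
    and "\<And>c. c \<in> Cell (oriental m) \<Longrightarrow> Fn2 G c = Fn2 G' c"
  shows "osimplex m G = osimplex m G'"
  by (rule simplex_eqI[OF inj_tags(1) realize.simps(1) osimplex(1)[OF assms(1)] osimplex(1)[OF assms(2)]])
    (use assms in \<open>simp_all add: osimplex[OF assms(1)] osimplex[OF assms(2)]\<close>)

text \<open>By the universal property of orientals it suffices to compare vertices, edges and triangles.\<close>

lemma unit_at_cong:
  assumes "two_category C" "two_functor (oriental m) C G" "two_functor (oriental m) C G'"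
    and "\<And>i. i \<le> m \<Longrightarrow> Fn0 G i = Fn0 G' i" "\<And>i j. i < j \<Longrightarrow> j \<le> m \<Longrightarrow> Fn1 G {i, j} = Fn1 G' {i, j}"
    and "\<And>i j k. i < j \<Longrightarrow> j < k \<Longrightarrow> k \<le> m \<Longrightarrow> Fn2 G ({i, k}, {i, j, k}) = Fn2 G' ({i, k}, {i, j, k})"
  shows "unit_at C m G = unit_at C m G'"
proof -
  have "osimplex m G = osimplex m G'"
    using ofun_unique[OF assms(2,3,1,4,5)] assms(6) by (intro osimplex_cong[OF assms(2,3,4)]) blast+
  then show ?thesis by (simp add: unit_at_def)
qed

text \<open>The relations of the categorification identify the units at the two simplices related by a structure map.\<close>

lemma unit_at_structure_map:
  assumes G: "two_functor (oriental m) C G"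
    and u: "td_arr u" "td_dom u = Simp k" "td_cod u = Simp m" "pre_realize_map u = tag_fun ori_tag ori_tag (ori_map \<phi>)"
    and \<phi>: "mono \<phi>" "\<And>i. i \<le> k \<Longrightarrow> \<phi> i \<le> m"
  shows "i \<le> k \<Longrightarrow> Fn0 (unit_at C k (ocomp G \<phi>)) i = Fn0 (unit_at C m G) (\<phi> i)"
    "S \<in> Mor (oriental k) \<Longrightarrow> Fn1 (unit_at C k (ocomp G \<phi>)) S = Fn1 (unit_at C m G) (\<phi> ` S)"
    "(S, T) \<in> Cell (oriental k) \<Longrightarrow> Fn2 (unit_at C k (ocomp G \<phi>)) (S, T) = Fn2 (unit_at C m G) (\<phi> ` S, \<phi> ` T)"
proof -
  interpret F: two_functor "oriental k" "oriental m" "ori_map \<phi>" by (rule two_functor_ori_map[OF \<phi>])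
  have r: "i \<in> Ob (oriental k) \<Longrightarrow> Fn0 (realize_map u) (Ori0 i) = Ori0 (\<phi> i)"
    "S \<in> Mor (oriental k) \<Longrightarrow> Fn1 (realize_map u) (Ori1 S) = Ori1 (\<phi> ` S)"
    "c \<in> Cell (oriental k) \<Longrightarrow> Fn2 (realize_map u) (Ori2 c) = Ori2 (map_prod (image \<phi>) (image \<phi>) c)" for i S c
    using tag_fun_simps[OF inj_tags(1), of ori_tag "ori_map \<phi>"]
    by (simp_all add: realize_map_def u ori_map_def)
  note G' = two_functor_ocomp[OF G \<phi>]
  note in' = osimplex(1)[OF G, folded u(3)]
  have c: "map_prod (image \<phi>) (image \<phi>) c \<in> Cell (oriental m)" if "c \<in> Cell (oriental k)" for c
    using F.Fn2_in[OF that] by (simp add: ori_map_def)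
  have act: "act (nerve C) u (osimplex m G) = osimplex k (ocomp G \<phi>)"
  proof (rule simplex_eqI[OF inj_tags(1) realize.simps(1)])
    show "act (nerve C) u (osimplex m G) \<in> simplices (nerve C) (Simp k)"
      using act_nerve_in[OF u(1) in'] u(2) by simp
    show "osimplex k (ocomp G \<phi>) \<in> simplices (nerve C) (Simp k)" by (rule osimplex(1)[OF G'])
    fix i S d
    show "i \<in> Ob (oriental k) \<Longrightarrow> Fn0 (act (nerve C) u (osimplex m G)) (Fn0 ori_tag i) = Fn0 (osimplex k (ocomp G \<phi>)) (Fn0 ori_tag i)"
      using F.Fn0_in[of i] by (simp add: act_nerve u(2) r osimplex[OF G] osimplex[OF G'] ori_map_def)
    show "S \<in> Mor (oriental k) \<Longrightarrow> Fn1 (act (nerve C) u (osimplex m G)) (Fn1 ori_tag S) = Fn1 (osimplex k (ocomp G \<phi>)) (Fn1 ori_tag S)"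
      using F.Fn1_in[of S] by (simp add: act_nerve u(2) r osimplex[OF G] osimplex[OF G'] ori_map_def)
    show "d \<in> Cell (oriental k) \<Longrightarrow> Fn2 (act (nerve C) u (osimplex m G)) (Fn2 ori_tag d) = Fn2 (osimplex k (ocomp G \<phi>)) (Fn2 ori_tag d)"
      using c[of d] by (cases d) (simp add: act_nerve u(2) r osimplex[OF G] osimplex[OF G'])
  qed
  note g = unit_glue[OF u(1) in' act_nerve_in[OF u(1) in'], unfolded u(2,3) act]
  show "i \<le> k \<Longrightarrow> Fn0 (unit_at C k (ocomp G \<phi>)) i = Fn0 (unit_at C m G) (\<phi> i)"
    using g(1)[of "Ori0 i"] r(1)[of i] by (simp add: unit_at_def)
  show "S \<in> Mor (oriental k) \<Longrightarrow> Fn1 (unit_at C k (ocomp G \<phi>)) S = Fn1 (unit_at C m G) (\<phi> ` S)"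
    using g(2)[of "Ori1 S"] r(2)[of S] by (simp add: unit_at_def)
  show "(S, T) \<in> Cell (oriental k) \<Longrightarrow> Fn2 (unit_at C k (ocomp G \<phi>)) (S, T) = Fn2 (unit_at C m G) (\<phi> ` S, \<phi> ` T)"
    using g(3)[of "Ori2 (S, T)"] r(3)[of "(S, T)"] by (simp add: unit_at_def)
qed

text \<open>Compatibility with all injective monotone maps follows by factoring them through cofaces.  It is
  used to restrict a simplex to its vertices, edges and triangles.\<close>

lemma unit_at_injective:
  assumes C: "two_category C" and "k \<le> m" and G: "two_functor (oriental m) C G"
    and \<phi>: "mono \<phi>" "\<And>i j. i < j \<Longrightarrow> j \<le> k \<Longrightarrow> \<phi> i < \<phi> j" "\<And>i. i \<le> k \<Longrightarrow> \<phi> i \<le> m"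
  shows "(\<forall>i \<le> k. Fn0 (unit_at C k (ocomp G \<phi>)) i = Fn0 (unit_at C m G) (\<phi> i))
    \<and> (\<forall>S \<in> Mor (oriental k). Fn1 (unit_at C k (ocomp G \<phi>)) S = Fn1 (unit_at C m G) (\<phi> ` S))
    \<and> (\<forall>(S, T) \<in> Cell (oriental k). Fn2 (unit_at C k (ocomp G \<phi>)) (S, T) = Fn2 (unit_at C m G) (\<phi> ` S, \<phi> ` T))"
  using assms(2) G \<phi>
proof (induction m arbitrary: G \<phi> rule: nat_induct_at_least)
  case base
  have id: "\<phi> i = i" if "i \<le> k" for i
    using increasing_endo[of k \<phi> i] base that by auto
  have im: "\<phi> ` S = S" if "S \<subseteq> {0..k}" for S
  proof -
    have "\<phi> ` S = (\<lambda>i. i) ` S" using that id by (intro image_cong) auto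
    then show ?thesis by simp
  qed
  have "osimplex k (ocomp G \<phi>) = osimplex k G"
    by (rule osimplex_cong[OF two_functor_ocomp[OF base(1,2,4)] base(1)])
      (auto simp: id im Mor_oriental Cell_oriental dest!: ocell_subset)
  then show ?case by (auto simp: unit_at_def id im Mor_oriental Cell_oriental dest!: ocell_subset)
next
  case (Suc m)
  have "card (\<phi> ` {0..k}) \<le> Suc k" using card_image_le[of "{0..k}" \<phi>] by simp
  then have "\<phi> ` {0..k} \<noteq> {0..Suc m}" using Suc.hyps by auto
  moreover have "\<phi> ` {0..k} \<subseteq> {0..Suc m}" using Suc.prems(4) by auto
  ultimately obtain i where "i \<in> {0..Suc m}" and i': "i \<notin> \<phi> ` {0..k}" by blast
  \<comment> \<open>A missed value \<open>i\<close> makes \<open>\<phi>\<close> factor through the coface that skips \<open>i\<close>.\<close>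
  then have i: "i \<le> Suc m" "i \<notin> \<phi> ` {0..k}" by simp_all
  define \<psi> where "\<psi> = codegen i \<circ> \<phi>"
  have ne: "\<phi> j \<noteq> i" if "j \<le> k" for j using i(2) that by auto
  have \<phi>\<psi>: "coface i (\<psi> j) = \<phi> j" if "j \<le> k" for j
    using ne[OF that] by (auto simp: \<psi>_def coface_def codegen_def)
  have \<psi>: "mono \<psi>" "\<And>a b. a < b \<Longrightarrow> b \<le> k \<Longrightarrow> \<psi> a < \<psi> b" "\<And>a. a \<le> k \<Longrightarrow> \<psi> a \<le> m"
  proof -
    show "mono \<psi>" using Suc.prems(2) mono_codegen[of i] by (auto simp: \<psi>_def mono_def)
    show "\<psi> a < \<psi> b" if "a < b" "b \<le> k" for a b
      using Suc.prems(3)[OF that] ne[of a] ne[of b] that by (auto simp: \<psi>_def codegen_def)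
    show "\<psi> a \<le> m" if "a \<le> k" for a
      using Suc.prems(4)[OF that] ne[OF that] i(1) by (auto simp: \<psi>_def codegen_def)
  qed
  have im: "coface i ` \<psi> ` S = \<phi> ` S" if "S \<subseteq> {0..k}" for S
    unfolding image_image by (rule image_cong) (use that \<phi>\<psi> in auto)
  have imc: "\<psi> ` S \<in> Mor (oriental m)" if "S \<in> Mor (oriental k)" for S
    using that \<psi>(3) by (auto simp: Mor_oriental subset_iff)
  have Gc: "two_functor (oriental m) C (ocomp G (coface i))"
    by (rule two_functor_ocomp[OF Suc.prems(1) mono_coface]) (use i in \<open>auto simp: coface_def\<close>)
  interpret F: two_functor "oriental k" "oriental m" "ori_map \<psi>" by (rule two_functor_ori_map[OF \<psi>(1,3)])
  have os: "osimplex k (ocomp (ocomp G (coface i)) \<psi>) = osimplex k (ocomp G \<phi>)"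
    by (rule osimplex_cong[OF two_functor_ocomp[OF Gc \<psi>(1,3)] two_functor_ocomp[OF Suc.prems(1,2,4)]])
      (auto simp: \<phi>\<psi> im Mor_oriental Cell_oriental dest!: ocell_subset)
  have eq: "unit_at C k (ocomp (ocomp G (coface i)) \<psi>) = unit_at C k (ocomp G \<phi>)"
    by (simp add: unit_at_def os)
  note f = unit_at_structure_map[OF Suc.prems(1), of "CoF m i" m "coface i", simplified]
  have f0: "Fn0 (unit_at C m (ocomp G (coface i))) (\<psi> j) = Fn0 (unit_at C (Suc m) G) (\<phi> j)" if "j \<le> k" for j
    using f(1)[of "\<psi> j"] i(1) mono_coface \<psi>(3)[OF that] \<phi>\<psi>[OF that] by (simp add: coface_def)
  have f1: "Fn1 (unit_at C m (ocomp G (coface i))) (\<psi> ` S) = Fn1 (unit_at C (Suc m) G) (\<phi> ` S)" if "S \<in> Mor (oriental k)" for S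
    using f(2)[of "\<psi> ` S"] i(1) mono_coface imc[OF that] im[of S] that by (simp add: coface_def Mor_oriental)
  have f2: "Fn2 (unit_at C m (ocomp G (coface i))) (\<psi> ` S, \<psi> ` T) = Fn2 (unit_at C (Suc m) G) (\<phi> ` S, \<phi> ` T)"
    if "(S, T) \<in> Cell (oriental k)" for S T
    using f(3)[of "\<psi> ` S" "\<psi> ` T"] i(1) mono_coface F.Fn2_in[OF that] im[of S] im[of T]
      ocellD[OF that[unfolded Cell_oriental]] by (simp add: coface_def ori_map_def)
  show ?case using Suc.IH[OF Gc \<psi>] unfolding eq using f0 f1 f2 by auto
qed

lemma Mor_pair: "i \<le> j \<Longrightarrow> j \<le> m \<Longrightarrow> {i, j} \<in> Mor (oriental m)"
  by (simp add: Mor_oriental)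

lemma Cell_triple: "i \<le> j \<Longrightarrow> j \<le> k \<Longrightarrow> k \<le> m \<Longrightarrow> ({i, k}, {i, j, k}) \<in> Cell (oriental m)"
  by (auto simp: Cell_oriental ocell_def)

definition vertex :: "('o, 'm, 'c) two_cat \<Rightarrow> 'o \<Rightarrow> (nat, nat set, nat set \<times> nat set, 'o, 'm, 'c) two_fun" where
  "vertex C x = simplex.diagram C (\<lambda>_. x) (\<lambda>_ _. IdM C x) (\<lambda>_ _ _. IdC C (IdM C x))"

definition edge :: "('o, 'm, 'c) two_cat \<Rightarrow> 'm \<Rightarrow> (nat, nat set, nat set \<times> nat set, 'o, 'm, 'c) two_fun" where
  "edge C h = simplex.diagram C (\<lambda>i. if i = 0 then Src C h else Tgt C h) (\<lambda>_ _. h) (\<lambda>_ _ _. IdC C h)"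

definition triangle2 :: "('o, 'm, 'c) two_cat \<Rightarrow> 'c \<Rightarrow> 'm \<Rightarrow> 'm
    \<Rightarrow> (nat, nat set, nat set \<times> nat set, 'o, 'm, 'c) two_fun" where
  "triangle2 C \<alpha> k h = simplex.diagram C (\<lambda>i. if i = 0 then Src C h else if i = 1 then Tgt C h else Tgt C k)
     (\<lambda>i j. if i = 0 then (if j = 1 then h else Dom C \<alpha>) else k) (\<lambda>_ _ _. \<alpha>)"

definition tetrahedron3 :: "('o, 'm, 'c) two_cat \<Rightarrow> 'm \<Rightarrow> 'm \<Rightarrow> 'm \<Rightarrow> 'c \<Rightarrow> 'c \<Rightarrow> 'c \<Rightarrow> 'c
    \<Rightarrow> (nat, nat set, nat set \<times> nat set, 'o, 'm, 'c) two_fun" where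
  "tetrahedron3 C f01 f12 f23 a012 a123 a013 a023 = simplex.diagram C
     (\<lambda>i. if i = 0 then Src C f01 else if i = 1 then Src C f12 else if i = 2 then Src C f23 else Tgt C f23)
     (\<lambda>i j. if i = 0 then (if j = 1 then f01 else if j = 2 then Dom C a012 else Dom C a013)
       else if i = 1 then (if j = 2 then f12 else Dom C a123) else f23)
     (\<lambda>i j k. if i = 0 then (if j = 1 then (if k = 2 then a012 else a013) else a023) else a123)"

locale nerve_of = C: two_category C for C :: "('o, 'm, 'c) two_cat"
begin

abbreviation "K \<equiv> categorification (nerve C)"

sublocale K: two_category K by (rule two_category_categorification)

text \<open>The pseudofunctor from \<open>C\<close> to the categorified nerve sends a cell of \<open>C\<close> to the nondegenerate cell of the
  simplex that it forms.\<close>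

definition s0 where "s0 x = Fn0 (unit_at C 0 (vertex C x)) 0"

definition s1 where "s1 h = Fn1 (unit_at C 1 (edge C h)) {0, 1}"

definition T where "T \<alpha> k h = Fn2 (unit_at C 2 (triangle2 C \<alpha> k h)) ({0, 2}, {0, 1, 2})"

lemma vertex:
  assumes "x \<in> Ob C"
  shows "two_functor (oriental 0) C (vertex C x)" "Fn0 (vertex C x) i = x"
proof -
  interpret simplex C 0 "\<lambda>_. x" "\<lambda>_ _. IdM C x" "\<lambda>_ _ _. IdC C (IdM C x)"
    by unfold_locales (use assms in auto)
  show "two_functor (oriental 0) C (vertex C x)" "Fn0 (vertex C x) i = x"
    using two_functor_diagram diagram_values by (simp_all add: vertex_def)
qed

lemma edge:
  assumes "h \<in> Mor C"
  shows "two_functor (oriental 1) C (edge C h)" "Fn0 (edge C h) 0 = Src C h" "Fn0 (edge C h) 1 = Tgt C h"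
    "Fn1 (edge C h) {0, 1} = h"
proof -
  interpret simplex C 1 "\<lambda>i. if i = 0 then Src C h else Tgt C h" "\<lambda>_ _. h" "\<lambda>_ _ _. IdC C h"
    by unfold_locales (use assms in \<open>auto simp: C.typing\<close>)
  show "two_functor (oriental 1) C (edge C h)" "Fn0 (edge C h) 0 = Src C h" "Fn0 (edge C h) 1 = Tgt C h"
    "Fn1 (edge C h) {0, 1} = h"
    using two_functor_diagram diagram_values(1) diagram_values(2)[of 0 1] by (simp_all add: edge_def)
qed

lemma triangle2:
  assumes "h \<in> Mor C" "k \<in> Mor C" "Tgt C h = Src C k" "\<alpha> \<in> Cell C" "Cod C \<alpha> = k \<odot>\<^bsub>C\<^esub> h"
  shows "two_functor (oriental 2) C (triangle2 C \<alpha> k h)"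
    "Fn0 (triangle2 C \<alpha> k h) 0 = Src C h" "Fn0 (triangle2 C \<alpha> k h) 1 = Tgt C h" "Fn0 (triangle2 C \<alpha> k h) 2 = Tgt C k"
    "Fn1 (triangle2 C \<alpha> k h) {0, 1} = h" "Fn1 (triangle2 C \<alpha> k h) {1, 2} = k" "Fn1 (triangle2 C \<alpha> k h) {0, 2} = Dom C \<alpha>"
    "Fn2 (triangle2 C \<alpha> k h) ({0, 2}, {0, 1, 2}) = \<alpha>"
proof -
  have [simp]: "Src C (Dom C \<alpha>) = Src C h" "Tgt C (Dom C \<alpha>) = Tgt C k"
    using C.Src_Cod[of \<alpha>] C.Tgt_Cod[of \<alpha>] assms by (simp_all add: C.typing)
  have le2: "i = 0 \<or> i = 1 \<or> i = 2" if "i \<le> 2" for i :: nat using that by linarith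
  interpret simplex C 2 "\<lambda>i. if i = 0 then Src C h else if i = 1 then Tgt C h else Tgt C k"
     "\<lambda>i j. if i = 0 then (if j = 1 then h else Dom C \<alpha>) else k" "\<lambda>_ _ _. \<alpha>"
    by unfold_locales (use assms in \<open>auto simp: C.typing dest!: le2\<close>)
  show "two_functor (oriental 2) C (triangle2 C \<alpha> k h)"
    "Fn0 (triangle2 C \<alpha> k h) 0 = Src C h" "Fn0 (triangle2 C \<alpha> k h) 1 = Tgt C h" "Fn0 (triangle2 C \<alpha> k h) 2 = Tgt C k"
    "Fn1 (triangle2 C \<alpha> k h) {0, 1} = h" "Fn1 (triangle2 C \<alpha> k h) {1, 2} = k" "Fn1 (triangle2 C \<alpha> k h) {0, 2} = Dom C \<alpha>"
    "Fn2 (triangle2 C \<alpha> k h) ({0, 2}, {0, 1, 2}) = \<alpha>"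
    using two_functor_diagram diagram_values(1) diagram_values(2)[of 0 1] diagram_values(2)[of 1 2]
      diagram_values(2)[of 0 2] diagram_values(3)[of 0 1 2] by (simp_all add: triangle2_def)
qed

text \<open>The image of a vertex, edge or triangle of a simplex in \<open>K\<close> depends on that vertex, edge or triangle
  only, since the unit is compatible with restriction to faces.\<close>

context
  fixes m G assumes G: "two_functor (oriental m) C G"
begin

interpretation D: oriental_diagram C m G
  using C.two_category_axioms G by (simp add: oriental_diagram_def)

lemma unit_at_vertex:
  assumes "i \<le> m"
  shows "Fn0 (unit_at C m G) i = s0 (Fn0 G i)"
proof -
  have x: "Fn0 G i \<in> Ob C" using D.G.Fn0_in assms by simp
  have "unit_at C 0 (ocomp G (\<lambda>_. i)) = unit_at C 0 (vertex C (Fn0 G i))"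
    by (rule unit_at_cong[OF C.two_category_axioms two_functor_ocomp[OF G] vertex(1)[OF x]])
      (use assms in \<open>auto simp: mono_def vertex(2)[OF x]\<close>)
  then show ?thesis
    using unit_at_injective[OF C.two_category_axioms _ G, of 0 "\<lambda>_. i"] assms by (simp add: s0_def mono_def)
qed

lemma unit_at_edge:
  assumes "i < j" "j \<le> m"
  shows "Fn1 (unit_at C m G) {i, j} = s1 (Fn1 G {i, j})"
proof -
  define \<phi> where "\<phi> = (\<lambda>n::nat. if n = 0 then i else j)"
  have \<phi>v: "\<phi> 0 = i" "\<phi> 1 = j" by (simp_all add: \<phi>_def)
  have \<phi>: "mono \<phi>" "\<And>n. n \<le> 1 \<Longrightarrow> \<phi> n \<le> m" "\<And>a b. a < b \<Longrightarrow> b \<le> 1 \<Longrightarrow> \<phi> a < \<phi> b"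
    using assms by (auto simp: mono_def \<phi>_def)
  have d: "Fn1 G {i, j} \<in> Mor C" "Src C (Fn1 G {i, j}) = Fn0 G i" "Tgt C (Fn1 G {i, j}) = Fn0 G j"
    using D.edge[of i j] assms by simp_all
  have "unit_at C 1 (ocomp G \<phi>) = unit_at C 1 (edge C (Fn1 G {i, j}))"
  proof (rule unit_at_cong[OF C.two_category_axioms two_functor_ocomp[OF G \<phi>(1,2)] edge(1)[OF d(1)]])
    fix a b c :: nat
    show "Fn0 (ocomp G \<phi>) a = Fn0 (edge C (Fn1 G {i, j})) a" if "a \<le> 1"
    proof -
      have "a = 0 \<or> a = 1" using that by linarith
      then show ?thesis using edge(2,3)[OF d(1)] d \<phi>v by (auto simp del: One_nat_def)
    qed
    show "Fn1 (ocomp G \<phi>) {a, b} = Fn1 (edge C (Fn1 G {i, j})) {a, b}" if "a < b" "b \<le> 1"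
    proof -
      have "a = 0" "b = 1" using that by linarith+
      then show ?thesis using edge(4)[OF d(1)] d \<phi>v by (simp del: One_nat_def)
    qed
    show "Fn2 (ocomp G \<phi>) ({a, c}, {a, b, c}) = Fn2 (edge C (Fn1 G {i, j})) ({a, c}, {a, b, c})"
      if "a < b" "b < c" "c \<le> 1"
      using that by linarith
  qed
  moreover have "Fn1 (unit_at C 1 (ocomp G \<phi>)) {0, 1} = Fn1 (unit_at C m G) (\<phi> ` {0, 1})"
    using bspec[OF unit_at_injective[OF C.two_category_axioms _ G \<phi>(1,3,2), THEN conjunct2, THEN conjunct1]
      Mor_pair[of 0 1 1]] assms by (simp del: One_nat_def image_insert)
  ultimately show ?thesis using \<phi>v by (simp add: s1_def del: One_nat_def)
qed

lemma unit_at_triangle: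
  assumes "i < j" "j < k" "k \<le> m"
  shows "Fn2 (unit_at C m G) ({i, k}, {i, j, k}) = T (Fn2 G ({i, k}, {i, j, k})) (Fn1 G {j, k}) (Fn1 G {i, j})"
proof -
  define \<phi> where "\<phi> = (\<lambda>n::nat. if n = 0 then i else if n = 1 then j else k)"
  have \<phi>v: "\<phi> 0 = i" "\<phi> 1 = j" "\<phi> 2 = k" by (simp_all add: \<phi>_def)
  let ?t = "triangle2 C (Fn2 G ({i, k}, {i, j, k})) (Fn1 G {j, k}) (Fn1 G {i, j})"
  have \<phi>: "mono \<phi>" "\<And>n. n \<le> 2 \<Longrightarrow> \<phi> n \<le> m" "\<And>a b. a < b \<Longrightarrow> b \<le> 2 \<Longrightarrow> \<phi> a < \<phi> b"
    using assms by (auto simp: mono_def \<phi>_def)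
  have d: "Fn1 G {i, j} \<in> Mor C" "Src C (Fn1 G {i, j}) = Fn0 G i" "Tgt C (Fn1 G {i, j}) = Fn0 G j"
    "Fn1 G {j, k} \<in> Mor C" "Src C (Fn1 G {j, k}) = Fn0 G j" "Tgt C (Fn1 G {j, k}) = Fn0 G k"
    "Fn2 G ({i, k}, {i, j, k}) \<in> Cell C" "Dom C (Fn2 G ({i, k}, {i, j, k})) = Fn1 G {i, k}"
    "Cod C (Fn2 G ({i, k}, {i, j, k})) = Fn1 G {j, k} \<odot>\<^bsub>C\<^esub> Fn1 G {i, j}"
    using D.edge[of i j] D.edge[of j k] D.tri[of i j k] assms by simp_all
  have st: "Tgt C (Fn1 G {i, j}) = Src C (Fn1 G {j, k})" by (simp add: d)
  note t = triangle2[OF d(1,4) st d(7,9)]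
  have le2: "n = 0 \<or> n = 1 \<or> n = 2" if "n \<le> 2" for n :: nat using that by linarith
  have "unit_at C 2 (ocomp G \<phi>) = unit_at C 2 ?t"
  proof (rule unit_at_cong[OF C.two_category_axioms two_functor_ocomp[OF G \<phi>(1,2)] t(1)])
    fix a b c :: nat
    show "a \<le> 2 \<Longrightarrow> Fn0 (ocomp G \<phi>) a = Fn0 ?t a"
      using le2[of a] t(2-4) d \<phi>v by (auto simp del: One_nat_def)
    show "Fn1 (ocomp G \<phi>) {a, b} = Fn1 ?t {a, b}" if "a < b" "b \<le> 2"
    proof -
      have "(a = 0 \<and> b = 1) \<or> (a = 1 \<and> b = 2) \<or> (a = 0 \<and> b = 2)" using that by linarith
      then show ?thesis using t(5-7) d \<phi>v by (auto simp del: One_nat_def)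
    qed
    show "Fn2 (ocomp G \<phi>) ({a, c}, {a, b, c}) = Fn2 ?t ({a, c}, {a, b, c})" if "a < b" "b < c" "c \<le> 2"
    proof -
      have "a = 0" "b = 1" "c = 2" using that by linarith+
      then show ?thesis using t(8) \<phi>v by (simp del: One_nat_def)
    qed
  qed
  moreover have "Fn2 (unit_at C 2 (ocomp G \<phi>)) ({0, 2}, {0, 1, 2}) = Fn2 (unit_at C m G) (\<phi> ` {0, 2}, \<phi> ` {0, 1, 2})"
    using bspec[OF unit_at_injective[OF C.two_category_axioms _ G \<phi>(1,3,2), THEN conjunct2, THEN conjunct2]
      Cell_triple[of 0 1 2 2]] assms by (simp del: One_nat_def image_insert)
  ultimately show ?thesis using \<phi>v by (simp add: T_def del: One_nat_def)
qed

end

end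

lemma marked_tag_simps [simp]:
  "Fn0 inv_tag = Inv0" "Fn1 inv_tag = Inv1" "Fn2 inv_tag = Inv2"
  "Fn0 adj_tag = Adj0" "Fn1 adj_tag = Adj1" "Fn2 adj_tag = Adj2"
  by (simp_all add: inv_tag_def adj_tag_def)

context nerve_of
begin

lemma unit_diagram:
  "two_functor (oriental m) C G \<Longrightarrow> oriental_diagram K m (unit_at C m G)"
  using two_functor_unit_at K.two_category_axioms by (simp add: oriental_diagram_def)

lemma tetrahedron3:
  assumes f: "f01 \<in> Mor C" "f12 \<in> Mor C" "f23 \<in> Mor C" "Tgt C f01 = Src C f12" "Tgt C f12 = Src C f23"
    and a: "a012 \<in> Cell C" "Cod C a012 = f12 \<odot>\<^bsub>C\<^esub> f01" "a123 \<in> Cell C" "Cod C a123 = f23 \<odot>\<^bsub>C\<^esub> f12"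
        "a013 \<in> Cell C" "Cod C a013 = Dom C a123 \<odot>\<^bsub>C\<^esub> f01" "a023 \<in> Cell C" "Cod C a023 = f23 \<odot>\<^bsub>C\<^esub> Dom C a012"
        "Dom C a023 = Dom C a013"
    and eq: "(a123 \<star>\<^bsub>C\<^esub> \<iota>\<^bsub>C\<^esub> f01) \<cdot>\<^bsub>C\<^esub> a013 = (\<iota>\<^bsub>C\<^esub> f23 \<star>\<^bsub>C\<^esub> a012) \<cdot>\<^bsub>C\<^esub> a023"
  defines "G \<equiv> tetrahedron3 C f01 f12 f23 a012 a123 a013 a023"
  shows "two_functor (oriental 3) C G"
    "Fn1 G {0, 1} = f01" "Fn1 G {1, 2} = f12" "Fn1 G {2, 3} = f23" "Fn1 G {0, 2} = Dom C a012" "Fn1 G {1, 3} = Dom C a123"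
    "Fn2 G ({0, 2}, {0, 1, 2}) = a012" "Fn2 G ({1, 3}, {1, 2, 3}) = a123"
    "Fn2 G ({0, 3}, {0, 1, 3}) = a013" "Fn2 G ({0, 3}, {0, 2, 3}) = a023"
proof -
  have st: "Src C (Dom C a012) = Src C f01" "Tgt C (Dom C a012) = Src C f23"
    "Src C (Dom C a123) = Src C f12" "Tgt C (Dom C a123) = Tgt C f23"
    using C.Src_Cod[of a012] C.Tgt_Cod[of a012] C.Src_Cod[of a123] C.Tgt_Cod[of a123] f a
    by (simp_all add: C.typing)
  then have st': "Src C (Dom C a013) = Src C f01" "Tgt C (Dom C a013) = Tgt C f23"
    using C.Src_Cod[of a013] C.Tgt_Cod[of a013] f a by (simp_all add: C.typing)
  let ?p = "\<lambda>i::nat. if i = 0 then Src C f01 else if i = 1 then Src C f12 else if i = 2 then Src C f23 else Tgt C f23"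
  let ?e = "\<lambda>i j :: nat. if i = 0 then (if j = 1 then f01 else if j = 2 then Dom C a012 else Dom C a013)
       else if i = 1 then (if j = 2 then f12 else Dom C a123) else f23"
  let ?t = "\<lambda>i j k :: nat. if i = 0 then (if j = 1 then (if k = 2 then a012 else a013) else a023) else a123"
  interpret simplex C 3 ?p ?e ?t
  proof
    fix i j k l :: nat
    show "?p i \<in> Ob C" using f by (simp add: C.typing)
    show "?e i j \<in> Mor C \<and> Src C (?e i j) = ?p i \<and> Tgt C (?e i j) = ?p j" if "i < j" "j \<le> 3"
    proof -
      have "(i = 0 \<and> j = 1) \<or> (i = 0 \<and> j = 2) \<or> (i = 0 \<and> j = 3) \<or> (i = 1 \<and> j = 2) \<or> (i = 1 \<and> j = 3) \<or> (i = 2 \<and> j = 3)"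
        using that by linarith
      then show ?thesis using f a st st' by (elim disjE) (simp_all add: C.typing)
    qed
    show "?t i j k \<in> Cell C \<and> Dom C (?t i j k) = ?e i k \<and> Cod C (?t i j k) = ?e j k \<odot>\<^bsub>C\<^esub> ?e i j"
      if "i < j" "j < k" "k \<le> 3"
    proof -
      have "(i = 0 \<and> j = 1 \<and> k = 2) \<or> (i = 0 \<and> j = 1 \<and> k = 3) \<or> (i = 0 \<and> j = 2 \<and> k = 3) \<or> (i = 1 \<and> j = 2 \<and> k = 3)"
        using that by linarith
      then show ?thesis using f a by (elim disjE) simp_all
    qed
    show "(?t j k l \<star>\<^bsub>C\<^esub> \<iota>\<^bsub>C\<^esub> (?e i j)) \<cdot>\<^bsub>C\<^esub> ?t i j l = (\<iota>\<^bsub>C\<^esub> (?e k l) \<star>\<^bsub>C\<^esub> ?t i j k) \<cdot>\<^bsub>C\<^esub> ?t i k l"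
      if "i < j" "j < k" "k < l" "l \<le> 3"
    proof -
      have "i = 0" "j = 1" "k = 2" "l = 3" using that by linarith+
      then show ?thesis using eq by simp
    qed
  qed
  have G: "G = diagram" by (simp add: G_def tetrahedron3_def)
  show "two_functor (oriental 3) C G" unfolding G by (rule two_functor_diagram)
  show "Fn1 G {0, 1} = f01" "Fn1 G {1, 2} = f12" "Fn1 G {2, 3} = f23" "Fn1 G {0, 2} = Dom C a012" "Fn1 G {1, 3} = Dom C a123"
    "Fn2 G ({0, 2}, {0, 1, 2}) = a012" "Fn2 G ({1, 3}, {1, 2, 3}) = a123"
    "Fn2 G ({0, 3}, {0, 1, 3}) = a013" "Fn2 G ({0, 3}, {0, 2, 3}) = a023"
    unfolding G
    using diagram_values(2)[of 0 1] diagram_values(2)[of 1 2] diagram_values(2)[of 2 3] diagram_values(2)[of 0 2]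
      diagram_values(2)[of 1 3] diagram_values(3)[of 0 1 2] diagram_values(3)[of 1 2 3]
      diagram_values(3)[of 0 1 3] diagram_values(3)[of 0 2 3] by simp_all
qed

lemma T_typing:
  assumes "h \<in> Mor C" "k \<in> Mor C" "Tgt C h = Src C k" "\<alpha> \<in> Cell C" "Cod C \<alpha> = k \<odot>\<^bsub>C\<^esub> h"
  shows "T \<alpha> k h \<in> Cell K \<and> Dom K (T \<alpha> k h) = s1 (Dom C \<alpha>) \<and> Cod K (T \<alpha> k h) = s1 k \<odot>\<^bsub>K\<^esub> s1 h"
proof -
  note t = triangle2[OF assms]
  interpret U: oriental_diagram K 2 "unit_at C 2 (triangle2 C \<alpha> k h)" by (rule unit_diagram[OF t(1)])
  show ?thesis
    using U.tri[of 0 1 2] unit_at_edge[OF t(1), of 0 1] unit_at_edge[OF t(1), of 1 2] unit_at_edge[OF t(1), of 0 2]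
      t(5-7) unfolding T_def by (simp del: One_nat_def)
qed

text \<open>The triangles in question are the two degeneracies of the edge \<open>h\<close>.\<close>

lemma T_unit:
  assumes h: "h \<in> Mor C"
  shows "T (\<iota>\<^bsub>C\<^esub> h) (IdM C (Tgt C h)) h = \<iota>\<^bsub>K\<^esub> (s1 h)" "T (\<iota>\<^bsub>C\<^esub> h) h (IdM C (Src C h)) = \<iota>\<^bsub>K\<^esub> (s1 h)"
proof -
  note e = edge[OF h]
  interpret E: oriental_diagram C 1 "edge C h" using e(1) C.two_category_axioms by (simp add: oriental_diagram_def)
  interpret U: oriental_diagram K 1 "unit_at C 1 (edge C h)" by (rule unit_diagram[OF e(1)])
  have id: "Fn2 (unit_at C 1 (edge C h)) ({0, 1}, {0, 1}) = \<iota>\<^bsub>K\<^esub> (s1 h)"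
    using U.tri_refl[of 0 1] unit_at_edge[OF e(1), of 0 1] e(4) by (simp del: One_nat_def)
  have C1: "Fn2 (edge C h) ({0, 1}, {0, 1}) = \<iota>\<^bsub>C\<^esub> h" using E.tri_refl[of 0 1] e(4) by (simp del: One_nat_def)
  have cg: "codegen 1 0 = 0" "codegen 1 1 = 1" "codegen 1 2 = 1" "codegen 0 0 = 0" "codegen 0 1 = 0" "codegen 0 2 = 1"
    by (simp_all add: codegen_def)
  have le: "n \<le> 2 \<Longrightarrow> codegen i n \<le> 1" if "i \<le> 1" for i n using that by (auto simp: codegen_def)
  have F: "two_functor (oriental 2) C (ocomp (edge C h) (codegen i))" if "i \<le> 1" for i
    by (rule two_functor_ocomp[OF e(1) mono_codegen le[OF that]])
  have s: "Fn2 (unit_at C 2 (ocomp (edge C h) (codegen i))) ({0, 2}, {0, 1, 2})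
      = Fn2 (unit_at C 1 (edge C h)) (codegen i ` {0, 2}, codegen i ` {0, 1, 2})" if "i \<le> 1" for i
    using unit_at_structure_map(3)[OF e(1), of "CoD 1 i" 2 "codegen i", OF _ _ _ _ mono_codegen le[OF that]]
      that Cell_triple[of 0 1 2 2] by (simp del: image_insert)
  show "T (\<iota>\<^bsub>C\<^esub> h) (IdM C (Tgt C h)) h = \<iota>\<^bsub>K\<^esub> (s1 h)"
    using unit_at_triangle[OF F[of 1], of 0 1 2] s[of 1] E.edge_refl[of 1] id C1 e(3,4)
    by (simp add: cg del: One_nat_def)
  show "T (\<iota>\<^bsub>C\<^esub> h) h (IdM C (Src C h)) = \<iota>\<^bsub>K\<^esub> (s1 h)"
    using unit_at_triangle[OF F[of 0], of 0 1 2] s[of 0] E.edge_refl[of 0] id C1 e(2,4)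
    by (simp add: cg del: One_nat_def)
qed

text \<open>A triangle filled by an identity extends to a marked triangle \<open>Y\<close>, and the unit at \<open>Y\<close> is defined on
  the 2-category in which the 2-cell of the triangle is inverted.\<close>

lemma T_iso:
  assumes h: "h \<in> Mor C" "k \<in> Mor C" "Tgt C h = Src C k"
  shows "iso_cell K (T (\<iota>\<^bsub>C\<^esub> (k \<odot>\<^bsub>C\<^esub> h)) k h)"
proof -
  let ?kh = "k \<odot>\<^bsub>C\<^esub> h"
  have kh: "?kh \<in> Mor C" using h by (simp add: C.typing)
  define G where "G = triangle2 C (\<iota>\<^bsub>C\<^esub> ?kh) k h"
  have t: "two_functor (oriental 2) C G" "Fn2 G ({0, 2}, {0, 1, 2}) = \<iota>\<^bsub>C\<^esub> ?kh"
    using triangle2[OF h, of "\<iota>\<^bsub>C\<^esub> ?kh"] kh by (simp_all add: G_def C.typing)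
  let ?w = "({0, 2}, {0, 1, 2}) :: nat set \<times> nat set"
  have w: "?w \<in> Cell (oriental 2)" using Cell_triple[of 0 1 2 2] by simp
  have "inverse_cells C (Fn2 G ?w) (\<iota>\<^bsub>C\<^esub> ?kh)"
    using C.VComp_IdC_left[of "\<iota>\<^bsub>C\<^esub> ?kh"] kh unfolding t(2) by (simp add: inverse_cells_def C.typing)
  from inv_pres.presented_functor_invert[OF C.two_category_axioms t(1) this]
  interpret I: presented_functor inv_pres C "Fn0 G" "Fn1 G" "case_option (\<iota>\<^bsub>C\<^esub> ?kh) (Fn2 G)" .
  define Y where "Y = tagged (Mark 2) inv_tag I.ind"
  have Y: "Y \<in> simplices (nerve C) (Mark 2)"
    "a \<in> Ob (presented inv_pres) \<Longrightarrow> Fn0 Y (Inv0 a) = Fn0 I.ind a"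
    "f \<in> Mor (presented inv_pres) \<Longrightarrow> Fn1 Y (Inv1 f) = Fn1 I.ind f"
    "c \<in> Cell (presented inv_pres) \<Longrightarrow> Fn2 Y (Inv2 c) = Fn2 I.ind c" for a f c
    using tagged[of inv_tag "Mark 2" "presented inv_pres" C I.ind] I.two_functor_induced inv_pres.two_category_presented
    by (simp_all add: Y_def)
  have ph: "i \<in> Ob (oriental 2) \<Longrightarrow> Fn0 (realize_map (Phi 2)) (Ori0 i) = Inv0 (Fn0 phi_inv i)"
    "S \<in> Mor (oriental 2) \<Longrightarrow> Fn1 (realize_map (Phi 2)) (Ori1 S) = Inv1 (Fn1 phi_inv S)"
    "c \<in> Cell (oriental 2) \<Longrightarrow> Fn2 (realize_map (Phi 2)) (Ori2 c) = Inv2 (Fn2 phi_inv c)" for i S c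
    using tag_fun_simps[OF inj_tags(1), of inv_tag phi_inv] by (simp_all add: realize_map_def)
  have act: "act (nerve C) (Phi 2) Y = osimplex 2 G"
  proof (rule simplex_eqI[OF inj_tags(1) realize.simps(1)])
    show "act (nerve C) (Phi 2) Y \<in> simplices (nerve C) (Simp 2)"
      using act_nerve_in[of "Phi 2" Y C] Y(1) by simp
    show "osimplex 2 G \<in> simplices (nerve C) (Simp 2)" by (rule osimplex(1)[OF t(1)])
    fix i S c
    show "i \<in> Ob (oriental 2) \<Longrightarrow> Fn0 (act (nerve C) (Phi 2) Y) (Fn0 ori_tag i) = Fn0 (osimplex 2 G) (Fn0 ori_tag i)"
      using Y(2) I.induced_cls(1)[of i] by (simp add: act_nerve ph osimplex[OF t(1)])
    show "S \<in> Mor (oriental 2) \<Longrightarrow> Fn1 (act (nerve C) (Phi 2) Y) (Fn1 ori_tag S) = Fn1 (osimplex 2 G) (Fn1 ori_tag S)"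
      using Y(3) I.induced_cls(2)[of "Gen1 S"] by (simp add: act_nerve ph osimplex[OF t(1)])
    show "c \<in> Cell (oriental 2) \<Longrightarrow> Fn2 (act (nerve C) (Phi 2) Y) (Fn2 ori_tag c) = Fn2 (osimplex 2 G) (Fn2 ori_tag c)"
      using Y(4) I.induced_cls(3)[of "Gen2 (Some c)"] by (simp add: act_nerve ph osimplex[OF t(1)])
  qed
  let ?U = "unit (nerve C) (Mark 2) Y"
  have U: "two_functor (presented inv_pres) K \<lparr>Fn0 = Fn0 ?U \<circ> Inv0, Fn1 = Fn1 ?U \<circ> Inv1, Fn2 = Fn2 ?U \<circ> Inv2\<rparr>"
  proof -
    have r: "realize (Mark 2) = tag inv_tag (presented inv_pres)" by simp
    show ?thesis
      using two_functor_comp[OF two_functor_tag(1)[OF inj_tags(3)] two_functor_unit[OF Y(1), unfolded r]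
        inv_pres.two_category_presented]
      by simp
  qed
  have "T (\<iota>\<^bsub>C\<^esub> ?kh) k h = Fn2 (unit (nerve C) (Simp 2) (osimplex 2 G)) (Ori2 ?w)"
    by (simp add: T_def unit_at_def G_def)
  also have "\<dots> = Fn2 ?U (Inv2 (Fn2 phi_inv ?w))"
    using unit_glue(3)[of "Phi 2" Y "nerve C" "Ori2 ?w"] Y(1) w ph(3)[OF w] osimplex(1)[OF t(1)] by (simp add: act del: phi_inv_simps)
  finally show ?thesis
    using inverse_cells_functor[OF U inv_pres.two_category_presented inverse_phi_inv]
    by (auto simp: iso_cell_def simp del: phi_inv_simps)
qed

text \<open>The relation for a tetrahedron holds because the unit is a 2-functor on the oriental of dimension 3.\<close>

sublocale triangle_data C K s0 s1 T
proof
  fix x assume x: "x \<in> Ob C"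
  note v = vertex[OF x]
  interpret V: two_functor "oriental 0" K "unit_at C 0 (vertex C x)" by (rule two_functor_unit_at[OF v(1)])
  interpret W: oriental_diagram C 0 "vertex C x" using v(1) C.two_category_axioms by (simp add: oriental_diagram_def)
  show "s0 x \<in> Ob K" using V.Fn0_in[of 0] by (simp add: s0_def)
  have cg: "codegen 0 0 = 0" "codegen 0 1 = 0" by (simp_all add: codegen_def)
  have le: "n \<le> 1 \<Longrightarrow> codegen 0 n \<le> 0" for n by (simp add: codegen_def)
  have F: "two_functor (oriental 1) C (ocomp (vertex C x) (codegen 0))"
    by (rule two_functor_ocomp[OF v(1) mono_codegen le])
  have "Fn1 (unit_at C 1 (ocomp (vertex C x) (codegen 0))) {0, 1} = Fn1 (unit_at C 0 (vertex C x)) (codegen 0 ` {0, 1})"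
    using unit_at_structure_map(2)[OF v(1), of "CoD 0 0" 1 "codegen 0", OF _ _ _ _ mono_codegen le] Mor_pair[of 0 1 1]
    by (simp del: image_insert)
  then show "s1 (IdM C x) = IdM K (s0 x)"
    using unit_at_edge[OF F, of 0 1] W.edge_refl[of 0] V.Fn_IdM[of 0] v(2)
    by (simp add: cg s0_def del: One_nat_def)
next
  fix h assume h: "h \<in> Mor C"
  note e = edge[OF h]
  interpret U: oriental_diagram K 1 "unit_at C 1 (edge C h)" by (rule unit_diagram[OF e(1)])
  show "s1 h \<in> Mor K" "Src K (s1 h) = s0 (Src C h)" "Tgt K (s1 h) = s0 (Tgt C h)"
    using U.edge[of 0 1] unit_at_vertex[OF e(1), of 0] unit_at_vertex[OF e(1), of 1] e(2,3)
    by (simp_all add: s1_def del: One_nat_def)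
  show "T (\<iota>\<^bsub>C\<^esub> h) (IdM C (Tgt C h)) h = \<iota>\<^bsub>K\<^esub> (s1 h)" "T (\<iota>\<^bsub>C\<^esub> h) h (IdM C (Src C h)) = \<iota>\<^bsub>K\<^esub> (s1 h)"
    using T_unit[OF h] .
next
  fix h k \<alpha> assume "h \<in> Mor C" "k \<in> Mor C" "Tgt C h = Src C k"
  then show "iso_cell K (T (\<iota>\<^bsub>C\<^esub> (k \<odot>\<^bsub>C\<^esub> h)) k h)"
    "\<alpha> \<in> Cell C \<Longrightarrow> Cod C \<alpha> = k \<odot>\<^bsub>C\<^esub> h
      \<Longrightarrow> T \<alpha> k h \<in> Cell K \<and> Dom K (T \<alpha> k h) = s1 (Dom C \<alpha>) \<and> Cod K (T \<alpha> k h) = s1 k \<odot>\<^bsub>K\<^esub> s1 h"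
    by (rule T_iso, rule T_typing)
next
  fix f01 f12 f23 a012 a123 a013 a023
  assume f: "f01 \<in> Mor C" "f12 \<in> Mor C" "f23 \<in> Mor C" "Tgt C f01 = Src C f12" "Tgt C f12 = Src C f23"
    and a: "a012 \<in> Cell C" "Cod C a012 = f12 \<odot>\<^bsub>C\<^esub> f01" "a123 \<in> Cell C" "Cod C a123 = f23 \<odot>\<^bsub>C\<^esub> f12"
        "a013 \<in> Cell C" "Cod C a013 = Dom C a123 \<odot>\<^bsub>C\<^esub> f01" "a023 \<in> Cell C" "Cod C a023 = f23 \<odot>\<^bsub>C\<^esub> Dom C a012"
        "Dom C a023 = Dom C a013"
        "(a123 \<star>\<^bsub>C\<^esub> \<iota>\<^bsub>C\<^esub> f01) \<cdot>\<^bsub>C\<^esub> a013 = (\<iota>\<^bsub>C\<^esub> f23 \<star>\<^bsub>C\<^esub> a012) \<cdot>\<^bsub>C\<^esub> a023"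
  let ?G = "tetrahedron3 C f01 f12 f23 a012 a123 a013 a023"
  note t = tetrahedron3[OF f a]
  interpret U: oriental_diagram K 3 "unit_at C 3 ?G" by (rule unit_diagram[OF t(1)])
  have U: "Fn1 (unit_at C 3 ?G) {0, 1} = s1 f01" "Fn1 (unit_at C 3 ?G) {2, 3} = s1 f23"
    "Fn2 (unit_at C 3 ?G) ({0, 2}, {0, 1, 2}) = T a012 f12 f01"
    "Fn2 (unit_at C 3 ?G) ({1, 3}, {1, 2, 3}) = T a123 f23 f12"
    "Fn2 (unit_at C 3 ?G) ({0, 3}, {0, 1, 3}) = T a013 (Dom C a123) f01"
    "Fn2 (unit_at C 3 ?G) ({0, 3}, {0, 2, 3}) = T a023 f23 (Dom C a012)"
    using unit_at_edge[OF t(1), of 0 1] unit_at_edge[OF t(1), of 2 3]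
      unit_at_triangle[OF t(1), of 0 1 2] unit_at_triangle[OF t(1), of 1 2 3]
      unit_at_triangle[OF t(1), of 0 1 3] unit_at_triangle[OF t(1), of 0 2 3] t(2-)
    by (simp_all del: One_nat_def)
  show "(T a123 f23 f12 \<star>\<^bsub>K\<^esub> \<iota>\<^bsub>K\<^esub> (s1 f01)) \<cdot>\<^bsub>K\<^esub> T a013 (Dom C a123) f01
        = (\<iota>\<^bsub>K\<^esub> (s1 f23) \<star>\<^bsub>K\<^esub> T a012 f12 f01) \<cdot>\<^bsub>K\<^esub> T a023 f23 (Dom C a012)"
    using U.tetrahedron[of 0 1 2 3] U by (simp del: One_nat_def)
qed

end

section \<open>Lifts of marked simplices\<close>

context normal_pseudofunctor
begin

interpretation P: two_category path_cat by (rule two_category_path_cat)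

lemma pC_simps [simp]: "Fn0 pC x = x" "Fn1 pC f = fst f" "Fn2 pC (f, g, \<alpha>, a) = \<alpha>"
  by (simp_all add: pC_def)

lemma pK_simps [simp]: "Fn0 pK x = s0 x" "Fn1 pK f = Cod K (snd f)" "Fn2 pK (f, g, \<alpha>, a) = a"
  by (simp_all add: pK_def)

lemma oriental_liftI: "two_functor (oriental m) C G \<Longrightarrow> oriental_lift C K s0 s1 s2 mu m G"
  using normal_pseudofunctor_axioms C.two_category_axioms by (simp add: oriental_lift_def oriental_diagram_def)

text \<open>Restricting the canonical lift along a monotone map gives a lift that is strict on edges.\<close>

lemma olift_ocomp:
  assumes G: "two_functor (oriental m) C G" and \<phi>: "mono \<phi>" "\<And>i. i \<le> k \<Longrightarrow> \<phi> i \<le> m"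
  shows "S \<in> Mor (oriental k) \<Longrightarrow> Fn1 (olift (ocomp G \<phi>)) S = Fn1 (olift G) (\<phi> ` S)"
proof -
  interpret G: oriental_lift C K s0 s1 s2 mu m G by (rule oriental_liftI[OF G])
  interpret F: two_functor "oriental k" "oriental m" "ori_map \<phi>" by (rule two_functor_ori_map[OF \<phi>])
  note G' = two_functor_ocomp[OF G \<phi>]
  interpret G': oriental_lift C K s0 s1 s2 mu k "ocomp G \<phi>" by (rule oriental_liftI[OF G'])
  have c: "map_prod (image \<phi>) (image \<phi>) c \<in> Cell (oriental m)" if "c \<in> Cell (oriental k)" for c
    using F.Fn2_in[OF that] by (simp add: ori_map_def)
  have "Fn1 (ocomp (olift G) \<phi>) S = Fn1 (olift (ocomp G \<phi>)) S" if "S \<in> Mor (oriental k)"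
  proof (rule G'.olift_unique(1)[OF two_functor_ocomp[OF G.two_functor_olift \<phi>] _ _ _ that])
    fix i j :: nat
    show "Fn0 (ocomp (olift G) \<phi>) i = Fn0 (ocomp G \<phi>) i" by (simp add: G.Fn0_olift)
    show "i < j \<Longrightarrow> j \<le> k \<Longrightarrow> Fn1 (ocomp (olift G) \<phi>) {i, j} = strict (Fn1 (ocomp G \<phi>) {i, j})"
      using G.olift_edge[of "\<phi> i" "\<phi> j"] monoD[OF \<phi>(1), of i j] \<phi>(2)[of j] by simp
    show "c \<in> Cell (oriental k) \<Longrightarrow> Fn2 pC (Fn2 (ocomp (olift G) \<phi>) c) = Fn2 (ocomp G \<phi>) c" for c
      using c[of c] G.pC_olift(2)[of "map_prod (image \<phi>) (image \<phi>) c"] by (cases c) simp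
  qed
  then show "S \<in> Mor (oriental k) \<Longrightarrow> Fn1 (olift (ocomp G \<phi>)) S = Fn1 (olift G) (\<phi> ` S)" by simp
qed

lemma olift_cong:
  assumes G: "two_functor (oriental m) C G" "two_functor (oriental m) C G'"
    and "\<And>i. i \<le> m \<Longrightarrow> Fn0 G i = Fn0 G' i" "\<And>S. S \<in> Mor (oriental m) \<Longrightarrow> Fn1 G S = Fn1 G' S"
    and "\<And>c. c \<in> Cell (oriental m) \<Longrightarrow> Fn2 G c = Fn2 G' c"
  shows "S \<in> Mor (oriental m) \<Longrightarrow> Fn1 (olift G) S = Fn1 (olift G') S"
proof -
  interpret G: oriental_lift C K s0 s1 s2 mu m G by (rule oriental_liftI[OF G(1)])
  interpret G': oriental_lift C K s0 s1 s2 mu m G' by (rule oriental_liftI[OF G(2)])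
  show "S \<in> Mor (oriental m) \<Longrightarrow> Fn1 (olift G) S = Fn1 (olift G') S"
    by (rule G'.olift_unique(1)[OF G.two_functor_olift])
      (use assms Mor_pair in \<open>simp_all add: G.Fn0_olift G.olift_edge G.pC_olift\<close>)
qed

text \<open>The lift of a marked edge: \<open>F\<close> is the adjoint equivalence in \<open>C\<close>, and \<open>H\<close> is its image in \<open>K\<close>, which
  agrees with the pseudofunctor on \<open>f\<close> but need not do so on \<open>g\<close>.\<close>

definition alift where
  "alift F H = induced adj_pres path_cat
     (case_adj0 (Fn0 F (cls0 adj_pres Adj_x)) (Fn0 F (cls0 adj_pres Adj_y)))
     (let f = Fn1 F (cls1 adj_pres (Gen1 Adj_f)); g = Fn1 F (cls1 adj_pres (Gen1 Adj_g)) in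
      case_adj1 (strict f) (g, mate f g (Fn2 F (cls2 adj_pres (Gen2 Adj_eps)))
        (Fn1 H (cls1 adj_pres (Gen1 Adj_g))) (Fn2 H (cls2 adj_pres (Gen2 Adj_eta)))))
     (let f = Fn1 F (cls1 adj_pres (Gen1 Adj_f)); g = Fn1 F (cls1 adj_pres (Gen1 Adj_g));
        k = (g, mate f g (Fn2 F (cls2 adj_pres (Gen2 Adj_eps)))
          (Fn1 H (cls1 adj_pres (Gen1 Adj_g))) (Fn2 H (cls2 adj_pres (Gen2 Adj_eta))));
        i = IdM path_cat (Fn0 F (cls0 adj_pres Adj_x)); j = IdM path_cat (Fn0 F (cls0 adj_pres Adj_y)) in
      case_adj2
        (i, pcomp k (strict f), Fn2 F (cls2 adj_pres (Gen2 Adj_eta)), Fn2 H (cls2 adj_pres (Gen2 Adj_eta)))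
        (pcomp k (strict f), i, Fn2 F (cls2 adj_pres (Gen2 Adj_eta_inv)), Fn2 H (cls2 adj_pres (Gen2 Adj_eta_inv)))
        (pcomp (strict f) k, j, Fn2 F (cls2 adj_pres (Gen2 Adj_eps)), Fn2 H (cls2 adj_pres (Gen2 Adj_eps)))
        (j, pcomp (strict f) k, Fn2 F (cls2 adj_pres (Gen2 Adj_eps_inv)), Fn2 H (cls2 adj_pres (Gen2 Adj_eps_inv))))"

lemma alift:
  assumes F: "two_functor (presented adj_pres) C F" and H: "two_functor (presented adj_pres) K H"
    and s: "\<And>x. Fn0 H (cls0 adj_pres x) = s0 (Fn0 F (cls0 adj_pres x))"
      "Fn1 H (cls1 adj_pres (Gen1 Adj_f)) = s1 (Fn1 F (cls1 adj_pres (Gen1 Adj_f)))"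
  shows "two_functor (presented adj_pres) path_cat (alift F H)"
    and "Fn0 (alift F H) (cls0 adj_pres x) = Fn0 F (cls0 adj_pres x)"
    and "Fn1 (alift F H) (cls1 adj_pres (Gen1 Adj_f)) = strict (Fn1 F (cls1 adj_pres (Gen1 Adj_f)))"
    and "Fn1 (alift F H) (cls1 adj_pres (Gen1 Adj_g)) = (Fn1 F (cls1 adj_pres (Gen1 Adj_g)),
      mate (Fn1 F (cls1 adj_pres (Gen1 Adj_f))) (Fn1 F (cls1 adj_pres (Gen1 Adj_g)))
        (Fn2 F (cls2 adj_pres (Gen2 Adj_eps))) (Fn1 H (cls1 adj_pres (Gen1 Adj_g))) (Fn2 H (cls2 adj_pres (Gen2 Adj_eta))))"
    and "f \<in> Mor (presented adj_pres) \<Longrightarrow> Fn1 pC (Fn1 (alift F H) f) = Fn1 F f"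
    and "c \<in> Cell (presented adj_pres) \<Longrightarrow> Fn2 pC (Fn2 (alift F H) c) = Fn2 F c"
    and "f \<in> Mor (presented adj_pres) \<Longrightarrow> Fn1 pK (Fn1 (alift F H) f) = Fn1 H f"
    and "c \<in> Cell (presented adj_pres) \<Longrightarrow> Fn2 pK (Fn2 (alift F H) c) = Fn2 H c"
proof -
  note aC = adjoint_equivalence_of_functor[OF F C.two_category_axioms]
  note aK = adjoint_equivalence_of_functor[OF H K.two_category_axioms, unfolded s]
  note aP = adjoint_equivalence_path[OF aC aK]
  have idp: "IdM path_cat x = (IdM C x, \<iota>\<^bsub>K\<^esub> (IdM K (s0 x)))" for x by simp
  from presented_functor_adj[OF P.two_category_axioms aP(1)]
  interpret L: presented_functor adj_pres path_cat
    "case_adj0 (Fn0 F (cls0 adj_pres Adj_x)) (Fn0 F (cls0 adj_pres Adj_y))"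
    "let f = Fn1 F (cls1 adj_pres (Gen1 Adj_f)); g = Fn1 F (cls1 adj_pres (Gen1 Adj_g)) in
      case_adj1 (strict f) (g, mate f g (Fn2 F (cls2 adj_pres (Gen2 Adj_eps)))
        (Fn1 H (cls1 adj_pres (Gen1 Adj_g))) (Fn2 H (cls2 adj_pres (Gen2 Adj_eta))))"
    "let f = Fn1 F (cls1 adj_pres (Gen1 Adj_f)); g = Fn1 F (cls1 adj_pres (Gen1 Adj_g));
        k = (g, mate f g (Fn2 F (cls2 adj_pres (Gen2 Adj_eps)))
          (Fn1 H (cls1 adj_pres (Gen1 Adj_g))) (Fn2 H (cls2 adj_pres (Gen2 Adj_eta))));
        i = IdM path_cat (Fn0 F (cls0 adj_pres Adj_x)); j = IdM path_cat (Fn0 F (cls0 adj_pres Adj_y)) in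
      case_adj2
        (i, pcomp k (strict f), Fn2 F (cls2 adj_pres (Gen2 Adj_eta)), Fn2 H (cls2 adj_pres (Gen2 Adj_eta)))
        (pcomp k (strict f), i, Fn2 F (cls2 adj_pres (Gen2 Adj_eta_inv)), Fn2 H (cls2 adj_pres (Gen2 Adj_eta_inv)))
        (pcomp (strict f) k, j, Fn2 F (cls2 adj_pres (Gen2 Adj_eps)), Fn2 H (cls2 adj_pres (Gen2 Adj_eps)))
        (j, pcomp (strict f) k, Fn2 F (cls2 adj_pres (Gen2 Adj_eps_inv)), Fn2 H (cls2 adj_pres (Gen2 Adj_eps_inv)))"
    unfolding Let_def idp .
  have ind: "alift F H = L.ind" by (simp only: alift_def)
  show L: "two_functor (presented adj_pres) path_cat (alift F H)"
    unfolding ind by (rule L.two_functor_induced)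
  show 0: "Fn0 (alift F H) (cls0 adj_pres x) = Fn0 F (cls0 adj_pres x)" for x
    unfolding ind using L.induced_cls(1)[of x] by (cases x) simp_all
  show 1: "Fn1 (alift F H) (cls1 adj_pres (Gen1 Adj_f)) = strict (Fn1 F (cls1 adj_pres (Gen1 Adj_f)))"
    "Fn1 (alift F H) (cls1 adj_pres (Gen1 Adj_g)) = (Fn1 F (cls1 adj_pres (Gen1 Adj_g)),
      mate (Fn1 F (cls1 adj_pres (Gen1 Adj_f))) (Fn1 F (cls1 adj_pres (Gen1 Adj_g)))
        (Fn2 F (cls2 adj_pres (Gen2 Adj_eps))) (Fn1 H (cls1 adj_pres (Gen1 Adj_g))) (Fn2 H (cls2 adj_pres (Gen2 Adj_eta))))"
    unfolding ind using L.induced_cls(2)[of "Gen1 Adj_f"] L.induced_cls(2)[of "Gen1 Adj_g"] by (simp_all add: Let_def)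
  have 2: "Fn2 pC (Fn2 (alift F H) (cls2 adj_pres (Gen2 a))) = Fn2 F (cls2 adj_pres (Gen2 a))"
    "Fn2 pK (Fn2 (alift F H) (cls2 adj_pres (Gen2 a))) = Fn2 H (cls2 adj_pres (Gen2 a))" for a
    unfolding ind using L.induced_cls(3)[of "Gen2 a"] by (cases a; simp add: Let_def)+
  note LC = two_functor_comp[OF L two_functor_pC adj_pres.two_category_presented]
  note LK = two_functor_comp[OF L two_functor_pK adj_pres.two_category_presented]
  have c1: "fst (Fn1 (alift F H) (cls1 adj_pres (Gen1 f))) = Fn1 F (cls1 adj_pres (Gen1 f))"
    "Cod K (snd (Fn1 (alift F H) (cls1 adj_pres (Gen1 f)))) = Fn1 H (cls1 adj_pres (Gen1 f))" for f
    using aP(2) s(2) aC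
    by (cases f; simp add: 1; simp add: strict_def typing adjoint_equivalence_def)+
  note uC = adj_pres.functor_eq_on_presented[OF LC F]
  note uK = adj_pres.functor_eq_on_presented[OF LK H]
  show "f \<in> Mor (presented adj_pres) \<Longrightarrow> Fn1 pC (Fn1 (alift F H) f) = Fn1 F f"
    "c \<in> Cell (presented adj_pres) \<Longrightarrow> Fn2 pC (Fn2 (alift F H) c) = Fn2 F c"
    using uC(1)[of f] uC(2)[of c] by (simp_all add: 0 2 c1)
  show "f \<in> Mor (presented adj_pres) \<Longrightarrow> Fn1 pK (Fn1 (alift F H) f) = Fn1 H f"
    "c \<in> Cell (presented adj_pres) \<Longrightarrow> Fn2 pK (Fn2 (alift F H) c) = Fn2 H c"
    using uK(1)[of f] uK(2)[of c] by (simp_all add: 0 2 c1 s(1))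
qed

text \<open>The triangle underlying a marked triangle.\<close>

definition along_phi :: "(nat set, (nat, nat set) tm1 set, (nat, nat set, (nat set \<times> nat set) option) tm2 set, 'x, 'y, 'z) two_fun
    \<Rightarrow> (nat, nat set, nat set \<times> nat set, 'x, 'y, 'z) two_fun" where
  "along_phi F = \<lparr>Fn0 = Fn0 F \<circ> Fn0 phi_inv, Fn1 = Fn1 F \<circ> Fn1 phi_inv, Fn2 = Fn2 F \<circ> Fn2 phi_inv\<rparr>"

lemma along_phi_simps [simp]:
  "Fn0 (along_phi F) i = Fn0 F (cls0 inv_pres i)" "Fn1 (along_phi F) S = Fn1 F (cls1 inv_pres (Gen1 S))"
  "Fn2 (along_phi F) c = Fn2 F (cls2 inv_pres (Gen2 (Some c)))"
  by (simp_all add: along_phi_def)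

text \<open>The lift of a marked triangle is the canonical lift of the underlying triangle, because a 2-cell of the
  path object is invertible if both its components are.\<close>

definition ilift where
  "ilift F H = (let L = olift (along_phi F); (f, g, \<alpha>, a) = Fn2 L ({0, 2}, {0, 1, 2}) in
     induced inv_pres path_cat (Fn0 L) (Fn1 L)
       (case_option (g, f, Fn2 F (cls2 inv_pres (Gen2 None)), Fn2 H (cls2 inv_pres (Gen2 None))) (Fn2 L)))"

lemma ilift:
  assumes F: "two_functor (presented inv_pres) C F" and H: "two_functor (presented inv_pres) K H"
    and s0: "\<And>i. i \<le> 2 \<Longrightarrow> Fn0 H (cls0 inv_pres i) = s0 (Fn0 F (cls0 inv_pres i))"
    and s1: "\<And>i j. i < j \<Longrightarrow> j \<le> 2 \<Longrightarrow> Fn1 H (cls1 inv_pres (Gen1 {i, j})) = s1 (Fn1 F (cls1 inv_pres (Gen1 {i, j})))"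
    and s2: "\<And>i j k. i < j \<Longrightarrow> j < k \<Longrightarrow> k \<le> 2 \<Longrightarrow> Fn2 H (cls2 inv_pres (Gen2 (Some ({i, k}, {i, j, k}))))
      = mu (Fn1 F (cls1 inv_pres (Gen1 {j, k}))) (Fn1 F (cls1 inv_pres (Gen1 {i, j})))
        \<cdot>\<^bsub>K\<^esub> s2 (Fn2 F (cls2 inv_pres (Gen2 (Some ({i, k}, {i, j, k})))))"
  shows "two_functor (presented inv_pres) path_cat (ilift F H)"
    and "i \<le> 2 \<Longrightarrow> Fn0 (ilift F H) (cls0 inv_pres i) = Fn0 F (cls0 inv_pres i)"
    and "S \<in> Mor (oriental 2) \<Longrightarrow> Fn1 (ilift F H) (cls1 inv_pres (Gen1 S)) = Fn1 (olift (along_phi F)) S"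
    and "f \<in> Mor (presented inv_pres) \<Longrightarrow> Fn1 pC (Fn1 (ilift F H) f) = Fn1 F f"
    and "c \<in> Cell (presented inv_pres) \<Longrightarrow> Fn2 pC (Fn2 (ilift F H) c) = Fn2 F c"
    and "f \<in> Mor (presented inv_pres) \<Longrightarrow> Fn1 pK (Fn1 (ilift F H) f) = Fn1 H f"
    and "c \<in> Cell (presented inv_pres) \<Longrightarrow> Fn2 pK (Fn2 (ilift F H) c) = Fn2 H c"
    and "two_functor (oriental 2) C (along_phi F)"
proof -
  let ?G = "along_phi F" and ?w = "({0, 2}, {0, 1, 2}) :: nat set \<times> nat set" and ?n = "cls2 inv_pres (Gen2 None)"
  have w: "?w \<in> Cell (oriental 2)" using Cell_triple[of 0 1 2 2] by simp
  show G: "two_functor (oriental 2) C ?G"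
    using two_functor_comp[OF two_functor_phi_inv F two_category_oriental] by (simp add: along_phi_def)
  have H': "two_functor (oriental 2) K (along_phi H)"
    using two_functor_comp[OF two_functor_phi_inv H two_category_oriental] by (simp add: along_phi_def)
  interpret G: oriental_lift C K s0 s1 s2 mu 2 ?G by (rule oriental_liftI[OF G])
  have pK: "S \<in> Mor (oriental 2) \<Longrightarrow> Fn1 pK (Fn1 (olift ?G) S) = Fn1 (along_phi H) S"
    "c \<in> Cell (oriental 2) \<Longrightarrow> Fn2 pK (Fn2 (olift ?G) c) = Fn2 (along_phi H) c" for S c
    by (rule G.pK_olift[OF H']; simp add: s0 s1 s2)+
  obtain f g \<alpha> a where fg: "Fn2 (olift ?G) ?w = (f, g, \<alpha>, a)" by (cases "Fn2 (olift ?G) ?w") auto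
  interpret O: two_functor "oriental 2" path_cat "olift ?G" by (rule G.two_functor_olift)
  have \<alpha>: "\<alpha> = Fn2 F (Fn2 phi_inv ?w)" "a = Fn2 H (Fn2 phi_inv ?w)" "(f, g, \<alpha>, a) \<in> pcell"
    using G.pC_olift(2)[OF w] pK(2)[OF w] O.Fn2_in[OF w] unfolding fg by (simp_all del: One_nat_def)
  have "inverse_cells path_cat (Fn2 (olift ?G) ?w) (g, f, Fn2 F ?n, Fn2 H ?n)"
    unfolding fg
  proof (rule inverse_cells_path[OF \<alpha>(3)])
    show "inverse_cells C \<alpha> (Fn2 F ?n)" "inverse_cells K a (Fn2 H ?n)"
      unfolding \<alpha>(1,2)
      by (rule inverse_cells_functor[OF F inv_pres.two_category_presented inverse_phi_inv],
          rule inverse_cells_functor[OF H inv_pres.two_category_presented inverse_phi_inv])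
  qed
  from inv_pres.presented_functor_invert[OF P.two_category_axioms G.two_functor_olift this]
  interpret L: presented_functor inv_pres path_cat "Fn0 (olift ?G)" "Fn1 (olift ?G)"
    "case_option (g, f, Fn2 F ?n, Fn2 H ?n) (Fn2 (olift ?G))" .
  have ind: "ilift F H = L.ind" unfolding ilift_def Let_def fg by simp
  show L: "two_functor (presented inv_pres) path_cat (ilift F H)"
    unfolding ind by (rule L.two_functor_induced)
  show 0: "i \<le> 2 \<Longrightarrow> Fn0 (ilift F H) (cls0 inv_pres i) = Fn0 F (cls0 inv_pres i)" for i
    unfolding ind using L.induced_cls(1)[of i] by (simp add: G.Fn0_olift)
  show 1: "S \<in> Mor (oriental 2) \<Longrightarrow> Fn1 (ilift F H) (cls1 inv_pres (Gen1 S)) = Fn1 (olift ?G) S" for S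
    unfolding ind using L.induced_cls(2)[of "Gen1 S"] by simp
  have 2: "Fn2 pC (Fn2 (ilift F H) (cls2 inv_pres (Gen2 c))) = Fn2 F (cls2 inv_pres (Gen2 c))
    \<and> Fn2 pK (Fn2 (ilift F H) (cls2 inv_pres (Gen2 c))) = Fn2 H (cls2 inv_pres (Gen2 c))"
    if "c \<in> Gens2 inv_pres" for c
    unfolding ind using L.induced_cls(3)[of "Gen2 c"] that G.pC_olift(2) pK(2)
    by (cases c) auto
  note LC = two_functor_comp[OF L two_functor_pC inv_pres.two_category_presented]
  note LK = two_functor_comp[OF L two_functor_pK inv_pres.two_category_presented]
  have c1: "fst (Fn1 (ilift F H) (cls1 inv_pres (Gen1 S))) = Fn1 F (cls1 inv_pres (Gen1 S))"
    "Cod K (snd (Fn1 (ilift F H) (cls1 inv_pres (Gen1 S)))) = Fn1 H (cls1 inv_pres (Gen1 S))"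
    if "S \<in> Mor (oriental 2)" for S
    using G.pC_olift(1)[OF that] pK(1)[OF that] 1[OF that] by simp_all
  note uC = inv_pres.functor_eq_on_presented[OF LC F]
  note uK = inv_pres.functor_eq_on_presented[OF LK H]
  show "f \<in> Mor (presented inv_pres) \<Longrightarrow> Fn1 pC (Fn1 (ilift F H) f) = Fn1 F f"
    "c \<in> Cell (presented inv_pres) \<Longrightarrow> Fn2 pC (Fn2 (ilift F H) c) = Fn2 F c" for f c
    using uC(1)[of f] uC(2)[of c] by (simp_all add: 0 2 c1)
  show "f \<in> Mor (presented inv_pres) \<Longrightarrow> Fn1 pK (Fn1 (ilift F H) f) = Fn1 H f"
    "c \<in> Cell (presented inv_pres) \<Longrightarrow> Fn2 pK (Fn2 (ilift F H) c) = Fn2 H c" for f c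
    using uK(1)[of f] uK(2)[of c] by (simp_all add: 0 2 c1 s0)
qed

end

section \<open>The lift of the categorified nerve\<close>

text \<open>Transport of 2-functors between a 2-category and its tagged copy.\<close>

definition pull :: "('o1, 'm1, 'c1) tagging \<Rightarrow> (real0, real1, real2, 'o, 'm, 'c) two_fun
    \<Rightarrow> ('o1, 'm1, 'c1, 'o, 'm, 'c) two_fun" where
  "pull W x = \<lparr>Fn0 = Fn0 x \<circ> Fn0 W, Fn1 = Fn1 x \<circ> Fn1 W, Fn2 = Fn2 x \<circ> Fn2 W\<rparr>"

definition push :: "('o1, 'm1, 'c1) tagging \<Rightarrow> ('o1, 'm1, 'c1, 'o, 'm, 'c) two_fun
    \<Rightarrow> (real0, real1, real2, 'o, 'm, 'c) two_fun" where
  "push W L = \<lparr>Fn0 = Fn0 L \<circ> Fn0 (untag W), Fn1 = Fn1 L \<circ> Fn1 (untag W), Fn2 = Fn2 L \<circ> Fn2 (untag W)\<rparr>"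

lemma pull_simps [simp]:
  "Fn0 (pull W x) a = Fn0 x (Fn0 W a)" "Fn1 (pull W x) f = Fn1 x (Fn1 W f)" "Fn2 (pull W x) c = Fn2 x (Fn2 W c)"
  by (simp_all add: pull_def)

lemma push_simps [simp]:
  assumes "inj_tag W"
  shows "Fn0 (push W L) (Fn0 W a) = Fn0 L a" "Fn1 (push W L) (Fn1 W f) = Fn1 L f" "Fn2 (push W L) (Fn2 W c) = Fn2 L c"
  using assms by (simp_all add: push_def)

lemma two_functor_pull:
  "inj_tag W \<Longrightarrow> two_category A \<Longrightarrow> two_functor (tag W A) D x \<Longrightarrow> two_functor A D (pull W x)"
  unfolding pull_def by (rule two_functor_comp[OF two_functor_tag(1)])

lemma two_functor_push:
  "inj_tag W \<Longrightarrow> two_category A \<Longrightarrow> two_functor A D L \<Longrightarrow> two_functor (tag W A) D (push W L)"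
  unfolding push_def by (rule two_functor_comp[OF two_functor_tag(2) _ two_category_tag])

text \<open>The objects of \<open>t\<Delta>\<close> whose value is an oriental include the marked ones of dimension at least
  three.\<close>

fun unmarked :: "td_obj \<Rightarrow> nat \<Rightarrow> bool" where
  "unmarked (Simp m) n \<longleftrightarrow> n = m"
| "unmarked (Mark m) n \<longleftrightarrow> n = m \<and> 3 \<le> m"

lemma realize_unmarked: "unmarked \<theta> m \<Longrightarrow> realize \<theta> = tag ori_tag (oriental m)"
  by (cases \<theta>) auto

lemma td_ob_cases:
  assumes "td_ob \<theta>"
  obtains m where "unmarked \<theta> m" | "\<theta> = Mark 1" | "\<theta> = Mark 2"
  using assms
proof (cases \<theta>)
  case (Mark m)
  then have "m = 1 \<or> m = 2 \<or> 3 \<le> m" using assms by auto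
  with Mark that show ?thesis by auto
qed auto

lemma push_tagged [simp]:
  "Fn0 (push ori_tag L) (Ori0 i) = Fn0 L i" "Fn1 (push ori_tag L) (Ori1 S) = Fn1 L S"
  "Fn2 (push ori_tag L) (Ori2 c) = Fn2 L c"
  using push_simps[OF inj_tags(1), of L] by simp_all

lemma push_tagged_adj [simp]:
  "Fn0 (push adj_tag L) (Adj0 a) = Fn0 L a" "Fn1 (push adj_tag L) (Adj1 f) = Fn1 L f"
  "Fn2 (push adj_tag L) (Adj2 d) = Fn2 L d"
  using push_simps[OF inj_tags(2), of L] by simp_all

lemma push_tagged_inv [simp]:
  "Fn0 (push inv_tag L) (Inv0 a) = Fn0 L a" "Fn1 (push inv_tag L) (Inv1 f) = Fn1 L f"
  "Fn2 (push inv_tag L) (Inv2 d) = Fn2 L d"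
  using push_simps[OF inj_tags(3), of L] by simp_all

lemma ori_map_id: "Fn0 (ori_map (\<lambda>k. k)) i = i" "Fn1 (ori_map (\<lambda>k. k)) S = S" "Fn2 (ori_map (\<lambda>k. k)) c = c"
  by (cases c; simp add: ori_map_def)+

lemma realize_Mark_1: "realize (Mark 1) = tag adj_tag (presented adj_pres)"
  and realize_Mark_2: "realize (Mark 2) = tag inv_tag (presented inv_pres)"
  by simp_all

context nerve_of
begin

abbreviation "N \<equiv> nerve C"

fun lift where
  "lift (Simp m) x = push ori_tag (olift (pull ori_tag x))"
| "lift (Mark m) x = (if m = 1 then push adj_tag (alift (pull adj_tag x) (pull adj_tag (unit N (Mark 1) x)))
     else if m = 2 then push inv_tag (ilift (pull inv_tag x) (pull inv_tag (unit N (Mark 2) x)))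
     else push ori_tag (olift (pull ori_tag x)))"

lemma lift_unmarked: "unmarked \<theta> m \<Longrightarrow> lift \<theta> x = push ori_tag (olift (pull ori_tag x))"
  by (cases \<theta>) auto

lemma pull_unmarked:
  assumes "unmarked \<theta> m" "x \<in> simplices N \<theta>"
  shows "two_functor (oriental m) C (pull ori_tag x)"
    "two_functor (oriental m) K (pull ori_tag (unit N \<theta> x))"
  using two_functor_pull[OF inj_tags(1) two_category_oriental]
    simplex_functor[OF assms(2)] two_functor_unit[OF assms(2)] realize_unmarked[OF assms(1)] by auto

lemma unit_at_pull:
  assumes x: "x \<in> simplices N (Simp m)"
  shows "unit_at C m (pull ori_tag x) = pull ori_tag (unit N (Simp m) x)"
proof -
  have F: "two_functor (oriental m) C (pull ori_tag x)" by (rule pull_unmarked[OF _ x]) simp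
  have "osimplex m (pull ori_tag x) = x"
    by (rule simplex_eqI[OF inj_tags(1) realize.simps(1) osimplex(1)[OF F] x])
      (simp_all add: osimplex[OF F])
  then show ?thesis by (simp add: unit_at_def pull_def)
qed

text \<open>The unit is compatible with \<open>Phi m\<close>, so on the underlying oriental the unit at a marked simplex is
  given by the pseudofunctor.\<close>

lemma unit_phi:
  assumes x: "x \<in> simplices N (Mark m)"
  defines "G \<equiv> pull ori_tag (act N (Phi m) x)"
  shows "two_functor (oriental m) C G"
    "\<lbrakk>i \<le> m\<rbrakk> \<Longrightarrow> Fn0 (unit N (Mark m) x) (Fn0 (realize_map (Phi m)) (Ori0 i)) = s0 (Fn0 G i)"
    "\<lbrakk>i < j; j \<le> m\<rbrakk> \<Longrightarrow> Fn1 (unit N (Mark m) x) (Fn1 (realize_map (Phi m)) (Ori1 {i, j})) = s1 (Fn1 G {i, j})"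
    "\<lbrakk>i < j; j < k; k \<le> m\<rbrakk> \<Longrightarrow> Fn2 (unit N (Mark m) x) (Fn2 (realize_map (Phi m)) (Ori2 ({i, k}, {i, j, k})))
      = T (Fn2 G ({i, k}, {i, j, k})) (Fn1 G {j, k}) (Fn1 G {i, j})"
proof -
  have "1 \<le> m" using x by (auto simp: simplices_nerve split: if_splits)
  then have u: "td_arr (Phi m)" "x \<in> simplices N (td_cod (Phi m))" using x by simp_all
  note a = act_nerve_in[OF u]
  show G: "two_functor (oriental m) C G"
    unfolding G_def by (rule pull_unmarked(1)[of "Simp m"]) (use a in simp_all)
  have e: "unit_at C m G = pull ori_tag (unit N (Simp m) (act N (Phi m) x))"
    unfolding G_def by (rule unit_at_pull) (use a in simp)
  note g = unit_glue[OF u a]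
  show "\<lbrakk>i \<le> m\<rbrakk> \<Longrightarrow> Fn0 (unit N (Mark m) x) (Fn0 (realize_map (Phi m)) (Ori0 i)) = s0 (Fn0 G i)"
    using unit_at_vertex[OF G, of i] g(1)[of "Ori0 i"] unfolding e by simp
  show "\<lbrakk>i < j; j \<le> m\<rbrakk> \<Longrightarrow> Fn1 (unit N (Mark m) x) (Fn1 (realize_map (Phi m)) (Ori1 {i, j})) = s1 (Fn1 G {i, j})"
    using unit_at_edge[OF G, of i j] g(2)[of "Ori1 {i, j}"] Mor_pair[of i j m] unfolding e by simp
  show "\<lbrakk>i < j; j < k; k \<le> m\<rbrakk> \<Longrightarrow> Fn2 (unit N (Mark m) x) (Fn2 (realize_map (Phi m)) (Ori2 ({i, k}, {i, j, k})))
      = T (Fn2 G ({i, k}, {i, j, k})) (Fn1 G {j, k}) (Fn1 G {i, j})"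
    using unit_at_triangle[OF G, of i j k] g(3)[of "Ori2 ({i, k}, {i, j, k})"] Cell_triple[of i j k m] unfolding e by simp
qed

lemma realize_map_phi_1:
  "Fn0 (realize_map (Phi 1)) (Ori0 0) = Adj0 (cls0 adj_pres Adj_x)"
  "Fn0 (realize_map (Phi 1)) (Ori0 1) = Adj0 (cls0 adj_pres Adj_y)"
  "Fn1 (realize_map (Phi 1)) (Ori1 {0, 1}) = Adj1 (cls1 adj_pres (Gen1 Adj_f))"
  using tag_fun_simps[OF inj_tags(1), of adj_tag phi_adj] Mor_pair[of 0 1 1]
  by (simp_all add: realize_map_def phi_adj_def Let_def del: One_nat_def)

lemma realize_map_phi_2:
  "i \<le> 2 \<Longrightarrow> Fn0 (realize_map (Phi 2)) (Ori0 i) = Inv0 (cls0 inv_pres i)"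
  "S \<in> Mor (oriental 2) \<Longrightarrow> Fn1 (realize_map (Phi 2)) (Ori1 S) = Inv1 (cls1 inv_pres (Gen1 S))"
  "c \<in> Cell (oriental 2) \<Longrightarrow> Fn2 (realize_map (Phi 2)) (Ori2 c) = Inv2 (cls2 inv_pres (Gen2 (Some c)))"
  using tag_fun_simps[OF inj_tags(1), of inv_tag phi_inv] by (simp_all add: realize_map_def)

lemma realize_map_phi_3:
  assumes "3 \<le> m"
  shows "i \<le> m \<Longrightarrow> Fn0 (realize_map (Phi m)) (Ori0 i) = Ori0 i"
  "S \<in> Mor (oriental m) \<Longrightarrow> Fn1 (realize_map (Phi m)) (Ori1 S) = Ori1 S"
  "c \<in> Cell (oriental m) \<Longrightarrow> Fn2 (realize_map (Phi m)) (Ori2 c) = Ori2 c"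
  using tag_fun_simps[OF inj_tags(1), of ori_tag "ori_map (\<lambda>k. k)"] assms
  by (simp_all add: realize_map_def ori_map_id)

text \<open>These are the premises under which the canonical lift projects to the unit.\<close>

lemma unit_unmarked:
  assumes \<theta>: "unmarked \<theta> m" and x: "x \<in> simplices N \<theta>"
  defines "G \<equiv> pull ori_tag x" and "H \<equiv> pull ori_tag (unit N \<theta> x)"
  shows "i \<le> m \<Longrightarrow> Fn0 H i = s0 (Fn0 G i)" "i < j \<Longrightarrow> j \<le> m \<Longrightarrow> Fn1 H {i, j} = s1 (Fn1 G {i, j})"
    "i < j \<Longrightarrow> j < k \<Longrightarrow> k \<le> m \<Longrightarrow> Fn2 H ({i, k}, {i, j, k})
      = mu (Fn1 G {j, k}) (Fn1 G {i, j}) \<cdot>\<^bsub>K\<^esub> s2 (Fn2 G ({i, k}, {i, j, k}))"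
proof -
  have G: "two_functor (oriental m) C G" unfolding G_def by (rule pull_unmarked(1)[OF \<theta> x])
  interpret G: oriental_diagram C m G using G C.two_category_axioms by (simp add: oriental_diagram_def)
  have "(\<forall>i \<le> m. Fn0 H i = s0 (Fn0 G i)) \<and> (\<forall>i j. i < j \<longrightarrow> j \<le> m \<longrightarrow> Fn1 H {i, j} = s1 (Fn1 G {i, j}))
    \<and> (\<forall>i j k. i < j \<longrightarrow> j < k \<longrightarrow> k \<le> m \<longrightarrow> Fn2 H ({i, k}, {i, j, k})
      = T (Fn2 G ({i, k}, {i, j, k})) (Fn1 G {j, k}) (Fn1 G {i, j}))"
  proof (cases \<theta>)
    case (Simp n)
    then have H: "H = unit_at C m G" using \<theta> x unit_at_pull by (simp add: G_def H_def)
    show ?thesis unfolding H using unit_at_vertex[OF G] unit_at_edge[OF G] unit_at_triangle[OF G] by blast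
  next
    case (Mark n)
    then have n: "3 \<le> m" "\<theta> = Mark m" using \<theta> by auto
    have x': "x \<in> simplices N (Mark m)" using x n by simp
    have p: "i \<le> m \<Longrightarrow> Fn0 (pull ori_tag (act N (Phi m) x)) i = Fn0 G i"
      "S \<in> Mor (oriental m) \<Longrightarrow> Fn1 (pull ori_tag (act N (Phi m) x)) S = Fn1 G S"
      "c \<in> Cell (oriental m) \<Longrightarrow> Fn2 (pull ori_tag (act N (Phi m) x)) c = Fn2 G c" for i S c
      using realize_map_phi_3[OF n(1)] by (simp_all add: act_nerve G_def)
    show ?thesis
      using unit_phi(2-4)[OF x'] realize_map_phi_3[OF n(1)] p Mor_pair Cell_triple n(2) by (simp add: H_def)
  qed
  then show "i \<le> m \<Longrightarrow> Fn0 H i = s0 (Fn0 G i)" "i < j \<Longrightarrow> j \<le> m \<Longrightarrow> Fn1 H {i, j} = s1 (Fn1 G {i, j})"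
    "i < j \<Longrightarrow> j < k \<Longrightarrow> k \<le> m \<Longrightarrow> Fn2 H ({i, k}, {i, j, k})
      = mu (Fn1 G {j, k}) (Fn1 G {i, j}) \<cdot>\<^bsub>K\<^esub> s2 (Fn2 G ({i, k}, {i, j, k}))"
    using T_eq[of "Fn1 G {i, j}" "Fn1 G {j, k}" "Fn2 G ({i, k}, {i, j, k})"] G.edge[of i j] G.edge[of j k] G.tri[of i j k]
    by simp_all
qed

lemma mark_1:
  assumes x: "x \<in> simplices N (Mark 1)"
  defines "F \<equiv> pull adj_tag x" and "H \<equiv> pull adj_tag (unit N (Mark 1) x)"
  shows "two_functor (presented adj_pres) C F" "two_functor (presented adj_pres) K H"
    "\<And>a. Fn0 H (cls0 adj_pres a) = s0 (Fn0 F (cls0 adj_pres a))"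
    "Fn1 H (cls1 adj_pres (Gen1 Adj_f)) = s1 (Fn1 F (cls1 adj_pres (Gen1 Adj_f)))"
proof -
  show "two_functor (presented adj_pres) C F" "two_functor (presented adj_pres) K H"
    unfolding F_def H_def
    using two_functor_pull[OF inj_tags(2) adj_pres.two_category_presented, folded realize_Mark_1]
      simplex_functor[OF x] two_functor_unit[OF x] by blast+
  show "Fn0 H (cls0 adj_pres a) = s0 (Fn0 F (cls0 adj_pres a))" for a
    using unit_phi(2)[OF x, of 0] unit_phi(2)[OF x, of 1] realize_map_phi_1
    by (cases a) (simp_all add: act_nerve F_def H_def del: One_nat_def)
  show "Fn1 H (cls1 adj_pres (Gen1 Adj_f)) = s1 (Fn1 F (cls1 adj_pres (Gen1 Adj_f)))"
    using unit_phi(3)[OF x, of 0 1] realize_map_phi_1 Mor_pair[of 0 1 1]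
    by (simp add: act_nerve F_def H_def del: One_nat_def)
qed

lemma mark_2:
  assumes x: "x \<in> simplices N (Mark 2)"
  defines "F \<equiv> pull inv_tag x" and "H \<equiv> pull inv_tag (unit N (Mark 2) x)"
  shows "two_functor (presented inv_pres) C F" "two_functor (presented inv_pres) K H"
    "i \<le> 2 \<Longrightarrow> Fn0 H (cls0 inv_pres i) = s0 (Fn0 F (cls0 inv_pres i))"
    "i < j \<Longrightarrow> j \<le> 2 \<Longrightarrow> Fn1 H (cls1 inv_pres (Gen1 {i, j})) = s1 (Fn1 F (cls1 inv_pres (Gen1 {i, j})))"
    "i < j \<Longrightarrow> j < k \<Longrightarrow> k \<le> 2 \<Longrightarrow> Fn2 H (cls2 inv_pres (Gen2 (Some ({i, k}, {i, j, k}))))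
      = mu (Fn1 F (cls1 inv_pres (Gen1 {j, k}))) (Fn1 F (cls1 inv_pres (Gen1 {i, j})))
        \<cdot>\<^bsub>K\<^esub> s2 (Fn2 F (cls2 inv_pres (Gen2 (Some ({i, k}, {i, j, k})))))"
proof -
  show "two_functor (presented inv_pres) C F" "two_functor (presented inv_pres) K H"
    unfolding F_def H_def
    using two_functor_pull[OF inj_tags(3) inv_pres.two_category_presented, folded realize_Mark_2]
      simplex_functor[OF x] two_functor_unit[OF x] by blast+
  define G where "G = pull ori_tag (act N (Phi 2) x)"
  note u = unit_phi[OF x, folded G_def]
  interpret G: oriental_diagram C 2 G using u(1) C.two_category_axioms by (simp add: oriental_diagram_def)
  have G: "i \<le> 2 \<Longrightarrow> Fn0 G i = Fn0 F (cls0 inv_pres i)"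
    "S \<in> Mor (oriental 2) \<Longrightarrow> Fn1 G S = Fn1 F (cls1 inv_pres (Gen1 S))"
    "c \<in> Cell (oriental 2) \<Longrightarrow> Fn2 G c = Fn2 F (cls2 inv_pres (Gen2 (Some c)))" for i S c
    using realize_map_phi_2 by (simp_all add: act_nerve G_def F_def)
  show "i \<le> 2 \<Longrightarrow> Fn0 H (cls0 inv_pres i) = s0 (Fn0 F (cls0 inv_pres i))"
    using u(2)[of i] realize_map_phi_2(1)[of i] G(1)[of i] by (simp add: H_def)
  show "i < j \<Longrightarrow> j \<le> 2 \<Longrightarrow> Fn1 H (cls1 inv_pres (Gen1 {i, j})) = s1 (Fn1 F (cls1 inv_pres (Gen1 {i, j})))"
    using u(3)[of i j] realize_map_phi_2(2)[of "{i, j}"] G(2)[of "{i, j}"] Mor_pair[of i j 2] by (simp add: H_def)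
  show "Fn2 H (cls2 inv_pres (Gen2 (Some ({i, k}, {i, j, k}))))
      = mu (Fn1 F (cls1 inv_pres (Gen1 {j, k}))) (Fn1 F (cls1 inv_pres (Gen1 {i, j})))
        \<cdot>\<^bsub>K\<^esub> s2 (Fn2 F (cls2 inv_pres (Gen2 (Some ({i, k}, {i, j, k})))))" if "i < j" "j < k" "k \<le> 2"
  proof -
    have "Fn2 H (cls2 inv_pres (Gen2 (Some ({i, k}, {i, j, k})))) = T (Fn2 G ({i, k}, {i, j, k})) (Fn1 G {j, k}) (Fn1 G {i, j})"
      using u(4)[OF that] realize_map_phi_2(3)[of "({i, k}, {i, j, k})"] Cell_triple[of i j k 2] that by (simp add: H_def)
    also have "\<dots> = mu (Fn1 G {j, k}) (Fn1 G {i, j}) \<cdot>\<^bsub>K\<^esub> s2 (Fn2 G ({i, k}, {i, j, k}))"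
      using G.edge[of i j] G.edge[of j k] G.tri[of i j k] that by (intro T_eq) auto
    finally show ?thesis
      using G(2)[of "{i, j}"] G(2)[of "{j, k}"] G(3)[of "({i, k}, {i, j, k})"] Mor_pair[of i j 2] Mor_pair[of j k 2]
        Cell_triple[of i j k 2] that by simp
  qed
qed

text \<open>The three kinds of lifts have in common the properties that determine the two projections of the glued
  2-functor.\<close>

lemma lift_functor:
  assumes x: "x \<in> simplices N \<theta>"
  shows "two_functor (realize \<theta>) path_cat (lift \<theta> x)"
    and "a \<in> Ob (realize \<theta>) \<Longrightarrow> Fn0 (lift \<theta> x) a = Fn0 x a"
    and "f \<in> Mor (realize \<theta>) \<Longrightarrow> Fn1 pC (Fn1 (lift \<theta> x) f) = Fn1 x f"
    and "c \<in> Cell (realize \<theta>) \<Longrightarrow> Fn2 pC (Fn2 (lift \<theta> x) c) = Fn2 x c"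
    and "f \<in> Mor (realize \<theta>) \<Longrightarrow> Fn1 pK (Fn1 (lift \<theta> x) f) = Fn1 (unit N \<theta> x) f"
    and "c \<in> Cell (realize \<theta>) \<Longrightarrow> Fn2 pK (Fn2 (lift \<theta> x) c) = Fn2 (unit N \<theta> x) c"
proof -
  have "td_ob \<theta>" using x by (auto simp: simplices_nerve split: if_splits)
  then have "two_functor (realize \<theta>) path_cat (lift \<theta> x) \<and> (\<forall>a \<in> Ob (realize \<theta>). Fn0 (lift \<theta> x) a = Fn0 x a)
    \<and> (\<forall>f \<in> Mor (realize \<theta>). Fn1 pC (Fn1 (lift \<theta> x) f) = Fn1 x f \<and> Fn1 pK (Fn1 (lift \<theta> x) f) = Fn1 (unit N \<theta> x) f)
    \<and> (\<forall>c \<in> Cell (realize \<theta>). Fn2 pC (Fn2 (lift \<theta> x) c) = Fn2 x c \<and> Fn2 pK (Fn2 (lift \<theta> x) c) = Fn2 (unit N \<theta> x) c)"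
  proof (cases rule: td_ob_cases)
    case (1 m)
    note F = pull_unmarked(1)[OF 1 x] and H = pull_unmarked(2)[OF 1 x]
    interpret G: oriental_lift C K s0 s1 s2 mu m "pull ori_tag x" by (rule oriental_liftI[OF F])
    note pK = G.pK_olift[OF H unit_unmarked[OF 1 x]]
    show ?thesis
      using two_functor_push[OF inj_tags(1) two_category_oriental G.two_functor_olift] G.pC_olift pK
      by (auto simp: lift_unmarked[OF 1] realize_unmarked[OF 1] G.Fn0_olift simp del: pC_simps pK_simps)
  next
    case 2
    have x': "x \<in> simplices N (Mark 1)" using x 2 by simp
    note l = alift[OF mark_1[OF x']]
    have e: "lift \<theta> x = push adj_tag (alift (pull adj_tag x) (pull adj_tag (unit N (Mark 1) x)))" by (simp add: 2)
    show ?thesis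
      using two_functor_push[OF inj_tags(2) adj_pres.two_category_presented l(1)] l(2,5-8)
      unfolding e 2 realize_Mark_1 by (auto simp del: pC_simps pK_simps presented_carriers(2,3))
  next
    case 3
    have x': "x \<in> simplices N (Mark 2)" using x 3 by simp
    note l = ilift[OF mark_2[OF x']]
    have e: "lift \<theta> x = push inv_tag (ilift (pull inv_tag x) (pull inv_tag (unit N (Mark 2) x)))" by (simp add: 3)
    show ?thesis
      using two_functor_push[OF inj_tags(3) inv_pres.two_category_presented l(1)] l(2,4-7)
      unfolding e 3 realize_Mark_2 by (auto simp del: pC_simps pK_simps presented_carriers(2,3))
  qed
  then show "two_functor (realize \<theta>) path_cat (lift \<theta> x)"
    and "a \<in> Ob (realize \<theta>) \<Longrightarrow> Fn0 (lift \<theta> x) a = Fn0 x a"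
    and "f \<in> Mor (realize \<theta>) \<Longrightarrow> Fn1 pC (Fn1 (lift \<theta> x) f) = Fn1 x f"
    and "c \<in> Cell (realize \<theta>) \<Longrightarrow> Fn2 pC (Fn2 (lift \<theta> x) c) = Fn2 x c"
    and "f \<in> Mor (realize \<theta>) \<Longrightarrow> Fn1 pK (Fn1 (lift \<theta> x) f) = Fn1 (unit N \<theta> x) f"
    and "c \<in> Cell (realize \<theta>) \<Longrightarrow> Fn2 pK (Fn2 (lift \<theta> x) c) = Fn2 (unit N \<theta> x) c"
    by blast+
qed

end

lemma realize_map_tagged:
  assumes "td_arr u" "realize (td_dom u) = tag ori_tag (oriental k)"
    "pre_realize_map u = tag_fun ori_tag ori_tag (ori_map \<phi>)"
  shows "i \<le> k \<Longrightarrow> Fn0 (realize_map u) (Ori0 i) = Ori0 (\<phi> i)"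
    "S \<in> Mor (oriental k) \<Longrightarrow> Fn1 (realize_map u) (Ori1 S) = Ori1 (\<phi> ` S)"
  using tag_fun_simps[OF inj_tags(1), of ori_tag "ori_map \<phi>"] assms
  by (simp_all add: realize_map_def ori_map_def)

lemma realize_map_zeta_0:
  "Fn0 (realize_map (Zeta 0 i)) (Adj0 (cls0 adj_pres a)) = Ori0 0"
  "Fn1 (realize_map (Zeta 0 i)) (Adj1 (cls1 adj_pres (Gen1 v))) = Ori1 {0}"
  "Fn2 (realize_map (Zeta 0 i)) (Adj2 (cls2 adj_pres (Gen2 w))) = Ori2 ({0}, {0})"
  using tag_fun_simps[OF inj_tags(2), of ori_tag zeta_adj] zeta_adj.induced_cls(1)[of a]
    zeta_adj.induced_cls(2)[of "Gen1 v"] zeta_adj.induced_cls(3)[of "Gen2 w"]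
  by (simp_all add: realize_map_def zeta_adj_def)

lemma realize_map_zeta_1:
  assumes "i \<le> 1"
  shows "n \<le> 2 \<Longrightarrow> Fn0 (realize_map (Zeta 1 i)) (Inv0 (cls0 inv_pres n)) = Ori0 (codegen i n)"
    "S \<in> Mor (oriental 2) \<Longrightarrow> Fn1 (realize_map (Zeta 1 i)) (Inv1 (cls1 inv_pres (Gen1 S))) = Ori1 (codegen i ` S)"
    "c \<in> Cell (oriental 2) \<Longrightarrow> Fn2 (realize_map (Zeta 1 i)) (Inv2 (cls2 inv_pres (Gen2 (Some c))))
      = Ori2 (map_prod (image (codegen i)) (image (codegen i)) c)"
proof -
  interpret Z: presented_functor inv_pres "oriental 1" "codegen i" "image (codegen i)"
    "\<lambda>a. case a of Some b \<Rightarrow> Fn2 (ori_map (codegen i)) b | None \<Rightarrow> ({0, 1}, {0, 1})"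
    by (rule presented_functor_zeta_inv[OF assms])
  have z: "zeta_inv i = Z.ind" by (simp only: zeta_inv_def)
  have d: "td_dom (Zeta 1 i) = Mark 2" by simp
  note [simp] = realize_map_def
  show "n \<le> 2 \<Longrightarrow> Fn0 (realize_map (Zeta 1 i)) (Inv0 (cls0 inv_pres n)) = Ori0 (codegen i n)"
    "S \<in> Mor (oriental 2) \<Longrightarrow> Fn1 (realize_map (Zeta 1 i)) (Inv1 (cls1 inv_pres (Gen1 S))) = Ori1 (codegen i ` S)"
    "c \<in> Cell (oriental 2) \<Longrightarrow> Fn2 (realize_map (Zeta 1 i)) (Inv2 (cls2 inv_pres (Gen2 (Some c))))
      = Ori2 (map_prod (image (codegen i)) (image (codegen i)) c)"
    using tag_fun_simps[OF inj_tags(3), of ori_tag "zeta_inv i"] Z.induced_cls(1)[of n]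
      Z.induced_cls(2)[of "Gen1 S"] Z.induced_cls(3)[of "Gen2 (Some c)"]
    unfolding realize_map_def d realize_Mark_2 z[symmetric]
    by (simp_all add: ori_map_def)
qed

context nerve_of
begin

interpretation P: two_category path_cat by (rule two_category_path_cat)

abbreviation composite where
  "composite u x \<equiv> \<lparr>Fn0 = Fn0 (lift (td_cod u) x) \<circ> Fn0 (realize_map u),
     Fn1 = Fn1 (lift (td_cod u) x) \<circ> Fn1 (realize_map u), Fn2 = Fn2 (lift (td_cod u) x) \<circ> Fn2 (realize_map u)\<rparr>"

context
  fixes u x assumes u: "td_arr u" and x: "x \<in> simplices N (td_cod u)"
begin

interpretation F: two_functor "realize (td_dom u)" "realize (td_cod u)" "realize_map u"
  by (rule two_functor_realize_map[OF u])

lemma two_functor_composite: "two_functor (realize (td_dom u)) path_cat (composite u x)"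
  by (rule two_functor_comp[OF two_functor_realize_map[OF u] lift_functor(1)[OF x] two_category_realize])

lemma lift_act_0:
  "a \<in> Ob (realize (td_dom u)) \<Longrightarrow> Fn0 (lift (td_dom u) (act N u x)) a = Fn0 (lift (td_cod u) x) (Fn0 (realize_map u) a)"
  using lift_functor(2)[OF act_nerve_in[OF u x], of a] lift_functor(2)[OF x, of "Fn0 (realize_map u) a"] F.Fn0_in[of a]
  by (simp add: act_nerve)

lemma lift_act_C:
  "c \<in> Cell (realize (td_dom u)) \<Longrightarrow>
    Fn2 pC (Fn2 (lift (td_dom u) (act N u x)) c) = Fn2 pC (Fn2 (lift (td_cod u) x) (Fn2 (realize_map u) c))"
  using lift_functor(4)[OF act_nerve_in[OF u x], of c] lift_functor(4)[OF x, of "Fn2 (realize_map u) c"] F.Fn2_in[of c]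
  by (simp add: act_nerve del: pC_simps)

text \<open>If the domain of \<open>u\<close> is an oriental, both sides are lifts of the same simplex, so it is enough that
  the right-hand side is strict on edges.\<close>

lemma lift_act_unmarked:
  assumes k: "unmarked (td_dom u) k"
    and e: "\<And>i j. i < j \<Longrightarrow> j \<le> k \<Longrightarrow> Fn1 (lift (td_cod u) x) (Fn1 (realize_map u) (Ori1 {i, j}))
      = strict (Fn1 x (Fn1 (realize_map u) (Ori1 {i, j})))"
    and f: "f \<in> Mor (realize (td_dom u))"
  shows "Fn1 (lift (td_dom u) (act N u x)) f = Fn1 (lift (td_cod u) x) (Fn1 (realize_map u) f)"
proof -
  note r = realize_unmarked[OF k]
  have y: "act N u x \<in> simplices N (td_dom u)" by (rule act_nerve_in[OF u x])
  note G = pull_unmarked(1)[OF k y]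
  interpret G: oriental_lift C K s0 s1 s2 mu k "pull ori_tag (act N u x)" by (rule oriental_liftI[OF G])
  have L: "two_functor (oriental k) path_cat (pull ori_tag (composite u x))"
    by (rule two_functor_pull[OF inj_tags(1) two_category_oriental two_functor_composite[unfolded r]])
  obtain S where S: "f = Ori1 S" "S \<in> Mor (oriental k)" using f r by auto
  have "Fn1 (pull ori_tag (composite u x)) S = Fn1 (olift (pull ori_tag (act N u x))) S"
  proof (rule G.olift_unique(1)[OF L _ _ _ S(2)])
    fix i j :: nat and c
    show "i \<le> k \<Longrightarrow> Fn0 (pull ori_tag (composite u x)) i = Fn0 (pull ori_tag (act N u x)) i"
      using lift_act_0[of "Ori0 i"] lift_functor(2)[OF y, of "Ori0 i"] r by simp
    show "i < j \<Longrightarrow> j \<le> k \<Longrightarrow> Fn1 (pull ori_tag (composite u x)) {i, j} = strict (Fn1 (pull ori_tag (act N u x)) {i, j})"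
      using e[of i j] Mor_pair[of i j k] r by (simp add: act_nerve)
    show "c \<in> Cell (oriental k) \<Longrightarrow> Fn2 pC (Fn2 (pull ori_tag (composite u x)) c) = Fn2 (pull ori_tag (act N u x)) c"
      using lift_act_C[of "Ori2 c"] lift_functor(4)[OF y, of "Ori2 c"] r by (simp del: pC_simps)
  qed
  then show ?thesis using S(1) by (simp add: lift_unmarked[OF k])
qed

lemma lift_act_oriental:
  assumes k: "unmarked (td_dom u) k" and m: "unmarked (td_cod u) m"
    and p: "pre_realize_map u = tag_fun ori_tag ori_tag (ori_map \<phi>)" and \<phi>: "mono \<phi>" "\<And>i. i \<le> k \<Longrightarrow> \<phi> i \<le> m"
    and f: "f \<in> Mor (realize (td_dom u))"
  shows "Fn1 (lift (td_dom u) (act N u x)) f = Fn1 (lift (td_cod u) x) (Fn1 (realize_map u) f)"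
proof (rule lift_act_unmarked[OF k _ f])
  interpret G: oriental_lift C K s0 s1 s2 mu m "pull ori_tag x"
    by (rule oriental_liftI[OF pull_unmarked(1)[OF m x]])
  fix i j assume ij: "i < j" "j \<le> k"
  have r: "Fn1 (realize_map u) (Ori1 {i, j}) = Ori1 {\<phi> i, \<phi> j}"
    using realize_map_tagged(2)[OF u realize_unmarked[OF k] p Mor_pair[of i j k]] ij by simp
  show "Fn1 (lift (td_cod u) x) (Fn1 (realize_map u) (Ori1 {i, j})) = strict (Fn1 x (Fn1 (realize_map u) (Ori1 {i, j})))"
    using G.olift_edge[of "\<phi> i" "\<phi> j"] \<phi>(2)[of j] monoD[OF \<phi>(1), of i j] ij
    by (simp add: r lift_unmarked[OF m])
qed

end

text \<open>The lifts are compatible with the structure maps.  If the domain is marked of dimension 1 or 2, the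
  structure map is a degeneracy and the generators of the domain are compared one by one; on the
  generator \<open>g\<close> of the free adjoint equivalence this is lemma \<open>mate_degenerate\<close>.\<close>

lemma lift_act_1:
  assumes u: "td_arr u" and x: "x \<in> simplices N (td_cod u)" and f: "f \<in> Mor (realize (td_dom u))"
  shows "Fn1 (lift (td_dom u) (act N u x)) f = Fn1 (lift (td_cod u) x) (Fn1 (realize_map u) f)"
proof (cases u)
  case (CoF m i)
  show ?thesis
    by (rule lift_act_oriental[OF u x _ _ _ mono_coface[of i] _ f, of m "Suc m"]) (simp_all add: CoF coface_def)
next
  case (CoD m i)
  show ?thesis
    by (rule lift_act_oriental[OF u x _ _ _ mono_codegen[of i] _ f, of "Suc m" m])
      (use u in \<open>auto simp: CoD codegen_def\<close>)
next
  case (Phi m)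
  consider "m = 1" | "m = 2" | "3 \<le> m" using u Phi by fastforce
  then show ?thesis
  proof cases
    case 1
    have x': "x \<in> simplices N (Mark 1)" using x Phi 1 by simp
    note l = alift[OF mark_1[OF x']]
    show ?thesis
    proof (rule lift_act_unmarked[OF u x _ _ f])
      show "unmarked (td_dom u) 1" using Phi 1 by simp
      fix i j :: nat assume "i < j" "j \<le> 1"
      then have ij: "i = 0" "j = 1" by linarith+
      show "Fn1 (lift (td_cod u) x) (Fn1 (realize_map u) (Ori1 {i, j})) = strict (Fn1 x (Fn1 (realize_map u) (Ori1 {i, j})))"
        unfolding Phi 1 ij realize_map_phi_1 using l(3) by simp
    qed
  next
    case 2
    have x': "x \<in> simplices N (Mark 2)" using x Phi 2 by simp
    note l = ilift[OF mark_2[OF x']]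
    interpret G: oriental_lift C K s0 s1 s2 mu 2 "along_phi (pull inv_tag x)" by (rule oriental_liftI[OF l(8)])
    show ?thesis
    proof (rule lift_act_unmarked[OF u x _ _ f])
      show "unmarked (td_dom u) 2" using Phi 2 by simp
      fix i j :: nat assume ij: "i < j" "j \<le> 2"
      have "{i, j} \<in> Mor (oriental 2)" using Mor_pair[of i j 2] ij by simp
      then show "Fn1 (lift (td_cod u) x) (Fn1 (realize_map u) (Ori1 {i, j})) = strict (Fn1 x (Fn1 (realize_map u) (Ori1 {i, j})))"
        unfolding Phi 2 using l(3)[of "{i, j}"] G.olift_edge[of i j] ij by (simp add: realize_map_phi_2)
    qed
  next
    case 3
    show ?thesis
      by (rule lift_act_oriental[OF u x, of m m "\<lambda>k. k"]) (use 3 f in \<open>auto simp: Phi mono_def\<close>)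
  qed
next
  case (Zeta m i)
  consider "m = 0" | "m = 1" | "2 \<le> m" by linarith
  then show ?thesis
  proof cases
    case 1
    have i: "i = 0" using u Zeta 1 by simp
    have uz: "u = Zeta 0 0" by (simp add: Zeta 1 i)
    have x0: "x \<in> simplices N (Simp 0)" using x uz by simp
    let ?y = "act N u x"
    have y: "?y \<in> simplices N (Mark 1)" using act_nerve_in[OF u x] uz by simp
    note l = alift[OF mark_1[OF y]]
    note F = pull_unmarked(1)[OF _ x0, of 0, simplified] and H = pull_unmarked(2)[OF _ x0, of 0, simplified]
    interpret F: two_functor "oriental 0" C "pull ori_tag x" by (rule F)
    interpret H: two_functor "oriental 0" K "pull ori_tag (unit N (Simp 0) x)" by (rule H)
    interpret G: oriental_lift C K s0 s1 s2 mu 0 "pull ori_tag x" by (rule oriental_liftI[OF F])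
    interpret O: two_functor "oriental 0" path_cat "olift (pull ori_tag x)" by (rule G.two_functor_olift)
    define a where "a = Fn0 x (Ori0 0)"
    have a: "a \<in> Ob C" using F.Fn0_in[of 0] by (simp add: a_def)
    have x1: "Fn1 x (Ori1 {0}) = IdM C a" using F.Fn_IdM[of 0] by (simp add: a_def)
    have x2: "Fn2 x (Ori2 ({0}, {0})) = \<iota>\<^bsub>C\<^esub> (IdM C a)" using F.Fn_IdC[of "{0}"] x1 by (simp add: Mor_oriental)
    have u0: "Fn0 (unit N (Simp 0) x) (Ori0 0) = s0 a" using unit_unmarked(1)[OF _ x0, of 0 0] by (simp add: a_def)
    have u1: "Fn1 (unit N (Simp 0) x) (Ori1 {0}) = IdM K (s0 a)" using H.Fn_IdM[of 0] u0 by simp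
    have u2: "Fn2 (unit N (Simp 0) x) (Ori2 ({0}, {0})) = \<iota>\<^bsub>K\<^esub> (IdM K (s0 a))"
      using H.Fn_IdC[of "{0}"] u1 by (simp add: Mor_oriental)
    have o: "Fn1 (olift (pull ori_tag x)) {0} = (IdM C a, \<iota>\<^bsub>K\<^esub> (IdM K (s0 a)))"
      using O.Fn_IdM[of 0] by (simp add: G.Fn0_olift a_def)
    have dm: "td_dom u = Mark 1" "td_cod u = Simp 0" by (simp_all add: uz)
    have un: "Fn1 (unit N (Mark 1) ?y) (Adj1 (cls1 adj_pres (Gen1 Adj_g))) = IdM K (s0 a)"
      "Fn2 (unit N (Mark 1) ?y) (Adj2 (cls2 adj_pres (Gen2 Adj_eta))) = \<iota>\<^bsub>K\<^esub> (IdM K (s0 a))"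
      using unit_glue(2,3)[OF u x act_nerve_in[OF u x]] u1 u2
      unfolding dm realize_Mark_1 by (simp_all add: uz realize_map_zeta_0)
    have y1: "Fn1 ?y (Adj1 (cls1 adj_pres (Gen1 v))) = IdM C a" for v
      unfolding act_nerve dm realize_Mark_1 using x1 by (simp add: uz realize_map_zeta_0)
    have y2: "Fn2 ?y (Adj2 (cls2 adj_pres (Gen2 Adj_eps))) = \<iota>\<^bsub>C\<^esub> (IdM C a)"
      unfolding act_nerve dm realize_Mark_1 using x2 by (simp add: uz realize_map_zeta_0)
    have L: "two_functor (presented adj_pres) path_cat (pull adj_tag (composite u x))"
      by (rule two_functor_pull[OF inj_tags(2) adj_pres.two_category_presented
        two_functor_composite[OF u x, unfolded dm(1) realize_Mark_1]])
    have g0: "Fn0 (alift (pull adj_tag ?y) (pull adj_tag (unit N (Mark 1) ?y))) (cls0 adj_pres b)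
        = Fn0 (pull adj_tag (composite u x)) (cls0 adj_pres b)" for b
      using lift_act_0[OF u x, of "Adj0 (cls0 adj_pres b)"] unfolding dm(1) realize_Mark_1 by simp
    have g1: "Fn1 (alift (pull adj_tag ?y) (pull adj_tag (unit N (Mark 1) ?y))) (cls1 adj_pres (Gen1 v))
        = Fn1 (pull adj_tag (composite u x)) (cls1 adj_pres (Gen1 v))" for v
    proof (cases v)
      case Adj_f
      then show ?thesis using l(3) y1 strict_IdM[OF a]
        by (simp add: uz realize_map_zeta_0 o)
    next
      case Adj_g
      then show ?thesis using l(4) y1 y2 un mate_degenerate[OF a]
        by (simp add: uz realize_map_zeta_0 o)
    qed
    obtain t where t: "f = Adj1 t" "t \<in> Mor (presented adj_pres)"
      using f unfolding dm(1) realize_Mark_1 by auto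
    show ?thesis
      using adj_pres.functor_eq_on_presented(1)[OF l(1) L g0 g1 t(2)] unfolding t(1) dm(1) by simp
  next
    case 2
    have i: "i \<le> 1" using u Zeta 2 by simp
    have uz: "u = Zeta 1 i" by (simp add: Zeta 2)
    have x1: "x \<in> simplices N (Simp 1)" using x uz by simp
    let ?y = "act N u x"
    have y: "?y \<in> simplices N (Mark 2)" using act_nerve_in[OF u x] uz by (simp add: numeral_2_eq_2)
    note l = ilift[OF mark_2[OF y]]
    note F = pull_unmarked(1)[OF _ x1, of 1, simplified]
    have le: "n \<le> 2 \<Longrightarrow> codegen i n \<le> 1" for n using i by (auto simp: codegen_def)
    have dm: "td_dom u = Mark 2" "td_cod u = Simp 1" by (simp_all add: uz)
    note z = realize_map_zeta_1[OF i, folded uz]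
    have F1: "two_functor (oriental 1) C (pull ori_tag x)" using F by simp
    have eq: "Fn1 (olift (along_phi (pull inv_tag ?y))) S = Fn1 (olift (ocomp (pull ori_tag x) (codegen i))) S"
      if "S \<in> Mor (oriental 2)" for S
    proof (rule olift_cong[OF l(8) two_functor_ocomp[OF F1 mono_codegen le] _ _ _ that])
      show "Fn0 (along_phi (pull inv_tag ?y)) n = Fn0 (ocomp (pull ori_tag x) (codegen i)) n" if "n \<le> 2" for n
        unfolding act_nerve dm(1) realize_Mark_2 using z(1)[OF that] that by simp
      show "Fn1 (along_phi (pull inv_tag ?y)) S = Fn1 (ocomp (pull ori_tag x) (codegen i)) S" if "S \<in> Mor (oriental 2)" for S
        unfolding act_nerve dm(1) realize_Mark_2 using z(2)[OF that] that by simp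
      show "Fn2 (along_phi (pull inv_tag ?y)) c = Fn2 (ocomp (pull ori_tag x) (codegen i)) c" if "c \<in> Cell (oriental 2)" for c
        unfolding act_nerve dm(1) realize_Mark_2 using z(3)[OF that] that by (cases c) simp
    qed
    have L: "two_functor (presented inv_pres) path_cat (pull inv_tag (composite u x))"
      by (rule two_functor_pull[OF inj_tags(3) inv_pres.two_category_presented
        two_functor_composite[OF u x, unfolded dm(1) realize_Mark_2]])
    have g0: "Fn0 (ilift (pull inv_tag ?y) (pull inv_tag (unit N (Mark 2) ?y))) (cls0 inv_pres b)
        = Fn0 (pull inv_tag (composite u x)) (cls0 inv_pres b)" if "b \<in> Gens0 inv_pres" for b
      using lift_act_0[OF u x, of "Inv0 (cls0 inv_pres b)"] that unfolding dm(1) realize_Mark_2 by simp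
    have g1: "Fn1 (ilift (pull inv_tag ?y) (pull inv_tag (unit N (Mark 2) ?y))) (cls1 inv_pres (Gen1 S))
        = Fn1 (pull inv_tag (composite u x)) (cls1 inv_pres (Gen1 S))" if "S \<in> Gens1 inv_pres" for S
    proof -
      have S: "S \<in> Mor (oriental 2)" using that by simp
      have "Fn1 (olift (ocomp (pull ori_tag x) (codegen i))) S = Fn1 (olift (pull ori_tag x)) (codegen i ` S)"
        by (rule olift_ocomp[OF F1 mono_codegen le S])
      then show ?thesis
        using l(3)[where S = S] S eq[OF S] z(2)[OF S] by (simp add: dm(2))
    qed
    obtain t where t: "f = Inv1 t" "t \<in> Mor (presented inv_pres)"
      using f unfolding dm(1) realize_Mark_2 by auto
    show ?thesis
      using inv_pres.functor_eq_on_presented(1)[OF l(1) L g0 g1 t(2)] unfolding t(1) dm(1) by simp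
  next
    case 3
    show ?thesis
      by (rule lift_act_oriental[OF u x, of "Suc m" m "codegen i"])
        (use 3 f u mono_codegen in \<open>auto simp: Zeta codegen_def\<close>)
  qed
qed

lemma lift_act_2:
  assumes u: "td_arr u" and x: "x \<in> simplices N (td_cod u)" and c: "c \<in> Cell (realize (td_dom u))"
  shows "Fn2 (lift (td_dom u) (act N u x)) c = Fn2 (lift (td_cod u) x) (Fn2 (realize_map u) c)"
proof -
  have "Fn2 (lift (td_dom u) (act N u x)) c = Fn2 (composite u x) c"
    by (rule path_functor_eq[OF lift_functor(1)[OF act_nerve_in[OF u x]] two_functor_composite[OF u x] two_category_realize _ _ c])
      (simp_all add: lift_act_1[OF u x] lift_act_C[OF u x] del: pC_simps)
  then show ?thesis by simp
qed

text \<open>The lifts form a cocone, hence glue to a 2-functor from \<open>K\<close> to the path object.  Its projections are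
  the counit and the identity because they are so on generators.\<close>

sublocale L: presented_functor "cat_pres N" path_cat "\<lambda>(\<theta>, x, a). Fn0 (lift \<theta> x) a"
  "\<lambda>(\<theta>, x, f). Fn1 (lift \<theta> x) f" "\<lambda>(\<theta>, x, c). Fn2 (lift \<theta> x) c"
  by (rule presented_functor_cat_pres[OF two_category_path_cat lift_functor(1)])
    (simp_all add: lift_act_0 lift_act_1 lift_act_2)

sublocale E: presented_functor "cat_pres N" C "\<lambda>(\<theta>, x, a). Fn0 x a" "\<lambda>(\<theta>, x, f). Fn1 x f" "\<lambda>(\<theta>, x, c). Fn2 x c"
  by (rule presented_functor_counit[OF C.two_category_axioms])

lemma counit_ind: "counit C = E.ind"
  by (simp add: counit_def adjunct_def)

lemma two_functor_counit: "two_functor K C (counit C)"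
  unfolding counit_ind by (rule E.two_functor_induced[folded categorification_def])

lemma two_functor_L: "two_functor K path_cat L.ind"
  by (rule L.two_functor_induced[folded categorification_def])

text \<open>The generating object \<open>X\<close> is recovered from the identity 1-cell of its lift, whose component in \<open>K\<close> has
  both source \<open>s0 (\<epsilon> X)\<close> and source \<open>X\<close>.\<close>

lemma Fn0_L:
  assumes "X \<in> Ob K"
  shows "Fn0 L.ind X = Fn0 (counit C) X" "s0 (Fn0 L.ind X) = X"
proof -
  obtain \<theta> x a where X: "X = cls0 (cat_pres N) (\<theta>, x, a)" "x \<in> simplices N \<theta>" "a \<in> Ob (realize \<theta>)"
    using assms by (auto simp: categorification_def)
  have g: "(\<theta>, x, a) \<in> Gens0 (cat_pres N)" using X by simp
  interpret l: two_functor "realize \<theta>" path_cat "lift \<theta> x" by (rule lift_functor(1)[OF X(2)])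
  interpret x: two_functor "realize \<theta>" C x by (rule simplex_functor[OF X(2)])
  interpret U: two_functor "realize \<theta>" K "unit N \<theta> x" by (rule two_functor_unit[OF X(2)])
  interpret A: two_category "realize \<theta>" by (rule two_category_realize)
  show "Fn0 L.ind X = Fn0 (counit C) X"
    unfolding counit_ind X(1) L.induced_cls(1)[OF g] E.induced_cls(1)[OF g] by (simp add: lift_functor(2)[OF X(2,3)])
  have i: "IdM (realize \<theta>) a \<in> Mor (realize \<theta>)" "Src (realize \<theta>) (IdM (realize \<theta>) a) = a"
    using X(3) by (simp_all add: A.typing)
  let ?f = "Fn1 (lift \<theta> x) (IdM (realize \<theta>) a)"
  have "s0 (Src C (fst ?f)) = Src K (Cod K (snd ?f))"
    using pmorD(5)[of ?f] l.Fn1_in[OF i(1)] by simp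
  also have "Cod K (snd ?f) = Fn1 (unit N \<theta> x) (IdM (realize \<theta>) a)"
    using lift_functor(5)[OF X(2) i(1)] by simp
  also have "Src K \<dots> = X" using U.Fn_Src[OF i(1)] i(2) by (simp add: unit_simps X(1))
  also have "Src C (fst ?f) = Fn0 (lift \<theta> x) a" using l.Fn_Src[OF i(1)] i(2) by simp
  finally show "s0 (Fn0 L.ind X) = X" unfolding X(1) L.induced_cls(1)[OF g] by simp
qed

lemma pC_L:
  "f \<in> Mor K \<Longrightarrow> Fn1 pC (Fn1 L.ind f) = Fn1 (counit C) f"
  "c \<in> Cell K \<Longrightarrow> Fn2 pC (Fn2 L.ind c) = Fn2 (counit C) c"
proof -
  note LC = two_functor_comp[OF two_functor_L two_functor_pC two_category_categorification]
  note u = cat_pres.functor_eq_on_presented[folded categorification_def, OF LC two_functor_counit]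
  have 0: "Fn0 L.ind (cls0 (cat_pres N) g) = Fn0 (counit C) (cls0 (cat_pres N) g)" if "g \<in> Gens0 (cat_pres N)" for g
    using Fn0_L(1)[of "cls0 (cat_pres N) g"] that by (simp add: categorification_def)
  have 1: "fst (Fn1 L.ind (cls1 (cat_pres N) (Gen1 g))) = Fn1 (counit C) (cls1 (cat_pres N) (Gen1 g))"
    if "g \<in> Gens1 (cat_pres N)" for g
    using that L.induced_cls(2)[of "Gen1 g"] E.induced_cls(2)[of "Gen1 g"] lift_functor(3)
    by (cases g) (simp add: counit_ind)
  have 2: "Fn2 pC (Fn2 L.ind (cls2 (cat_pres N) (Gen2 g))) = Fn2 (counit C) (cls2 (cat_pres N) (Gen2 g))"
    if "g \<in> Gens2 (cat_pres N)" for g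
    using that L.induced_cls(3)[of "Gen2 g"] E.induced_cls(3)[of "Gen2 g"] lift_functor(4)
    by (cases g) (simp add: counit_ind del: pC_simps)
  show "f \<in> Mor K \<Longrightarrow> Fn1 pC (Fn1 L.ind f) = Fn1 (counit C) f"
    "c \<in> Cell K \<Longrightarrow> Fn2 pC (Fn2 L.ind c) = Fn2 (counit C) c"
    using u(1)[of f] u(2)[of c] 0 1 2 by simp_all
qed

lemma two_functor_identity: "two_category A \<Longrightarrow> two_functor A A \<lparr>Fn0 = (\<lambda>x. x), Fn1 = (\<lambda>f. f), Fn2 = (\<lambda>c. c)\<rparr>"
  by unfold_locales simp_all

lemma pK_L:
  "f \<in> Mor K \<Longrightarrow> Fn1 pK (Fn1 L.ind f) = f"
  "c \<in> Cell K \<Longrightarrow> Fn2 pK (Fn2 L.ind c) = c"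
proof -
  note LK = two_functor_comp[OF two_functor_L two_functor_pK two_category_categorification]
  note u = cat_pres.functor_eq_on_presented[folded categorification_def, OF LK
    two_functor_identity[OF two_category_categorification]]
  have 0: "s0 (Fn0 L.ind (cls0 (cat_pres N) g)) = cls0 (cat_pres N) g" if "g \<in> Gens0 (cat_pres N)" for g
    using Fn0_L(2)[of "cls0 (cat_pres N) g"] that by (simp add: categorification_def)
  have 1: "Fn1 pK (Fn1 L.ind (cls1 (cat_pres N) (Gen1 g))) = cls1 (cat_pres N) (Gen1 g)"
    if "g \<in> Gens1 (cat_pres N)" for g
    using that L.induced_cls(2)[of "Gen1 g"] lift_functor(5) by (cases g) (simp add: unit_simps del: pK_simps)
  have 2: "Fn2 pK (Fn2 L.ind (cls2 (cat_pres N) (Gen2 g))) = cls2 (cat_pres N) (Gen2 g)"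
    if "g \<in> Gens2 (cat_pres N)" for g
    using that L.induced_cls(3)[of "Gen2 g"] lift_functor(6) by (cases g) (simp add: unit_simps del: pK_simps)
  show "f \<in> Mor K \<Longrightarrow> Fn1 pK (Fn1 L.ind f) = f" "c \<in> Cell K \<Longrightarrow> Fn2 pK (Fn2 L.ind c) = c"
    using u(1)[of f] u(2)[of c] 0 1 2 by simp_all
qed

end

section \<open>The counit\<close>

context nerve_of
begin

lemma counit_unit_at:
  assumes G: "two_functor (oriental m) C G"
  shows "i \<le> m \<Longrightarrow> Fn0 (counit C) (Fn0 (unit_at C m G) i) = Fn0 G i"
    "S \<in> Mor (oriental m) \<Longrightarrow> Fn1 (counit C) (Fn1 (unit_at C m G) S) = Fn1 G S"
    "c \<in> Cell (oriental m) \<Longrightarrow> Fn2 (counit C) (Fn2 (unit_at C m G) c) = Fn2 G c"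
proof -
  let ?x = "osimplex m G"
  note o = osimplex[OF G]
  show "i \<le> m \<Longrightarrow> Fn0 (counit C) (Fn0 (unit_at C m G) i) = Fn0 G i"
    using E.induced_cls(1)[of "(Simp m, ?x, Ori0 i)"] o(1,2) by (simp add: counit_ind unit_at_def unit_simps)
  show "S \<in> Mor (oriental m) \<Longrightarrow> Fn1 (counit C) (Fn1 (unit_at C m G) S) = Fn1 G S"
    using E.induced_cls(2)[of "Gen1 (Simp m, ?x, Ori1 S)"] o(1,3) by (simp add: counit_ind unit_at_def unit_simps)
  show "c \<in> Cell (oriental m) \<Longrightarrow> Fn2 (counit C) (Fn2 (unit_at C m G) c) = Fn2 G c"
    using E.induced_cls(3)[of "Gen2 (Simp m, ?x, Ori2 c)"] o(1,4) by (simp add: counit_ind unit_at_def unit_simps)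
qed

text \<open>The counit evaluates a generator, which is a cell of a simplex of \<open>C\<close>, in \<open>C\<close>.\<close>

lemma counit_section:
  "x \<in> Ob C \<Longrightarrow> Fn0 (counit C) (s0 x) = x"
  "h \<in> Mor C \<Longrightarrow> Fn1 (counit C) (s1 h) = h"
  "\<alpha> \<in> Cell C \<Longrightarrow> Fn2 (counit C) (s2 \<alpha>) = \<alpha>"
proof -
  show "x \<in> Ob C \<Longrightarrow> Fn0 (counit C) (s0 x) = x"
    using counit_unit_at(1)[OF vertex(1), of x 0] vertex(2)[of x 0] by (simp add: s0_def)
  show "h \<in> Mor C \<Longrightarrow> Fn1 (counit C) (s1 h) = h"
    using counit_unit_at(2)[OF edge(1), of h "{0, 1}"] edge(4)[of h] Mor_pair[of 0 1 1]
    by (simp add: s1_def del: One_nat_def)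
  show "Fn2 (counit C) (s2 \<alpha>) = \<alpha>" if \<alpha>: "\<alpha> \<in> Cell C"
  proof -
    have "IdM C (Src C (Dom C \<alpha>)) \<in> Mor C" "Cod C \<alpha> \<in> Mor C"
      "Tgt C (IdM C (Src C (Dom C \<alpha>))) = Src C (Cod C \<alpha>)" "Cod C \<alpha> = Cod C \<alpha> \<odot>\<^bsub>C\<^esub> IdM C (Src C (Dom C \<alpha>))"
      using \<alpha> C.Src_Cod[of \<alpha>] C.Comp_IdM_right[of "Cod C \<alpha>"] by (simp_all add: C.typing)
    note t = triangle2[OF this(1-3) \<alpha> this(4)]
    show ?thesis
      using counit_unit_at(3)[OF t(1), of "({0, 2}, {0, 1, 2})"] t(8) Cell_triple[of 0 1 2 2]
      by (simp add: s2_def T_def del: One_nat_def)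
  qed
qed

interpretation E: two_functor K C "counit C" by (rule two_functor_counit)
interpretation L: two_functor K path_cat L.ind by (rule two_functor_L)

text \<open>A 2-cell of \<open>K\<close> is a component of a 2-cell of the path object, hence is determined by its ends and
  by its image in \<open>C\<close>.\<close>

lemma L_Cell:
  assumes "a \<in> Cell K"
  shows "(Fn1 L.ind (Dom K a), Fn1 L.ind (Cod K a), Fn2 (counit C) a, a) \<in> pcell"
proof -
  have "Fn2 L.ind a = (Fn1 L.ind (Dom K a), Fn1 L.ind (Cod K a), Fn2 (counit C) a, a)"
    using L.Fn_Dom[OF assms] L.Fn_Cod[OF assms] pC_L(2)[OF assms] pK_L(2)[OF assms]
    by (cases "Fn2 L.ind a") simp
  then show ?thesis using L.Fn2_in[OF assms] by simp
qed

lemma counit_faithful: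
  assumes "a \<in> Cell K" "b \<in> Cell K" "Dom K a = Dom K b" "Cod K a = Cod K b" "Fn2 (counit C) a = Fn2 (counit C) b"
  shows "a = b"
  using L_Cell[OF assms(1)] L_Cell[OF assms(2)] unfolding assms(3-5) by (rule pcell_unique)

text \<open>The 2-functor \<open>L\<close> provides the isomorphism from \<open>s1 (\<epsilon> f)\<close> to \<open>f\<close>.\<close>

lemma L_Mor:
  assumes "f \<in> Mor K"
  shows "iso_cell K (snd (Fn1 L.ind f))" "Dom K (snd (Fn1 L.ind f)) = s1 (Fn1 (counit C) f)" "Cod K (snd (Fn1 L.ind f)) = f"
  using pmorD[of "Fn1 L.ind f"] L.Fn1_in[OF assms] pC_L(1)[OF assms] pK_L(1)[OF assms] by simp_all

text \<open>A 2-cell \<open>\<alpha>\<close> between images lifts to the conjugate of \<open>s2 \<alpha>\<close> by the invertible 2-cells that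
  compare the 1-cells of \<open>K\<close> with the chosen preimages of their images.\<close>

lemma counit_full:
  assumes f: "f \<in> Mor K" and g: "g \<in> Mor K"
    and \<alpha>: "\<alpha> \<in> cells C (Fn1 (counit C) f) (Fn1 (counit C) g)"
  shows "\<exists>a \<in> cells K f g. Fn2 (counit C) a = \<alpha>"
proof -
  let ?k = "snd (Fn1 L.ind f)" and ?l = "snd (Fn1 L.ind g)"
  note k = L_Mor[OF f] and l = L_Mor[OF g]
  obtain k' where k': "inverse_cells K ?k k'" using k by (auto simp: iso_cell_def)
  obtain l' where l': "inverse_cells K ?l l'" using l by (auto simp: iso_cell_def)
  note dk = K.inverse_cellsD[OF k'] and dl = K.inverse_cellsD[OF l']
  have \<alpha>': "\<alpha> \<in> Cell C" "Dom C \<alpha> = Fn1 (counit C) f" "Cod C \<alpha> = Fn1 (counit C) g" using \<alpha> by (auto simp: cells_def)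
  note s = s2_typing[OF \<alpha>'(1)]
  define b where "b = ?l \<cdot>\<^bsub>K\<^esub> s2 \<alpha>"
  define a where "a = b \<cdot>\<^bsub>K\<^esub> k'"
  have b: "b \<in> Cell K" "Dom K b = s1 (Fn1 (counit C) f)" "Cod K b = g"
    using s dl l \<alpha>' by (simp_all add: b_def K.typing)
  have a: "a \<in> Cell K" "Dom K a = f" "Cod K a = g" using b dk k by (simp_all add: a_def K.typing)
  have ak: "a \<cdot>\<^bsub>K\<^esub> ?k = b"
    using K.VComp_assoc[of ?k k' b] K.VComp_IdC_right[OF b(1)] b dk k by (simp add: a_def)
  have cancel: "l' \<cdot>\<^bsub>K\<^esub> (?l \<cdot>\<^bsub>K\<^esub> c) = c" if "c \<in> Cell K" "Cod K c = s1 (Fn1 (counit C) g)" for c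
    using K.VComp_assoc[of c ?l l'] K.VComp_IdC_left[OF that(1)] that dl l by simp
  \<comment> \<open>Naturality of the comparison at \<open>a\<close> shows that \<open>a\<close> is also the conjugate of \<open>s2\<close> of its image.\<close>
  have p: "?l \<cdot>\<^bsub>K\<^esub> s2 (Fn2 (counit C) a) = a \<cdot>\<^bsub>K\<^esub> ?k"
    using pcellD(9)[OF L_Cell[OF a(1)]] a by simp
  have e: "Fn2 (counit C) a \<in> Cell C" "Cod C (Fn2 (counit C) a) = Fn1 (counit C) g"
    using E.Fn2_in[OF a(1)] E.Fn_Cod[OF a(1)] a by simp_all
  have "s2 (Fn2 (counit C) a) = l' \<cdot>\<^bsub>K\<^esub> (?l \<cdot>\<^bsub>K\<^esub> s2 (Fn2 (counit C) a))"
    by (rule cancel[symmetric]) (use s2_typing[OF e(1)] e in simp_all)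
  also have "\<dots> = l' \<cdot>\<^bsub>K\<^esub> (?l \<cdot>\<^bsub>K\<^esub> s2 \<alpha>)" unfolding p ak by (simp add: b_def)
  also have "\<dots> = s2 \<alpha>" by (rule cancel) (use s \<alpha>' in simp_all)
  finally have "s2 (Fn2 (counit C) a) = s2 \<alpha>" .
  from arg_cong[OF this, of "Fn2 (counit C)"] have "Fn2 (counit C) a = \<alpha>"
    by (rule box_equals[OF _ counit_section(3)[OF e(1)] counit_section(3)[OF \<alpha>'(1)]])
  then show ?thesis using a by (auto simp: cells_def)
qed

text \<open>The equation \<open>s0 (\<epsilon> x) = x\<close> makes \<open>s1 h\<close> a 1-cell from \<open>x\<close> to \<open>y\<close>.\<close>

lemma counit_full_on_mors:
  assumes "x \<in> Ob K" "y \<in> Ob K" "h \<in> hom C (Fn0 (counit C) x) (Fn0 (counit C) y)"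
  shows "\<exists>f \<in> hom K x y. Fn1 (counit C) f = h"
proof
  show "s1 h \<in> hom K x y" "Fn1 (counit C) (s1 h) = h"
    using assms s1_typing[of h] Fn0_L[of x] Fn0_L[of y] counit_section(2)[of h] by (simp_all add: hom_def)
qed

lemma counit_in: "counit C \<in> two_functors K C"
  unfolding two_functors_def using two_functor_counit
  by (simp add: counit_ind) (simp add: induced_def categorification_def)

end

section \<open>Acyclic fibrations\<close>

lemma two_comp_eqI:
  assumes "u \<in> two_functors A X" "\<And>x. x \<in> Ob A \<Longrightarrow> Fn0 G (Fn0 F x) = Fn0 u x"
    "\<And>f. f \<in> Mor A \<Longrightarrow> Fn1 G (Fn1 F f) = Fn1 u f" "\<And>a. a \<in> Cell A \<Longrightarrow> Fn2 G (Fn2 F a) = Fn2 u a"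
  shows "two_comp A G F = u"
proof -
  have "two_comp A G F = restr A u"
    using assms(2-4) by (simp add: two_comp_def restr_def restrict_def fun_eq_iff)
  then show ?thesis using assms(1) by (simp add: two_functors_def)
qed

lemma two_comp_eqD:
  assumes "two_comp A p u = two_comp A v i"
  shows "x \<in> Ob A \<Longrightarrow> Fn0 p (Fn0 u x) = Fn0 v (Fn0 i x)" "f \<in> Mor A \<Longrightarrow> Fn1 p (Fn1 u f) = Fn1 v (Fn1 i f)"
    "a \<in> Cell A \<Longrightarrow> Fn2 p (Fn2 u a) = Fn2 v (Fn2 i a)"
  using Fn_two_comp[of _ A p u] Fn_two_comp[of _ A v i] unfolding assms by metis+

lemma ordinal_simps [simp]:
  "CObj (ordinal n) = {..<n}" "CArr (ordinal n) = {(i, j). i \<le> j \<and> j < n}"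
  "CDom (ordinal n) = fst" "CCod (ordinal n) = snd" "CId (ordinal n) i = (i, i)"
  "CComp (ordinal n) (j, k) (i, j') = (i, k)"
  by (simp_all add: ordinal_def)

lemma discrete_simps [simp]:
  "CObj (discrete n) = {..<n}" "CArr (discrete n) = {(i, i) |i. i < n}"
  "CDom (discrete n) = fst" "CCod (discrete n) = snd" "CId (discrete n) i = (i, i)"
  by (simp_all add: discrete_def ordinal_def)

lemma parallel_arrows_simps [simp]:
  "CObj parallel_arrows = {0, 1}" "CDom parallel_arrows (i, es, j) = i" "CCod parallel_arrows (i, es, j) = j"
  "CId parallel_arrows i = (i, [], i)"
  by (simp_all add: parallel_arrows_def free_cat_def)

text \<open>Paths have length at most one, since no edge starts at \<open>1\<close>.\<close>

lemma CArr_parallel_arrows: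
  "(i, es, j) \<in> CArr parallel_arrows \<longleftrightarrow> i \<le> 1 \<and> i = j \<and> es = [] \<or> i = 0 \<and> j = 1 \<and> (\<exists>b. es = [b])"
proof -
  have "path (\<lambda>_. 0) (\<lambda>_. 1) i es j \<longleftrightarrow> i = j \<and> es = [] \<or> i = 0 \<and> j = 1 \<and> (\<exists>b. es = [b])" for i j :: nat and es :: "bool list"
  proof (cases es)
    case (Cons b bs)
    then show ?thesis by (cases bs) auto
  qed auto
  then show ?thesis by (auto simp: parallel_arrows_def free_cat_def)
qed

lemma locally_discrete_simps [simp]:
  "Ob (locally_discrete D) = CObj D" "Mor (locally_discrete D) = CArr D" "Cell (locally_discrete D) = CArr D"
  "Src (locally_discrete D) = CDom D" "Tgt (locally_discrete D) = CCod D"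
  "Dom (locally_discrete D) a = a" "Cod (locally_discrete D) a = a" "IdM (locally_discrete D) = CId D"
  "IdC (locally_discrete D) f = f" "Comp (locally_discrete D) = CComp D"
  "VComp (locally_discrete D) b a = b" "HComp (locally_discrete D) = CComp D"
  by (simp_all add: locally_discrete_def)

lemma suspension_simps [simp]:
  "Ob (suspension D) = UNIV" "Mor (suspension D) = {Id_x, Id_y} \<union> Inner ` CObj D"
  "Cell (suspension D) = {Id_x, Id_y} \<union> Inner ` CArr D"
  "Src (suspension D) f \<longleftrightarrow> f = Id_y" "Tgt (suspension D) f \<longleftrightarrow> f \<noteq> Id_x"
  "Dom (suspension D) = map_susp (CDom D)" "Cod (suspension D) = map_susp (CCod D)"
  "IdM (suspension D) u = (if u then Id_y else Id_x)" "IdC (suspension D) = map_susp (CId D)"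
  "Comp (suspension D) = susp_comp (\<lambda>g f. g)" "VComp (suspension D) = susp_comp (CComp D)"
  "HComp (suspension D) = susp_comp (\<lambda>b a. b)"
  by (simp_all add: suspension_def)

lemma two_category_locally_discrete: "two_category (locally_discrete (ordinal n))"
  by unfold_locales auto

lemma two_category_suspension: "two_category (suspension (ordinal n))"
  by unfold_locales auto

lemma lessThan_2: "{..<2} = {0, 1 :: nat}"
  by auto

lemma arrows_ordinal_2: "{(i, j). i \<le> j \<and> j < 2} = {(0, 0), (0, 1), (1, 1 :: nat)}"
  by auto

context two_category
begin

lemma unit_laws:
  "f \<in> Mor C \<Longrightarrow> IdC C f \<cdot>\<^bsub>C\<^esub> IdC C f = IdC C f"
  "a \<in> Cell C \<Longrightarrow> Src C (Dom C a) = x \<Longrightarrow> a \<star>\<^bsub>C\<^esub> IdC C (IdM C x) = a"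
  "a \<in> Cell C \<Longrightarrow> Tgt C (Dom C a) = x \<Longrightarrow> IdC C (IdM C x) \<star>\<^bsub>C\<^esub> a = a"
  "f \<in> Mor C \<Longrightarrow> Src C f = x \<Longrightarrow> f \<odot>\<^bsub>C\<^esub> IdM C x = f"
  "f \<in> Mor C \<Longrightarrow> Tgt C f = x \<Longrightarrow> IdM C x \<odot>\<^bsub>C\<^esub> f = f"
  using VComp_IdC_left[of "IdC C f"] HComp_Id_right[of a] HComp_Id_left[of a] Comp_IdM_right[of f] Comp_IdM_left[of f]
  by (auto simp: typing)

text \<open>The 2-functors out of the targets of the generating cofibrations: a point or an arrow is given by
  a 1-cell, and a 2-functor out of the suspension of the arrow by a 2-cell.\<close>

definition from_arrow :: "nat \<Rightarrow> 'm \<Rightarrow> (nat, nat \<times> nat, nat \<times> nat, 'o, 'm, 'c) two_fun" where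
  "from_arrow n f = (let e0 = (\<lambda>i. if i = 0 then Src C f else Tgt C f); e1 = (\<lambda>(i, j). if i = j then IdM C (e0 i) else f)
    in restr (locally_discrete (ordinal n)) \<lparr>Fn0 = e0, Fn1 = e1, Fn2 = (\<lambda>a. IdC C (e1 a))\<rparr>)"

lemma from_arrow_simps [simp]:
  "i < n \<Longrightarrow> Fn0 (from_arrow n f) i = (if i = 0 then Src C f else Tgt C f)"
  "i \<le> j \<Longrightarrow> j < n \<Longrightarrow> Fn1 (from_arrow n f) (i, j) = (if i = j then IdM C (if i = 0 then Src C f else Tgt C f) else f)"
  "i \<le> j \<Longrightarrow> j < n \<Longrightarrow> Fn2 (from_arrow n f) (i, j) = IdC C (Fn1 (from_arrow n f) (i, j))"
  by (simp_all add: from_arrow_def Let_def)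

lemma from_arrow_in:
  assumes "f \<in> Mor C" "n \<le> 2"
  shows "from_arrow n f \<in> two_functors (locally_discrete (ordinal n)) C"
proof -
  have le: "i = 0 \<or> i = 1" if "i < n" for i using that assms(2) by linarith
  show ?thesis
    unfolding from_arrow_def Let_def
    by (rule restr_in_two_functors[OF _ two_category_locally_discrete], unfold_locales)
      (use assms in \<open>auto simp: typing HComp_IdC unit_laws le_Suc_eq dest!: le\<close>)
qed

definition from_cell :: "'c \<Rightarrow> (bool, nat susp, (nat \<times> nat) susp, 'o, 'm, 'c) two_fun" where
  "from_cell a = (let s0 = (\<lambda>b. if b then Tgt C (Dom C a) else Src C (Dom C a));
      s1 = (\<lambda>f. case f of Id_x \<Rightarrow> IdM C (s0 False) | Id_y \<Rightarrow> IdM C (s0 True) | Inner i \<Rightarrow> if i = 0 then Dom C a else Cod C a)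
    in restr (suspension (ordinal 2)) \<lparr>Fn0 = s0, Fn1 = s1,
      Fn2 = (\<lambda>c. if c = Inner (0, 1) then a else IdC C (s1 (map_susp fst c)))\<rparr>)"

lemma from_cell_simps [simp]:
  "Fn0 (from_cell a) b = (if b then Tgt C (Dom C a) else Src C (Dom C a))"
  "Fn1 (from_cell a) Id_x = IdM C (Src C (Dom C a))" "Fn1 (from_cell a) Id_y = IdM C (Tgt C (Dom C a))"
  "Fn1 (from_cell a) (Inner 0) = Dom C a" "Fn1 (from_cell a) (Inner 1) = Cod C a"
  "Fn2 (from_cell a) Id_x = IdC C (IdM C (Src C (Dom C a)))" "Fn2 (from_cell a) Id_y = IdC C (IdM C (Tgt C (Dom C a)))"
  "Fn2 (from_cell a) (Inner (0, 0)) = IdC C (Dom C a)" "Fn2 (from_cell a) (Inner (0, 1)) = a"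
  "Fn2 (from_cell a) (Inner (1, 1)) = IdC C (Cod C a)"
  by (simp_all add: from_cell_def Let_def)

lemma from_cell_in:
  assumes a: "a \<in> Cell C"
  shows "from_cell a \<in> two_functors (suspension (ordinal 2)) C"
proof -
  show ?thesis
    unfolding from_cell_def Let_def
    by (rule restr_in_two_functors[OF _ two_category_suspension], unfold_locales)
      (use a in \<open>auto simp: typing Src_Cod Tgt_Cod unit_laws VComp_IdC_left VComp_IdC_right lessThan_2 arrows_ordinal_2\<close>)
qed

end

text \<open>The lifting properties against the generating cofibrations, unfolded: in this order against
  \<open>[-1] \<rightarrow> [0]\<close>, \<open>[0] \<amalg> [0] \<rightarrow> [1]\<close>, and the suspensions of \<open>[0] \<amalg> [0] \<rightarrow> [1]\<close> and of the collapse of two parallel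
  arrows.\<close>

locale trivial_fibration = X: two_category X + Y: two_category Y
  for X :: "('o, 'm, 'k) two_cat" and Y :: "('p, 'n, 'l) two_cat" and p :: "('o, 'm, 'k, 'p, 'n, 'l) two_fun" +
  assumes p_in: "p \<in> two_functors X Y"
    and surjective: "w \<in> Ob Y \<Longrightarrow> \<exists>x \<in> Ob X. Fn0 p x = w"
    and full_on_mors: "\<lbrakk>x \<in> Ob X; y \<in> Ob X; h \<in> hom Y (Fn0 p x) (Fn0 p y)\<rbrakk> \<Longrightarrow> \<exists>f \<in> hom X x y. Fn1 p f = h"
    and full: "\<lbrakk>f \<in> Mor X; g \<in> Mor X; \<alpha> \<in> cells Y (Fn1 p f) (Fn1 p g)\<rbrakk> \<Longrightarrow> \<exists>a \<in> cells X f g. Fn2 p a = \<alpha>"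
    and faithful: "\<lbrakk>a \<in> Cell X; b \<in> Cell X; Dom X a = Dom X b; Cod X a = Cod X b; Fn2 p a = Fn2 p b\<rbrakk> \<Longrightarrow> a = b"
begin

sublocale p: two_functor X Y p
  using p_in by (simp add: two_functors_def)

lemma isomorphic_refl: "f \<in> Mor Y \<Longrightarrow> isomorphic Y f f"
  unfolding isomorphic_def cells_def
  by (rule bexI[of _ "IdC Y f"], rule bexI[of _ "IdC Y f"]) (simp_all add: Y.typing Y.unit_laws)

lemma equivalent_refl: "y \<in> Ob Y \<Longrightarrow> equivalent Y y y"
  unfolding equivalent_def hom_def
  by (rule bexI[of _ "IdM Y y"], rule bexI[of _ "IdM Y y"]) (simp_all add: Y.typing Y.unit_laws isomorphic_refl)

theorem biequivalence: "biequivalence X Y p"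
  unfolding biequivalence_def
proof (intro conjI ballI)
  show "two_category X" "two_category Y" by unfold_locales
  show "p \<in> two_functors X Y" by (rule p_in)
  show "\<exists>x \<in> Ob X. equivalent Y (Fn0 p x) y" if "y \<in> Ob Y" for y
    using surjective[OF that] equivalent_refl[OF that] by auto
  show "\<exists>f \<in> hom X x y. isomorphic Y (Fn1 p f) g"
    if "x \<in> Ob X" "y \<in> Ob X" "g \<in> hom Y (Fn0 p x) (Fn0 p y)" for x y g
    using full_on_mors[OF that] isomorphic_refl[of g] that(3) by (auto simp: hom_def)
  show "bij_betw (Fn2 p) (cells X f g) (cells Y (Fn1 p f) (Fn1 p g))" if "f \<in> hom X x y" "g \<in> hom X x y" for x y f g
  proof (rule bij_betw_imageI)
    show "inj_on (Fn2 p) (cells X f g)" by (auto simp: inj_on_def cells_def intro: faithful)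
    show "Fn2 p ` cells X f g = cells Y (Fn1 p f) (Fn1 p g)"
    proof
      show "Fn2 p ` cells X f g \<subseteq> cells Y (Fn1 p f) (Fn1 p g)"
        by (auto simp: cells_def p.Fn2_in p.Fn_Dom p.Fn_Cod)
      show "cells Y (Fn1 p f) (Fn1 p g) \<subseteq> Fn2 p ` cells X f g"
        using full[of f g] that by (auto simp: hom_def)
    qed
  qed
qed

lemma lift_point:
  "has_rlp (locally_discrete (ordinal 0)) (locally_discrete (ordinal 1)) (inclusion (locally_discrete (ordinal 0))) X Y p"
  unfolding has_rlp_def
proof (intro ballI impI)
  fix u v assume u: "u \<in> two_functors (locally_discrete (ordinal 0)) X"
    and v: "v \<in> two_functors (locally_discrete (ordinal 1)) Y"
  interpret v: two_functor "locally_discrete (ordinal 1)" Y v using v by (simp add: two_functors_def)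
  obtain x where x: "x \<in> Ob X" "Fn0 p x = Fn0 v 0" using surjective[of "Fn0 v 0"] v.Fn0_in[of 0] by auto
  let ?h = "X.from_arrow 1 (IdM X x)"
  show "\<exists>h \<in> two_functors (locally_discrete (ordinal 1)) X.
      two_comp (locally_discrete (ordinal 0)) h (inclusion (locally_discrete (ordinal 0))) = u \<and>
      two_comp (locally_discrete (ordinal 1)) p h = v"
  proof (intro bexI conjI)
    show "?h \<in> two_functors (locally_discrete (ordinal 1)) X"
      by (rule X.from_arrow_in) (simp_all add: x X.typing)
    show "two_comp (locally_discrete (ordinal 0)) ?h (inclusion (locally_discrete (ordinal 0))) = u"
      by (rule two_comp_eqI[OF u]) auto
    show "two_comp (locally_discrete (ordinal 1)) p ?h = v"
      by (rule two_comp_eqI[OF v])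
        (use v.Fn_IdM[of 0] v.Fn_IdC[of "(0, 0)"] x in \<open>auto simp: X.typing p.Fn_IdM p.Fn_IdC\<close>)
  qed
qed

lemma lift_arrow:
  "has_rlp (locally_discrete (discrete 2)) (locally_discrete (ordinal 2)) (inclusion (locally_discrete (discrete 2))) X Y p"
  unfolding has_rlp_def
proof (intro ballI impI)
  let ?A = "locally_discrete (discrete 2)" and ?B = "locally_discrete (ordinal 2)"
  fix u v assume u: "u \<in> two_functors ?A X" and v: "v \<in> two_functors ?B Y"
    and e: "two_comp ?A p u = two_comp ?A v (inclusion ?A)"
  interpret u: two_functor ?A X u using u by (simp add: two_functors_def)
  interpret v: two_functor ?B Y v using v by (simp add: two_functors_def)
  have e0: "Fn0 p (Fn0 u i) = Fn0 v i" if "i < 2" for i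
    using two_comp_eqD(1)[OF e, of i] that by (simp add: inclusion_def)
  have "Fn1 v (0, 1) \<in> hom Y (Fn0 p (Fn0 u 0)) (Fn0 p (Fn0 u 1))"
    using v.Fn1_in[of "(0, 1)"] v.Fn_Src[of "(0, 1)"] v.Fn_Tgt[of "(0, 1)"] by (simp add: hom_def e0)
  then obtain f where f: "f \<in> Mor X" "Src X f = Fn0 u 0" "Tgt X f = Fn0 u 1" "Fn1 p f = Fn1 v (0, 1)"
    using full_on_mors[of "Fn0 u 0" "Fn0 u 1" "Fn1 v (0, 1)"] u.Fn0_in[of 0] u.Fn0_in[of 1] by (auto simp: hom_def)
  let ?h = "X.from_arrow 2 f"
  have le: "i = 0 \<or> i = 1" if "i < 2" for i :: nat using that by linarith
  show "\<exists>h \<in> two_functors ?B X. two_comp ?A h (inclusion ?A) = u \<and> two_comp ?B p h = v"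
  proof (intro bexI conjI)
    show "?h \<in> two_functors ?B X" by (rule X.from_arrow_in) (simp_all add: f)
    show "two_comp ?A ?h (inclusion ?A) = u"
      by (rule two_comp_eqI[OF u])
        (use u.Fn_IdM u.Fn_IdC f in \<open>auto simp: inclusion_def X.typing dest!: le\<close>)
    show "two_comp ?B p ?h = v"
      by (rule two_comp_eqI[OF v])
        (use f e0[of 0] e0[of 1] u.Fn0_in[of 0] u.Fn0_in[of 1] v.Fn_IdM[of 0] v.Fn_IdM[of 1] v.Fn_IdC[of "(0, 0)"] v.Fn_IdC[of "(0, 1)"] v.Fn_IdC[of "(1, 1)"]
          in \<open>auto simp: X.typing p.Fn_IdM p.Fn_IdC le_Suc_eq dest!: le\<close>)
  qed
qed

text \<open>Both remaining lifting problems amount to choosing one 2-cell of \<open>X\<close> with given ends and image.\<close>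

lemma from_cell_over:
  assumes v: "v \<in> two_functors (suspension (ordinal 2)) Y" and a: "a \<in> Cell X" "Fn2 p a = Fn2 v (Inner (0, 1))"
  shows "two_comp (suspension (ordinal 2)) p (X.from_cell a) = v"
proof -
  interpret v: two_functor "suspension (ordinal 2)" Y v using v by (simp add: two_functors_def)
  have d: "Fn1 p (Dom X a) = Fn1 v (Inner 0)" "Fn1 p (Cod X a) = Fn1 v (Inner 1)"
    using p.Fn_Dom[OF a(1)] p.Fn_Cod[OF a(1)] v.Fn_Dom[of "Inner (0, 1)"] v.Fn_Cod[of "Inner (0, 1)"] a(2) by simp_all
  have s: "Fn0 p (Src X (Dom X a)) = Fn0 v False" "Fn0 p (Tgt X (Dom X a)) = Fn0 v True"
    using p.Fn_Src[of "Dom X a"] p.Fn_Tgt[of "Dom X a"] v.Fn_Src[of "Inner 0"] v.Fn_Tgt[of "Inner 0"] a d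
    by (simp_all add: X.typing)
  have m: "Fn1 v Id_x = IdM Y (Fn0 v False)" "Fn1 v Id_y = IdM Y (Fn0 v True)"
    using v.Fn_IdM[of False] v.Fn_IdM[of True] by simp_all
  have c: "Fn2 v Id_x = IdC Y (IdM Y (Fn0 v False))" "Fn2 v Id_y = IdC Y (IdM Y (Fn0 v True))"
    "Fn2 v (Inner (0, 0)) = IdC Y (Fn1 v (Inner 0))" "Fn2 v (Inner (1, 1)) = IdC Y (Fn1 v (Inner 1))"
    using v.Fn_IdC[of Id_x] v.Fn_IdC[of Id_y] v.Fn_IdC[of "Inner 0"] v.Fn_IdC[of "Inner 1"] m by simp_all
  show ?thesis
  proof (rule two_comp_eqI[OF v])
    show "Fn0 p (Fn0 (X.from_cell a) b) = Fn0 v b" for b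
      using s by simp
    show "Fn1 p (Fn1 (X.from_cell a) f) = Fn1 v f" if "f \<in> Mor (suspension (ordinal 2))" for f
      using that d s m a(1) by (auto simp: lessThan_2 X.typing p.Fn_IdM simp del: One_nat_def)
    show "Fn2 p (Fn2 (X.from_cell a) c') = Fn2 v c'" if "c' \<in> Cell (suspension (ordinal 2))" for c'
      using that d s c a by (auto simp: arrows_ordinal_2 X.typing p.Fn_IdM p.Fn_IdC simp del: One_nat_def)
  qed
qed

lemma lift_cell:
  "has_rlp (suspension (discrete 2)) (suspension (ordinal 2)) (inclusion (suspension (discrete 2))) X Y p"
  unfolding has_rlp_def
proof (intro ballI impI)
  let ?A = "suspension (discrete 2)" and ?B = "suspension (ordinal 2)"
  fix u v assume u: "u \<in> two_functors ?A X" and v: "v \<in> two_functors ?B Y"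
    and e: "two_comp ?A p u = two_comp ?A v (inclusion ?A)"
  interpret u: two_functor ?A X u using u by (simp add: two_functors_def)
  interpret v: two_functor ?B Y v using v by (simp add: two_functors_def)
  have e1: "Fn1 p (Fn1 u (Inner i)) = Fn1 v (Inner i)" if "i < 2" for i
    using two_comp_eqD(2)[OF e, of "Inner i"] that by (simp add: inclusion_def)
  have "Fn2 v (Inner (0, 1)) \<in> cells Y (Fn1 p (Fn1 u (Inner 0))) (Fn1 p (Fn1 u (Inner 1)))"
    using v.Fn2_in[of "Inner (0, 1)"] v.Fn_Dom[of "Inner (0, 1)"] v.Fn_Cod[of "Inner (0, 1)"] by (simp add: cells_def e1)
  then obtain a where a: "a \<in> Cell X" "Dom X a = Fn1 u (Inner 0)" "Cod X a = Fn1 u (Inner 1)" "Fn2 p a = Fn2 v (Inner (0, 1))"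
    using full[of "Fn1 u (Inner 0)" "Fn1 u (Inner 1)" "Fn2 v (Inner (0, 1))"] u.Fn1_in[of "Inner 0"] u.Fn1_in[of "Inner 1"]
    by (auto simp: cells_def)
  have s: "Src X (Dom X a) = Fn0 u False" "Tgt X (Dom X a) = Fn0 u True"
    using u.Fn_Src[of "Inner 0"] u.Fn_Tgt[of "Inner 0"] a by simp_all
  have m: "Fn1 u Id_x = IdM X (Fn0 u False)" "Fn1 u Id_y = IdM X (Fn0 u True)"
    using u.Fn_IdM[of False] u.Fn_IdM[of True] by simp_all
  have c: "Fn2 u Id_x = IdC X (IdM X (Fn0 u False))" "Fn2 u Id_y = IdC X (IdM X (Fn0 u True))"
    "Fn2 u (Inner (0, 0)) = IdC X (Fn1 u (Inner 0))" "Fn2 u (Inner (1, 1)) = IdC X (Fn1 u (Inner 1))"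
    using u.Fn_IdC[of Id_x] u.Fn_IdC[of Id_y] u.Fn_IdC[of "Inner 0"] u.Fn_IdC[of "Inner 1"] m by simp_all
  have disc: "{(i, i) |i. i < 2} = {(0, 0), (1, 1 :: nat)}" by auto
  show "\<exists>h \<in> two_functors ?B X. two_comp ?A h (inclusion ?A) = u \<and> two_comp ?B p h = v"
  proof (intro bexI conjI)
    show "X.from_cell a \<in> two_functors ?B X" by (rule X.from_cell_in[OF a(1)])
    show "two_comp ?B p (X.from_cell a) = v" by (rule from_cell_over[OF v a(1,4)])
    show "two_comp ?A (X.from_cell a) (inclusion ?A) = u"
    proof (rule two_comp_eqI[OF u])
      show "Fn0 (X.from_cell a) (Fn0 (inclusion ?A) b) = Fn0 u b" for b
        using s by (simp add: inclusion_def)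
      show "Fn1 (X.from_cell a) (Fn1 (inclusion ?A) f) = Fn1 u f" if "f \<in> Mor ?A" for f
        using that s m a by (auto simp: inclusion_def lessThan_2 simp del: One_nat_def)
      show "Fn2 (X.from_cell a) (Fn2 (inclusion ?A) c') = Fn2 u c'" if "c' \<in> Cell ?A" for c'
        using that s c a by (auto simp: inclusion_def disc simp del: One_nat_def)
    qed
  qed
qed

lemma lift_parallel_cells:
  "has_rlp (suspension parallel_arrows) (suspension (ordinal 2)) (restr (suspension parallel_arrows)
     \<lparr>Fn0 = (\<lambda>u. u), Fn1 = (\<lambda>f. f), Fn2 = map_susp (\<lambda>(i, es, j). (i, j))\<rparr>) X Y p"
  unfolding has_rlp_def
proof (intro ballI impI)
  let ?A = "suspension parallel_arrows" and ?B = "suspension (ordinal 2)"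
  let ?i = "restr ?A \<lparr>Fn0 = (\<lambda>u. u), Fn1 = (\<lambda>f. f), Fn2 = map_susp (\<lambda>(i, es, j). (i, j))\<rparr>"
  fix u v assume u: "u \<in> two_functors ?A X" and v: "v \<in> two_functors ?B Y"
    and e: "two_comp ?A p u = two_comp ?A v ?i"
  interpret u: two_functor ?A X u using u by (simp add: two_functors_def)
  have w: "Inner (0, [b], 1) \<in> Cell ?A" "Inner (0, [], 0) \<in> Cell ?A" "Inner (1, [], 1) \<in> Cell ?A" for b
    by (simp_all add: CArr_parallel_arrows image_iff)
  define a where "a = Fn2 u (Inner (0, [True], 1))"
  have e2: "Fn2 p (Fn2 u (Inner (0, [b], 1))) = Fn2 v (Inner (0, 1))" for b
    using two_comp_eqD(3)[OF e w(1)[of b]] w(1)[of b] by simp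
  have ends: "Fn2 u (Inner (0, [b], 1)) \<in> Cell X" "Dom X (Fn2 u (Inner (0, [b], 1))) = Fn1 u (Inner 0)"
    "Cod X (Fn2 u (Inner (0, [b], 1))) = Fn1 u (Inner 1)" for b
    using u.Fn2_in[OF w(1)] u.Fn_Dom[OF w(1)] u.Fn_Cod[OF w(1)] by simp_all
  \<comment> \<open>The two parallel 2-cells have the same image, so they agree.\<close>
  have ab: "Fn2 u (Inner (0, [b], 1)) = a" for b
    unfolding a_def by (rule faithful) (simp_all add: ends e2 del: One_nat_def)
  have a: "a \<in> Cell X" "Dom X a = Fn1 u (Inner 0)" "Cod X a = Fn1 u (Inner 1)" "Fn2 p a = Fn2 v (Inner (0, 1))"
    unfolding a_def by (simp_all add: ends e2 del: One_nat_def)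
  have s: "Src X (Dom X a) = Fn0 u False" "Tgt X (Dom X a) = Fn0 u True"
    using u.Fn_Src[of "Inner 0"] u.Fn_Tgt[of "Inner 0"] a by simp_all
  have m: "Fn1 u Id_x = IdM X (Fn0 u False)" "Fn1 u Id_y = IdM X (Fn0 u True)"
    using u.Fn_IdM[of False] u.Fn_IdM[of True] by simp_all
  have c: "Fn2 u Id_x = IdC X (IdM X (Fn0 u False))" "Fn2 u Id_y = IdC X (IdM X (Fn0 u True))"
    "Fn2 u (Inner (0, [], 0)) = IdC X (Fn1 u (Inner 0))" "Fn2 u (Inner (1, [], 1)) = IdC X (Fn1 u (Inner 1))"
    using u.Fn_IdC[of Id_x] u.Fn_IdC[of Id_y] u.Fn_IdC[of "Inner 0"] u.Fn_IdC[of "Inner 1"] m by simp_all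
  show "\<exists>h \<in> two_functors ?B X. two_comp ?A h ?i = u \<and> two_comp ?B p h = v"
  proof (intro bexI conjI)
    show "X.from_cell a \<in> two_functors ?B X" by (rule X.from_cell_in[OF a(1)])
    show "two_comp ?B p (X.from_cell a) = v" by (rule from_cell_over[OF v a(1,4)])
    show "two_comp ?A (X.from_cell a) ?i = u"
    proof (rule two_comp_eqI[OF u])
      show "Fn0 (X.from_cell a) (Fn0 ?i b) = Fn0 u b" for b
        using s by simp
      show "Fn1 (X.from_cell a) (Fn1 ?i f) = Fn1 u f" if "f \<in> Mor ?A" for f
        using that s m a by (auto simp del: One_nat_def)
      show "Fn2 (X.from_cell a) (Fn2 ?i c') = Fn2 u c'" if c': "c' \<in> Cell ?A" for c'
      proof -
        have "c' = Id_x \<or> c' = Id_y \<or> c' = Inner (0, [], 0) \<or> c' = Inner (1, [], 1) \<or> (\<exists>b. c' = Inner (0, [b], 1))"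
          using c' by (auto simp: CArr_parallel_arrows le_Suc_eq)
        then show ?thesis using s c a ab w by (auto simp del: One_nat_def)
      qed
    qed
  qed
qed

theorem acyclic_fibration: "acyclic_fibration X Y p"
  unfolding acyclic_fibration_def
  using lift_point lift_arrow lift_cell lift_parallel_cells p_in X.two_category_axioms Y.two_category_axioms by blast

end

sublocale nerve_of \<subseteq> counit: trivial_fibration K C "counit C"
  by unfold_locales
    (use counit_in counit_section(1) s0_in counit_full_on_mors counit_full counit_faithful in blast)+

theorem theorem4p10:
  fixes C :: "('o, 'm, 'c) two_cat"
  assumes "two_category C"
  shows "acyclic_fibration (categorification (nerve C)) C (counit C)
    \<and> biequivalence (categorification (nerve C)) C (counit C)"
proof -
  interpret nerve_of C using assms by (simp add: nerve_of_def)
  show ?thesis using counit.acyclic_fibration counit.biequivalence by simp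
qed

end
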